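(* Let $M$, its triangulated discrete surface $M_h$, the integer $k\ge 0$, and the spaces $\mathbb{S}^{k+1}_0$, $\mathbb{BDM}^k_0$, $\mathbb{J}^k_{\mathbb{BDM}}$, $\mathbb{H}^k_{\mathbb{BDM}}$ be as defined in the context. Then one has the $L^2(M_h)$-orthogonal direct sum decomposition $$\mathbb{J}^k_{\mathbb{BDM}} = \mathbf{rot}(\mathbb{S}^{k+1}_0)\oplus_{L^2}\mathbb{H}^k_{\mathbb{BDM}},$$ and the space of discrete harmonic fields has the correct dimension, $$\dim(\mathbb{H}^k_{\mathbb{BDM}})=b_1(M).$$ Consequently, one also has the $L^2(M_h)$-orthogonal direct sum decomposition $$\mathbb{BDM}^k_0=\mathbf{rot}(\mathbb{S}^{k+1}_0)\oplus_{L^2}\mathbb{H}^k_{\mathbb{BDM}}\oplus_{L^2}(\mathbb{J}^k_{\mathbb{BDM}})^{\perp},$$ where $(\mathbb{J}^k_{\mathbb{BDM}})^{\perp}$ denotes the $L^2(M_h)$-orthogonal complement of $\mathbb{J}^k_{\mathbb{BDM}}$ in $\mathbb{BDM}^k_0$.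
   Context: **Surface.** $M\subset\mathbb{R}^3$ is a smooth, oriented, compact, two-dimensional Riemannian manifold, possibly with a $C^{0,1}$ boundary $\Gamma=\partial M$ (the closed case $\Gamma=\emptyset$ is allowed). $b_1(M)$ is its first Betti number. **Triangulation.** $\mathcal{T}_h$ is an admissible (conforming) shape-regular triangulation of $M$ into closed, possibly curved, triangles $T=\Phi_T(\hat T)\subset\mathbb{R}^3$, where $\hat T\subset\mathbb{R}^2$ is a flat triangle and $\Phi_T$ is a smooth parametrization (diffeomorphism onto $T$); on an edge shared by two triangles, the two parametrizations agree up to an affine reparametrization of the edge (as is the case when the curved triangulation is obtained from a flat one by a continuous piecewise smooth map). The discrete surface is $M_h=\bigcup_{T\in\mathcal{T}_h}T$, a piecewise smooth oriented surface with the metric induced from $\mathbb{R}^3$ and boundary $\Gamma_h=\partial M_h$. As a triangulation of $M$, it has the topology of $M$; in particular the numbers of vertices, edges and triangles satisfy $|\mathcal{V}|-|\mathcal{E}|+|\mathcal{T}|=\chi(M)$. Let $\boldsymbol{n}|_T$ be the oriented unit normal field on $T$. **Differential operators.** On each element, $\mathbf{grad}$ and $\operatorname{div}$ are the surface gradient and surface divergence, $J=\boldsymbol{n}\times\cdot$ is the rotation by $90^\circ$ in the tangent plane, and $\mathbf{rot}=-J\,\mathbf{grad}$. **Sobolev spaces.** $\mathbf{H}(\operatorname{div},M_h)$ is the space of tangential $L^2$ vector fields on $M_h$ whose weak surface divergence is in $L^2(M_h)$. For piecewise smooth fields this means that the normal jump vanishes on each interior edge $E=T_1\cap T_2$: $\mathbf{v}|_{T_1}\cdot\boldsymbol{\nu}_1+\mathbf{v}|_{T_2}\cdot\boldsymbol{\nu}_2=0$,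 where $\boldsymbol{\nu}_i$ is the unit vector tangent to $T_i$, normal to $E$ and pointing out of $T_i$. $H^1_0(M_h)$ is the space of $H^1(M_h)$ functions with zero trace on $\Gamma_h$ if $\Gamma\neq\emptyset$, and the space of $H^1(M_h)$ functions with zero integral mean if $\Gamma=\emptyset$. **Polynomial spaces.** Let $\hat{\mathbb{P}}^k(\hat T)$ be the polynomials of degree at most $k$ on $\hat T$. Scalar mapped polynomials: $\mathbb{P}^k(T)=\{\hat v\circ\Phi_T^{-1}\mid\hat v\in\hat{\mathbb{P}}^k(\hat T)\}$. Piola-mapped tangential vector polynomials: $$\mathbf{P}^k(T)=\{\mathcal{J}_T^{-1}(D\Phi_T\,\hat{\mathbf{v}})\circ\Phi_T^{-1}\mid\hat{\mathbf{v}}\in[\hat{\mathbb{P}}^k(\hat T)]^2\},\qquad \mathcal{J}_T=\bigl(\det(D\Phi_T^{\top}D\Phi_T)\bigr)^{1/2}.$$ $\mathbb{P}^k$ and $\mathbf{P}^k$ denote the corresponding piecewise (discontinuous across elements) spaces on $\mathcal{T}_h$. **Finite element spaces.** For $k\ge 0$: - $\mathbb{S}^{k+1}_0=\mathbb{P}^{k+1}\cap H^1_0(M_h)$ (continuous Lagrange elements of degree $k+1$ with zero boundary trace, or zero mean if $\Gamma=\emptyset$). - $\mathbb{BDM}^k=\mathbf{P}^k\cap\mathbf{H}(\operatorname{div},M_h)$ and $\mathbb{BDM}^k_0=\{\mathbf{v}_h\in\mathbb{BDM}^k\mid\mathbf{v}_h\cdot\boldsymbol{\nu}_{\Gamma_h}=0\text{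 on }\Gamma_h\}$, where $\boldsymbol{\nu}_{\Gamma_h}$ is the in-plane outward unit normal on $\Gamma_h$. - $\mathbb{J}^k_{\mathbb{BDM}}=\mathbb{BDM}^k_0\cap\ker(\operatorname{div})$. One has $\mathbf{rot}(\mathbb{S}^{k+1}_0)\subset\mathbb{J}^k_{\mathbb{BDM}}$. - $\mathbb{H}^k_{\mathbb{BDM}}=\bigl(\mathbf{rot}(\mathbb{S}^{k+1}_0)\bigr)^{\perp}\subset\mathbb{J}^k_{\mathbb{BDM}}$, the orthogonal complement of $\mathbf{rot}(\mathbb{S}^{k+1}_0)$ in $\mathbb{J}^k_{\mathbb{BDM}}$ with respect to the $L^2(M_h)$ inner product (the space of discrete harmonic fields). The symbol $\oplus_{L^2}$ denotes an $L^2(M_h)$-orthogonal direct sum. *)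

theory Defs
  imports "HOL-Analysis.Analysis" "HOL-Homology.Homology" "HOL-Library.Function_Algebras"
begin

section \<open>Functions as a real vector space\<close>

instantiation "fun" :: (type, real_vector) real_vector
begin

definition scaleR_fun_def: "scaleR c f = (\<lambda>x. c *\<^sub>R f x)"

instance
  by standard
    (simp_all add: scaleR_fun_def plus_fun_def scaleR_add_right scaleR_add_left)

end

section \<open>Betti numbers\<close>

definition int_independent :: "('a, 'b) monoid_scheme \<Rightarrow> 'a set \<Rightarrow> bool" where
  "int_independent G S \<longleftrightarrow> finite S \<and> S \<subseteq> carrier G \<and>
     (\<forall>c :: 'a \<Rightarrow> int. finprod G (\<lambda>x. x [^]\<^bsub>G\<^esub> c x) S = \<one>\<^bsub>G\<^esub> \<longrightarrow> (\<forall>x\<in>S. c x = 0))"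

text \<open>The torsion-free rank of an abelian group. It is only used for groups of finite rank, where
  the supremum is a maximum.\<close>
definition abelian_rank :: "('a, 'b) monoid_scheme \<Rightarrow> nat" where
  "abelian_rank G = Sup {card S | S. int_independent G S}"

definition betti :: "nat \<Rightarrow> 'a::topological_space set \<Rightarrow> nat" where
  "betti p M = abelian_rank (homology_group (int p) (top_of_set M))"

definition euler_char :: "(real^3) set \<Rightarrow> int" where
  "euler_char M = (\<Sum>p\<le>2. (-1) ^ p * int (betti p M))"

section \<open>Smooth compact oriented surfaces with Lipschitz boundary\<close>

text \<open>Only meaningful for open \<open>U\<close>.\<close>
primrec Ck_on :: "nat \<Rightarrow> 'a::euclidean_space set \<Rightarrow> ('a \<Rightarrow> 'b::real_normed_vector) \<Rightarrow> bool" where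
  "Ck_on 0 U f \<longleftrightarrow> continuous_on U f"
| "Ck_on (Suc k) U f \<longleftrightarrow> f differentiable_on U \<and>
     (\<forall>i\<in>Basis. Ck_on k U (\<lambda>x. frechet_derivative f (at x) i))"

definition smooth_on :: "'a::euclidean_space set \<Rightarrow> ('a \<Rightarrow> 'b::real_normed_vector) \<Rightarrow> bool" where
  "smooth_on U f \<longleftrightarrow> (\<forall>k. Ck_on k U f)"

definition regular_patch :: "(real^2 \<Rightarrow> real^3) \<Rightarrow> (real^2) set \<Rightarrow> bool" where
  "regular_patch \<phi> U \<longleftrightarrow> open U \<and> smooth_on U \<phi> \<and> inj_on \<phi> U \<and>
     continuous_on (\<phi> ` U) (inv_into U \<phi>) \<and> (\<forall>x\<in>U. inj (frechet_derivative \<phi> (at x)))"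

text \<open>The part of \<open>M\<close> covered by a chart is the image of a full planar open set (interior chart) or
  of the part of it below the graph of a Lipschitz function (boundary chart).\<close>
definition surface_chart ::
    "(real^3) set \<Rightarrow> (real^2 \<Rightarrow> real^3) \<Rightarrow> (real^2) set \<Rightarrow> (real^2) set \<Rightarrow> bool" where
  "surface_chart M \<phi> U D \<longleftrightarrow> regular_patch \<phi> U \<and>
     (D = U \<or> (\<exists>L \<gamma>. L-lipschitz_on (UNIV :: real set) (\<gamma> :: real \<Rightarrow> real) \<and>
                  D = {x\<in>U. x$2 \<le> \<gamma> (x$1)})) \<and>
     openin (top_of_set M) (\<phi> ` D)"

definition unit_normal_field :: "(real^3) set \<Rightarrow> (real^3 \<Rightarrow> real^3) \<Rightarrow> bool" where
  "unit_normal_field M N \<longleftrightarrow> continuous_on M N \<and> (\<forall>p\<in>M. norm (N p) = 1) \<and>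
     (\<forall>\<phi> U D. surface_chart M \<phi> U D \<longrightarrow>
        (\<forall>x\<in>D. \<forall>w. N (\<phi> x) \<bullet> frechet_derivative \<phi> (at x) w = 0))"

definition compact_oriented_surface :: "(real^3) set \<Rightarrow> bool" where
  "compact_oriented_surface M \<longleftrightarrow> compact M \<and>
     (\<forall>p\<in>M. \<exists>\<phi> U D. surface_chart M \<phi> U D \<and> p \<in> \<phi> ` D) \<and>
     (\<exists>N. unit_normal_field M N)"

section \<open>Curved triangulations\<close>

text \<open>A curved triangle \<open>T\<close> is a subset of space; \<open>ref_verts K T\<close> are the three vertices of its flat
  reference triangle, \<open>param K T\<close> is its parametrization (only the values on the
  reference triangle matter) and \<open>unit_normal K T\<close> is its unit normal field.\<close>
record surface_mesh =
  triangles :: "(real^3) set set"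
  ref_verts :: "(real^3) set \<Rightarrow> (real^2) set"
  param :: "(real^3) set \<Rightarrow> real^2 \<Rightarrow> real^3"
  unit_normal :: "(real^3) set \<Rightarrow> real^3 \<Rightarrow> real^3"

definition ref_tri :: "surface_mesh \<Rightarrow> (real^3) set \<Rightarrow> (real^2) set" where
  "ref_tri K T = convex hull (ref_verts K T)"

definition verts :: "surface_mesh \<Rightarrow> (real^3) set \<Rightarrow> (real^3) set" where
  "verts K T = param K T ` ref_verts K T"

definition edges :: "surface_mesh \<Rightarrow> (real^3) set \<Rightarrow> (real^3) set set" where
  "edges K T = {param K T ` closed_segment a b | a b.
     a \<in> ref_verts K T \<and> b \<in> ref_verts K T \<and> a \<noteq> b}"

definition all_verts :: "surface_mesh \<Rightarrow> (real^3) set" where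
  "all_verts K = (\<Union>T\<in>triangles K. verts K T)"

definition all_edges :: "surface_mesh \<Rightarrow> (real^3) set set" where
  "all_edges K = (\<Union>T\<in>triangles K. edges K T)"

definition mesh_surface :: "surface_mesh \<Rightarrow> (real^3) set" where
  "mesh_surface K = \<Union>(triangles K)"

definition boundary_edges :: "surface_mesh \<Rightarrow> (real^3) set set" where
  "boundary_edges K = {E \<in> all_edges K. \<exists>!T. T \<in> triangles K \<and> E \<in> edges K T}"

definition mesh_boundary :: "surface_mesh \<Rightarrow> (real^3) set" where
  "mesh_boundary K = \<Union>(boundary_edges K)"

text \<open>The one-sided derivative on the closed reference triangle is used throughout, so
  that everything below depends only on values on the elements.\<close>
definition D_param :: "surface_mesh \<Rightarrow> (real^3) set \<Rightarrow> real^2 \<Rightarrow> real^2^3" where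
  "D_param K T y = jacobian (param K T) (at y within ref_tri K T)"

definition gram :: "surface_mesh \<Rightarrow> (real^3) set \<Rightarrow> real^2 \<Rightarrow> real^2^2" where
  "gram K T y = transpose (D_param K T y) ** D_param K T y"

definition area_factor :: "surface_mesh \<Rightarrow> (real^3) set \<Rightarrow> real^2 \<Rightarrow> real" where
  "area_factor K T y = sqrt (det (gram K T y))"

definition ref_point :: "surface_mesh \<Rightarrow> (real^3) set \<Rightarrow> real^3 \<Rightarrow> real^2" where
  "ref_point K T x = inv_into (ref_tri K T) (param K T) x"

definition tangent_plane :: "surface_mesh \<Rightarrow> (real^3) set \<Rightarrow> real^3 \<Rightarrow> (real^3) set" where
  "tangent_plane K T x = range ((*v) (D_param K T (ref_point K T x)))"

text \<open>The conormal \<open>\<nu>\<close>: the unit vector tangent to \<open>T\<close>, orthogonal to the edge \<open>E\<close> and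
  pointing out of \<open>T\<close>. The vectors \<open>D_param K T y *v (z - y)\<close> with \<open>z\<close> in the reference
  triangle are the directions pointing into \<open>T\<close>; those with \<open>z\<close> on the reference edge
  are tangent to \<open>E\<close>.\<close>
definition conormal :: "surface_mesh \<Rightarrow> (real^3) set \<Rightarrow> (real^3) set \<Rightarrow> real^3 \<Rightarrow> real^3" where
  "conormal K T E x = (let y = ref_point K T x in
     THE \<nu>. norm \<nu> = 1 \<and> \<nu> \<in> tangent_plane K T x \<and>
       (\<forall>z\<in>ref_tri K T. param K T z \<in> E \<longrightarrow> \<nu> \<bullet> (D_param K T y *v (z - y)) = 0) \<and>
       (\<forall>z\<in>ref_tri K T. \<nu> \<bullet> (D_param K T y *v (z - y)) \<le> 0))"

definition curved_triangle :: "surface_mesh \<Rightarrow> (real^3) set \<Rightarrow> bool" where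
  "curved_triangle K T \<longleftrightarrow>
     card (ref_verts K T) = 3 \<and> \<not> affine_dependent (ref_verts K T) \<and>
     T = param K T ` ref_tri K T \<and> inj_on (param K T) (ref_tri K T) \<and>
     (\<exists>U. open U \<and> ref_tri K T \<subseteq> U \<and> smooth_on U (param K T)) \<and>
     (\<forall>y\<in>ref_tri K T. inj ((*v) (D_param K T y)))"

definition conforming :: "surface_mesh \<Rightarrow> bool" where
  "conforming K \<longleftrightarrow> (\<forall>T1\<in>triangles K. \<forall>T2\<in>triangles K. T1 \<noteq> T2 \<longrightarrow>
     T1 \<inter> T2 = {} \<or> (\<exists>x \<in> verts K T1 \<inter> verts K T2. T1 \<inter> T2 = {x}) \<or>
     T1 \<inter> T2 \<in> edges K T1 \<inter> edges K T2)"

definition edge_compatible :: "surface_mesh \<Rightarrow> bool" where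
  "edge_compatible K \<longleftrightarrow>
     (\<forall>T1\<in>triangles K. \<forall>T2\<in>triangles K. \<forall>E \<in> edges K T1 \<inter> edges K T2. T1 \<noteq> T2 \<longrightarrow>
       (\<exists>a1\<in>ref_verts K T1. \<exists>b1\<in>ref_verts K T1. \<exists>a2\<in>ref_verts K T2. \<exists>b2\<in>ref_verts K T2.
          E = param K T1 ` closed_segment a1 b1 \<and>
          (\<forall>t\<in>{0..1}. param K T1 (linepath a1 b1 t) = param K T2 (linepath a2 b2 t))))"

text \<open>Shape regularity with constant \<open>\<kappa>\<close>: a bound on the ratio of diameter and inradius of the
  reference triangle and on the condition number of the parametrization.\<close>
definition shape_regular :: "real \<Rightarrow> surface_mesh \<Rightarrow> bool" where
  "shape_regular \<kappa> K \<longleftrightarrow> (\<forall>T\<in>triangles K.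
     (\<exists>c r. 0 < r \<and> cball c r \<subseteq> ref_tri K T \<and> diameter (ref_tri K T) \<le> \<kappa> * r) \<and>
     (\<forall>y\<in>ref_tri K T. \<forall>v w. norm v = 1 \<longrightarrow> norm w = 1 \<longrightarrow>
        norm (D_param K T y *v v) \<le> \<kappa> * norm (D_param K T y *v w)))"

text \<open>The mesh is a surface: no edge lies in more than two triangles, and the triangles around a
  vertex can be traversed through common edges, so that vertex links are paths or cycles.\<close>
definition surface_like :: "surface_mesh \<Rightarrow> bool" where
  "surface_like K \<longleftrightarrow>
     (\<forall>E\<in>all_edges K. card {T\<in>triangles K. E \<in> edges K T} \<le> 2) \<and>
     (\<forall>z\<in>all_verts K. \<forall>T\<in>triangles K. \<forall>T'\<in>triangles K. z \<in> T \<longrightarrow> z \<in> T' \<longrightarrow>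
        (T, T') \<in> {(A, B). A \<in> triangles K \<and> B \<in> triangles K \<and> z \<in> A \<inter> B \<and>
                          A \<inter> B \<in> edges K A \<inter> edges K B}\<^sup>*)"

text \<open>\<open>unit_normal K\<close> is an orientation: on a shared edge the two triangles induce opposite
  directions, \<open>n \<times> \<nu>\<close> being the edge tangent of the induced boundary orientation.\<close>
definition oriented_mesh :: "surface_mesh \<Rightarrow> bool" where
  "oriented_mesh K \<longleftrightarrow>
     (\<forall>T\<in>triangles K. continuous_on T (unit_normal K T) \<and>
        (\<forall>x\<in>T. norm (unit_normal K T x) = 1 \<and> (\<forall>w\<in>tangent_plane K T x. unit_normal K T x \<bullet> w = 0))) \<and>
     (\<forall>T1\<in>triangles K. \<forall>T2\<in>triangles K. \<forall>E \<in> edges K T1 \<inter> edges K T2. T1 \<noteq> T2 \<longrightarrow>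
        (\<forall>x\<in>E. cross3 (unit_normal K T1 x) (conormal K T1 E x) =
               - cross3 (unit_normal K T2 x) (conormal K T2 E x)))"

definition oriented_triangulation :: "surface_mesh \<Rightarrow> bool" where
  "oriented_triangulation K \<longleftrightarrow> finite (triangles K) \<and>
     (\<forall>T\<in>triangles K. curved_triangle K T) \<and>
     conforming K \<and> edge_compatible K \<and> surface_like K \<and> oriented_mesh K"

text \<open>The Euler formula follows from the homeomorphism; it is listed because it is a stated property
  of the triangulation.\<close>
definition has_topology_of :: "surface_mesh \<Rightarrow> (real^3) set \<Rightarrow> bool" where
  "has_topology_of K M \<longleftrightarrow> mesh_surface K homeomorphic M \<and>
     int (card (all_verts K)) - int (card (all_edges K)) + int (card (triangles K)) = euler_char M"

section \<open>Piecewise fields\<close>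

text \<open>A piecewise field assigns to a triangle \<open>T\<close> and a point \<open>x \<in> T\<close> the value (or trace) at \<open>x\<close>
  of its restriction to \<open>T\<close>, so that it may be multivalued on edges. It is normalized to
  be zero for all other arguments; without this, dimensions would be wrong.\<close>
type_synonym scalar_field = "(real^3) set \<Rightarrow> real^3 \<Rightarrow> real"
type_synonym vector_field = "(real^3) set \<Rightarrow> real^3 \<Rightarrow> real^3"

definition supported :: "surface_mesh \<Rightarrow> ((real^3) set \<Rightarrow> real^3 \<Rightarrow> 'a::zero) \<Rightarrow> bool" where
  "supported K f \<longleftrightarrow> (\<forall>T x. T \<notin> triangles K \<or> x \<notin> T \<longrightarrow> f T x = 0)"

definition surface_integral :: "surface_mesh \<Rightarrow> scalar_field \<Rightarrow> real" where
  "surface_integral K f =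
     (\<Sum>T\<in>triangles K. integral (ref_tri K T) (\<lambda>y. f T (param K T y) * area_factor K T y))"

definition L2_inner :: "surface_mesh \<Rightarrow> vector_field \<Rightarrow> vector_field \<Rightarrow> real" where
  "L2_inner K v w = surface_integral K (\<lambda>T x. v T x \<bullet> w T x)"

text \<open>In coordinates, with the metric \<open>G = D\<Phi>\<^sup>T D\<Phi>\<close>, the surface gradient is
  \<open>D\<Phi> G\<^sup>-\<^sup>1 \<nabla>(u \<circ> \<Phi>)\<close> and the surface divergence is
  \<open>\<Sum>ij. (G\<^sup>-\<^sup>1)\<^sub>ij \<partial>\<^sub>i\<Phi> \<bullet> \<partial>\<^sub>j(v \<circ> \<Phi>) = tr (G\<^sup>-\<^sup>1 D\<Phi>\<^sup>T D(v \<circ> \<Phi>))\<close>.\<close>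
definition surf_grad :: "surface_mesh \<Rightarrow> scalar_field \<Rightarrow> vector_field" where
  "surf_grad K u T x = (if T \<in> triangles K \<and> x \<in> T then
     (let y = ref_point K T x in
        D_param K T y *v (matrix_inv (gram K T y) *v
          (\<chi> i. frechet_derivative (\<lambda>z. u T (param K T z)) (at y within ref_tri K T) (axis i 1))))
     else 0)"

definition surf_div :: "surface_mesh \<Rightarrow> vector_field \<Rightarrow> scalar_field" where
  "surf_div K v T x = (if T \<in> triangles K \<and> x \<in> T then
     (let y = ref_point K T x in
        trace (matrix_inv (gram K T y) ** (transpose (D_param K T y) **
          jacobian (\<lambda>z. v T (param K T z)) (at y within ref_tri K T))))
     else 0)"

definition rotate_J :: "surface_mesh \<Rightarrow> vector_field \<Rightarrow> vector_field" where
  "rotate_J K v T x = (if T \<in> triangles K \<and> x \<in> T then cross3 (unit_normal K T x) (v T x) else 0)"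

definition rot :: "surface_mesh \<Rightarrow> scalar_field \<Rightarrow> vector_field" where
  "rot K u = - rotate_J K (surf_grad K u)"

section \<open>Finite element spaces\<close>

definition poly2 :: "nat \<Rightarrow> (real^2 \<Rightarrow> real) set" where
  "poly2 k = {p. \<exists>c :: nat \<Rightarrow> nat \<Rightarrow> real.
     \<forall>y. p y = (\<Sum>i\<le>k. \<Sum>j\<le>k - i. c i j * (y$1) ^ i * (y$2) ^ j)}"

definition scalar_P :: "surface_mesh \<Rightarrow> nat \<Rightarrow> scalar_field set" where
  "scalar_P K k = {u. supported K u \<and>
     (\<forall>T\<in>triangles K. \<exists>p\<in>poly2 k. \<forall>y\<in>ref_tri K T. u T (param K T y) = p y)}"

definition vector_P :: "surface_mesh \<Rightarrow> nat \<Rightarrow> vector_field set" where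
  "vector_P K k = {v. supported K v \<and>
     (\<forall>T\<in>triangles K. \<exists>p :: real^2 \<Rightarrow> real^2. (\<forall>i. (\<lambda>y. p y $ i) \<in> poly2 k) \<and>
        (\<forall>y\<in>ref_tri K T. v T (param K T y) = (1 / area_factor K T y) *\<^sub>R (D_param K T y *v p y)))}"

text \<open>Continuous Lagrange elements of degree \<open>m\<close>, with zero boundary trace or, on a closed
  surface, zero mean.\<close>
definition lagrange0 :: "surface_mesh \<Rightarrow> nat \<Rightarrow> scalar_field set" where
  "lagrange0 K m = {u \<in> scalar_P K m.
     (\<forall>T1\<in>triangles K. \<forall>T2\<in>triangles K. \<forall>x \<in> T1 \<inter> T2. u T1 x = u T2 x) \<and>
     (if mesh_boundary K \<noteq> {} then \<forall>T\<in>triangles K. \<forall>x \<in> T \<inter> mesh_boundary K. u T x = 0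
      else surface_integral K u = 0)}"

definition BDM :: "surface_mesh \<Rightarrow> nat \<Rightarrow> vector_field set" where
  "BDM K k = {v \<in> vector_P K k.
     \<forall>T1\<in>triangles K. \<forall>T2\<in>triangles K. \<forall>E \<in> edges K T1 \<inter> edges K T2. T1 \<noteq> T2 \<longrightarrow>
       (\<forall>x\<in>E. v T1 x \<bullet> conormal K T1 E x + v T2 x \<bullet> conormal K T2 E x = 0)}"

definition BDM0 :: "surface_mesh \<Rightarrow> nat \<Rightarrow> vector_field set" where
  "BDM0 K k = {v \<in> BDM K k.
     \<forall>T\<in>triangles K. \<forall>E \<in> edges K T \<inter> boundary_edges K. \<forall>x\<in>E. v T x \<bullet> conormal K T E x = 0}"

text \<open>For fields in \<open>BDM\<close> the weak divergence is the elementwise one.\<close>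
definition J_BDM :: "surface_mesh \<Rightarrow> nat \<Rightarrow> vector_field set" where
  "J_BDM K k = {v \<in> BDM0 K k. \<forall>T\<in>triangles K. \<forall>x\<in>T. surf_div K v T x = 0}"

definition orth_complement_in ::
    "surface_mesh \<Rightarrow> vector_field set \<Rightarrow> vector_field set \<Rightarrow> vector_field set" where
  "orth_complement_in K V W = {v \<in> V. \<forall>w\<in>W. L2_inner K v w = 0}"

definition H_BDM :: "surface_mesh \<Rightarrow> nat \<Rightarrow> vector_field set" where
  "H_BDM K k = orth_complement_in K (J_BDM K k) (rot K ` lagrange0 K (k + 1))"

text \<open>\<open>V\<close> is the orthogonal direct sum of the subspaces in the list \<open>Ws\<close>: every element of \<open>V\<close> is,
  in a unique way, a sum of elements of these subspaces, and all such sums lie in \<open>V\<close>.\<close>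
definition orth_direct_sum ::
    "surface_mesh \<Rightarrow> vector_field set \<Rightarrow> vector_field set list \<Rightarrow> bool" where
  "orth_direct_sum K V Ws \<longleftrightarrow>
     (\<forall>W\<in>set Ws. subspace W) \<and>
     bij_betw sum_list (listset Ws) V \<and>
     (\<forall>i<length Ws. \<forall>j<length Ws. i \<noteq> j \<longrightarrow>
        (\<forall>v \<in> Ws!i. \<forall>w \<in> Ws!j. L2_inner K v w = 0))"

end

theory Submission
  imports Defs "HOL-Complex_Analysis.Complex_Analysis" "HOL-Computational_Algebra.Polynomial"
begin

text \<open>Why the theorem holds. Off the edges every solenoidal field in \<open>J_BDM\<close> has a stream function,
  so that everything can be expressed by potentials, that is, piecewise polynomials of degree
  \<open>k + 1\<close> without any continuity. On an edge the normal component of the rotated gradient is the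
  tangential derivative of the potential divided by the speed of the edge, and the Piola map makes
  this exact on curved triangles. Hence the rotated gradient of a potential is in \<open>J_BDM\<close> iff on
  each edge the jump of the potential (its trace, on a boundary edge) is constant:
  \<open>J_BDM_potentials\<close>. The potentials with zero jumps are the continuous ones with zero
  boundary values, whose rotated gradients are those of the Lagrange elements (\<open>rot_lagrange\<close>).

  The dimension of the harmonic fields is therefore obtained from three applications of rank-nullity
  (\<open>dim_J_BDM_minus_rot\<close>). The rotated gradient has the piecewise constants as its kernel on the
  potentials; on those with zero jumps its kernel consists of the simplicial two-cycles. The map to the
  constant jumps has as its image exactly the simplicial one-cycles (\<open>jumps_image\<close>): such a jump
  function is a cycle because it can be evaluated at either end of an edge, and conversely vertex
  values with prescribed jumps are found separately around each vertex, whose link is connected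
  (\<open>cycles_are_jumps\<close>), and interpolated linearly. The degree \<open>k\<close> has dropped out, and what remains is
  the simplicial homology of the triangulation over the reals.

  Its dimensions are counted in \<open>dim_cycles1\<close> and \<open>dim_cycles2\<close>: besides the numbers of vertices,
  edges and triangles there enter the number of components of the surface and the number of components
  without boundary. These are the zeroth and the second Betti number (\<open>betti_0\<close>,
  \<open>betti_2\<close>), so that the Euler formula leaves the first one. For the second Betti number, the
  triangles are removed one by one (\<open>dismantle\<close>): a triangle with a free edge is pushed onto its other
  sides, and any other triangle is punctured, which happens once for each component without boundary
  and costs at most one unit of rank. Conversely, the oriented sums of the triangles of
  these components are independent: seen from an inner point of one of its triangles, such a sum becomes the
  boundary of the standard triangle, which winds once around the midpoint.

  The orthogonal decompositions are then linear algebra, as \<open>L2_inner\<close> is positive definite on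
  piecewise polynomial fields and \<open>J_BDM\<close> has finite dimension.\<close>

section \<open>Finite-dimensional subspaces\<close>

text \<open>The function \<open>dim\<close> is zero on spaces of infinite dimension, so that counting dimensions needs this
  predicate.\<close>
definition finite_dim :: "'a::real_vector set \<Rightarrow> bool" where
  "finite_dim S \<longleftrightarrow> (\<exists>B. finite B \<and> S \<subseteq> span B)"

lemma finite_dim_subset: "finite_dim T \<Longrightarrow> S \<subseteq> T \<Longrightarrow> finite_dim S"
  unfolding finite_dim_def by blast

lemma finite_dim_independent:
  assumes "finite_dim S" "independent B" "B \<subseteq> S"
  shows "finite B"
proof -
  obtain A where "finite A" "S \<subseteq> span A"
    using assms(1) unfolding finite_dim_def by blast
  then show ?thesis
    using independent_span_bound[of A B] assms by auto
qed

text \<open>Linearity is relative to a subspace, because differential operators on piecewise fields are linear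
  only where the derivatives exist.\<close>
definition linear_map_on :: "'a::real_vector set \<Rightarrow> ('a \<Rightarrow> 'b::real_vector) \<Rightarrow> bool" where
  "linear_map_on S f \<longleftrightarrow> (\<forall>x\<in>S. \<forall>y\<in>S. f (x + y) = f x + f y) \<and> (\<forall>c. \<forall>x\<in>S. f (c *\<^sub>R x) = c *\<^sub>R f x)"

lemma linear_map_on_subset: "linear_map_on T f \<Longrightarrow> S \<subseteq> T \<Longrightarrow> linear_map_on S f"
  unfolding linear_map_on_def by blast

lemma linear_map_on_zero: "subspace S \<Longrightarrow> linear_map_on S f \<Longrightarrow> f 0 = 0"
  unfolding linear_map_on_def by (metis scaleR_zero_left subspace_0)

lemma linear_map_on_kernel: "subspace S \<Longrightarrow> linear_map_on S f \<Longrightarrow> subspace {x\<in>S. f x = 0}"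
  using linear_map_on_zero[of S f]
  unfolding subspace_def linear_map_on_def by auto

lemma linear_map_on_image: "subspace S \<Longrightarrow> linear_map_on S f \<Longrightarrow> subspace (f ` S)"
  unfolding subspace_def
proof safe
  assume "0 \<in> S" "\<forall>x\<in>S. \<forall>y\<in>S. x + y \<in> S" "\<forall>c. \<forall>x\<in>S. c *\<^sub>R x \<in> S" and lin: "linear_map_on S f"
  then have "subspace S" by (simp add: subspace_def)
  then show "0 \<in> f ` S" using linear_map_on_zero[OF _ lin] \<open>0 \<in> S\<close> by force
qed (auto simp: linear_map_on_def image_iff, metis, metis)

lemma linear_map_on_extends:
  assumes "linear_map_on S f" "subspace S"
  obtains g where "linear g" "\<And>x. x \<in> S \<Longrightarrow> g x = f x"
proof -
  obtain B where B: "B \<subseteq> S" "independent B" "S \<subseteq> span B"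
    using maximal_independent_subset by blast
  obtain g where g: "linear g" "\<And>x. x \<in> B \<Longrightarrow> g x = f x"
    using linear_independent_extend[OF B(2)] by metis
  have "x \<in> S \<and> g x = f x" if "x \<in> span B" for x
    using that
  proof (induction rule: span_induct_alt)
    case base
    then show ?case
      using linear_map_on_zero[OF assms(2,1)] linear_0[OF g(1)] assms(2) by (simp add: subspace_0)
  next
    case (step c x y)
    then show ?case using g B(1) assms
      by (auto simp: linear_add linear_scale linear_map_on_def subspace_def subset_iff)
  qed
  then show ?thesis using that g(1) B(3) by blast
qed

text \<open>A basis \<open>A\<close> of the kernel is extended to a basis \<open>B\<close> of \<open>S\<close>; then \<open>f\<close> maps \<open>B - A\<close> injectively onto a
  basis of the image.\<close>
lemma rank_nullity:
  assumes S: "subspace S" "finite_dim S" and f: "linear_map_on S f"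
  shows "finite_dim (f ` S)" "dim S = dim {x\<in>S. f x = 0} + dim (f ` S)"
proof -
  obtain g where g: "linear g" "\<And>x. x \<in> S \<Longrightarrow> g x = f x"
    using linear_map_on_extends[OF f S(1)] by blast
  define N where "N = {x\<in>S. f x = 0}"
  obtain A where A: "A \<subseteq> N" "independent A" "N \<subseteq> span A"
    using maximal_independent_subset by blast
  have "A \<subseteq> S" using A(1) by (auto simp: N_def)
  obtain B where B: "A \<subseteq> B" "B \<subseteq> S" "independent B" "S \<subseteq> span B"
    using maximal_independent_subset_extend[OF \<open>A \<subseteq> S\<close> A(2)] by blast
  have "finite B" using finite_dim_independent[OF S(2) B(3,2)] .
  have spB: "span B = S" using B S(1) by (meson span_minimal subset_antisym)
  have "subspace N" unfolding N_def by (rule linear_map_on_kernel[OF S(1) f])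
  then have spA: "span A = N" using A by (meson span_minimal subset_antisym)
  define C where "C = B - A"
  have "C \<subseteq> S" using B unfolding C_def by blast
  have int: "x = 0" if "x \<in> span A" "x \<in> span C" for x
  proof -
    have CB: "C \<subseteq> B" by (auto simp: C_def)
    have "representation B x b = 0" for b
      using representation_extend[OF B(3) that(1) B(1)] representation_extend[OF B(3) that(2) CB]
        representation_ne_zero[of A x b] representation_ne_zero[of C x b] unfolding C_def by auto
    moreover have "x \<in> span B" using that(1) B(1) span_mono by blast
    ultimately show "x = 0"
      using sum_nonzero_representation_eq[OF B(3), of x] by simp
  qed
  have inj: "inj_on g (span C)"
  proof -
    have "x = 0" if "x \<in> span C" "g x = 0" for x
    proof -
      have "x \<in> S" using that(1) \<open>C \<subseteq> S\<close> S(1) by (meson span_minimal subset_iff)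
      then have "x \<in> N" using that(2) g(2) by (simp add: N_def)
      then show ?thesis using int that(1) spA by blast
    qed
    then show ?thesis
      using linear_inj_on_span_iff_independent_image linear_injective_on_subspace_0[OF g(1) subspace_span] by blast
  qed
  have im: "f ` S = g ` S" using g(2) by auto
  have gS: "g ` S = span (g ` C)"
  proof -
    have "g ` S = span (g ` B)" using spB linear_span_image[OF g(1), of B] by simp
    also have "\<dots> = span (g ` C)"
    proof -
      have "g ` A \<subseteq> {0}" using A(1) g(2) by (force simp: N_def)
      then have "g ` B \<subseteq> insert 0 (g ` C)" unfolding C_def by blast
      then have "span (g ` B) \<subseteq> span (insert 0 (g ` C))" by (rule span_mono)
      moreover have "span (g ` C) \<subseteq> span (g ` B)" by (intro span_mono image_mono) (auto simp: C_def)
      ultimately show ?thesis by (simp add: span_insert_0)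
    qed
    finally show ?thesis .
  qed
  have fC: "finite C" using \<open>finite B\<close> by (simp add: C_def)
  show "finite_dim (f ` S)" unfolding finite_dim_def im gS using fC by blast
  have indC: "independent C" using B(3) independent_mono unfolding C_def by blast
  have "independent (g ` C)" using linear_independent_injective_image[OF g(1) indC inj] .
  then have "dim (f ` S) = card (g ` C)" unfolding im gS by (simp add: dim_eq_card_independent)
  also have "\<dots> = card C" using inj by (meson card_image inj_on_subset span_superset)
  finally have "dim (f ` S) = card B - card A"
    using \<open>finite B\<close> B(1) by (simp add: C_def card_Diff_subset finite_subset)
  moreover have "dim S = card B" using spB B(3) by (metis dim_span dim_eq_card_independent)
  moreover have "dim N = card A" using spA A(2) by (metis dim_span dim_eq_card_independent)
  moreover have "card A \<le> card B" using \<open>finite B\<close> B(1) by (rule card_mono)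
  ultimately show "dim S = dim {x\<in>S. f x = 0} + dim (f ` S)" by (simp add: N_def)
qed

lemma dim_injective_image:
  assumes "subspace S" "finite_dim S" "linear_map_on S f" "\<And>x. x \<in> S \<Longrightarrow> f x = 0 \<Longrightarrow> x = 0"
  shows "dim (f ` S) = dim S"
proof -
  have "{x\<in>S. f x = 0} = {0}" 
    using assms linear_map_on_zero[OF assms(1,3)] by (auto simp: subspace_0)
  moreover have "dim {0::'a} = 0" using dim_eq_card_independent[OF independent_empty, where 'a='a] dim_span[of "{}::'a set"] by simp
  ultimately show ?thesis using rank_nullity(2)[OF assms(1-3)] by simp
qed

definition functions_on :: "'a set \<Rightarrow> ('a \<Rightarrow> real) set" where
  "functions_on A = {f. \<forall>x. x \<notin> A \<longrightarrow> f x = 0}"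

definition unit_fun :: "'a \<Rightarrow> 'a \<Rightarrow> real" where
  "unit_fun a = (\<lambda>x. if x = a then 1 else 0)"

lemma subspace_functions_on: "subspace (functions_on A)"
  by (simp add: subspace_def functions_on_def scaleR_fun_def)

lemma sum_fun_apply: "sum f A x = (\<Sum>a\<in>A. f a x)" for f :: "'a \<Rightarrow> 'b \<Rightarrow> real"
  by (induction A rule: infinite_finite_induct) auto

lemma functions_on_expand:
  assumes "finite A" "f \<in> functions_on A"
  shows "f = (\<Sum>a\<in>A. f a *\<^sub>R unit_fun a)"
proof
  fix x
  have "(\<Sum>a\<in>A. f a *\<^sub>R unit_fun a) x = (\<Sum>a\<in>A. if a = x then f a else 0)"
    by (auto simp: sum_fun_apply scaleR_fun_def unit_fun_def intro!: sum.cong)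
  also have "\<dots> = f x" using assms by (auto simp: functions_on_def)
  finally show "f x = (\<Sum>a\<in>A. f a *\<^sub>R unit_fun a) x" by simp
qed

lemma functions_on_dim:
  assumes "finite A"
  shows "finite_dim (functions_on A)" "dim (functions_on A) = card A"
proof -
  have sub: "functions_on A \<subseteq> span (unit_fun ` A)"
  proof
    fix f assume f: "f \<in> functions_on A"
    show "f \<in> span (unit_fun ` A)"
      by (subst functions_on_expand[OF assms f]) (intro span_sum span_scale span_base imageI)
  qed
  then show "finite_dim (functions_on A)" using assms unfolding finite_dim_def by blast
  have inj: "inj_on unit_fun A" by (auto simp: inj_on_def unit_fun_def fun_eq_iff split: if_splits)
  have "independent (unit_fun ` A)"
  proof (rule independent_if_scalars_zero)
    fix h :: "('a \<Rightarrow> real) \<Rightarrow> real" and b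
    assume "(\<Sum>x\<in>unit_fun ` A. h x *\<^sub>R x) = 0" "b \<in> unit_fun ` A"
    then obtain a where a: "a \<in> A" "b = unit_fun a" by blast
    have "0 = (\<Sum>x\<in>unit_fun ` A. h x *\<^sub>R x) a" using \<open>(\<Sum>x\<in>unit_fun ` A. h x *\<^sub>R x) = 0\<close> by simp
    also have "\<dots> = (\<Sum>x\<in>A. h (unit_fun x) * unit_fun x a)"
      by (simp add: sum.reindex[OF inj] sum_fun_apply scaleR_fun_def)
    also have "\<dots> = (\<Sum>x\<in>A. if x = a then h (unit_fun x) else 0)"
      by (intro sum.cong) (auto simp: unit_fun_def)
    also have "\<dots> = h b" using a assms by simp
    finally show "h b = 0" by simp
  qed (use assms in auto)
  moreover have "span (unit_fun ` A) = span (functions_on A)"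
  proof (rule subset_antisym)
    show "span (unit_fun ` A) \<subseteq> span (functions_on A)"
      by (rule span_mono) (auto simp: functions_on_def unit_fun_def)
    show "span (functions_on A) \<subseteq> span (unit_fun ` A)"
      using sub by (simp add: span_minimal)
  qed
  ultimately have "dim (functions_on A) = card (unit_fun ` A)" by (metis dim_eq_card)
  then show "dim (functions_on A) = card A" using inj by (simp add: card_image)
qed

text \<open>Subtracting the zero multiple \<open>sum d N\<close> of one unit function turns the expansion of \<open>d\<close> into a
  combination of differences.\<close>
lemma zero_sum_in_subspace:
  assumes "finite N" "d \<in> functions_on N" "sum d N = 0" "subspace U"
    and "\<And>a b. a \<in> N \<Longrightarrow> b \<in> N \<Longrightarrow> unit_fun a - unit_fun b \<in> U"
  shows "d \<in> U"
proof (cases "N = {}")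
  case True
  then have "d = 0" using assms(2) by (auto simp: functions_on_def)
  then show ?thesis using assms(4) by (simp add: subspace_0)
next
  case False
  then obtain o' where o': "o' \<in> N" by blast
  have "d = (\<Sum>a\<in>N. d a *\<^sub>R unit_fun a) - sum d N *\<^sub>R unit_fun o'"
    using functions_on_expand[OF assms(1,2)] assms(3) by simp
  also have "\<dots> = (\<Sum>a\<in>N. d a *\<^sub>R (unit_fun a - unit_fun o'))"
    by (simp add: scaleR_diff_right sum_subtractf scaleR_sum_left)
  also have "\<dots> \<in> U"
    by (intro subspace_sum[OF assms(4)] subspace_scale[OF assms(4)] assms(5) o')
  finally show ?thesis .
qed

section \<open>Orthogonal projection onto finite-dimensional subspaces\<close>

text \<open>The \<open>L\<^sup>2\<close> form is bilinear only on integrable fields and definite only on continuous ones; hence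
  the restriction to a subspace.\<close>
definition inner_product_on :: "'a::real_vector set \<Rightarrow> ('a \<Rightarrow> 'a \<Rightarrow> real) \<Rightarrow> bool" where
  "inner_product_on V ip \<longleftrightarrow> subspace V \<and>
     (\<forall>x\<in>V. \<forall>y\<in>V. \<forall>z\<in>V. ip (x + y) z = ip x z + ip y z) \<and>
     (\<forall>c. \<forall>x\<in>V. \<forall>y\<in>V. ip (c *\<^sub>R x) y = c * ip x y) \<and>
     (\<forall>x\<in>V. \<forall>y\<in>V. ip x y = ip y x) \<and> (\<forall>x\<in>V. ip x x = 0 \<longrightarrow> x = 0)"

context
  fixes V :: "'a::real_vector set" and ip :: "'a \<Rightarrow> 'a \<Rightarrow> real"
  assumes ip: "inner_product_on V ip"
begin

lemma ip_subspace: "subspace V" using ip by (simp add: inner_product_on_def)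

lemma ip_add: "x \<in> V \<Longrightarrow> y \<in> V \<Longrightarrow> z \<in> V \<Longrightarrow> ip (x + y) z = ip x z + ip y z"
  and ip_scale: "x \<in> V \<Longrightarrow> y \<in> V \<Longrightarrow> ip (c *\<^sub>R x) y = c * ip x y"
  and ip_sym: "x \<in> V \<Longrightarrow> y \<in> V \<Longrightarrow> ip x y = ip y x"
  and ip_definite: "x \<in> V \<Longrightarrow> ip x x = 0 \<Longrightarrow> x = 0"
  using ip by (auto simp: inner_product_on_def)

lemma ip_diff: "x \<in> V \<Longrightarrow> y \<in> V \<Longrightarrow> z \<in> V \<Longrightarrow> ip (x - y) z = ip x z - ip y z"
  using ip_add[of x "- y" z] ip_scale[of y z "-1"] ip_subspace
  by (simp add: subspace_neg)

text \<open>Gram-Schmidt: the projection onto the larger span gains the component in the direction of the part of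
  the new vector that is orthogonal to the smaller span.\<close>
lemma orthogonal_projection_span:
  assumes "finite B" "B \<subseteq> V" "v \<in> V"
  shows "\<exists>w\<in>span B. \<forall>u\<in>span B. ip (v - w) u = 0"
  using assms
proof (induction B arbitrary: v rule: finite_induct)
  case empty
  then have "ip v 0 = 0" using ip_scale[of 0 v 0] ip_sym[of v 0] ip_subspace by (simp add: subspace_0)
  then show ?case by simp
next
  case (insert b B)
  have B: "B \<subseteq> V" and b: "b \<in> V" and v: "v \<in> V" using insert by auto
  have spB: "span B \<subseteq> V" using B ip_subspace by (rule span_minimal)
  obtain p where p: "p \<in> span B" "\<And>u. u \<in> span B \<Longrightarrow> ip (b - p) u = 0"
    using insert.IH[OF B b] by blast
  obtain w where w: "w \<in> span B" "\<And>u. u \<in> span B \<Longrightarrow> ip (v - w) u = 0"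
    using insert.IH[OF B v] by blast
  define c where "c = b - p"
  have c: "c \<in> V" using b p spB ip_subspace by (auto simp: c_def subspace_diff)
  \<comment> \<open>for \<open>c = 0\<close> the quotient is zero by default, which is the coefficient of a zero direction\<close>
  define t where "t = ip v c / ip c c"
  have tc: "t * ip c c = ip v c"
  proof (cases "c = 0")
    case True
    moreover have "ip 0 0 = 0" "ip v 0 = 0"
      using ip_scale[of 0 v 0] ip_scale[of 0 0 0] ip_sym[of v 0] ip_subspace v by (simp_all add: subspace_0)
    ultimately show ?thesis by simp
  next
    case False
    then show ?thesis using ip_definite[OF c] by (auto simp: t_def)
  qed
  have wV: "w \<in> V" and pV: "p \<in> V" using w p spB by auto
  have memV: "v - w - t *\<^sub>R c \<in> V" "v - w \<in> V" "t *\<^sub>R c \<in> V"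
    using v wV c ip_subspace by (auto intro!: subspace_diff subspace_scale)
  have "c \<in> span (insert b B)" unfolding c_def
    using p(1) span_mono[of B "insert b B"] by (intro span_diff) (auto intro: span_base)
  moreover have "w \<in> span (insert b B)" using w(1) span_mono[of B "insert b B"] by auto
  ultimately have "w + t *\<^sub>R c \<in> span (insert b B)" by (intro span_add span_scale)
  moreover have "ip (v - (w + t *\<^sub>R c)) u = 0" if u_in: "u \<in> span (insert b B)" for u
  proof -
    obtain k where "u - k *\<^sub>R b \<in> span B" using u_in by (auto simp: span_insert)
    then have u0: "u - k *\<^sub>R b + k *\<^sub>R p \<in> span B" using p(1) by (intro span_add span_scale)
    define x where "x = u - k *\<^sub>R b + k *\<^sub>R p"
    have x: "x \<in> span B" "x \<in> V" using u0 spB by (auto simp: x_def)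
    have u: "u = x + k *\<^sub>R c" by (simp add: x_def c_def algebra_simps)
    have kc: "k *\<^sub>R c \<in> V" using c ip_subspace by (simp add: subspace_scale)
    have 1: "ip (v - w - t *\<^sub>R c) y = ip (v - w) y - t * ip c y" if "y \<in> V" for y
      using that memV c by (simp add: ip_diff ip_scale)
    have "ip (v - w - t *\<^sub>R c) u = ip (v - w - t *\<^sub>R c) x + k * ip (v - w - t *\<^sub>R c) c"
    proof -
      have "ip (v - w - t *\<^sub>R c) u = ip u (v - w - t *\<^sub>R c)" 
        using u x kc memV ip_subspace by (intro ip_sym) (auto intro!: subspace_add)
      also have "\<dots> = ip x (v - w - t *\<^sub>R c) + k * ip c (v - w - t *\<^sub>R c)"
        unfolding u using x kc memV c by (simp add: ip_add ip_scale)
      finally show ?thesis using x memV c by (simp add: ip_sym)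
    qed
    also have "ip (v - w - t *\<^sub>R c) x = 0" using 1[OF x(2)] w(2)[OF x(1)] p(2)[OF x(1)] by (simp add: c_def)
    also have "ip (v - w - t *\<^sub>R c) c = 0"
    proof -
      have "ip w c = 0" using p(2)[OF w(1)] ip_sym[OF wV c] by (simp add: c_def)
      then show ?thesis using 1[OF c] v wV c tc by (simp add: ip_diff)
    qed
    finally show ?thesis by (simp add: diff_diff_eq)
  qed
  ultimately show ?case by blast
qed

lemma orthogonal_projection:
  assumes "subspace W" "W \<subseteq> V" "finite_dim W" "v \<in> V"
  obtains w where "w \<in> W" "\<And>u. u \<in> W \<Longrightarrow> ip (v - w) u = 0"
proof -
  obtain B where B: "B \<subseteq> W" "independent B" "W \<subseteq> span B"
    using maximal_independent_subset by blast
  have "finite B" using finite_dim_independent[OF assms(3) B(2,1)] .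
  moreover have "span B = W" using B assms(1) by (meson span_minimal subset_antisym)
  ultimately show ?thesis
    using orthogonal_projection_span[of B v] B(1) assms(2,4) that by blast
qed

end

lemma orth_complement_subspace:
  assumes "inner_product_on V (L2_inner K)" "subspace V'" "V' \<subseteq> V" "W \<subseteq> V"
  shows "subspace (orth_complement_in K V' W)"
proof -
  have "L2_inner K 0 w = 0" if "w \<in> W" for w
    using ip_scale[OF assms(1), of 0 w 0] that assms(4) ip_subspace[OF assms(1)] by (auto simp: subspace_0)
  then show ?thesis
    using assms(2-4) ip_add[OF assms(1)] ip_scale[OF assms(1)]
    unfolding orth_complement_in_def subspace_def by (auto simp: subset_iff)
qed

text \<open>The orthogonal projection onto \<open>W\<close> splits every element, and by definiteness \<open>W\<close> meets its complement only
  in zero.\<close>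
lemma orth_direct_sum_complement:
  assumes ip: "inner_product_on V (L2_inner K)" and "subspace V'" "V' \<subseteq> V"
    and W: "subspace W" "W \<subseteq> V'" "finite_dim W"
  shows "orth_direct_sum K V' [W, orth_complement_in K V' W]"
proof -
  let ?C = "orth_complement_in K V' W"
  have C: "subspace ?C" using orth_complement_subspace[OF ip assms(2,3)] assms(3) W(2) by blast
  have CV: "?C \<subseteq> V'" by (auto simp: orth_complement_in_def)
  have ort: "L2_inner K c w = 0" if "c \<in> ?C" "w \<in> W" for c w
    using that by (auto simp: orth_complement_in_def)
  have ort': "L2_inner K w c = 0" if "c \<in> ?C" "w \<in> W" for c w
    using ort[OF that] ip_sym[OF ip, of w c] that CV W(2) assms(3) by auto
  have int: "x = 0" if "x \<in> W" "x \<in> ?C" for x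
    using ort[OF that(2,1)] ip_definite[OF ip, of x] that(1) W(2) assms(3) by auto
  have "bij_betw sum_list (listset [W, ?C]) V'"
    unfolding bij_betw_def
  proof
    show "inj_on sum_list (listset [W, ?C])"
    proof (rule inj_onI)
      fix xs ys assume "xs \<in> listset [W, ?C]" "ys \<in> listset [W, ?C]" "sum_list xs = sum_list ys"
      then obtain a b c d where *: "xs = [a, b]" "ys = [c, d]" "a \<in> W" "c \<in> W" "b \<in> ?C" "d \<in> ?C" "a + b = c + d"
        by (auto simp: set_Cons_def)
      then have "a - c = d - b" by (simp add: algebra_simps)
      moreover have "a - c \<in> W" "d - b \<in> ?C" using * W(1) C by (auto intro: subspace_diff)
      ultimately have "a - c = 0" using int by metis
      then show "xs = ys" using * by simp
    qed
    show "sum_list ` listset [W, ?C] = V'"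
    proof (intro equalityI subsetI)
      fix x assume "x \<in> sum_list ` listset [W, ?C]"
      then obtain a b where "x = a + b" "a \<in> W" "b \<in> ?C" by (auto simp: set_Cons_def)
      then show "x \<in> V'" using W(2) CV assms(2) by (auto intro: subspace_add)
    next
      fix x assume x: "x \<in> V'"
      obtain w where w: "w \<in> W" "\<And>u. u \<in> W \<Longrightarrow> L2_inner K (x - w) u = 0"
        using orthogonal_projection[OF ip W(1) _ W(3), of x] W(2) assms(3) x by blast
      have "x - w \<in> ?C" using w x W(2) assms(2) by (auto simp: orth_complement_in_def intro: subspace_diff)
      then have "[w, x - w] \<in> listset [W, ?C]" using w(1) by (auto simp: set_Cons_def)
      moreover have "x = sum_list [w, x - w]" by simp
      ultimately show "x \<in> sum_list ` listset [W, ?C]" by blast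
    qed
  qed
  moreover have "L2_inner K v w = 0"
    if "i < length [W, ?C]" "j < length [W, ?C]" "i \<noteq> j" "v \<in> [W, ?C] ! i" "w \<in> [W, ?C] ! j" for i j v w
  proof -
    have "i \<in> {0, 1}" "j \<in> {0, 1}" using that(1,2) by auto
    then show ?thesis using that(3-5) ort ort' by auto
  qed
  ultimately show ?thesis
    unfolding orth_direct_sum_def using W(1) C by simp
qed

lemma orth_direct_sum_mem:
  assumes "orth_direct_sum K V [A, B]"
  shows "x \<in> V \<longleftrightarrow> (\<exists>a\<in>A. \<exists>b\<in>B. x = a + b)"
proof -
  have "bij_betw sum_list (listset [A, B]) V"
    using assms unfolding orth_direct_sum_def by blast
  then have "V = sum_list ` listset [A, B]" by (simp add: bij_betw_def)
  moreover have "listset [A, B] = (\<lambda>(a, b). [a, b]) ` (A \<times> B)"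
    by (auto simp: set_Cons_def image_iff)
  ultimately have "V = (\<lambda>(a, b). a + b) ` (A \<times> B)" by (auto simp: image_image split_def)
  then show ?thesis by auto
qed

lemma orth_direct_sum_pairD:
  assumes "orth_direct_sum K V [A, B]" "a \<in> A" "b \<in> B"
  shows "L2_inner K a b = 0" "L2_inner K b a = 0"
proof -
  have "\<forall>i<length [A, B]. \<forall>j<length [A, B]. i \<noteq> j \<longrightarrow> (\<forall>v \<in> [A, B]!i. \<forall>w \<in> [A, B]!j. L2_inner K v w = 0)"
    using assms(1) unfolding orth_direct_sum_def by blast
  from this[rule_format, of 0 1 a b] this[rule_format, of 1 0 b a] assms(2,3)
  show "L2_inner K a b = 0" "L2_inner K b a = 0" by auto
qed

text \<open>The summands of \<open>J\<close> inherit orthogonality to \<open>C\<close> from \<open>J\<close>.\<close>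
lemma orth_direct_sum_refine:
  assumes VJ: "orth_direct_sum K V [J, C]" and J: "orth_direct_sum K J [A, B]"
  shows "orth_direct_sum K V [A, B, C]"
proof -
  have 1: "bij_betw sum_list (listset [J, C]) V" and 2: "bij_betw sum_list (listset [A, B]) J"
    using assms by (auto simp: orth_direct_sum_def)
  have sub: "subspace A" "subspace B" "subspace C" "subspace J" 
    using assms by (auto simp: orth_direct_sum_def)
  have J_mem: "x \<in> J \<longleftrightarrow> (\<exists>a\<in>A. \<exists>b\<in>B. x = a + b)" for x
    using orth_direct_sum_mem[OF J] .
  have J_uniq: "a = a' \<and> b = b'" if "a \<in> A" "b \<in> B" "a' \<in> A" "b' \<in> B" "a + b = a' + b'" for a a' b b'
    using 2 that inj_onD[of sum_list "listset [A, B]" "[a, b]" "[a', b']"] unfolding bij_betw_def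
    by (auto simp: set_Cons_def)
  have V_mem: "x \<in> V \<longleftrightarrow> (\<exists>a\<in>J. \<exists>b\<in>C. x = a + b)" for x
    using orth_direct_sum_mem[OF VJ] .
  have V_uniq: "a = a' \<and> b = b'" if "a \<in> J" "b \<in> C" "a' \<in> J" "b' \<in> C" "a + b = a' + b'" for a a' b b'
    using 1 that inj_onD[of sum_list "listset [J, C]" "[a, b]" "[a', b']"] unfolding bij_betw_def
    by (auto simp: set_Cons_def)
  have bij: "bij_betw sum_list (listset [A, B, C]) V"
    unfolding bij_betw_def
  proof
    show "inj_on sum_list (listset [A, B, C])"
    proof (rule inj_onI)
      fix xs ys assume "xs \<in> listset [A, B, C]" "ys \<in> listset [A, B, C]" "sum_list xs = sum_list ys"
      then obtain a b c a' b' c' where *: "xs = [a, b, c]" "ys = [a', b', c']" "a \<in> A" "a' \<in> A" "b \<in> B" "b' \<in> B"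
        "c \<in> C" "c' \<in> C" "(a + b) + c = (a' + b') + c'"
        by (auto simp: set_Cons_def add.assoc)
      then have "a + b = a' + b' \<and> c = c'" using J_mem by (intro V_uniq) auto
      then show "xs = ys" using * J_uniq by blast
    qed
    show "sum_list ` listset [A, B, C] = V"
    proof (intro equalityI subsetI)
      fix x assume "x \<in> sum_list ` listset [A, B, C]"
      then obtain a b c where "x = (a + b) + c" "a \<in> A" "b \<in> B" "c \<in> C" by (auto simp: set_Cons_def add.assoc)
      then show "x \<in> V" using V_mem J_mem by blast
    next
      fix x assume "x \<in> V"
      then obtain j c where "x = j + c" "j \<in> J" "c \<in> C" using V_mem by blast
      moreover then obtain a b where "j = a + b" "a \<in> A" "b \<in> B" using J_mem by blast
      ultimately obtain a b c where *: "x = (a + b) + c" "a \<in> A" "b \<in> B" "c \<in> C" by blast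
      then have "[a, b, c] \<in> listset [A, B, C]" "x = sum_list [a, b, c]" by (auto simp: set_Cons_def add.assoc)
      then show "x \<in> sum_list ` listset [A, B, C]" by blast
    qed
  qed
  have AJ: "A \<subseteq> J" "B \<subseteq> J"
  proof -
    show "A \<subseteq> J" using J_mem sub(2) subspace_0 by (metis add.right_neutral subsetI)
    show "B \<subseteq> J" using J_mem sub(1) subspace_0 by (metis add.left_neutral subsetI)
  qed
  have JC: "L2_inner K v w = 0" "L2_inner K w v = 0" if "v \<in> J" "w \<in> C" for v w
    using that orth_direct_sum_pairD[OF VJ] by auto
  have AB: "L2_inner K v w = 0" "L2_inner K w v = 0" if "v \<in> A" "w \<in> B" for v w
    using that orth_direct_sum_pairD[OF J] by auto
  have ort: "L2_inner K v w = 0"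
    if "i < length [A, B, C]" "j < length [A, B, C]" "i \<noteq> j" "v \<in> [A, B, C] ! i" "w \<in> [A, B, C] ! j" for i j v w
  proof -
    have "i \<in> {0, 1, 2}" "j \<in> {0, 1, 2}" using that(1,2) by auto
    then show ?thesis using that(3-5) AB JC AJ by auto
  qed
  show ?thesis
    unfolding orth_direct_sum_def using bij sub ort by simp
qed

text \<open>Rank-nullity for the projection along \<open>W\<close>.\<close>
lemma dim_orth_complement:
  assumes ip: "inner_product_on V (L2_inner K)" and V: "subspace V'" "V' \<subseteq> V" "finite_dim V'"
    and W: "subspace W" "W \<subseteq> V'"
  shows "dim V' = dim W + dim (orth_complement_in K V' W)"
proof -
  let ?C = "orth_complement_in K V' W"
  have fW: "finite_dim W" using finite_dim_subset V W by blast
  have bij: "bij_betw sum_list (listset [W, ?C]) V'"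
    using orth_direct_sum_complement[OF ip V(1,2) W fW] by (simp add: orth_direct_sum_def)
  have C: "subspace ?C" "?C \<subseteq> V'" using orth_complement_subspace[OF ip V(1,2)] V W
    by (auto simp: orth_complement_in_def)
  define P where "P v = (SOME c. c \<in> ?C \<and> v - c \<in> W)" for v
  have mem: "\<exists>c. c \<in> ?C \<and> v - c \<in> W" if "v \<in> V'" for v
  proof -
    have "v \<in> sum_list ` listset [W, ?C]" using bij that by (simp add: bij_betw_def)
    then show ?thesis by (force simp: set_Cons_def)
  qed
  have P: "P v \<in> ?C" "v - P v \<in> W" if "v \<in> V'" for v
    using someI_ex[OF mem[OF that]] by (auto simp: P_def)
  have uniq: "P v = c" if "v \<in> V'" "c \<in> ?C" "v - c \<in> W" for v c
    using bij inj_onD[of sum_list "listset [W, ?C]" "[v - c, c]" "[v - P v, P v]"] that P[OF that(1)]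
    unfolding bij_betw_def by (auto simp: set_Cons_def)
  have lin: "linear_map_on V' P"
    unfolding linear_map_on_def
  proof (intro conjI ballI allI)
    fix x y assume xy: "x \<in> V'" "y \<in> V'"
    have "x + y - (P x + P y) = (x - P x) + (y - P y)" by simp
    also have "\<dots> \<in> W" using xy P W(1) by (intro subspace_add)
    finally show "P (x + y) = P x + P y"
      using xy P V(1) C(1) by (intro uniq subspace_add)
  next
    fix c x assume x: "x \<in> V'"
    have "c *\<^sub>R x - c *\<^sub>R P x = c *\<^sub>R (x - P x)" by (simp add: scaleR_diff_right)
    also have "\<dots> \<in> W" using x P W(1) by (intro subspace_scale)
    finally show "P (c *\<^sub>R x) = c *\<^sub>R P x"
      using x P V(1) C(1) by (intro uniq subspace_scale)
  qed
  have Pid: "P v = v" if "v \<in> ?C" for v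
    using that C(2) subspace_0[OF W(1)] by (intro uniq) auto
  have im: "P ` V' = ?C"
  proof (intro equalityI subsetI)
    fix c assume "c \<in> P ` V'"
    then show "c \<in> ?C" using P(1) by blast
  next
    fix c assume c: "c \<in> ?C"
    then show "c \<in> P ` V'" using Pid[OF c] C(2) by (intro image_eqI[of _ _ c]) auto
  qed
  have ker: "{v\<in>V'. P v = 0} = W"
  proof (intro equalityI subsetI CollectI conjI)
    fix v assume "v \<in> {v\<in>V'. P v = 0}"
    then show "v \<in> W" using P(2)[of v] by simp
  next
    fix v assume v: "v \<in> W"
    then show "v \<in> V'" using W(2) by blast
    then show "P v = 0" using v subspace_0[OF C(1)] by (intro uniq) auto
  qed
  show ?thesis using rank_nullity(2)[OF V(1,3) lin] unfolding im ker by simp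
qed

section \<open>Oriented two-dimensional complexes\<close>

text \<open>The incidence data of a triangulated oriented surface. An edge is directed from \<open>tl e\<close> to \<open>hd e\<close>, and
  \<open>s t e\<close> is its sign in the boundary of \<open>t\<close>; orientability is the opposition of signs in
  \<open>opposite\<close>. The last assumption excludes surfaces that are pinched at a vertex.\<close>
locale oriented_complex =
  fixes V :: "'v set" and E :: "'e set" and T :: "'t set"
    and tl hd :: "'e \<Rightarrow> 'v" and ed :: "'t \<Rightarrow> 'e set" and s :: "'t \<Rightarrow> 'e \<Rightarrow> int"
  assumes finite_T: "finite T" and finite_ed: "t \<in> T \<Longrightarrow> finite (ed t)"
    and ed_nonempty: "t \<in> T \<Longrightarrow> ed t \<noteq> {}"
    and E_def: "E = (\<Union>t\<in>T. ed t)" and V_def: "V = (\<Union>e\<in>E. {tl e, hd e})"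
    and tl_hd: "e \<in> E \<Longrightarrow> tl e \<noteq> hd e"
    and two_triangles: "e \<in> E \<Longrightarrow> card {t\<in>T. e \<in> ed t} \<le> 2"
    and sign: "t \<in> T \<Longrightarrow> e \<in> ed t \<Longrightarrow> s t e = 1 \<or> s t e = -1"
    and sign_outside: "e \<notin> ed t \<Longrightarrow> s t e = 0"
    and opposite: "t \<in> T \<Longrightarrow> t' \<in> T \<Longrightarrow> t \<noteq> t' \<Longrightarrow> e \<in> ed t \<Longrightarrow> e \<in> ed t' \<Longrightarrow> s t' e = - s t e"
    and boundary_boundary: "t \<in> T \<Longrightarrow>
      (\<Sum>e\<in>ed t. s t e * (if z = hd e then 1 else if z = tl e then -1 else 0)) = 0"
    and corner: "t \<in> T \<Longrightarrow> e \<in> ed t \<Longrightarrow> z \<in> {tl e, hd e} \<Longrightarrow>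
      \<exists>e'. e' \<noteq> e \<and> {e\<in>ed t. z \<in> {tl e, hd e}} = {e, e'}"
    and joined: "t \<in> T \<Longrightarrow> e \<in> ed t \<Longrightarrow> e' \<in> ed t \<Longrightarrow> z \<in> {tl e, hd e} \<Longrightarrow> z' \<in> {tl e', hd e'} \<Longrightarrow> z \<noteq> z' \<Longrightarrow>
      \<exists>e''\<in>ed t. {tl e'', hd e''} = {z, z'}"
    and link_connected: "t \<in> T \<Longrightarrow> t' \<in> T \<Longrightarrow> e \<in> ed t \<Longrightarrow> e' \<in> ed t' \<Longrightarrow> z \<in> {tl e, hd e} \<Longrightarrow> z \<in> {tl e', hd e'} \<Longrightarrow>
      (t, t') \<in> {(A, B). A \<in> T \<and> B \<in> T \<and> (\<exists>f\<in>ed A \<inter> ed B. z \<in> {tl f, hd f})}\<^sup>*"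
begin

definition inc :: "'e \<Rightarrow> 'v \<Rightarrow> int" where
  "inc e z = (if z = hd e then 1 else if z = tl e then -1 else 0)"

definition vt :: "'t \<Rightarrow> 'v set" where
  "vt t = (\<Union>e\<in>ed t. {tl e, hd e})"

definition adj :: "('t \<times> 't) set" where
  "adj = {(A, B). A \<in> T \<and> B \<in> T \<and> ed A \<inter> ed B \<noteq> {}}"

definition conn :: "('t \<times> 't) set" where
  "conn = adj\<^sup>* \<inter> T \<times> T"

text \<open>Such a class of triangles is a component without boundary.\<close>
definition closed_class :: "'t set \<Rightarrow> bool" where
  "closed_class C \<longleftrightarrow> (\<forall>t\<in>C. \<forall>e\<in>ed t. \<exists>t'\<in>T. t' \<noteq> t \<and> e \<in> ed t')"

definition closed_classes :: "'t set set" where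
  "closed_classes = {C \<in> T // conn. closed_class C}"

lemma finite_E: "finite E" using finite_T finite_ed E_def by auto
lemma finite_V: "finite V" using finite_E V_def by auto

lemma ed_E: "t \<in> T \<Longrightarrow> e \<in> ed t \<Longrightarrow> e \<in> E"
  unfolding E_def by blast

lemma equiv_conn: "equiv T conn"
proof (rule equivI)
  have "sym adj" by (auto simp: adj_def sym_def)
  then have "sym (adj\<^sup>*)" by (rule sym_rtrancl)
  then show "sym conn" unfolding conn_def by (auto simp: sym_def)
  show "trans conn" unfolding conn_def trans_def by auto
qed (auto simp: conn_def refl_on_def)

lemma conn_induct:
  assumes "(t, t') \<in> conn" "P t" "\<And>a b e. a \<in> T \<Longrightarrow> b \<in> T \<Longrightarrow> e \<in> ed a \<Longrightarrow> e \<in> ed b \<Longrightarrow> P a \<Longrightarrow> P b"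
  shows "P t'"
proof -
  have "(t, t') \<in> adj\<^sup>*" using assms(1) by (simp add: conn_def)
  then show ?thesis
    by induction (use assms(2,3) in \<open>auto simp: adj_def\<close>)
qed

lemma adj_conn: "t \<in> T \<Longrightarrow> t' \<in> T \<Longrightarrow> e \<in> ed t \<Longrightarrow> e \<in> ed t' \<Longrightarrow> (t, t') \<in> conn"
  by (auto simp: conn_def adj_def)

lemma vertex_conn:
  assumes "t \<in> T" "t' \<in> T" "z \<in> vt t" "z \<in> vt t'"
  shows "(t, t') \<in> conn"
proof -
  obtain e e' where e: "e \<in> ed t" "e' \<in> ed t'" "z \<in> {tl e, hd e}" "z \<in> {tl e', hd e'}"
    using assms(3,4) by (auto simp: vt_def)
  have "(t, t') \<in> {(A, B). A \<in> T \<and> B \<in> T \<and> (\<exists>f\<in>ed A \<inter> ed B. z \<in> {tl f, hd f})}\<^sup>*"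
    by (rule link_connected[OF assms(1,2) e])
  moreover have "{(A, B). A \<in> T \<and> B \<in> T \<and> (\<exists>f\<in>ed A \<inter> ed B. z \<in> {tl f, hd f})} \<subseteq> adj"
    by (auto simp: adj_def)
  ultimately have "(t, t') \<in> adj\<^sup>*" using rtrancl_mono by blast
  then show ?thesis using assms(1,2) by (simp add: conn_def)
qed

lemma finite_classes: "finite (T // conn)"
  using finite_T equiv_conn finite_quotient equiv_type by blast

lemma closed_classes_finite: "finite closed_classes"
  using finite_classes by (simp add: closed_classes_def)

lemma V_vt: "V = (\<Union>t\<in>T. vt t)"
  using V_def E_def by (auto simp: vt_def)

lemma edges_of_two:
  assumes "t \<in> T" "t' \<in> T" "t \<noteq> t'" "e \<in> ed t" "e \<in> ed t'"
  shows "{t\<in>T. e \<in> ed t} = {t, t'}"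
proof (rule card_seteq[symmetric])
  show "card {t \<in> T. e \<in> ed t} \<le> card {t, t'}"
    using two_triangles[OF ed_E[OF assms(1,4)]] assms(3) by simp
qed (use assms finite_T in auto)

lemma sum_signs:
  fixes x :: "'t \<Rightarrow> real"
  shows "(\<Sum>t\<in>T. s t e * x t) = (\<Sum>t\<in>{t\<in>T. e \<in> ed t}. s t e * x t)"
  using finite_T sign_outside by (intro sum.mono_neutral_right) auto

lemma jump_shared:
  fixes x :: "'t \<Rightarrow> real"
  assumes "t \<in> T" "t' \<in> T" "t \<noteq> t'" "e \<in> ed t" "e \<in> ed t'"
  shows "(\<Sum>t\<in>T. s t e * x t) = s t e * (x t - x t')"
  unfolding sum_signs edges_of_two[OF assms] using assms opposite[OF assms] by (simp add: algebra_simps)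

lemma jump_free:
  fixes x :: "'t \<Rightarrow> real"
  assumes "t \<in> T" "e \<in> ed t" "\<And>t'. t' \<in> T \<Longrightarrow> t' \<noteq> t \<Longrightarrow> e \<notin> ed t'"
  shows "(\<Sum>t\<in>T. s t e * x t) = s t e * x t"
proof -
  have "{t\<in>T. e \<in> ed t} = {t}" using assms by auto
  then show ?thesis unfolding sum_signs by simp
qed

subsection \<open>One-cycles\<close>

text \<open>The simplicial boundary operator on one-chains.\<close>
definition bd1 :: "('e \<Rightarrow> real) \<Rightarrow> 'v \<Rightarrow> real" where
  "bd1 c z = (if z \<in> V then \<Sum>e\<in>E. real_of_int (inc e z) * c e else 0)"

definition cycles1 :: "('e \<Rightarrow> real) set" where
  "cycles1 = {c \<in> functions_on E. bd1 c = 0}"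

lemma bd1_linear: "linear_map_on S bd1"
  unfolding linear_map_on_def
  by (auto simp: bd1_def fun_eq_iff scaleR_fun_def algebra_simps sum.distrib sum_distrib_left)

definition class_sum :: "('v \<Rightarrow> real) \<Rightarrow> 't set \<Rightarrow> real" where
  "class_sum x C = (if C \<in> T // conn then \<Sum>z\<in>V \<inter> (\<Union>t\<in>C. vt t). x z else 0)"

lemma class_sum_linear: "linear_map_on S class_sum"
  unfolding linear_map_on_def
  by (auto simp: class_sum_def fun_eq_iff scaleR_fun_def sum.distrib sum_distrib_left)

lemma bd1_unit:
  assumes "e \<in> E"
  shows "bd1 (unit_fun e) = unit_fun (hd e) - unit_fun (tl e)"
proof
  fix z
  have "(\<Sum>e'\<in>E. inc e' z * unit_fun e e') = (\<Sum>e'\<in>E. if e' = e then real_of_int (inc e z) else 0)"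
    by (rule sum.cong) (auto simp: unit_fun_def)
  also have "\<dots> = inc e z" using assms finite_E by simp
  finally have *: "(\<Sum>e'\<in>E. inc e' z * unit_fun e e') = inc e z" .
  have "hd e \<in> V" "tl e \<in> V" using assms V_def by auto
  then show "bd1 (unit_fun e) z = (unit_fun (hd e) - unit_fun (tl e)) z"
    unfolding bd1_def * using tl_hd[OF assms] by (auto simp: unit_fun_def inc_def)
qed

text \<open>The two vertices are joined by a path of edges through the class.\<close>
lemma class_vertices_diff:
  assumes "(t, t') \<in> conn" "z \<in> vt t" "z' \<in> vt t'"
  shows "unit_fun z - unit_fun z' \<in> bd1 ` functions_on E"
proof -
  let ?U = "bd1 ` functions_on E"
  have U: "subspace ?U" by (rule linear_map_on_image[OF subspace_functions_on bd1_linear])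
  have edge: "unit_fun (hd e) - unit_fun (tl e) \<in> ?U" if "e \<in> E" for e
    using bd1_unit[OF that] that by (intro image_eqI[of _ _ "unit_fun e"]) (auto simp: functions_on_def unit_fun_def)
  have edge': "unit_fun (tl e) - unit_fun (hd e) \<in> ?U" if "e \<in> E" for e
    using subspace_neg[OF U edge[OF that]] by simp
  have tri: "unit_fun z - unit_fun z' \<in> ?U" if t: "t \<in> T" and "z \<in> vt t" "z' \<in> vt t" for t z z'
  proof (cases "z = z'")
    case True
    then show ?thesis using U by (simp add: subspace_0)
  next
    case False
    obtain e1 e2 where "e1 \<in> ed t" "e2 \<in> ed t" "z \<in> {tl e1, hd e1}" "z' \<in> {tl e2, hd e2}"
      using \<open>z \<in> vt t\<close> \<open>z' \<in> vt t\<close> unfolding vt_def by blast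
    then obtain e where e: "e \<in> ed t" "{tl e, hd e} = {z, z'}"
      using joined[OF t _ _ _ _ False] by blast
    then have "e \<in> E" using t ed_E by blast
    moreover have "z = tl e \<and> z' = hd e \<or> z = hd e \<and> z' = tl e"
      using e(2) by (auto simp: doubleton_eq_iff)
    ultimately show ?thesis using edge edge' by auto
  qed
  have "\<forall>z'\<in>vt t'. unit_fun z - unit_fun z' \<in> ?U"
    using assms(1)
  proof (rule conn_induct)
    show "\<forall>z'\<in>vt t. unit_fun z - unit_fun z' \<in> ?U"
      using tri assms by (auto simp: conn_def)
  next
    fix a b e assume ab: "a \<in> T" "b \<in> T" "e \<in> ed a" "e \<in> ed b" and IH: "\<forall>z'\<in>vt a. unit_fun z - unit_fun z' \<in> ?U"
    have w: "tl e \<in> vt a" "tl e \<in> vt b" using ab by (auto simp: vt_def)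
    show "\<forall>z'\<in>vt b. unit_fun z - unit_fun z' \<in> ?U"
    proof
      fix z' assume "z' \<in> vt b"
      then have "unit_fun (tl e) - unit_fun z' \<in> ?U" using tri ab(2) w(2) by blast
      moreover have "unit_fun z - unit_fun (tl e) \<in> ?U" using IH w(1) by blast
      ultimately have "(unit_fun z - unit_fun (tl e)) + (unit_fun (tl e) - unit_fun z') \<in> ?U"
        using U by (intro subspace_add)
      then show "unit_fun z - unit_fun z' \<in> ?U" by simp
    qed
  qed
  then show ?thesis using assms(3) by blast
qed

lemma class_disjoint:
  assumes "C \<in> T // conn" "C' \<in> T // conn" "z \<in> (\<Union>t\<in>C. vt t)" "z \<in> (\<Union>t\<in>C'. vt t)"
  shows "C = C'"
proof -
  obtain t t' where t: "t \<in> C" "t' \<in> C'" "z \<in> vt t" "z \<in> vt t'" using assms by blast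
  then have "t \<in> T" "t' \<in> T" using assms(1,2) equiv_conn by (auto dest: in_quotient_imp_subset)
  then show ?thesis using quotient_eqI[OF equiv_conn assms(1,2) t(1,2)] vertex_conn t by blast
qed

text \<open>Both ends of an edge lie in the same component, with opposite signs.\<close>
lemma class_sum_bd1: "class_sum (bd1 c) = 0"
proof
  fix C
  show "class_sum (bd1 c) C = 0 C"
  proof (cases "C \<in> T // conn")
    case True
    have "(\<Sum>z\<in>V \<inter> (\<Union>t\<in>C. vt t). inc e z) = 0" if e: "e \<in> E" for e
    proof -
      obtain t where t: "t \<in> T" "e \<in> ed t" using e E_def by blast
      have ends: "tl e \<in> vt t" "hd e \<in> vt t" using t by (auto simp: vt_def)
      have VV: "tl e \<in> V" "hd e \<in> V" using e V_def by auto
      have cc: "(\<exists>a\<in>C. z \<in> vt a) \<longleftrightarrow> t \<in> C" if "z \<in> vt t" for z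
      proof
        assume "\<exists>a\<in>C. z \<in> vt a"
        then obtain a where a: "a \<in> C" "z \<in> vt a" by blast
        then have "a \<in> T" using True in_quotient_imp_subset[OF equiv_conn] by blast
        then have "(a, t) \<in> conn" using vertex_conn t(1) a(2) that by blast
        then show "t \<in> C" using in_quotient_imp_closed[OF equiv_conn True a(1)] by blast
      qed (use that in blast)
      show ?thesis
      proof (cases "t \<in> C")
        case True
        let ?S = "V \<inter> (\<Union>t\<in>C. vt t)"
        have "(\<Sum>z\<in>?S. inc e z) = (\<Sum>z\<in>{tl e, hd e}. inc e z)"
          using finite_V VV cc ends True by (intro sum.mono_neutral_right) (auto simp: inc_def)
        also have "\<dots> = 0" using tl_hd[OF e] by (simp add: inc_def)
        finally show ?thesis .
      next
        case False
        then have "inc e z = 0" if "z \<in> V \<inter> (\<Union>t\<in>C. vt t)" for z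
          using that cc ends by (auto simp: inc_def)
        then show ?thesis by simp
      qed
    qed
    then have 0: "(\<Sum>z\<in>V \<inter> (\<Union>t\<in>C. vt t). real_of_int (inc e z)) = 0" if "e \<in> E" for e
      using that by (metis of_int_sum of_int_0)
    have "class_sum (bd1 c) C = (\<Sum>z\<in>V \<inter> (\<Union>t\<in>C. vt t). \<Sum>e\<in>E. inc e z * c e)"
      using True by (simp add: class_sum_def bd1_def)
    also have "\<dots> = (\<Sum>e\<in>E. \<Sum>z\<in>V \<inter> (\<Union>t\<in>C. vt t). inc e z * c e)" by (rule sum.swap)
    also have "\<dots> = 0" using 0 by (simp add: sum_distrib_right[symmetric])
    finally show ?thesis by simp
  qed (simp add: class_sum_def)
qed

text \<open>A zero-chain is the sum of its parts on the components; each of these has sum zero and is a combination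
  of differences of vertices of one component.\<close>
lemma boundaries0: "bd1 ` functions_on E = {x \<in> functions_on V. class_sum x = 0}"
proof (intro equalityI subsetI)
  fix x assume "x \<in> bd1 ` functions_on E"
  then show "x \<in> {x \<in> functions_on V. class_sum x = 0}"
    using class_sum_bd1 by (auto simp: functions_on_def bd1_def)
next
  fix x assume "x \<in> {x \<in> functions_on V. class_sum x = 0}"
  then have x: "x \<in> functions_on V" "class_sum x = 0" by auto
  let ?U = "bd1 ` functions_on E"
  have U: "subspace ?U" by (rule linear_map_on_image[OF subspace_functions_on bd1_linear])
  define xC where "xC C = (\<lambda>z. if z \<in> V \<inter> (\<Union>t\<in>C. vt t) then x z else 0)" for C
  have "xC C \<in> ?U" if C: "C \<in> T // conn" for C
  proof (rule zero_sum_in_subspace[OF _ _ _ U])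
    show "finite (V \<inter> (\<Union>t\<in>C. vt t))" using finite_V by simp
    show "xC C \<in> functions_on (V \<inter> (\<Union>t\<in>C. vt t))" by (auto simp: functions_on_def xC_def)
    have "sum (xC C) (V \<inter> (\<Union>t\<in>C. vt t)) = class_sum x C"
    proof -
      have "sum (xC C) (V \<inter> (\<Union>t\<in>C. vt t)) = sum x (V \<inter> (\<Union>t\<in>C. vt t))"
        by (rule sum.cong[OF refl]) (simp only: xC_def if_True)
      then show ?thesis using C by (simp add: class_sum_def)
    qed
    then show "sum (xC C) (V \<inter> (\<Union>t\<in>C. vt t)) = 0" using x(2) by simp
    fix a b assume "a \<in> V \<inter> (\<Union>t\<in>C. vt t)" "b \<in> V \<inter> (\<Union>t\<in>C. vt t)"
    then obtain t t' where "t \<in> C" "t' \<in> C" "a \<in> vt t" "b \<in> vt t'" by blast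
    moreover then have "(t, t') \<in> conn" using in_quotient_imp_in_rel[OF equiv_conn C] by blast
    ultimately show "unit_fun a - unit_fun b \<in> ?U" by (intro class_vertices_diff)
  qed
  then have "(\<Sum>C\<in>T // conn. xC C) \<in> ?U" by (intro subspace_sum[OF U])
  moreover have "x = (\<Sum>C\<in>T // conn. xC C)"
  proof
    fix z
    show "x z = (\<Sum>C\<in>T // conn. xC C) z"
    proof (cases "z \<in> V")
      case True
      then obtain t where t: "t \<in> T" "z \<in> vt t" using V_vt by blast
      define C0 where "C0 = conn `` {t}"
      have C0: "C0 \<in> T // conn" "t \<in> C0" unfolding C0_def using quotientI[OF t(1)] equiv_class_self[OF equiv_conn t(1)] by auto
      have "(\<Sum>C\<in>T // conn. xC C z) = (\<Sum>C\<in>T // conn. if C = C0 then x z else 0)"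
      proof (rule sum.cong[OF refl])
        fix C assume "C \<in> T // conn"
        then show "xC C z = (if C = C0 then x z else 0)"
          using class_disjoint[of C C0 z] C0 t True by (auto simp: xC_def)
      qed
      also have "\<dots> = x z" using C0 finite_classes by simp
      finally show ?thesis by (simp add: sum_fun_apply)
    qed (use x(1) in \<open>simp add: sum_fun_apply xC_def functions_on_def\<close>)
  qed
  ultimately show "x \<in> ?U" by simp
qed

text \<open>Rank-nullity for \<open>bd1\<close>, and for \<open>class_sum\<close>, whose kernel is the image of \<open>bd1\<close>.\<close>
theorem dim_cycles1: "dim cycles1 + card V = card E + card (T // conn)"
proof -
  have 1: "card E = dim cycles1 + dim (bd1 ` functions_on E)"
    using rank_nullity(2)[OF subspace_functions_on functions_on_dim(1)[OF finite_E] bd1_linear]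
    by (simp add: functions_on_dim(2)[OF finite_E] cycles1_def)
  have "class_sum ` functions_on V = functions_on (T // conn)"
  proof (intro equalityI subsetI)
    fix y assume "y \<in> functions_on (T // conn)"
    define p where "p C = (SOME z. z \<in> V \<inter> (\<Union>t\<in>C. vt t))" for C
    have p: "p C \<in> V \<inter> (\<Union>t\<in>C. vt t)" if C: "C \<in> T // conn" for C
      unfolding p_def
    proof (rule someI_ex)
      obtain t where t: "t \<in> C" "t \<in> T"
        using C equiv_conn by (metis equiv_class_self quotientE)
      then obtain e where "e \<in> ed t" using ed_nonempty by blast
      then show "\<exists>z. z \<in> V \<inter> (\<Union>t\<in>C. vt t)" using t V_vt by (auto simp: vt_def intro!: exI[of _ "tl e"])
    qed
    define x where "x = (\<Sum>C\<in>T // conn. y C *\<^sub>R unit_fun (p C))"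
    have "x \<in> functions_on V"
      unfolding x_def by (intro subspace_sum subspace_scale subspace_functions_on)
        (use p in \<open>auto simp: functions_on_def unit_fun_def\<close>)
    moreover have "class_sum x = y"
    proof
      fix C
      show "class_sum x C = y C"
      proof (cases "C \<in> T // conn")
        case True
        have "class_sum (unit_fun (p C')) C = (if C' = C then 1 else 0)" if "C' \<in> T // conn" for C'
        proof -
          have "(\<Sum>z\<in>V \<inter> (\<Union>t\<in>C. vt t). unit_fun (p C') z) = (if p C' \<in> V \<inter> (\<Union>t\<in>C. vt t) then 1 else 0)"
            unfolding unit_fun_def using finite_V by (simp add: sum.delta)
          then show ?thesis using class_disjoint[OF that True, of "p C'"] p[OF that] p[OF True] True
            by (auto simp: class_sum_def)
        qed
        moreover have "class_sum x C = (\<Sum>C'\<in>T // conn. y C' * class_sum (unit_fun (p C')) C)"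
          unfolding x_def class_sum_def using True
          by (simp add: sum_fun_apply scaleR_fun_def sum_distrib_left) (rule sum.swap)
        ultimately have "class_sum x C = (\<Sum>C'\<in>T // conn. if C' = C then y C' else 0)"
          by (auto intro!: sum.cong)
        then show ?thesis using True finite_classes by simp
      next
        case False
        then show ?thesis using \<open>y \<in> functions_on (T // conn)\<close> by (simp add: class_sum_def functions_on_def)
      qed
    qed
    ultimately show "y \<in> class_sum ` functions_on V" by blast
  qed (auto simp: functions_on_def class_sum_def)
  then have "card V = dim (bd1 ` functions_on E) + card (T // conn)"
    using rank_nullity(2)[OF subspace_functions_on functions_on_dim(1)[OF finite_V] class_sum_linear]
    by (simp add: functions_on_dim(2)[OF finite_V] functions_on_dim(2)[OF finite_classes] boundaries0)
  then show ?thesis using 1 by simp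
qed

subsection \<open>Two-cycles\<close>

text \<open>The simplicial two-cycles.\<close>
definition cycles2 :: "('t \<Rightarrow> real) set" where
  "cycles2 = {x \<in> functions_on T. \<forall>e\<in>E. (\<Sum>t\<in>T. s t e * x t) = 0}"

text \<open>On a common edge the two signs are opposite, so that a cycle has the same coefficient on both sides.\<close>
lemma cycles2_class:
  assumes "x \<in> cycles2" "(t, t') \<in> conn"
  shows "x t' = x t"
  using assms(2)
proof (rule conn_induct)
  fix a b e assume ab: "a \<in> T" "b \<in> T" "e \<in> ed a" "e \<in> ed b" "x a = x t"
  then have "(\<Sum>t\<in>T. s t e * x t) = 0" using assms(1) ed_E by (auto simp: cycles2_def)
  then have "a \<noteq> b \<Longrightarrow> s a e * (x a - x b) = 0"
    using jump_shared[OF ab(1,2) _ ab(3,4), of x] by metis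
  moreover have "s a e \<noteq> 0" using sign[OF ab(1,3)] by auto
  ultimately have "x a = x b" by (cases "a = b") auto
  then show "x b = x t" using ab(5) by simp
qed (rule refl)

lemma closed_class_opposite_edges:
  assumes "C \<in> closed_classes" "t \<in> C" "e \<in> ed t"
  obtains t' where "t' \<in> C" "t' \<noteq> t" "e \<in> ed t'" "{t\<in>T. e \<in> ed t} = {t, t'}"
proof -
  have C: "C \<in> T // conn" "closed_class C" using assms(1) by (auto simp: closed_classes_def)
  have "t \<in> T" using C(1) assms(2) in_quotient_imp_subset[OF equiv_conn] by blast
  obtain t' where t': "t' \<in> T" "t' \<noteq> t" "e \<in> ed t'" using C(2) assms unfolding closed_class_def by blast
  have "t' \<in> C" using in_quotient_imp_closed[OF equiv_conn C(1) assms(2)] adj_conn[OF \<open>t \<in> T\<close> t'(1) assms(3) t'(3)] .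
  then show ?thesis using that t' edges_of_two[OF \<open>t \<in> T\<close> t'(1) _ assms(3) t'(3)] by auto
qed

text \<open>A two-cycle is constant on every class, and this constant is zero if a triangle of the class has a
  free edge.\<close>
theorem dim_cycles2: "dim cycles2 = card closed_classes"
proof -
  define f where "f y = (\<lambda>t. if t \<in> T then y (conn `` {t}) else 0)" for y :: "'t set \<Rightarrow> real"
  have lin: "linear_map_on S f" for S by (auto simp: linear_map_on_def f_def fun_eq_iff scaleR_fun_def)
  have cl: "conn `` {t} = C" if C: "C \<in> T // conn" and tC: "t \<in> C" for C t
  proof -
    obtain a where a: "C = conn `` {a}" using C by (rule quotientE)
    then have "(a, t) \<in> conn" using tC by simp
    then show ?thesis unfolding a by (rule equiv_class_eq[OF equiv_conn, symmetric])
  qed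
  have inj: "y = 0" if "y \<in> functions_on closed_classes" "f y = 0" for y
  proof
    fix C show "y C = 0 C"
    proof (cases "C \<in> closed_classes")
      case True
      then have C: "C \<in> T // conn" by (simp add: closed_classes_def)
      then obtain t where "t \<in> C" "t \<in> T" using equiv_conn by (metis equiv_class_self quotientE)
      then show ?thesis using fun_cong[OF that(2), of t] cl[OF C] by (simp add: f_def)
    qed (use that(1) in \<open>simp add: functions_on_def\<close>)
  qed
  have "f ` functions_on closed_classes = cycles2"
  proof (intro equalityI subsetI)
    fix x assume "x \<in> f ` functions_on closed_classes"
    then obtain y where y: "y \<in> functions_on closed_classes" "x = f y" by blast
    have "(\<Sum>t\<in>T. s t e * x t) = 0" if "e \<in> E" for e
    proof -
      obtain t where t: "t \<in> T" "e \<in> ed t" using \<open>e \<in> E\<close> E_def by blast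
      show ?thesis
      proof (cases "\<exists>t'\<in>T. t' \<noteq> t \<and> e \<in> ed t'")
        case True
        then obtain t' where t': "t' \<in> T" "t' \<noteq> t" "e \<in> ed t'" by blast
        have "conn `` {t} = conn `` {t'}"
          using equiv_class_eq[OF equiv_conn adj_conn[OF t(1) t'(1) t(2) t'(3)]] .
        then show ?thesis using jump_shared[OF t(1) t'(1) t'(2)[symmetric] t(2) t'(3)] t(1) t'(1)
          by (simp add: y(2) f_def)
      next
        case False
        then have "\<not> closed_class (conn `` {t})"
          using t equiv_class_self[OF equiv_conn t(1)] by (auto simp: closed_class_def)
        then have "x t = 0" using y by (auto simp: functions_on_def closed_classes_def f_def)
        then show ?thesis using jump_free[OF t, of x] False by auto
      qed
    qed
    then show "x \<in> cycles2" by (auto simp: cycles2_def functions_on_def y(2) f_def)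
  next
    fix x assume x: "x \<in> cycles2"
    have const: "x t = x t'" if "C \<in> T // conn" "t \<in> C" "t' \<in> C" for C t t'
      using cycles2_class[OF x, of t' t] in_quotient_imp_in_rel[OF equiv_conn that(1), of t' t] that by blast
    define y where "y C = (if C \<in> closed_classes then x (SOME t. t \<in> C) else 0)" for C
    have "x = f y"
    proof
      fix t show "x t = f y t"
      proof (cases "t \<in> T")
        case True
        let ?C = "conn `` {t}"
        have C: "?C \<in> T // conn" "t \<in> ?C" using quotientI[OF True] equiv_class_self[OF equiv_conn True] by auto
        show ?thesis
        proof (cases "closed_class ?C")
          case closed: True
          have "(SOME t. t \<in> ?C) \<in> ?C" using C(2) by (metis someI)
          then have "x (SOME t. t \<in> ?C) = x t" using const[OF C(1)] C(2) by blast
          then show ?thesis using True closed C(1) by (simp add: f_def y_def closed_classes_def)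
        next
          case False
          then obtain a e where a: "a \<in> ?C" "e \<in> ed a" "\<And>t'. t' \<in> T \<Longrightarrow> t' \<noteq> a \<Longrightarrow> e \<notin> ed t'"
            unfolding closed_class_def by blast
          have "a \<in> T" using a(1) in_quotient_imp_subset[OF equiv_conn C(1)] by blast
          then have "s a e * x a = 0"
            using jump_free[OF _ a(2,3), of x] x a(2) ed_E by (auto simp: cycles2_def)
          then have "x a = 0" using sign[OF \<open>a \<in> T\<close> a(2)] by auto
          then have "x t = 0" using const[OF C(1) C(2) a(1)] by simp
          then show ?thesis using False by (simp add: f_def y_def closed_classes_def)
        qed
      qed (use x in \<open>simp add: f_def cycles2_def functions_on_def\<close>)
    qed
    then show "x \<in> f ` functions_on closed_classes" by (auto simp: functions_on_def y_def)
  qed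
  then show ?thesis
    using dim_injective_image[OF subspace_functions_on functions_on_dim(1)[OF closed_classes_finite] lin inj]
      functions_on_dim(2)[OF closed_classes_finite] by simp
qed

subsection \<open>Jumps of vertex values\<close>

text \<open>At a vertex \<open>z\<close> the boundary of \<open>c\<close> is a sum over the triangles \<open>t\<close> of \<open>u t z\<close> times a coefficient of
  the boundary of the boundary of \<open>t\<close>.\<close>
lemma jumps_are_cycles:
  fixes u :: "'t \<Rightarrow> 'v \<Rightarrow> real" and c :: "'e \<Rightarrow> real"
  assumes "c \<in> functions_on E"
    and "\<And>e z. e \<in> E \<Longrightarrow> z \<in> {tl e, hd e} \<Longrightarrow> c e = (\<Sum>t\<in>T. s t e * u t z)"
  shows "c \<in> cycles1"
proof -
  have "bd1 c z = 0" if "z \<in> V" for z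
  proof -
    have "inc e z * c e = inc e z * (\<Sum>t\<in>T. s t e * u t z)" if "e \<in> E" for e
      using assms(2)[OF that, of z] by (cases "z \<in> {tl e, hd e}") (auto simp: inc_def)
    then have "bd1 c z = (\<Sum>e\<in>E. \<Sum>t\<in>T. u t z * (s t e * inc e z))"
      using that by (simp add: bd1_def sum_distrib_left algebra_simps)
    also have "\<dots> = (\<Sum>t\<in>T. u t z * of_int (\<Sum>e\<in>E. s t e * inc e z))"
      by (subst sum.swap) (simp add: sum_distrib_left)
    also have "(\<Sum>e\<in>E. s t e * inc e z) = 0" if "t \<in> T" for t
    proof -
      have "(\<Sum>e\<in>E. s t e * inc e z) = (\<Sum>e\<in>ed t. s t e * inc e z)"
        using that E_def finite_E sign_outside by (intro sum.mono_neutral_right) auto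
      then show ?thesis using boundary_boundary[OF that, of z] by (simp add: inc_def)
    qed
    then have "(\<Sum>t\<in>T. u t z * of_int (\<Sum>e\<in>E. s t e * inc e z)) = 0" by simp
    finally show ?thesis .
  qed
  then show ?thesis using assms(1) by (auto simp: cycles1_def fun_eq_iff bd1_def)
qed

text \<open>Jumps with prescribed values on the edges at one vertex. A unit change of the value in one triangle
  changes the jumps, taken with the signs \<open>inc\<close>, by a difference of the two edges of this triangle at the
  vertex. Since the link of the vertex is connected, these differences span all functions of sum zero on
  the star, and the cycle condition at the vertex says that the sum is zero.\<close>
lemma cycles_are_jumps:
  fixes c :: "'e \<Rightarrow> real"
  assumes "c \<in> cycles1" "z \<in> V"
  shows "\<exists>w::'t \<Rightarrow> real. \<forall>e\<in>E. z \<in> {tl e, hd e} \<longrightarrow> (\<Sum>t\<in>T. s t e * w t) = c e"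
proof -
  define N where "N = {e\<in>E. z \<in> {tl e, hd e}}"
  have inc2: "real_of_int (inc e z) * real_of_int (inc e z) = 1" if "e \<in> N" for e
    using that by (auto simp: N_def inc_def)
  have inc0: "inc e z = 0" if "e \<in> E" "e \<notin> N" for e using that by (auto simp: N_def inc_def)
  have fN: "finite N" using finite_E by (simp add: N_def)
  \<comment> \<open>the jumps at the edges of the star, signed so that cycles have sum zero\<close>
  define L where "L w = (\<lambda>e. if e \<in> N then inc e z * (\<Sum>t\<in>T. s t e * w t) else 0)" for w :: "'t \<Rightarrow> real"
  have lin: "linear_map_on S L" for S
    by (auto simp: linear_map_on_def L_def fun_eq_iff scaleR_fun_def algebra_simps sum.distrib sum_distrib_left)
  have U: "subspace (range L)" using linear_map_on_image[OF subspace_UNIV lin] .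
  have same: "unit_fun e - unit_fun e' \<in> range L" if "t \<in> T" "e \<in> N" "e' \<in> N" "e \<in> ed t" "e' \<in> ed t" for t e e'
  proof (cases "e = e'")
    case True
    then show ?thesis using U by (simp add: subspace_0)
  next
    case False
    obtain e'' where "e'' \<noteq> e" "{e\<in>ed t. z \<in> {tl e, hd e}} = {e, e''}"
      using corner[of t e z] \<open>t \<in> T\<close> \<open>e \<in> ed t\<close> \<open>e \<in> N\<close> by (auto simp: N_def)
    moreover have "e' \<in> {e\<in>ed t. z \<in> {tl e, hd e}}" using that by (auto simp: N_def)
    ultimately have two: "{e\<in>ed t. z \<in> {tl e, hd e}} = {e, e'}" using False by auto
    have "(\<Sum>f\<in>ed t. s t f * inc f z) = (\<Sum>f\<in>{e, e'}. s t f * inc f z)"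
      unfolding two[symmetric] using finite_ed[OF that(1)] by (intro sum.mono_neutral_right) (auto simp: inc_def)
    then have neg: "s t e' * inc e' z = - (s t e * inc e z)"
      using boundary_boundary[OF that(1), of z] False by (simp add: inc_def)
    \<comment> \<open>the sign makes the coefficient of \<open>e\<close> positive\<close>
    define w where "w = (real_of_int (s t e * inc e z)) *\<^sub>R unit_fun t"
    have Lw: "L w f = (if f \<in> N then real_of_int (inc f z * s t f * (s t e * inc e z)) else 0)" for f
    proof -
      have "(\<Sum>t'\<in>T. s t' f * w t') = (\<Sum>t'\<in>T. if t' = t then real_of_int (s t f * (s t e * inc e z)) else 0)"
        by (rule sum.cong) (auto simp: w_def unit_fun_def scaleR_fun_def)
      also have "\<dots> = s t f * (s t e * inc e z)" using \<open>t \<in> T\<close> finite_T by simp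
      finally show ?thesis by (simp add: L_def)
    qed
    have se: "s t e * s t e = 1" "inc e z * inc e z = 1"
      using sign[OF that(1,4)] \<open>e \<in> N\<close> by (auto simp: N_def inc_def)
    have "L w = unit_fun e - unit_fun e'"
    proof
      fix f
      consider "f = e" | "f = e'" | "f \<noteq> e" "f \<noteq> e'" by blast
      then show "L w f = (unit_fun e - unit_fun e') f"
      proof cases
        case 1
        have "inc e z * s t e * (s t e * inc e z) = (s t e * s t e) * (inc e z * inc e z)" by simp
        then show ?thesis using 1 Lw[of e] se False \<open>e \<in> N\<close> by (simp add: unit_fun_def)
      next
        case 2
        have "inc e' z * s t e' * (s t e * inc e z) = (s t e' * inc e' z) * (s t e * inc e z)" by simp
        also have "\<dots> = - ((s t e * s t e) * (inc e z * inc e z))" unfolding neg by simp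
        finally show ?thesis using 2 Lw[of e'] se False \<open>e' \<in> N\<close> by (simp add: unit_fun_def)
      next
        case 3
        then have "f \<notin> N \<or> f \<notin> ed t" using two by (auto simp: N_def)
        then show ?thesis using 3 Lw[of f] sign_outside[of f t] by (auto simp: unit_fun_def)
      qed
    qed
    then show ?thesis by (metis rangeI)
  qed
  have diff: "unit_fun e - unit_fun e' \<in> range L" if ee: "e \<in> N" "e' \<in> N" for e e'
  proof -
    obtain t t' where t: "t \<in> T" "e \<in> ed t" "t' \<in> T" "e' \<in> ed t'"
      using ee E_def by (auto simp: N_def)
    have z: "z \<in> {tl e, hd e}" "z \<in> {tl e', hd e'}" using ee by (auto simp: N_def)
    have "\<forall>g\<in>N \<inter> ed t'. unit_fun e - unit_fun g \<in> range L"
      using link_connected[OF t(1) t(3) t(2) t(4) z]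
    proof induction
      case base
      then show ?case using same t ee by blast
    next
      case (step a b)
      then obtain f where f: "a \<in> T" "b \<in> T" "f \<in> ed a" "f \<in> ed b" "z \<in> {tl f, hd f}" by blast
      then have fN: "f \<in> N" using E_def by (auto simp: N_def)
      show ?case
      proof
        fix g assume "g \<in> N \<inter> ed b"
        then have "unit_fun f - unit_fun g \<in> range L" using same[OF f(2) fN] f(4) by blast
        moreover have "unit_fun e - unit_fun f \<in> range L" using step.IH fN f(3) by blast
        ultimately have "(unit_fun e - unit_fun f) + (unit_fun f - unit_fun g) \<in> range L"
          using U by (intro subspace_add)
        then show "unit_fun e - unit_fun g \<in> range L" by simp
      qed
    qed
    then show ?thesis using t(4) ee by blast
  qed
  define d where "d = (\<lambda>e. if e \<in> N then real_of_int (inc e z) * c e else 0)"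
  have "d \<in> range L"
  proof (rule zero_sum_in_subspace[OF fN _ _ U diff])
    show "d \<in> functions_on N" by (simp add: functions_on_def d_def)
    have "sum d N = (\<Sum>e\<in>E. inc e z * c e)"
      using finite_E inc0 by (intro sum.mono_neutral_cong_left) (auto simp: d_def N_def)
    also have "\<dots> = bd1 c z" using assms(2) by (simp add: bd1_def)
    also have "\<dots> = 0" using assms(1) by (simp add: cycles1_def)
    finally show "sum d N = 0" .
  qed
  then obtain w where w: "d = L w" by blast
  have "(\<Sum>t\<in>T. s t e * w t) = c e" if "e \<in> E" "z \<in> {tl e, hd e}" for e
  proof -
    have eN: "e \<in> N" using that by (simp add: N_def)
    then have "real_of_int (inc e z) * (\<Sum>t\<in>T. s t e * w t) = real_of_int (inc e z) * c e"
      using fun_cong[OF w[symmetric], of e] by (simp add: d_def L_def)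
    then show ?thesis using inc2[OF eN] by auto
  qed
  then show ?thesis by blast
qed

subsection \<open>Dismantling\<close>

text \<open>The triangles are removed one at a time, one with a free edge as long as there is such a triangle.
  When there is none, the remaining triangles contain a whole closed class, and the removal of one of its
  triangles destroys this class and no other one.\<close>
lemma dismantle:
  assumes base: "P 0 {}"
    and puncture: "\<And>n S t. S \<subseteq> T \<Longrightarrow> t \<in> S \<Longrightarrow> P n (S - {t}) \<Longrightarrow> P (Suc n) S"
    and free: "\<And>n S t e. S \<subseteq> T \<Longrightarrow> t \<in> S \<Longrightarrow> e \<in> ed t \<Longrightarrow> (\<And>t'. t' \<in> S \<Longrightarrow> t' \<noteq> t \<Longrightarrow> e \<notin> ed t') \<Longrightarrow>
      P n (S - {t}) \<Longrightarrow> P n S"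
  shows "P (card closed_classes) T"
proof -
  \<comment> \<open>the closed classes of which no triangle has been removed\<close>
  define cl where "cl S = {C \<in> closed_classes. C \<subseteq> S}" for S
  have fcl: "finite (cl S)" for S using closed_classes_finite by (simp add: cl_def)
  have "P (card (cl S)) S" if "S \<subseteq> T" for S
    using finite_subset[OF that finite_T] that
  proof (induction S rule: finite_psubset_induct)
    case (psubset S)
    have "C \<noteq> {}" if "C \<in> closed_classes" for C
      using that in_quotient_imp_non_empty[OF equiv_conn] by (auto simp: closed_classes_def)
    then have cl0: "cl {} = {}" by (auto simp: cl_def)
    show ?case
    proof (cases "S = {}")
      case True
      then show ?thesis using base cl0 by simp
    next
      case False
      then obtain t0 where t0: "t0 \<in> S" by blast
      have IH: "P (card (cl (S - {t}))) (S - {t})" if "t \<in> S" for t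
        using psubset.IH[of "S - {t}"] that psubset.prems by blast
      show ?thesis
      proof (cases "\<exists>t\<in>S. \<exists>e\<in>ed t. \<forall>t'\<in>S. t' \<noteq> t \<longrightarrow> e \<notin> ed t'")
        case True
        then obtain t e where te: "t \<in> S" "e \<in> ed t" and te': "\<forall>t'\<in>S. t' \<noteq> t \<longrightarrow> e \<notin> ed t'" by auto
        have "cl (S - {t}) = cl S"
        proof -
          have "t \<notin> C" if C_closed: "C \<in> closed_classes" and CS: "C \<subseteq> S" for C
          proof
            assume "t \<in> C"
            then obtain t' where "t' \<in> C" "t' \<noteq> t" "e \<in> ed t'"
              using closed_class_opposite_edges[OF C_closed _ te(2)] by metis
            then show False using te' CS by blast
          qed
          then show ?thesis by (auto simp: cl_def)
        qed
        then show ?thesis using free[OF psubset.prems te, of "card (cl S)"] te' IH[OF te(1)] by simp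
      next
        case False
        let ?C = "conn `` {t0}"
        have t0T: "t0 \<in> T" using t0 psubset.prems by blast
        have C: "?C \<in> T // conn" "t0 \<in> ?C" using quotientI[OF t0T] equiv_class_self[OF equiv_conn t0T] by auto
        have CS: "?C \<subseteq> S"
        proof
          fix t assume "t \<in> ?C"
          then have "(t0, t) \<in> conn" by simp
          then show "t \<in> S"
          proof (rule conn_induct)
            fix a b e assume ab: "a \<in> T" "b \<in> T" "e \<in> ed a" "e \<in> ed b" "a \<in> S"
            then obtain t' where t': "t' \<in> S" "t' \<noteq> a" "e \<in> ed t'" using False ab(3,5) by auto
            then have "{t\<in>T. e \<in> ed t} = {a, t'}" using edges_of_two[of a t' e] ab psubset.prems by auto
            moreover have "b \<in> {t\<in>T. e \<in> ed t}" using ab by simp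
            ultimately show "b \<in> S" using ab(5) t'(1) by auto
          qed (rule t0)
        qed
        have "closed_class ?C" unfolding closed_class_def
        proof (intro ballI)
          fix t e assume "t \<in> ?C" "e \<in> ed t"
          moreover then have "t \<in> S" using CS by blast
          ultimately obtain t' where "t' \<in> S" "t' \<noteq> t" "e \<in> ed t'" using False by auto
          then show "\<exists>t'\<in>T. t' \<noteq> t \<and> e \<in> ed t'" using psubset.prems by blast
        qed
        then have Ccl: "?C \<in> cl S" using C CS by (simp add: cl_def closed_classes_def)
        have "cl (S - {t0}) = cl S - {?C}"
        proof -
          have "C' = ?C" if C': "C' \<in> closed_classes" "t0 \<in> C'" for C'
          proof -
            have "C' \<in> T // conn" using C'(1) by (simp add: closed_classes_def)
            then obtain t where "C' = conn `` {t}" by (rule quotientE)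
            then show ?thesis using equiv_class_eq[OF equiv_conn, of t t0] C'(2) by simp
          qed
          then have "t0 \<in> C' \<longleftrightarrow> C' = ?C" if "C' \<in> closed_classes" for C' using that C(2) by metis
          then show ?thesis unfolding cl_def by blast
        qed
        then have "card (cl S) = Suc (card (cl (S - {t0})))"
          using card.remove[OF fcl Ccl] by simp
        then show ?thesis using puncture[OF psubset.prems t0 IH[OF t0]] by simp
      qed
    qed
  qed
  from this[of T] have "P (card (cl T)) T" by simp
  moreover have "cl T = closed_classes"
    using in_quotient_imp_subset[OF equiv_conn] by (auto simp: cl_def closed_classes_def)
  ultimately show ?thesis by simp
qed

end

section \<open>The torsion-free rank of an abelian group\<close>

text \<open>Families, as opposed to sets, can be mapped before the map is known to be injective on them.\<close>
definition int_indep_family :: "('a, 'b) monoid_scheme \<Rightarrow> 'i set \<Rightarrow> ('i \<Rightarrow> 'a) \<Rightarrow> bool" where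
  "int_indep_family G I f \<longleftrightarrow> finite I \<and> f \<in> I \<rightarrow> carrier G \<and>
     (\<forall>c :: 'i \<Rightarrow> int. finprod G (\<lambda>i. f i [^]\<^bsub>G\<^esub> c i) I = \<one>\<^bsub>G\<^esub> \<longrightarrow> (\<forall>i\<in>I. c i = 0))"

definition rank_le :: "('a, 'b) monoid_scheme \<Rightarrow> nat \<Rightarrow> bool" where
  "rank_le G n \<longleftrightarrow> (\<forall>S. int_independent G S \<longrightarrow> card S \<le> n)"

lemma int_indep_familyD:
  fixes c :: "'i \<Rightarrow> int"
  assumes "int_indep_family G I f" "finprod G (\<lambda>i. f i [^]\<^bsub>G\<^esub> c i) I = \<one>\<^bsub>G\<^esub>" "i \<in> I"
  shows "c i = 0"
  using assms unfolding int_indep_family_def by blast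

lemma int_independent_family: "int_independent G S \<longleftrightarrow> int_indep_family G S (\<lambda>x. x)"
  by (auto simp: int_independent_def int_indep_family_def)

lemma hom_finprod:
  assumes "comm_group A" "comm_group B" "h \<in> hom A B" "f \<in> I \<rightarrow> carrier A"
  shows "h (finprod A f I) = finprod B (\<lambda>i. h (f i)) I"
proof -
  interpret A: comm_group A by fact
  interpret B: comm_group B by fact
  interpret h: group_hom A B h by unfold_locales fact
  show ?thesis
    using assms(4)
  proof (induction I rule: infinite_finite_induct)
    case (insert i I)
    moreover from insert.prems have "f i \<in> carrier A" "f \<in> I \<rightarrow> carrier A"
      "(\<lambda>i. h (f i)) \<in> I \<rightarrow> carrier B" "h (f i) \<in> carrier B"
      by (auto simp: Pi_iff)
    ultimately show ?case by (simp add: A.finprod_insert B.finprod_insert Pi_iff)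
  qed auto
qed

lemma hom_finprod_pow:
  fixes c :: "'i \<Rightarrow> int"
  assumes "comm_group A" "comm_group B" "h \<in> hom A B" "f \<in> I \<rightarrow> carrier A"
  shows "h (finprod A (\<lambda>i. f i [^]\<^bsub>A\<^esub> c i) I) = finprod B (\<lambda>i. h (f i) [^]\<^bsub>B\<^esub> c i) I"
proof -
  interpret A: comm_group A by fact
  interpret B: comm_group B by fact
  interpret h: group_hom A B h by unfold_locales fact
  have "h (finprod A (\<lambda>i. f i [^]\<^bsub>A\<^esub> c i) I) = finprod B (\<lambda>i. h (f i [^]\<^bsub>A\<^esub> c i)) I"
    using assms by (intro hom_finprod) auto
  also have "\<dots> = finprod B (\<lambda>i. h (f i) [^]\<^bsub>B\<^esub> c i) I"
    using assms(4) by (intro B.finprod_cong) (auto simp: h.hom_int_pow Pi_iff simp_implies_def)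
  finally show ?thesis .
qed

lemma (in comm_group) finprod_pow_const:
  fixes c :: "'i \<Rightarrow> int"
  assumes "finite I" "x \<in> carrier G"
  shows "finprod G (\<lambda>i. x [^] c i) I = x [^] (\<Sum>i\<in>I. c i)"
  using assms(1)
proof (induction I rule: finite_induct)
  case (insert i I)
  then show ?case using assms(2) by (simp add: int_pow_mult Pi_iff)
qed simp

lemma (in comm_group) finprod_single:
  fixes c :: "'i \<Rightarrow> int"
  assumes "finite I" "f \<in> I \<rightarrow> carrier G" "i \<in> I" "\<And>j. j \<in> I \<Longrightarrow> j \<noteq> i \<Longrightarrow> f j = \<one>"
  shows "finprod G f I = f i"
proof -
  have "finprod G f I = finprod G (\<lambda>j. if i = j then f j else \<one>) I"
    using assms by (intro finprod_cong) (auto simp: simp_implies_def)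
  also have "\<dots> = f i" using assms by (intro finprod_singleton) auto
  finally show ?thesis .
qed

text \<open>If two members coincide, then their quotient is a nontrivial relation.\<close>
lemma int_indep_family_inj:
  assumes "comm_group G" "int_indep_family G I f"
  shows "inj_on f I"
proof (rule inj_onI, rule ccontr)
  interpret comm_group G by fact
  fix i j assume ij: "i \<in> I" "j \<in> I" "f i = f j" "i \<noteq> j"
  have fin: "finite I" and f: "f \<in> I \<rightarrow> carrier G" using assms(2) by (auto simp: int_indep_family_def)
  define c where "c k = (if k = i then 1 else if k = j then -1 else 0 :: int)" for k
  have "finprod G (\<lambda>k. f k [^]\<^bsub>G\<^esub> c k) I = finprod G (\<lambda>k. f k [^]\<^bsub>G\<^esub> c k) {i, j}"
    using fin f ij by (intro finprod_mono_neutral_cong_right) (auto simp: c_def)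
  also have "\<dots> = f i [^]\<^bsub>G\<^esub> c i \<otimes>\<^bsub>G\<^esub> f j [^]\<^bsub>G\<^esub> c j" using ij f by (simp add: Pi_iff)
  also have "\<dots> = \<one>\<^bsub>G\<^esub>"
    using ij f by (simp add: c_def Pi_iff int_pow_neg_int[of _ 1, simplified] int_pow_neg)
  finally have "c i = 0" using int_indep_familyD[OF assms(2) _ ij(1)] by blast
  then show False by (simp add: c_def)
qed

lemma int_indep_family_imp_set:
  assumes "comm_group G" "int_indep_family G I f"
  shows "int_independent G (f ` I)" "card (f ` I) = card I"
proof -
  interpret comm_group G by fact
  have inj: "inj_on f I" by (rule int_indep_family_inj[OF assms])
  have fin: "finite I" and f: "f \<in> I \<rightarrow> carrier G" using assms(2) by (auto simp: int_indep_family_def)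
  have "c x = 0" if "finprod G (\<lambda>x. x [^]\<^bsub>G\<^esub> c x) (f ` I) = \<one>\<^bsub>G\<^esub>" "x \<in> f ` I" for c :: "'a \<Rightarrow> int" and x
  proof -
    have "finprod G (\<lambda>x. x [^]\<^bsub>G\<^esub> c x) (f ` I) = finprod G (\<lambda>i. f i [^]\<^bsub>G\<^esub> c (f i)) I"
      using f by (intro finprod_reindex inj) auto
    then show ?thesis using int_indep_familyD[OF assms(2), of "\<lambda>i. c (f i)"] that by auto
  qed
  then show "int_independent G (f ` I)" using fin f by (auto simp: int_independent_def)
  show "card (f ` I) = card I" using inj by (rule card_image)
qed

lemma rank_le_family:
  assumes "comm_group G" "rank_le G n" "int_indep_family G I f"
  shows "card I \<le> n"
  using int_indep_family_imp_set[OF assms(1,3)] assms(2) by (metis rank_le_def)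

text \<open>A relation is mapped to a relation with the same exponents.\<close>
lemma int_indep_family_lift:
  fixes f :: "'i \<Rightarrow> 'a"
  assumes "comm_group A" "comm_group B" "h \<in> hom A B" "f \<in> I \<rightarrow> carrier A"
    "int_indep_family B I (\<lambda>i. h (f i))"
  shows "int_indep_family A I f"
proof -
  interpret A: comm_group A by fact
  interpret B: comm_group B by fact
  interpret h: group_hom A B h by unfold_locales fact
  have "c i = 0" if "finprod A (\<lambda>i. f i [^]\<^bsub>A\<^esub> c i) I = \<one>\<^bsub>A\<^esub>" "i \<in> I" for c :: "'i \<Rightarrow> int" and i
    using hom_finprod_pow[OF assms(1-4), of c] that int_indep_familyD[OF assms(5) _ that(2), of c] by simp
  then show ?thesis using assms(4,5) by (auto simp: int_indep_family_def)
qed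

lemma rank_le_surj:
  assumes "comm_group A" "comm_group B" "h \<in> hom A B" "carrier B \<subseteq> h ` carrier A" "rank_le A n"
  shows "rank_le B n"
  unfolding rank_le_def
proof (intro allI impI)
  fix S assume S: "int_independent B S"
  then have "\<forall>x\<in>S. \<exists>a\<in>carrier A. h a = x" using assms(4) by (auto simp: int_independent_def)
  then obtain f where f: "\<And>x. x \<in> S \<Longrightarrow> f x \<in> carrier A" "\<And>x. x \<in> S \<Longrightarrow> h (f x) = x" by metis
  have fin: "finite S" "S \<subseteq> carrier B" using S by (auto simp: int_independent_def)
  have "int_indep_family B S (\<lambda>x. h (f x))"
  proof -
    interpret B: comm_group B by fact
    have "finprod B (\<lambda>i. h (f i) [^]\<^bsub>B\<^esub> c i) S = finprod B (\<lambda>i. i [^]\<^bsub>B\<^esub> c i) S" for c :: "'c \<Rightarrow> int"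
      using fin f by (intro B.finprod_cong) (auto simp: simp_implies_def)
    then show ?thesis using S f fin by (auto simp: int_independent_family int_indep_family_def)
  qed
  then have "int_indep_family A S f" using assms f by (intro int_indep_family_lift[of A B h]) auto
  then show "card S \<le> n" using rank_le_family assms by metis
qed

text \<open>If one member \<open>o\<close> of an independent family has nonzero image \<open>m\<close> in the integers, the
  combinations \<open>m x - h(x) o\<close> of the other members with it are independent elements of the kernel.\<close>
lemma rank_le_extension:
  fixes A :: "('a, 'b) monoid_scheme" and B :: "('c, 'd) monoid_scheme"
  assumes AB: "comm_group A" "comm_group B" and k: "k \<in> hom A B" and h: "h \<in> hom B integer_group"
    and exact: "kernel B integer_group h \<subseteq> k ` carrier A" and r: "rank_le A n"
  shows "rank_le B (Suc n)"
  unfolding rank_le_def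
proof (intro allI impI)
  interpret A: comm_group A by fact
  interpret B: comm_group B by fact
  interpret h: group_hom B integer_group h using h by (simp add: group_hom_def group_hom_axioms_def)
  have h_mult: "h (x \<otimes>\<^bsub>B\<^esub> y) = h x + h y" if "x \<in> carrier B" "y \<in> carrier B" for x y
    using h.hom_mult[OF that] by simp
  have h_pow: "h (x [^]\<^bsub>B\<^esub> c) = c * h x" if "x \<in> carrier B" for x and c :: int
    using h.hom_int_pow[OF that, of c] by (simp add: mult.commute)
  have lift: "card I \<le> n" if fam: "int_indep_family B I f" and ker: "\<And>i. i \<in> I \<Longrightarrow> h (f i) = 0"
    for f and I :: "'c set"
  proof -
    have fI: "f \<in> I \<rightarrow> carrier B" using fam by (simp add: int_indep_family_def)
    then have "\<forall>i\<in>I. \<exists>a\<in>carrier A. k a = f i"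
      using exact ker by (fastforce simp: kernel_def)
    then obtain g where g: "\<And>i. i \<in> I \<Longrightarrow> g i \<in> carrier A" "\<And>i. i \<in> I \<Longrightarrow> k (g i) = f i" by metis
    have "f i \<in> carrier B" if "i \<in> I" for i using fI that by blast
    then have "finprod B (\<lambda>i. k (g i) [^]\<^bsub>B\<^esub> c i) I = finprod B (\<lambda>i. f i [^]\<^bsub>B\<^esub> c i) I" for c :: "'c \<Rightarrow> int"
      using g by (intro B.finprod_cong) (auto simp: simp_implies_def)
    then have "int_indep_family B I (\<lambda>i. k (g i))" using fam g by (auto simp: int_indep_family_def)
    then have "int_indep_family A I g" using AB k g by (intro int_indep_family_lift[of A B k]) auto
    then show ?thesis using rank_le_family AB r by metis
  qed
  fix S assume S: "int_independent B S"
  then have fin: "finite S" "S \<subseteq> carrier B" by (auto simp: int_independent_def)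
  show "card S \<le> Suc n"
  proof (cases "\<forall>x\<in>S. h x = 0")
    case True
    then show ?thesis using lift[of S "\<lambda>x. x"] S by (simp add: int_independent_family)
  next
    case False
    then obtain o' where o': "o' \<in> S" "h o' \<noteq> 0" by blast
    define f where "f x = x [^]\<^bsub>B\<^esub> h o' \<otimes>\<^bsub>B\<^esub> o' [^]\<^bsub>B\<^esub> (- h x)" for x
    have f: "f x \<in> carrier B" if "x \<in> S" for x using that fin o' by (auto simp: f_def)
    have hf: "h (f x) = 0" if "x \<in> S" for x
      using that fin o' unfolding f_def by (subst h_mult) (auto simp: h_pow subset_iff)
    have "int_indep_family B (S - {o'}) f"
      unfolding int_indep_family_def
    proof (intro conjI allI impI ballI)
      show "finite (S - {o'})" using fin by simp
      show "f \<in> S - {o'} \<rightarrow> carrier B" using f by auto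
      fix c :: "'c \<Rightarrow> int" and x
      assume one: "finprod B (\<lambda>i. f i [^]\<^bsub>B\<^esub> c i) (S - {o'}) = \<one>\<^bsub>B\<^esub>" and x: "x \<in> S - {o'}"
      define d where "d y = (if y = o' then - (\<Sum>y\<in>S - {o'}. h y * c y) else h o' * c y)" for y
      have S': "y \<in> carrier B" if "y \<in> S" for y using that fin by blast
      have "finprod B (\<lambda>y. f y [^]\<^bsub>B\<^esub> c y) (S - {o'})
        = finprod B (\<lambda>y. y [^]\<^bsub>B\<^esub> d y \<otimes>\<^bsub>B\<^esub> o' [^]\<^bsub>B\<^esub> (- (h y * c y))) (S - {o'})"
        using S' o'
        by (intro B.finprod_cong)
          (auto simp: simp_implies_def f_def d_def B.int_pow_distrib B.int_pow_pow)
      also have "\<dots> = finprod B (\<lambda>y. y [^]\<^bsub>B\<^esub> d y) (S - {o'}) \<otimes>\<^bsub>B\<^esub>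
          finprod B (\<lambda>y. o' [^]\<^bsub>B\<^esub> (- (h y * c y))) (S - {o'})"
        using S' o' by (intro B.finprod_multf) auto
      also have "finprod B (\<lambda>y. o' [^]\<^bsub>B\<^esub> (- (h y * c y))) (S - {o'}) = o' [^]\<^bsub>B\<^esub> d o'"
        using S' o' fin by (subst B.finprod_pow_const) (auto simp: d_def sum_negf)
      also have "finprod B (\<lambda>y. y [^]\<^bsub>B\<^esub> d y) (S - {o'}) \<otimes>\<^bsub>B\<^esub> o' [^]\<^bsub>B\<^esub> d o'
        = finprod B (\<lambda>y. y [^]\<^bsub>B\<^esub> d y) (insert o' (S - {o'}))"
        using S' o' fin by (subst B.finprod_insert) (auto intro!: B.m_comm B.finprod_closed)
      finally have "finprod B (\<lambda>y. y [^]\<^bsub>B\<^esub> d y) S = \<one>\<^bsub>B\<^esub>" using one o' by (simp add: insert_absorb)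
      then have "d x = 0" using S x by (auto simp: int_independent_def)
      then show "c x = 0" using x o' by (auto simp: d_def)
    qed
    then have "card (S - {o'}) \<le> n" using lift hf by blast
    then show ?thesis using o' fin by (simp add: card_Diff_singleton)
  qed
qed

text \<open>Independence of a set of neutral elements is violated by the exponents one unless the set is empty.\<close>
lemma rank_le_trivial: "trivial_group G \<Longrightarrow> rank_le G 0"
  unfolding rank_le_def
proof (intro allI impI)
  fix S assume G: "trivial_group G" and S: "int_independent G S"
  interpret comm_group G
    using G by (intro group.group_comm_groupI) (auto simp: trivial_group_def)
  have S1: "S \<subseteq> {\<one>\<^bsub>G\<^esub>}" using G S by (auto simp: trivial_group_def int_independent_def)
  have "finprod G (\<lambda>x. x [^]\<^bsub>G\<^esub> (1::int)) S = \<one>\<^bsub>G\<^esub>"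
    using S1 by (intro finprod_one_eqI) auto
  moreover have "\<forall>c::'a \<Rightarrow> int. finprod G (\<lambda>x. x [^]\<^bsub>G\<^esub> c x) S = \<one>\<^bsub>G\<^esub> \<longrightarrow> (\<forall>x\<in>S. c x = 0)"
    using S by (simp add: int_independent_def)
  note spec[OF this, of "\<lambda>_. 1"]
  ultimately have "S = {}" by auto
  then show "card S \<le> 0" by simp
qed

lemma abelian_rankI:
  assumes "comm_group G" "rank_le G n" "int_indep_family G I f" "card I = n"
  shows "abelian_rank G = n"
  unfolding abelian_rank_def
proof (rule cSup_eq_maximum)
  show "n \<in> {card S |S. int_independent G S}"
    using int_indep_family_imp_set[OF assms(1,3)] assms(4) by auto
qed (use assms(2) in \<open>auto simp: rank_le_def\<close>)

lemma abelian_rank_iso: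
  assumes "comm_group A" "comm_group B" "A \<cong> B"
  shows "abelian_rank A = abelian_rank B"
proof -
  have sub: "{card S |S. int_independent A S} \<subseteq> {card S |S. int_independent B S}"
    if AB: "comm_group A" "comm_group B" "A \<cong> B" for A :: "('x, 'p) monoid_scheme" and B :: "('y, 'q) monoid_scheme"
  proof safe
    fix S assume S: "int_independent A S"
    have grp: "group A" using AB(1) by (simp add: comm_group.axioms(2))
    then have "B \<cong> A" using AB(3) by (simp add: group.iso_sym)
    then obtain h where h: "h \<in> hom B A" "bij_betw h (carrier B) (carrier A)"
      by (auto simp: is_iso_def iso_def)
    have fin: "finite S" "S \<subseteq> carrier A" using S by (auto simp: int_independent_def)
    define g where "g = inv_into (carrier B) h"
    have g: "g x \<in> carrier B" "h (g x) = x" if "x \<in> S" for x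
      using that fin h(2) by (auto simp: g_def bij_betw_def inv_into_into f_inv_into_f subset_iff)
    have "int_indep_family A S (\<lambda>x. h (g x))"
    proof -
      interpret A: comm_group A by fact
      have "finprod A (\<lambda>i. h (g i) [^]\<^bsub>A\<^esub> c i) S = finprod A (\<lambda>i. i [^]\<^bsub>A\<^esub> c i) S" for c :: "'x \<Rightarrow> int"
        using fin g by (intro A.finprod_cong) (auto simp: simp_implies_def)
      then show ?thesis using S g fin by (auto simp: int_independent_family int_indep_family_def)
    qed
    then have "int_indep_family B S g" using AB h g by (intro int_indep_family_lift[of B A h]) auto
    then show "\<exists>S'. card S = card S' \<and> int_independent B S'"
      using int_indep_family_imp_set[OF AB(2)] by metis
  qed
  have "B \<cong> A" using assms by (simp add: comm_group.axioms(2) group.iso_sym)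
  then have "{card S |S. int_independent A S} = {card S |S. int_independent B S}"
    by (intro subset_antisym sub assms)
  then show ?thesis unfolding abelian_rank_def by simp
qed

lemma rank_le_free_Abelian_group:
  "finite S \<Longrightarrow> rank_le (free_Abelian_group S) (card S)"
proof (induction S rule: finite_induct)
  case empty
  have "trivial_group (free_Abelian_group {} :: ('a \<Rightarrow>\<^sub>0 int) monoid)"
    by (auto simp: trivial_group_def)
  then show ?case using rank_le_trivial by simp
next
  case (insert a S)
  have "rank_le (free_Abelian_group (insert a S)) (Suc (card S))"
  proof (rule rank_le_extension[OF _ _ _ _ _ insert.IH])
    show "id \<in> hom (free_Abelian_group S) (free_Abelian_group (insert a S))" by (auto simp: hom_def)
    show "(\<lambda>x. Poly_Mapping.lookup x a) \<in> hom (free_Abelian_group (insert a S)) integer_group"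
      by (auto simp: hom_def lookup_add)
    show "kernel (free_Abelian_group (insert a S)) integer_group (\<lambda>x. Poly_Mapping.lookup x a)
      \<subseteq> id ` carrier (free_Abelian_group S)"
    proof
      fix x assume "x \<in> kernel (free_Abelian_group (insert a S)) integer_group (\<lambda>x. Poly_Mapping.lookup x a)"
      then have "Poly_Mapping.keys x \<subseteq> insert a S" "a \<notin> Poly_Mapping.keys x"
        by (auto simp: kernel_def in_keys_iff)
      then show "x \<in> id ` carrier (free_Abelian_group S)" by auto
    qed
  qed (auto simp: abelian_free_Abelian_group)
  then show ?case using insert by simp
qed

lemma finprod_free_Abelian_group:
  fixes c :: "'i \<Rightarrow> int"
  assumes "finite I" "f \<in> I \<rightarrow> carrier (free_Abelian_group S)"
  shows "finprod (free_Abelian_group S) f I = sum f I"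
  using assms
proof (induction I rule: finite_induct)
  case (insert i I)
  interpret comm_group "free_Abelian_group S" by (rule abelian_free_Abelian_group)
  from insert show ?case by (subst finprod_insert) auto
next
  case empty
  interpret comm_group "free_Abelian_group S" by (rule abelian_free_Abelian_group)
  show ?case by simp
qed

lemma abelian_rank_free_Abelian_group:
  assumes "finite S"
  shows "abelian_rank (free_Abelian_group S) = card S"
proof (rule abelian_rankI[OF abelian_free_Abelian_group rank_le_free_Abelian_group[OF assms] _ refl])
  show "int_indep_family (free_Abelian_group S) S frag_of"
    unfolding int_indep_family_def
  proof (intro conjI allI impI ballI assms)
    show "frag_of \<in> S \<rightarrow> carrier (free_Abelian_group S)" by simp
    fix c :: "'a \<Rightarrow> int" and i
    assume "finprod (free_Abelian_group S) (\<lambda>i. frag_of i [^]\<^bsub>free_Abelian_group S\<^esub> c i) S = \<one>\<^bsub>free_Abelian_group S\<^esub>"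
      and i: "i \<in> S"
    moreover have "finprod (free_Abelian_group S) (\<lambda>i. frag_of i [^]\<^bsub>free_Abelian_group S\<^esub> c i) S = (\<Sum>i\<in>S. frag_cmul (c i) (frag_of i))"
      using assms by (subst finprod_free_Abelian_group) (auto intro!: sum.cong)
    ultimately have "0 = Poly_Mapping.lookup (\<Sum>i\<in>S. frag_cmul (c i) (frag_of i)) i" by simp
    also have "\<dots> = (\<Sum>j\<in>S. if j = i then c i else 0)"
      by (simp add: lookup_sum) (auto simp: intro!: sum.cong)
    also have "\<dots> = c i" using i assms by simp
    finally show "c i = 0" by simp
  qed
qed

section \<open>Attaching a cell\<close>

text \<open>The homotopy that pushes a punctured cell onto its frontier is the straight one in the
  parameter domain; it fixes the frontier, so that it extends by the identity.\<close>
definition radial_retraction :: "'b::euclidean_space set \<Rightarrow> 'b set \<Rightarrow> 'b \<Rightarrow> ('b \<Rightarrow> 'b) \<Rightarrow> bool" where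
  "radial_retraction S F p r \<longleftrightarrow> convex S \<and> compact S \<and> F \<subseteq> S \<and> p \<in> S - F \<and>
     continuous_on (S - {p}) r \<and> r ` (S - {p}) \<subseteq> F \<and> (\<forall>x\<in>F. r x = x) \<and>
     (\<forall>x\<in>S - {p}. closed_segment x (r x) \<subseteq> S - {p})"

text \<open>Where the cell meets \<open>A\<close> the push \<open>g\<close> is the identity, so that the straight homotopy in the parameter
  domain glues with the constant one on the closed set \<open>A\<close>.\<close>
lemma homotopic_push:
  fixes \<phi> :: "'b::euclidean_space \<Rightarrow> 'a::euclidean_space" and S N :: "'b set" and A :: "'a set"
  assumes S: "compact S" and \<phi>: "continuous_on S \<phi>" "inj_on \<phi> S" and A: "closed A"
    and N: "N \<subseteq> S" and g: "continuous_on N g" "\<And>x. x \<in> N \<Longrightarrow> closed_segment x (g x) \<subseteq> N"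
    and fix_g: "\<And>x. x \<in> N \<Longrightarrow> \<phi> x \<in> A \<Longrightarrow> g x = x"
    and Y: "Y = A \<union> \<phi> ` N" "closedin (top_of_set Y) (\<phi> ` N)"
  obtains f where "homotopic_with_canon (\<lambda>x. True) Y Y id f"
    "\<And>x. x \<in> N \<Longrightarrow> f (\<phi> x) = \<phi> (g x)" "\<And>y. y \<in> A \<Longrightarrow> f y = y"
proof -
  obtain \<psi> where hom: "homeomorphism S (\<phi> ` S) \<phi> \<psi>"
    using homeomorphism_compact[OF S \<phi>(1) refl \<phi>(2)] by blast
  have \<psi>\<phi>: "\<psi> (\<phi> x) = x" if "x \<in> S" for x using hom that by (auto simp: homeomorphism_def)
  have \<psi>c: "continuous_on (\<phi> ` N) \<psi>"
    using hom N by (meson continuous_on_subset homeomorphism_cont2 image_mono)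
  define h where "h = (\<lambda>(t::real, y). if y \<in> A then y else \<phi> ((1 - t) *\<^sub>R \<psi> y + t *\<^sub>R g (\<psi> y)))"
  have seg: "(1 - t) *\<^sub>R x + t *\<^sub>R g x \<in> N" if "x \<in> N" "t \<in> {0..1}" for x t
    using g(2)[OF that(1)] that(2) by (auto simp: closed_segment_def)
  have hA: "h (t, y) = y" if "y \<in> A" for t y using that by (simp add: h_def)
  have hN: "h (t, \<phi> x) = \<phi> ((1 - t) *\<^sub>R x + t *\<^sub>R g x)" if "x \<in> N" for t x
  proof (cases "\<phi> x \<in> A")
    case True
    then have "g x = x" using fix_g that by blast
    then show ?thesis using True by (simp add: hA algebra_simps flip: scaleR_add_left)
  next
    case False
    then show ?thesis using \<psi>\<phi>[of x] that N by (auto simp: h_def)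
  qed
  have c2: "continuous_on ({0..1} \<times> \<phi> ` N) h"
  proof (rule continuous_on_eq)
    have "continuous_on ({0..1} \<times> \<phi> ` N) (\<lambda>z. (1 - fst z) *\<^sub>R \<psi> (snd z) + fst z *\<^sub>R g (\<psi> (snd z)))"
    proof (intro continuous_intros)
      show 1: "continuous_on ({0..1} \<times> \<phi> ` N) (\<lambda>z. \<psi> (snd z))"
        by (rule continuous_on_compose2[OF \<psi>c continuous_on_snd[OF continuous_on_id]]) auto
      show "continuous_on ({0..1} \<times> \<phi> ` N) (\<lambda>z. g (\<psi> (snd z)))"
        by (rule continuous_on_compose2[OF g(1) 1]) (use \<psi>\<phi> N in auto)
    qed
    then show "continuous_on ({0..1} \<times> \<phi> ` N) (\<lambda>z. \<phi> ((1 - fst z) *\<^sub>R \<psi> (snd z) + fst z *\<^sub>R g (\<psi> (snd z))))"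
      by (rule continuous_on_compose2[OF continuous_on_subset[OF \<phi>(1) N]]) (use seg \<psi>\<phi> N in auto)
    show "\<phi> ((1 - fst z) *\<^sub>R \<psi> (snd z) + fst z *\<^sub>R g (\<psi> (snd z))) = h z" if "z \<in> {0..1} \<times> \<phi> ` N" for z
      using that hN \<psi>\<phi> N by auto
  qed
  have c1: "continuous_on ({0..1} \<times> A) h"
    by (rule continuous_on_eq[of _ snd]) (auto intro: continuous_intros simp: hA)
  have cl: "closedin (top_of_set ({0..1} \<times> Y)) ({0..1::real} \<times> A)"
    "closedin (top_of_set ({0..1} \<times> Y)) ({0..1::real} \<times> \<phi> ` N)"
    using Y closed_subset[OF _ A, of Y] closedin_Times[of "{0..1::real}" "{0..1}" Y] by auto
  have "{0..1::real} \<times> Y = {0..1} \<times> A \<union> {0..1} \<times> \<phi> ` N" using Y(1) by auto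
  then have "continuous_on ({0..1} \<times> Y) h"
    using continuous_on_Un_local[of "{0..1::real} \<times> A" "{0..1} \<times> \<phi> ` N" h] cl c1 c2 by simp
  moreover have "h ` ({0..1} \<times> Y) \<subseteq> Y" using hA hN seg unfolding Y(1) by auto
  ultimately have "homotopic_with_canon (\<lambda>x. True) Y Y id (\<lambda>y. h (1, y))"
    by (subst homotopic_with)
      (use hA hN Y(1) in \<open>auto intro!: exI[of _ h] simp: prod_topology_subtopology_eu image_subset_iff_funcset\<close>)
  then show ?thesis
    using that[of "\<lambda>y. h (1, y)"] hA hN by simp
qed

text \<open>The map \<open>h\<close> is the composition of \<open>H\<^sub>q(X)\<close> to \<open>H\<^sub>q(X, X - \<phi> p)\<close>, the inverse of the excision isomorphism
  from \<open>H\<^sub>q(S, S - p)\<close>, and the boundary map to \<open>H\<^sub>q\<^sub>-\<^sub>1(S - p)\<close>. The last one is injective since \<open>S\<close> is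
  contractible; therefore the kernel comes from \<open>X - \<phi> p\<close>, and hence from \<open>A\<close>, onto which the punctured cell
  is pushed. The last clause evaluates \<open>h\<close> on a cycle that near \<open>\<phi> p\<close> is the image of a chain in \<open>S\<close>.\<close>
lemma cell_attachment:
  fixes \<phi> :: "'b::euclidean_space \<Rightarrow> 'a::euclidean_space" and S F :: "'b set" and A :: "'a set" and q :: nat
  assumes r: "radial_retraction S F p r" and \<phi>: "continuous_on S \<phi>" "inj_on \<phi> S"
    and A: "closed A" "\<phi> ` F \<subseteq> A" "A \<inter> \<phi> ` S \<subseteq> \<phi> ` F" and X: "X = A \<union> \<phi> ` S" and q: "q \<ge> 1"
  obtains h where "h \<in> hom (homology_group (int q) (top_of_set X)) (homology_group (int q - 1) (top_of_set (S - {p})))"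
    "kernel (homology_group (int q) (top_of_set X)) (homology_group (int q - 1) (top_of_set (S - {p}))) h
      \<subseteq> hom_induced (int q) (top_of_set A) {} (top_of_set X) {} id ` carrier (homology_group (int q) (top_of_set A))"
    "\<And>c d. singular_relcycle q (top_of_set X) {} c \<Longrightarrow> singular_relcycle q (top_of_set S) (S - {p}) d \<Longrightarrow>
      singular_chain q (top_of_set (X - {\<phi> p})) (c - chain_map q \<phi> d) \<Longrightarrow>
      h (homologous_rel_set q (top_of_set X) {} c)
        = homologous_rel_set (q - 1) (top_of_set (S - {p})) {} (chain_boundary q d)"
proof -
  have S: "convex S" "compact S" "F \<subseteq> S" "p \<in> S" "p \<notin> F" and rc: "continuous_on (S - {p}) r"
    "r ` (S - {p}) \<subseteq> F" "\<And>x. x \<in> F \<Longrightarrow> r x = x" "\<And>x. x \<in> S - {p} \<Longrightarrow> closed_segment x (r x) \<subseteq> S - {p}"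
    using r by (auto simp: radial_retraction_def)
  let ?TX = "top_of_set X" and ?TS = "top_of_set S"
  define P where "P = X - {\<phi> p}"
  have pA: "\<phi> p \<notin> A" using A(3) S \<phi>(2) by (auto simp: inj_on_def)
  have pX: "\<phi> p \<in> X" using X S by blast
  have cX: "closed (\<phi> ` S)" using \<phi>(1) S(2) by (simp add: compact_continuous_image compact_imp_closed)
  have AP: "A \<subseteq> P" using pA X by (auto simp: P_def)
  have im: "\<phi> ` (S - {p}) = \<phi> ` S - {\<phi> p}" using \<phi>(2) S(4) by (auto simp: inj_on_def)
  have P: "P = A \<union> \<phi> ` (S - {p})" unfolding im P_def X using pA by blast
  \<comment> \<open>the punctured space is pushed into \<open>A\<close>\<close>
  have epiA: "carrier (homology_group q (top_of_set P)) \<subseteq>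
      hom_induced q (top_of_set A) {} (top_of_set P) {} id ` carrier (homology_group q (top_of_set A))"
  proof -
    obtain f where f: "homotopic_with_canon (\<lambda>x. True) P P id f"
      "\<And>x. x \<in> S - {p} \<Longrightarrow> f (\<phi> x) = \<phi> (r x)" "\<And>y. y \<in> A \<Longrightarrow> f y = y"
    proof (rule homotopic_push[of S \<phi> A "S - {p}" r P])
      show "r x = x" if x: "x \<in> S - {p}" "\<phi> x \<in> A" for x
      proof -
        have "\<phi> x \<in> \<phi> ` F" using x A(3) by blast
        then obtain y where y: "y \<in> F" "\<phi> x = \<phi> y" by blast
        then have "x = y" using inj_onD[OF \<phi>(2), of x y] x S(3) by auto
        then show ?thesis using rc(3) y(1) by simp
      qed
      have "\<phi> ` (S - {p}) = P \<inter> \<phi> ` S" unfolding im P_def X by blast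
      then show "closedin (top_of_set P) (\<phi> ` (S - {p}))" using cX by (simp add: closedin_closed_Int)
    qed (use S \<phi> A rc P in auto)
    have "f \<in> topspace (top_of_set P) \<rightarrow> A"
    proof
      fix y assume "y \<in> topspace (top_of_set P)"
      then consider "y \<in> A" | x where "x \<in> S - {p}" "y = \<phi> x" unfolding P by auto
      then show "f y \<in> A"
      proof cases
        case 2
        then have "r x \<in> F" using rc(2) by blast
        then show ?thesis using 2 f(2) A(2) by auto
      qed (use f(3) in simp)
    qed
    with f(1) have "hom_induced q (subtopology (top_of_set P) A) {} (top_of_set P) {} id
      \<in> epi (homology_group q (subtopology (top_of_set P) A)) (homology_group q (top_of_set P))"
      by (intro epi_hom_induced_inclusion[of _ f]) auto
    then show ?thesis using AP by (simp add: epi_def subtopology_subtopology inf.absorb2)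
  qed
  let ?G1 = "homology_group q ?TX" and ?G2 = "relative_homology_group q ?TX P"
    and ?G3 = "relative_homology_group q ?TS (S - {p})" and ?G4 = "homology_group (int q - 1) (top_of_set (S - {p}))"
  define I where "I = hom_induced q ?TS (S - {p}) ?TX P \<phi>"
  have I: "I \<in> iso ?G3 ?G2"
  proof -
    let ?e = "\<phi> ` S"
    have hm: "homeomorphic_map ?TS (top_of_set ?e) \<phi>"
    proof -
      obtain \<psi> where "homeomorphism S ?e \<phi> \<psi>"
        using homeomorphism_compact[OF S(2) \<phi>(1) refl \<phi>(2)] by blast
      then have "homeomorphic_maps ?TS (top_of_set ?e) \<phi> \<psi>"
        by (auto simp: homeomorphic_maps_def homeomorphism_def)
      then show ?thesis using homeomorphic_map_maps by blast
    qed
    have 1: "hom_induced q ?TS (S - {p}) (top_of_set ?e) (\<phi> ` (S - {p})) \<phi>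
      \<in> iso ?G3 (relative_homology_group q (top_of_set ?e) (\<phi> ` (S - {p})))"
      by (rule homeomorphic_map_relative_homology_iso[OF hm]) auto
    have "hom_induced q (subtopology ?TX (X - (X - ?e))) (P - (X - ?e)) (subtopology ?TX X) P id
      \<in> iso (relative_homology_group q (subtopology ?TX (X - (X - ?e))) (P - (X - ?e)))
            (relative_homology_group q (subtopology ?TX X) P)"
    proof (rule homology_excision_axiom)
      have "openin ?TX P" unfolding P_def by (simp add: openin_delete)
      then have "?TX interior_of P = P" by (simp add: interior_of_openin)
      moreover have "?TX closure_of (X - ?e) \<subseteq> A"
        using A(1) X by (intro closure_of_minimal) (auto simp: closed_subset)
      ultimately show "?TX closure_of (X - ?e) \<subseteq> ?TX interior_of P" using AP by blast
      show "P \<subseteq> X" by (auto simp: P_def)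
    qed
    moreover have "subtopology ?TX X = ?TX" by (simp add: subtopology_subtopology)
    moreover have "X - (X - ?e) = ?e" using X by blast
    moreover have "P - (X - ?e) = \<phi> ` (S - {p})" unfolding im P_def using X by blast
    moreover have "subtopology ?TX ?e = top_of_set ?e" using X by (simp add: subtopology_subtopology inf.absorb2)
    ultimately have 2: "hom_induced q (top_of_set ?e) (\<phi> ` (S - {p})) ?TX P id
      \<in> iso (relative_homology_group q (top_of_set ?e) (\<phi> ` (S - {p}))) ?G2" by simp
    have "hom_induced q ?TS (S - {p}) ?TX P (id \<circ> \<phi>) = hom_induced q (top_of_set ?e) (\<phi> ` (S - {p})) ?TX P id \<circ>
      hom_induced q ?TS (S - {p}) (top_of_set ?e) (\<phi> ` (S - {p})) \<phi>"
      using \<phi>(1) X P by (intro hom_induced_compose) auto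
    then show ?thesis unfolding I_def using iso_set_trans[OF 1 2] by simp
  qed
  define J where "J = inv_into (carrier ?G3) I"
  have J: "J \<in> iso ?G2 ?G3" unfolding J_def by (rule group.iso_set_sym[OF _ I]) simp
  have JI: "J (I x) = x" if "x \<in> carrier ?G3" for x
    using I that unfolding J_def iso_def bij_betw_def by auto
  define R where "R = hom_induced q ?TX {} ?TX P id"
  have R: "R \<in> hom ?G1 ?G2" unfolding R_def by (rule hom_induced_hom)
  define D where "D = hom_boundary q ?TS (S - {p})"
  have subS: "subtopology ?TS (S - {p}) = top_of_set (S - {p})"
    by (simp add: subtopology_subtopology inf.absorb2 Diff_subset)
  have D: "D \<in> hom ?G3 ?G4" unfolding D_def using hom_boundary_hom[of q ?TS "S - {p}"] by (simp add: subS)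
  have trivS: "trivial_group (homology_group q ?TS)"
  proof -
    have "contractible_space ?TS" using S(1) by (simp add: convex_imp_contractible)
    then have "trivial_group (reduced_homology_group q ?TS)" by (rule trivial_reduced_homology_group_contractible_space)
    then show ?thesis using q by (simp add: un_reduced_homology_group)
  qed
  have D_inj: "x = \<one>\<^bsub>?G3\<^esub>" if x: "x \<in> carrier ?G3" "D x = \<one>\<^bsub>?G4\<^esub>" for x
  proof -
    have "kernel ?G3 ?G4 D = hom_induced q ?TS {} ?TS (S - {p}) id ` carrier (homology_group q ?TS)"
      using homology_exactness_axiom_1[of q ?TS "S - {p}"] unfolding D_def by (simp add: subS)
    moreover have "x \<in> kernel ?G3 ?G4 D" using x by (simp add: kernel_def)
    ultimately have "x \<in> hom_induced q ?TS {} ?TS (S - {p}) id ` {\<one>\<^bsub>homology_group q ?TS\<^esub>}"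
      using trivS by (simp add: trivial_group_def)
    moreover have "group_hom (homology_group q ?TS) ?G3 (hom_induced q ?TS {} ?TS (S - {p}) id)"
      using hom_induced_hom by (simp add: group_hom_def group_hom_axioms_def)
    ultimately show ?thesis using group_hom.hom_one by fastforce
  qed
  show ?thesis
  proof (rule that[of "D \<circ> J \<circ> R"])
    show "D \<circ> J \<circ> R \<in> hom ?G1 ?G4"
      using R J D by (auto simp: iso_def intro: hom_compose)
    show "kernel ?G1 ?G4 (D \<circ> J \<circ> R) \<subseteq> hom_induced q (top_of_set A) {} ?TX {} id ` carrier (homology_group q (top_of_set A))"
    proof
      fix x assume "x \<in> kernel ?G1 ?G4 (D \<circ> J \<circ> R)"
      then have x: "x \<in> carrier ?G1" "D (J (R x)) = \<one>\<^bsub>?G4\<^esub>" by (auto simp: kernel_def)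
      have Rx: "R x \<in> carrier ?G2" using R x(1) by (auto simp: hom_def)
      then have "J (R x) \<in> carrier ?G3" using J by (auto simp: iso_def hom_def)
      then have "J (R x) = \<one>\<^bsub>?G3\<^esub>" using D_inj x(2) by blast
      moreover have "J \<one>\<^bsub>?G2\<^esub> = \<one>\<^bsub>?G3\<^esub>"
        using J by (intro hom_one) (auto simp: iso_def)
      moreover have "\<one>\<^bsub>?G2\<^esub> \<in> carrier ?G2" using group.is_monoid[OF group_relative_homology_group] monoid.one_closed by blast
      ultimately have "R x = \<one>\<^bsub>?G2\<^esub>"
        using J Rx unfolding iso_def bij_betw_def by (metis (no_types, lifting) inj_onD mem_Collect_eq)
      then have "x \<in> kernel ?G1 ?G2 R" using x(1) by (simp add: kernel_def)
      moreover have "kernel ?G1 ?G2 R = hom_induced q (subtopology ?TX P) {} ?TX {} id ` carrier (homology_group q (subtopology ?TX P))"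
        using homology_exactness_axiom_3[of q ?TX P] unfolding R_def by simp
      moreover have sP: "subtopology ?TX P = top_of_set P" by (simp add: P_def subtopology_subtopology inf.absorb2 Diff_subset)
      ultimately obtain y where y: "y \<in> carrier (homology_group q (top_of_set P))"
        "x = hom_induced q (top_of_set P) {} ?TX {} id y" by auto
      then obtain a where a: "a \<in> carrier (homology_group q (top_of_set A))"
        "y = hom_induced q (top_of_set A) {} (top_of_set P) {} id a" using epiA by blast
      have "x = hom_induced q (top_of_set A) {} ?TX {} (id \<circ> id) a"
        unfolding y(2) a(2) using AP by (intro hom_induced_compose') (auto simp: P_def)
      then show "x \<in> hom_induced q (top_of_set A) {} ?TX {} id ` carrier (homology_group q (top_of_set A))"
        using a(1) by simp
    qed
    fix c d assume c: "singular_relcycle q ?TX {} c" and d: "singular_relcycle q ?TS (S - {p}) d"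
      and cd: "singular_chain q (top_of_set (X - {\<phi> p})) (c - chain_map q \<phi> d)"
    have sP: "subtopology ?TX P = top_of_set (X - {\<phi> p})" by (simp add: P_def subtopology_subtopology inf.absorb2 Diff_subset)
    have Rc: "R (homologous_rel_set q ?TX {} c) = homologous_rel_set q ?TX P (chain_map q id c)"
      unfolding R_def using c by (intro hom_induced_chain_map) auto
    have Id: "I (homologous_rel_set q ?TS (S - {p}) d) = homologous_rel_set q ?TX P (chain_map q \<phi> d)"
      unfolding I_def using d \<phi>(1) P X by (intro hom_induced_chain_map) auto
    have cc: "chain_map q id c = c" using c by (intro chain_map_ident) (auto simp: singular_relcycle_def)
    have "homologous_rel q ?TX P c (chain_map q \<phi> d)"
      unfolding homologous_rel_def using cd by (intro singular_chain_imp_relboundary) (simp add: sP)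
    then have "R (homologous_rel_set q ?TX {} c) = I (homologous_rel_set q ?TS (S - {p}) d)"
      unfolding Rc Id cc by (simp add: homologous_rel_set_eq)
    moreover have "homologous_rel_set q ?TS (S - {p}) d \<in> carrier ?G3"
      using d by (auto simp: carrier_relative_homology_group)
    ultimately have "(D \<circ> J \<circ> R) (homologous_rel_set q ?TX {} c) = D (homologous_rel_set q ?TS (S - {p}) d)"
      using JI by simp
    also have "\<dots> = homologous_rel_set (q - 1) (top_of_set (S - {p})) {} (chain_boundary q d)"
      unfolding D_def using hom_boundary_chain_boundary[OF d q] by (simp add: subS)
    finally show "(D \<circ> J \<circ> R) (homologous_rel_set q ?TX {} c)
      = homologous_rel_set (q - 1) (top_of_set (S - {p})) {} (chain_boundary q d)" .
  qed
qed

section \<open>The standard triangle\<close>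

definition std_tri :: "complex set" where
  "std_tri = {z. 0 \<le> Re z \<and> 0 \<le> Im z \<and> Re z + Im z \<le> 1}"

definition std_mid :: complex where
  "std_mid = Complex (1/3) (1/3)"

text \<open>The side \<open>k\<close> is opposite to the corner \<open>k\<close> in the list \<open>0, 1, \<i>\<close>, which is the numbering of the faces
  of a singular triangle.\<close>
definition std_side :: "nat \<Rightarrow> complex set" where
  "std_side k = {z\<in>std_tri. (if k = 0 then Re z + Im z = 1 else if k = 1 then Re z = 0 else Im z = 0)}"

definition std_frontier :: "complex set" where
  "std_frontier = std_side 0 \<union> std_side 1 \<union> std_side 2"

lemma std_tri_hull: "std_tri = convex hull {0, 1, \<i>}"
proof -
  have "z \<in> std_tri \<longleftrightarrow> z \<in> convex hull {0, 1, \<i>}" for z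
  proof
    assume "z \<in> std_tri"
    then have "z = (1 - Re z - Im z) *\<^sub>R 0 + Re z *\<^sub>R 1 + Im z *\<^sub>R \<i>" "0 \<le> 1 - Re z - Im z" "0 \<le> Re z" "0 \<le> Im z"
      by (auto simp: std_tri_def complex_eq_iff)
    then show "z \<in> convex hull {0, 1, \<i>}"
      unfolding convex_hull_3 by (intro CollectI exI[of _ "1 - Re z - Im z"] exI[of _ "Re z"] exI[of _ "Im z"]) auto
  qed (auto simp: convex_hull_3 std_tri_def)
  then show ?thesis by blast
qed

lemma std_tri_convex: "convex std_tri" and std_tri_compact: "compact std_tri"
  unfolding std_tri_hull by (auto simp: finite_imp_compact_convex_hull)

lemma std_mid_interior: "std_mid \<in> interior std_tri"
proof -
  have "open {z. 0 < Re z \<and> 0 < Im z \<and> Re z + Im z < 1}"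
    by (intro open_Collect_conj open_Collect_less continuous_intros)
  then have "{z. 0 < Re z \<and> 0 < Im z \<and> Re z + Im z < 1} \<subseteq> interior std_tri"
    by (intro interior_maximal) (auto simp: std_tri_def)
  then show ?thesis by (auto simp: std_mid_def)
qed

lemma std_mid_in: "std_mid \<in> std_tri" by (simp add: std_mid_def std_tri_def)

lemma std_side_segment:
  "std_side 0 = closed_segment 1 \<i>" "std_side 1 = closed_segment 0 \<i>" "std_side 2 = closed_segment 0 1"
proof -
  show "std_side 0 = closed_segment 1 \<i>"
  proof (intro equalityI subsetI)
    fix z assume "z \<in> std_side 0"
    then show "z \<in> closed_segment 1 \<i>"
      unfolding closed_segment_def by (intro CollectI exI[of _ "Im z"]) (auto simp: std_side_def std_tri_def complex_eq_iff)
  qed (auto simp: closed_segment_def std_side_def std_tri_def)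
  show "std_side 1 = closed_segment 0 \<i>"
  proof (intro equalityI subsetI)
    fix z assume "z \<in> std_side 1"
    then show "z \<in> closed_segment 0 \<i>"
      unfolding closed_segment_def by (intro CollectI exI[of _ "Im z"]) (auto simp: std_side_def std_tri_def complex_eq_iff)
  qed (auto simp: closed_segment_def std_side_def std_tri_def)
  show "std_side 2 = closed_segment 0 1"
  proof (intro equalityI subsetI)
    fix z assume "z \<in> std_side 2"
    then show "z \<in> closed_segment 0 1"
      unfolding closed_segment_def by (intro CollectI exI[of _ "Re z"]) (auto simp: std_side_def std_tri_def complex_eq_iff)
  qed (auto simp: closed_segment_def std_side_def std_tri_def)
qed

text \<open>In barycentric coordinates, subtract the smallest coordinate from all of them and rescale.\<close>
lemma std_tri_radial: "\<exists>r. radial_retraction std_tri std_frontier std_mid r"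
proof -
  define m where "m z = min (Re z) (min (Im z) (1 - Re z - Im z))" for z
  define r where "r z = Complex ((Re z - m z) / (1 - 3 * m z)) ((Im z - m z) / (1 - 3 * m z))" for z
  have pos: "1 - 3 * m z > 0" if "z \<noteq> std_mid" for z
    using that by (auto simp: m_def min_def complex_eq_iff std_mid_def split: if_splits)
  have shift: "Re (r z) - 1/3 = (Re z - 1/3) / (1 - 3 * m z)" "Im (r z) - 1/3 = (Im z - 1/3) / (1 - 3 * m z)"
    if "z \<noteq> std_mid" for z using pos[OF that] by (auto simp: r_def field_simps)
  have front: "r z \<in> std_frontier" if z: "z \<in> std_tri - {std_mid}" for z
  proof -
    have p: "1 - 3 * m z > 0" using pos z by blast
    have m0: "m z \<le> Re z" "m z \<le> Im z" "m z \<le> 1 - Re z - Im z" by (auto simp: m_def)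
    have b0: "1 - Re (r z) - Im (r z) = (1 - Re z - Im z - m z) / (1 - 3 * m z)"
    proof -
      have "(1 - 3 * m z) / (1 - 3 * m z) - (Re z - m z) / (1 - 3 * m z) - (Im z - m z) / (1 - 3 * m z)
        = ((1 - 3 * m z) - (Re z - m z) - (Im z - m z)) / (1 - 3 * m z)"
        by (simp only: diff_divide_distrib)
      moreover have "(1 - 3 * m z) / (1 - 3 * m z) = 1" using p by simp
      ultimately show ?thesis by (simp add: r_def)
    qed
    have ge: "Re (r z) \<ge> 0" "Im (r z) \<ge> 0" using p m0 by (auto simp: r_def)
    have ge0: "1 - Re (r z) - Im (r z) \<ge> 0" unfolding b0 using p m0 by simp
    have "m z = Re z \<or> m z = Im z \<or> m z = 1 - Re z - Im z" by (auto simp: m_def)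
    then have "Re (r z) = 0 \<or> Im (r z) = 0 \<or> 1 - Re (r z) - Im (r z) = 0"
      unfolding b0 by (auto simp: r_def)
    then show ?thesis using ge ge0 by (auto simp: std_frontier_def std_side_def std_tri_def)
  qed
  have "radial_retraction std_tri std_frontier std_mid r"
    unfolding radial_retraction_def
  proof (intro conjI ballI std_tri_convex std_tri_compact)
    show "std_frontier \<subseteq> std_tri" by (auto simp: std_frontier_def std_side_def)
    show "std_mid \<in> std_tri - std_frontier"
      by (auto simp: std_mid_def std_frontier_def std_side_def std_tri_def)
    show "continuous_on (std_tri - {std_mid}) r"
      unfolding r_def m_def
      by (intro continuous_on_Complex continuous_intros) (use pos in \<open>force simp: m_def\<close>)+
    show "r ` (std_tri - {std_mid}) \<subseteq> std_frontier" using front by blast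
    show "r z = z" if "z \<in> std_frontier" for z
    proof -
      have "m z = 0" using that by (auto simp: m_def std_frontier_def std_side_def std_tri_def)
      then show ?thesis by (simp add: r_def)
    qed
    show "closed_segment z (r z) \<subseteq> std_tri - {std_mid}" if z: "z \<in> std_tri - {std_mid}" for z
    proof
      fix w assume w: "w \<in> closed_segment z (r z)"
      have "r z \<in> std_tri" using front[OF z] by (auto simp: std_frontier_def std_side_def)
      then have w_in: "w \<in> std_tri" using z w closed_segment_subset[OF _ _ std_tri_convex] by blast
      obtain t where t: "0 \<le> t" "t \<le> 1" "w = (1 - t) *\<^sub>R z + t *\<^sub>R r z"
        using w by (auto simp: closed_segment_def)
      have p: "1 - 3 * m z > 0" using pos z by blast
      define l where "l = (1 - t) + t / (1 - 3 * m z)"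
      have comb: "(1 - t) * a + t * (a / (1 - 3 * m z)) = a * l" for a
        by (simp add: l_def distrib_left mult.commute)
      have l: "l > 0"
      proof (cases "t = 0")
        case False
        then show ?thesis using t p by (simp add: l_def add_nonneg_pos)
      qed (simp add: l_def)
      have "Re w = (1 - t) * Re z + t * Re (r z)" unfolding t(3) by simp
      then have "Re w - 1/3 = (1 - t) * (Re z - 1/3) + t * (Re (r z) - 1/3)" by (simp add: field_simps)
      also have "\<dots> = (1 - t) * (Re z - 1/3) + t * ((Re z - 1/3) / (1 - 3 * m z))" using shift(1)[of z] z by simp
      also have "\<dots> = (Re z - 1/3) * l" by (rule comb)
      finally have 1: "Re w - 1/3 = (Re z - 1/3) * l" .
      have "Im w = (1 - t) * Im z + t * Im (r z)" unfolding t(3) by simp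
      then have "Im w - 1/3 = (1 - t) * (Im z - 1/3) + t * (Im (r z) - 1/3)" by (simp add: field_simps)
      also have "\<dots> = (1 - t) * (Im z - 1/3) + t * ((Im z - 1/3) / (1 - 3 * m z))" using shift(2)[of z] z by simp
      also have "\<dots> = (Im z - 1/3) * l" by (rule comb)
      finally have 2: "Im w - 1/3 = (Im z - 1/3) * l" .
      have "w \<noteq> std_mid"
      proof
        assume "w = std_mid"
        then have "(Re z - 1/3) * l = 0" "(Im z - 1/3) * l = 0" using 1 2 by (auto simp: std_mid_def)
        then have "z = std_mid" using l by (auto simp: std_mid_def complex_eq_iff)
        then show False using z by blast
      qed
      then show "w \<in> std_tri - {std_mid}" using w_in by blast
    qed
  qed
  then show ?thesis by blast
qed

text \<open>The retraction away from one side subtracts the smaller one of the two coordinates that do not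
  vanish on this side and adds what is lost to the third one.\<close>
lemma std_tri_collapse:
  assumes "k \<le> 2"
  obtains g where "continuous_on std_tri g" "\<And>z. z \<in> std_tri \<Longrightarrow> \<exists>j\<le>2. j \<noteq> k \<and> g z \<in> std_side j"
    "\<And>j z. j \<le> 2 \<Longrightarrow> j \<noteq> k \<Longrightarrow> z \<in> std_side j \<Longrightarrow> g z = z"
proof -
  have le2: "j \<le> 2 \<longleftrightarrow> j = 0 \<or> j = 1 \<or> j = 2" for j :: nat by auto
  consider "k = 0" | "k = 1" | "k = 2" using assms by linarith
  then show ?thesis
  proof cases
    case 1
    define g where "g z = Complex (Re z - min (Re z) (Im z)) (Im z - min (Re z) (Im z))" for z
    show ?thesis
    proof (rule that[of g])
      show "continuous_on std_tri g" unfolding g_def by (intro continuous_on_Complex continuous_intros)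
      show "\<exists>j\<le>2. j \<noteq> k \<and> g z \<in> std_side j" if "z \<in> std_tri" for z
      proof -
        have "g z \<in> std_side 1 \<or> g z \<in> std_side 2"
          using that by (auto simp: g_def std_side_def std_tri_def min_def)
        then show ?thesis
        proof
          assume "g z \<in> std_side 1"
          then show ?thesis using 1 by (intro exI[of _ 1]) simp
        next
          assume "g z \<in> std_side 2"
          then show ?thesis using 1 by (intro exI[of _ 2]) simp
        qed
      qed
      show "g z = z" if "j \<le> 2" "j \<noteq> k" "z \<in> std_side j" for j z
        using that 1 unfolding le2 by (auto simp: g_def std_side_def std_tri_def complex_eq_iff)
    qed
  next
    case 2
    define g where "g z = Complex (Re z + 2 * min (1 - Re z - Im z) (Im z)) (Im z - min (1 - Re z - Im z) (Im z))" for z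
    show ?thesis
    proof (rule that[of g])
      show "continuous_on std_tri g" unfolding g_def by (intro continuous_on_Complex continuous_intros)
      show "\<exists>j\<le>2. j \<noteq> k \<and> g z \<in> std_side j" if "z \<in> std_tri" for z
      proof -
        have "g z \<in> std_side 0 \<or> g z \<in> std_side 2"
          using that by (auto simp: g_def std_side_def std_tri_def min_def)
        then show ?thesis
        proof
          assume "g z \<in> std_side 0"
          then show ?thesis using 2 by (intro exI[of _ 0]) simp
        next
          assume "g z \<in> std_side 2"
          then show ?thesis using 2 by (intro exI[of _ 2]) simp
        qed
      qed
      show "g z = z" if "j \<le> 2" "j \<noteq> k" "z \<in> std_side j" for j z
        using that 2 unfolding le2 by (auto simp: g_def std_side_def std_tri_def complex_eq_iff)
    qed
  next
    case 3
    define g where "g z = Complex (Re z - min (1 - Re z - Im z) (Re z)) (Im z + 2 * min (1 - Re z - Im z) (Re z))" for z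
    show ?thesis
    proof (rule that[of g])
      show "continuous_on std_tri g" unfolding g_def by (intro continuous_on_Complex continuous_intros)
      show "\<exists>j\<le>2. j \<noteq> k \<and> g z \<in> std_side j" if "z \<in> std_tri" for z
      proof -
        have "g z \<in> std_side 0 \<or> g z \<in> std_side 1"
          using that by (auto simp: g_def std_side_def std_tri_def min_def)
        then show ?thesis
        proof
          assume "g z \<in> std_side 0"
          then show ?thesis using 3 by (intro exI[of _ 0]) simp
        next
          assume "g z \<in> std_side 1"
          then show ?thesis using 3 by (intro exI[of _ 1]) simp
        qed
      qed
      show "g z = z" if "j \<le> 2" "j \<noteq> k" "z \<in> std_side j" for j z
        using that 3 unfolding le2 by (auto simp: g_def std_side_def std_tri_def complex_eq_iff)
    qed
  qed
qed

lemma unit_interval_radial: "\<exists>r. radial_retraction {0..1::real} {0, 1} (1/2) r"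
proof -
  define r where "r x = (1 + sgn (x - 1/2)) / 2" for x :: real
  have "radial_retraction {0..1::real} {0, 1} (1/2) r"
    unfolding radial_retraction_def
  proof (intro conjI ballI)
    show "continuous_on ({0..1} - {1 / 2}) r" unfolding r_def by (intro continuous_intros) auto
    show "closed_segment x (r x) \<subseteq> {0..1} - {1/2}" if "x \<in> {0..1} - {1/2}" for x
      using that by (auto simp: r_def sgn_if closed_segment_eq_real_ivl split: if_splits)
    show "r ` ({0..1} - {1/2}) \<subseteq> {0, 1}"
    proof
      fix y assume "y \<in> r ` ({0..1} - {1/2})"
      then obtain x where "x \<noteq> 1/2" "y = r x" by blast
      then show "y \<in> {0, 1}" by (cases "x < 1/2") (auto simp: r_def sgn_if)
    qed
  qed (auto simp: r_def sgn_if)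
  then show ?thesis by blast
qed

lemma homeomorphic_imp_homeomorphic_space:
  "S homeomorphic T \<Longrightarrow> top_of_set S homeomorphic_space top_of_set T"
proof -
  assume "S homeomorphic T"
  then obtain f g where "homeomorphism S T f g" by (auto simp: homeomorphic_def)
  then have "homeomorphic_maps (top_of_set S) (top_of_set T) f g"
    by (auto simp: homeomorphism_def homeomorphic_maps_def)
  then show ?thesis by (auto simp: homeomorphic_space_def)
qed

lemma punctured_convex_homology:
  fixes S :: "'b::euclidean_space set"
  assumes "convex S" "compact S" "a \<in> rel_interior S"
  shows "homology_group p (top_of_set (S - {a})) \<cong> homology_group p (top_of_set (rel_frontier S))"
proof -
  have sub: "rel_frontier S \<subseteq> S" using assms(2) by (simp add: rel_frontier_def compact_imp_closed Diff_subset)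
  obtain r where r: "homotopic_with_canon (\<lambda>x. True) (S - {a}) (S - {a}) id r"
    "retraction (S - {a}) (rel_frontier S) r"
    using rel_frontier_deformation_retract_of_punctured_convex[OF assms(1,1) compact_imp_bounded[OF assms(2)] assms(3) sub hull_subset] .
  have "retraction_maps (top_of_set (S - {a})) (top_of_set (rel_frontier S)) r id"
    using r(2) by (auto simp: retraction_maps_def retraction_def)
  then show ?thesis
    using r(1) by (intro deformation_retract_imp_isomorphic_homology_groups) (auto simp: homotopic_with_sym)
qed

lemma homology_punctured_interval: "trivial_group (homology_group 1 (top_of_set ({0..1::real} - {1/2})))"
proof -
  have ri: "rel_interior {0..1::real} = {0<..<1}"
    using rel_interior_nonempty_interior[of "{0..1::real}"] by (simp add: interior_atLeastAtMost_real)
  have "rel_frontier {0..1::real} = {0, 1}"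
    by (auto simp: rel_frontier_def ri)
  then have "homology_group 1 (top_of_set ({0..1::real} - {1/2})) \<cong> homology_group 1 (top_of_set {0, 1::real})"
    using punctured_convex_homology[of "{0..1::real}" "1/2" 1] by (simp add: ri)
  also have "homology_group 1 (top_of_set {0, 1::real}) = reduced_homology_group 1 (top_of_set {0, 1::real})"
    by (simp add: un_reduced_homology_group)
  also have "\<dots> \<cong> homology_group 1 (top_of_set {0::real})"
    using reduced_homology_group_pair[of "euclidean :: real topology" 0 1 1] by (simp add: t1_space_euclidean)
  finally have "homology_group 1 (top_of_set ({0..1::real} - {1/2})) \<cong> homology_group 1 (top_of_set {0::real})"
    by (simp add: isomorphism_trans)
  moreover have "trivial_group (homology_group 1 (top_of_set {0::real}))"
    by (rule homology_dimension_axiom[of _ 0]) auto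
  ultimately show ?thesis by (meson group_relative_homology_group isomorphic_group_triviality)
qed

text \<open>The punctured triangle retracts to its frontier, which is a circle.\<close>
lemma homology_punctured_std_tri: "homology_group 1 (top_of_set (std_tri - {std_mid})) \<cong> integer_group"
proof -
  have int: "interior std_tri \<noteq> {}" using std_mid_interior by blast
  have ri: "std_mid \<in> rel_interior std_tri" using std_mid_interior rel_interior_nonempty_interior[OF int] by simp
  have 1: "homology_group 1 (top_of_set (std_tri - {std_mid})) \<cong> homology_group 1 (top_of_set (rel_frontier std_tri))"
    by (rule punctured_convex_homology[OF std_tri_convex std_tri_compact ri])
  have "rel_frontier std_tri homeomorphic rel_frontier (cball (0::complex) 1)"
    using int by (intro homeomorphic_rel_frontiers_convex_bounded_sets)
      (auto simp: std_tri_convex std_tri_compact compact_imp_bounded aff_dim_nonempty_interior)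
  then have "rel_frontier std_tri homeomorphic (sphere (0::complex) 1)"
    by (simp add: rel_frontier_nonempty_interior)
  then have 2: "homology_group 1 (top_of_set (rel_frontier std_tri)) \<cong> homology_group 1 (top_of_set (sphere (0::complex) 1))"
    by (intro homeomorphic_space_imp_isomorphic_homology_groups homeomorphic_imp_homeomorphic_space)
  obtain f g where "homeomorphic_maps (nsphere 1) (top_of_set (sphere (0::complex) 1 \<inter> span Basis)) f g"
    using homeomorphic_maps_nsphere_euclidean_sphere[of "Basis :: complex set" 2]
      independent_Basis orthogonal_Basis by auto
  then have "nsphere 1 homeomorphic_space top_of_set (sphere (0::complex) 1)"
    by (auto simp: homeomorphic_space_def)
  then have 3: "homology_group 1 (nsphere 1) \<cong> homology_group 1 (top_of_set (sphere (0::complex) 1))"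
    by (rule homeomorphic_space_imp_isomorphic_homology_groups)
  have 4: "homology_group 1 (nsphere 1) \<cong> integer_group"
    using reduced_homology_group_nsphere(1)[of 1] by (simp add: un_reduced_homology_group)
  show ?thesis
    using 1 2 3 4 by (meson group.iso_sym group_relative_homology_group iso_trans)
qed

section \<open>The boundary of the standard triangle winds around its midpoint\<close>

text \<open>The total winding number of a singular one-chain around \<open>p\<close>; a singular segment becomes a path by means
  of its second barycentric coordinate \<open>u\<close>.\<close>
definition chain_winding :: "complex \<Rightarrow> complex chain \<Rightarrow> complex" where
  "chain_winding p c = (\<Sum>\<sigma>\<in>Poly_Mapping.keys c.
     of_int (Poly_Mapping.lookup c \<sigma>) * winding_number (\<lambda>u. \<sigma> (\<lambda>i. if i = 0 then 1 - u else if i = 1 then u else 0)) p)"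

lemma chain_winding_superset:
  assumes "finite A" "Poly_Mapping.keys c \<subseteq> A"
  shows "chain_winding p c = (\<Sum>\<sigma>\<in>A.
     of_int (Poly_Mapping.lookup c \<sigma>) * winding_number (\<lambda>u. \<sigma> (\<lambda>i. if i = 0 then 1 - u else if i = 1 then u else 0)) p)"
  unfolding chain_winding_def using assms by (intro sum.mono_neutral_left) (auto simp: in_keys_iff)

lemma chain_winding_diff: "chain_winding p (a - b) = chain_winding p a - chain_winding p b"
proof -
  let ?A = "Poly_Mapping.keys a \<union> Poly_Mapping.keys b"
  have "Poly_Mapping.keys (a - b) \<subseteq> ?A" by (rule keys_diff)
  then show ?thesis
    by (simp add: chain_winding_superset[of ?A] lookup_minus algebra_simps sum_subtractf)
qed

lemma chain_winding_add: "chain_winding p (a + b) = chain_winding p a + chain_winding p b"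
  using chain_winding_diff[of p "a + b" b] by simp

lemma chain_winding_cmul: "chain_winding p (frag_cmul k a) = of_int k * chain_winding p a"
proof -
  have "Poly_Mapping.keys (frag_cmul k a) \<subseteq> Poly_Mapping.keys a" by (rule keys_cmul)
  then show ?thesis
    by (simp add: chain_winding_superset[of "Poly_Mapping.keys a"] sum_distrib_left mult.assoc)
qed

lemma chain_winding_of:
  "chain_winding p (frag_of \<sigma>) = winding_number (\<lambda>u. \<sigma> (\<lambda>i. if i = 0 then 1 - u else if i = 1 then u else 0)) p"
  by (simp add: chain_winding_def)

text \<open>A singular triangle as a map on \<open>std_tri\<close>, whose Cartesian coordinates are the last two barycentric
  ones.\<close>
definition tri_simplex :: "((nat \<Rightarrow> real) \<Rightarrow> 'a) \<Rightarrow> complex \<Rightarrow> 'a" where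
  "tri_simplex \<sigma> z = \<sigma> (\<lambda>i. if i = 0 then 1 - Re z - Im z else if i = 1 then Re z else if i = 2 then Im z else 0)"

lemma chain_winding_face:
  "chain_winding p (chain_boundary 2 (frag_of \<sigma>)) =
     winding_number (tri_simplex \<sigma> \<circ> linepath 1 \<i>) p - winding_number (tri_simplex \<sigma> \<circ> linepath 0 \<i>) p
     + winding_number (tri_simplex \<sigma> \<circ> linepath 0 1) p"
proof -
  have face: "winding_number (\<lambda>u. singular_face 2 k \<sigma> (\<lambda>i. if i = 0 then 1 - u else if i = 1 then u else 0)) p
    = winding_number (tri_simplex \<sigma> \<circ> l) p"
    if "k \<le> 2" "\<And>u. simplical_face k (\<lambda>i. if i = 0 then 1 - u else if i = 1 then u else 0) =
      (\<lambda>i. if i = 0 then 1 - Re (l u) - Im (l u) else if i = 1 then Re (l u) else if i = 2 then Im (l u) else 0)" for k l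
  proof (rule winding_number_cong)
    fix u :: real assume "0 \<le> u" "u \<le> 1"
    then have "(\<lambda>i. if i = 0 then 1 - u else if i = 1 then u else 0) \<in> standard_simplex (2 - Suc 0)"
      by (auto simp: standard_simplex_def)
    then show "singular_face 2 k \<sigma> (\<lambda>i. if i = 0 then 1 - u else if i = 1 then u else 0) = (tri_simplex \<sigma> \<circ> l) u"
      using that by (simp add: singular_face_def tri_simplex_def)
  qed
  have f0: "winding_number (\<lambda>u. singular_face 2 0 \<sigma> (\<lambda>i. if i = 0 then 1 - u else if i = 1 then u else 0)) p
    = winding_number (tri_simplex \<sigma> \<circ> linepath 1 \<i>) p"
    by (rule face) (auto simp: simplical_face_def linepath_def fun_eq_iff)
  have f1: "winding_number (\<lambda>u. singular_face 2 1 \<sigma> (\<lambda>i. if i = 0 then 1 - u else if i = 1 then u else 0)) p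
    = winding_number (tri_simplex \<sigma> \<circ> linepath 0 \<i>) p"
    by (rule face) (auto simp: simplical_face_def linepath_def fun_eq_iff)
  have f2: "winding_number (\<lambda>u. singular_face 2 2 \<sigma> (\<lambda>i. if i = 0 then 1 - u else if i = 1 then u else 0)) p
    = winding_number (tri_simplex \<sigma> \<circ> linepath 0 1) p"
    by (rule face) (auto simp: simplical_face_def linepath_def fun_eq_iff)
  have "chain_boundary 2 (frag_of \<sigma>) = frag_of (singular_face 2 0 \<sigma>) - frag_of (singular_face 2 1 \<sigma>) + frag_of (singular_face 2 2 \<sigma>)"
    by (simp add: chain_boundary_of numeral_2_eq_2)
  then show ?thesis
    by (simp add: chain_winding_add chain_winding_diff chain_winding_of f0 f1[simplified] f2)
qed

text \<open>A singular triangle that avoids the point has a continuous logarithm, whose increments along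
  the three faces cancel.\<close>
lemma chain_winding_boundary:
  assumes "singular_chain 2 (top_of_set (- {p})) c"
  shows "chain_winding p (chain_boundary 2 c) = 0"
proof -
  have simplex: "chain_winding p (chain_boundary 2 (frag_of \<sigma>)) = 0" if "singular_simplex 2 (top_of_set (- {p})) \<sigma>" for \<sigma>
  proof -
    define b where "b z = (\<lambda>i::nat. if i = 0 then 1 - Re z - Im z else if i = 1 then Re z else if i = 2 then Im z else 0)" for z
    have "continuous_map (top_of_set std_tri) (subtopology (powertop_real UNIV) (standard_simplex 2)) b"
      unfolding continuous_map_in_subtopology continuous_map_componentwise_UNIV
    proof (intro conjI allI)
      show "continuous_map (top_of_set std_tri) euclideanreal (\<lambda>x. b x i)" for i
        unfolding b_def by (cases "i = 0"; cases "i = 1"; cases "i = 2") (auto intro!: continuous_intros)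
      show "b \<in> topspace (top_of_set std_tri) \<rightarrow> standard_simplex 2"
        by (auto simp: b_def standard_simplex_def std_tri_def numeral_2_eq_2)
    qed
    moreover have "continuous_map (subtopology (powertop_real UNIV) (standard_simplex 2)) (top_of_set (- {p})) \<sigma>"
      using that by (simp add: singular_simplex_def)
    ultimately have "continuous_map (top_of_set std_tri) (top_of_set (- {p})) (\<sigma> \<circ> b)"
      by (rule continuous_map_compose)
    then have F: "continuous_on std_tri (tri_simplex \<sigma>)" "\<And>z. z \<in> std_tri \<Longrightarrow> tri_simplex \<sigma> z \<noteq> p"
      by (auto simp: tri_simplex_def[abs_def] o_def b_def[abs_def])
    have "continuous_on std_tri (\<lambda>z. tri_simplex \<sigma> z - p)" using F(1) by (intro continuous_intros)
    then obtain g where g: "continuous_on std_tri g" "\<And>z. z \<in> std_tri \<Longrightarrow> tri_simplex \<sigma> z - p = exp (g z)"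
      by (rule continuous_logarithm_on_contractible[OF _ convex_imp_contractible[OF std_tri_convex]])
        (use F(2) in auto)
    have w: "winding_number (tri_simplex \<sigma> \<circ> linepath a b) p = (g b - g a) / (2 * of_real pi * \<i>)"
      if "closed_segment a b \<subseteq> std_tri" for a b
    proof -
      have "winding_number (tri_simplex \<sigma> \<circ> linepath a b) p = winding_number (exp \<circ> (g \<circ> linepath a b)) 0"
        unfolding winding_number_offset[of _ p]
      proof (rule winding_number_cong)
        fix t :: real assume "0 \<le> t" "t \<le> 1"
        then have "linepath a b t \<in> std_tri" using that linepath_in_path[of t a b] by auto
        then show "(tri_simplex \<sigma> \<circ> linepath a b) t - p = (exp \<circ> (g \<circ> linepath a b)) t" using g(2) by simp
      qed
      moreover have "path (g \<circ> linepath a b)"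
        using that g(1) by (intro path_continuous_image) (auto intro: continuous_on_subset)
      ultimately show ?thesis
        using winding_number_compose_exp[of "g \<circ> linepath a b"] by (simp add: pathfinish_def pathstart_def linepath_def)
    qed
    have "closed_segment 1 \<i> \<subseteq> std_tri" "closed_segment 0 \<i> \<subseteq> std_tri" "closed_segment 0 1 \<subseteq> std_tri"
      unfolding std_side_segment[symmetric] by (auto simp: std_side_def)
    then show ?thesis unfolding chain_winding_face by (simp add: w field_simps)
  qed
  show ?thesis
    using assms unfolding singular_chain_def
  proof (induction c rule: frag_induction)
    case (diff a b)
    then show ?case by (simp add: chain_boundary_diff chain_winding_diff)
  next
    case (one \<sigma>)
    then show ?case using simplex by simp
  qed (simp add: chain_winding_def)
qed

definition std_simplex2 :: "(nat \<Rightarrow> real) \<Rightarrow> complex" where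
  "std_simplex2 = restrict (\<lambda>x. Complex (x 1) (x 2)) (standard_simplex 2)"

lemma std_simplex2_singular: "singular_simplex 2 (top_of_set std_tri) std_simplex2"
  unfolding singular_simplex_def
proof
  have "continuous_map (subtopology (powertop_real UNIV) (standard_simplex 2)) euclidean (\<lambda>x. of_real (x 1) + \<i> * of_real (x 2) :: complex)"
  proof -
    have "continuous_map (subtopology (powertop_real UNIV) (standard_simplex 2)) euclideanreal (\<lambda>x. x i)" for i
      by (intro continuous_map_from_subtopology continuous_map_product_projection) auto
    then have "continuous_map (subtopology (powertop_real UNIV) (standard_simplex 2)) euclidean (\<lambda>x. of_real (x i) :: complex)" for i
      using continuous_map_compose[of _ euclideanreal "\<lambda>x. x i" "euclidean :: complex topology" of_real]
      by (auto simp: o_def intro: continuous_intros)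
    then show ?thesis
      by (intro continuous_map_add continuous_map_compose[of _ euclidean "\<lambda>x. of_real (x 2)" euclidean "\<lambda>z. \<i> * z", unfolded o_def])
        (auto intro: continuous_intros)
  qed
  then have "continuous_map (subtopology (powertop_real UNIV) (standard_simplex 2)) euclidean std_simplex2"
    by (rule continuous_map_eq) (auto simp: std_simplex2_def complex_eq_iff)
  then show "continuous_map (subtopology (powertop_real UNIV) (standard_simplex 2)) (top_of_set std_tri) std_simplex2"
  proof (rule continuous_map_into_subtopology)
    show "std_simplex2 \<in> topspace (subtopology (powertop_real UNIV) (standard_simplex 2)) \<rightarrow> std_tri"
    proof
      fix x assume "x \<in> topspace (subtopology (powertop_real UNIV) (standard_simplex 2))"
      then have x: "x \<in> standard_simplex 2" by simp
      then have "0 \<le> x 0" "0 \<le> x 1" "0 \<le> x 2" "x 0 + x 1 + x 2 = 1"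
        by (auto simp: standard_simplex_def numeral_2_eq_2)
      then show "std_simplex2 x \<in> std_tri" using x by (simp add: std_simplex2_def std_tri_def)
    qed
  qed
qed (simp add: std_simplex2_def)

lemma tri_simplex_std:
  assumes "z \<in> std_tri"
  shows "tri_simplex std_simplex2 z = z"
proof -
  have "(\<lambda>i. if i = 0 then 1 - Re z - Im z else if i = 1 then Re z else if i = 2 then Im z else 0) \<in> standard_simplex 2"
    using assms by (auto simp: standard_simplex_def std_tri_def numeral_2_eq_2)
  then show ?thesis by (simp add: tri_simplex_def std_simplex2_def)
qed

text \<open>The three sides form the closed triangular path through \<open>0, 1, \<i>\<close>, which winds once around each inner
  point.\<close>
lemma std_boundary_winding: "chain_winding std_mid (chain_boundary 2 (frag_of std_simplex2)) \<noteq> 0"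
proof -
  have sub: "closed_segment 1 \<i> \<subseteq> std_tri - {std_mid}" "closed_segment 0 \<i> \<subseteq> std_tri - {std_mid}" "closed_segment 0 1 \<subseteq> std_tri - {std_mid}"
    unfolding std_side_segment[symmetric] by (auto simp: std_side_def std_mid_def)
  have w: "winding_number (tri_simplex std_simplex2 \<circ> linepath a b) std_mid = winding_number (linepath a b) std_mid"
    if "closed_segment a b \<subseteq> std_tri - {std_mid}" for a b
  proof (rule winding_number_cong)
    fix t :: real assume "0 \<le> t" "t \<le> 1"
    then have "linepath a b t \<in> std_tri" using that linepath_in_path[of t a b] by auto
    then show "(tri_simplex std_simplex2 \<circ> linepath a b) t = linepath a b t" by (simp add: tri_simplex_std)
  qed
  have rev: "winding_number (linepath \<i> 0) std_mid = - winding_number (linepath 0 \<i>) std_mid"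
    using winding_number_reversepath[of "linepath 0 \<i>" std_mid] sub(2) by auto
  have "chain_winding std_mid (chain_boundary 2 (frag_of std_simplex2)) =
    winding_number (linepath 0 1) std_mid + (winding_number (linepath 1 \<i>) std_mid + winding_number (linepath \<i> 0) std_mid)"
    unfolding chain_winding_face by (simp add: w sub rev)
  also have "\<dots> = winding_number (linepath 0 1 +++ linepath 1 \<i> +++ linepath \<i> 0) std_mid"
  proof -
    have "std_mid \<notin> closed_segment 1 \<i>" "std_mid \<notin> closed_segment \<i> 0" "std_mid \<notin> closed_segment 0 1"
      using sub closed_segment_commute[of 0 \<i>] by auto
    then show ?thesis by (simp add: winding_number_join path_image_join)
  qed
  also have "\<dots> \<noteq> 0"
    using winding_number_triangle[of std_mid 0 1 \<i>] std_mid_interior by (simp add: std_tri_hull)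
  finally show ?thesis .
qed

section \<open>Homology of a curved complex\<close>

lemma homologous_rel_set_hom:
  "homologous_rel_set p X S \<in> hom (relcycle_group p X S) (relative_homology_group (int p) X S)"
  using normal.r_coset_hom_Mod[OF normal_subgroup_singular_relboundary_relcycle[of p X S]]
  by (simp add: nontrivial_relative_homology_group right_coset_singular_relboundary[abs_def])

lemma int_pow_homologous_rel_set:
  assumes "singular_relcycle p X S c"
  shows "homologous_rel_set p X S c [^]\<^bsub>relative_homology_group (int p) X S\<^esub> (k::int)
    = homologous_rel_set p X S (frag_cmul k c)"
proof -
  let ?Z = "relcycle_group p X S"
  have c: "c \<in> carrier ?Z" using assms by simp
  have "c [^]\<^bsub>?Z\<^esub> k = frag_cmul k c"
  proof -
    have "c \<in> carrier (subgroup_generated (chain_group p X) (singular_relcycle_set p X S))"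
      using c by (simp add: relcycle_group_def)
    then have "c [^]\<^bsub>?Z\<^esub> k = c [^]\<^bsub>chain_group p X\<^esub> k"
      unfolding relcycle_group_def by (intro group.int_pow_subgroup_generated) auto
    also have "\<dots> = frag_cmul k c"
    proof -
      have "Poly_Mapping.keys c \<subseteq> singular_simplex_set p X"
        using assms by (simp add: singular_relcycle_def singular_chain_def)
      then show ?thesis by (simp add: chain_group_def)
    qed
    finally show ?thesis .
  qed
  then show ?thesis
    using hom_int_pow[OF homologous_rel_set_hom c, of k] by simp
qed

text \<open>In the sequence of \<open>cell_attachment\<close> both neighbours of the new homology group are trivial.\<close>
lemma trivial_homology_attach:
  fixes \<phi> :: "'b::euclidean_space \<Rightarrow> 'a::euclidean_space"
  assumes r: "radial_retraction S F p r" and \<phi>: "continuous_on S \<phi>" "inj_on \<phi> S"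
    and A: "closed A" "\<phi> ` F \<subseteq> A" "A \<inter> \<phi> ` S \<subseteq> \<phi> ` F"
    and triv: "trivial_group (homology_group 1 (top_of_set (S - {p})))" "trivial_group (homology_group 2 (top_of_set A))"
  shows "trivial_group (homology_group 2 (top_of_set (A \<union> \<phi> ` S)))"
proof -
  let ?X = "A \<union> \<phi> ` S"
  obtain h where h: "h \<in> hom (homology_group (int 2) (top_of_set ?X)) (homology_group (int 2 - 1) (top_of_set (S - {p})))"
    "kernel (homology_group (int 2) (top_of_set ?X)) (homology_group (int 2 - 1) (top_of_set (S - {p}))) h
      \<subseteq> hom_induced (int 2) (top_of_set A) {} (top_of_set ?X) {} id ` carrier (homology_group (int 2) (top_of_set A))"
    by (rule cell_attachment[OF r \<phi> A refl, of 2]) simp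
  let ?i = "hom_induced 2 (top_of_set A) {} (top_of_set ?X) {} id"
  have "kernel (homology_group 2 (top_of_set ?X)) (homology_group 1 (top_of_set (S - {p}))) h = carrier (homology_group 2 (top_of_set ?X))"
    using h(1) triv(1) by (auto simp: kernel_def trivial_group_def hom_def)
  then have "carrier (homology_group 2 (top_of_set ?X)) \<subseteq> ?i ` {\<one>\<^bsub>homology_group 2 (top_of_set A)\<^esub>}"
    using h(2) triv(2) by (simp add: trivial_group_def)
  moreover have "?i \<one>\<^bsub>homology_group 2 (top_of_set A)\<^esub> = \<one>\<^bsub>homology_group 2 (top_of_set ?X)\<^esub>"
    by (intro hom_one hom_induced_hom) auto
  moreover have "\<one>\<^bsub>homology_group 2 (top_of_set ?X)\<^esub> \<in> carrier (homology_group 2 (top_of_set ?X))"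
    by (intro monoid.one_closed group.is_monoid) simp
  ultimately show ?thesis by (auto simp: trivial_group_def)
qed

text \<open>A further point is attached as a cell with empty frontier.\<close>
lemma trivial_homology_finite:
  assumes "finite (V :: 'a::euclidean_space set)"
  shows "trivial_group (homology_group 2 (top_of_set V))"
  using assms
proof (induction V rule: finite_induct)
  case empty
  then show ?case by (intro trivial_homology_group_empty) simp
next
  case (insert v V)
  have r: "radial_retraction {0::real} {} 0 (\<lambda>_. 0)" by (simp add: radial_retraction_def)
  have "trivial_group (homology_group 2 (top_of_set (V \<union> (\<lambda>_::real. v) ` {0})))"
  proof (rule trivial_homology_attach[OF r])
    show "trivial_group (homology_group 1 (top_of_set ({0::real} - {0})))"
      by (intro trivial_homology_group_empty) simp
  qed (use insert in \<open>auto simp: finite_imp_closed\<close>)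
  then show ?case by simp
qed

text \<open>A complex of curved edges and triangles, parametrized over the unit interval and over \<open>std_tri\<close> in a
  compatible way, which meet only in common edges and common vertices.\<close>
locale curved_complex = oriented_complex V E T tl hd ed s
  for V :: "'a::euclidean_space set" and E :: "'a set set" and T :: "'a set set"
    and tl hd :: "'a set \<Rightarrow> 'a" and ed :: "'a set \<Rightarrow> 'a set set" and s :: "'a set \<Rightarrow> 'a set \<Rightarrow> int" +
  fixes \<phi> :: "'a set \<Rightarrow> real \<Rightarrow> 'a" and \<Phi> :: "'a set \<Rightarrow> complex \<Rightarrow> 'a"
  assumes edge_param: "e \<in> E \<Longrightarrow> continuous_on {0..1} (\<phi> e) \<and> inj_on (\<phi> e) {0..1} \<and> \<phi> e ` {0..1} = e
      \<and> \<phi> e 0 = tl e \<and> \<phi> e 1 = hd e"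
    and tri_param: "t \<in> T \<Longrightarrow> continuous_on std_tri (\<Phi> t) \<and> inj_on (\<Phi> t) std_tri \<and> \<Phi> t ` std_tri = t"
    and tri_sides: "t \<in> T \<Longrightarrow> \<exists>a b c. ed t = {a, b, c} \<and> s t b = - s t a \<and> s t c = s t a \<and> a \<noteq> b \<and> b \<noteq> c \<and> a \<noteq> c \<and>
      (\<forall>u\<in>{0..1}. \<Phi> t (linepath 1 \<i> u) = \<phi> a u \<and> \<Phi> t (linepath 0 \<i> u) = \<phi> b u \<and> \<Phi> t (linepath 0 1 u) = \<phi> c u)"
    and edge_inter: "e \<in> E \<Longrightarrow> e' \<in> E \<Longrightarrow> e \<noteq> e' \<Longrightarrow> e \<inter> e' \<subseteq> {tl e, hd e}"
    and tri_inter: "t \<in> T \<Longrightarrow> t' \<in> T \<Longrightarrow> t \<noteq> t' \<Longrightarrow> t \<inter> t' \<subseteq> \<Union>(ed t \<inter> ed t') \<union> (\<Union>e\<in>ed t. {tl e, hd e}) \<inter> (\<Union>e\<in>ed t'. {tl e, hd e})"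
begin

definition side :: "'a set \<Rightarrow> nat \<Rightarrow> 'a set" where
  "side t k = \<Phi> t ` std_side k"

lemma sides:
  assumes "t \<in> T"
  shows "ed t = {side t 0, side t 1, side t 2}" "s t (side t 1) = - s t (side t 0)" "s t (side t 2) = s t (side t 0)"
    "side t 0 \<noteq> side t 1" "side t 1 \<noteq> side t 2" "side t 0 \<noteq> side t 2"
    "\<And>u. u \<in> {0..1} \<Longrightarrow> \<Phi> t (linepath 1 \<i> u) = \<phi> (side t 0) u"
    "\<And>u. u \<in> {0..1} \<Longrightarrow> \<Phi> t (linepath 0 \<i> u) = \<phi> (side t 1) u"
    "\<And>u. u \<in> {0..1} \<Longrightarrow> \<Phi> t (linepath 0 1 u) = \<phi> (side t 2) u"
proof -
  obtain a b c where abc: "ed t = {a, b, c}" "s t b = - s t a" "s t c = s t a" "a \<noteq> b" "b \<noteq> c" "a \<noteq> c"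
      "\<And>u. u \<in> {0..1} \<Longrightarrow> \<Phi> t (linepath 1 \<i> u) = \<phi> a u"
      "\<And>u. u \<in> {0..1} \<Longrightarrow> \<Phi> t (linepath 0 \<i> u) = \<phi> b u"
      "\<And>u. u \<in> {0..1} \<Longrightarrow> \<Phi> t (linepath 0 1 u) = \<phi> c u"
    using tri_sides[OF assms] by blast
  have mem: "a \<in> E" "b \<in> E" "c \<in> E" using abc(1) ed_E[OF assms] by auto
  have img: "\<Phi> t ` closed_segment x y = e" if "e \<in> E" "\<And>u. u \<in> {0..1} \<Longrightarrow> \<Phi> t (linepath x y u) = \<phi> e u" for x y e
  proof -
    have "\<Phi> t ` closed_segment x y = (\<lambda>u. \<Phi> t (linepath x y u)) ` {0..1}"
      by (simp add: linepath_image_01[symmetric] image_image)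
    also have "\<dots> = \<phi> e ` {0..1}" using that(2) by (intro image_cong) auto
    finally show ?thesis using edge_param[OF that(1)] by simp
  qed
  have sd: "side t 0 = a" "side t 1 = b" "side t 2 = c"
    unfolding side_def std_side_segment using img mem abc(7-9) by auto
  show "ed t = {side t 0, side t 1, side t 2}" "s t (side t 1) = - s t (side t 0)" "s t (side t 2) = s t (side t 0)"
    "side t 0 \<noteq> side t 1" "side t 1 \<noteq> side t 2" "side t 0 \<noteq> side t 2"
    "\<And>u. u \<in> {0..1} \<Longrightarrow> \<Phi> t (linepath 1 \<i> u) = \<phi> (side t 0) u"
    "\<And>u. u \<in> {0..1} \<Longrightarrow> \<Phi> t (linepath 0 \<i> u) = \<phi> (side t 1) u"
    "\<And>u. u \<in> {0..1} \<Longrightarrow> \<Phi> t (linepath 0 1 u) = \<phi> (side t 2) u"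
    unfolding sd using abc by auto
qed

lemma ed_side: "t \<in> T \<Longrightarrow> e \<in> ed t \<longleftrightarrow> (\<exists>k\<le>2. e = side t k)"
  using sides(1)[of t] by (auto simp: le_Suc_eq numeral_2_eq_2)

lemma ends_in_edge: "e \<in> E \<Longrightarrow> {tl e, hd e} \<subseteq> e"
proof -
  assume e: "e \<in> E"
  have "\<phi> e 0 \<in> \<phi> e ` {0..1}" "\<phi> e 1 \<in> \<phi> e ` {0..1}" by auto
  then show ?thesis using edge_param[OF e] by simp
qed

lemma edge_subset: "t \<in> T \<Longrightarrow> e \<in> ed t \<Longrightarrow> e \<subseteq> t"
  using sides(1)[of t] tri_param[of t] by (auto simp: side_def std_side_def)

lemma vt_subset: "t \<in> T \<Longrightarrow> vt t \<subseteq> \<Union>(ed t)"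
  using ends_in_edge ed_E unfolding vt_def by blast

lemma frontier_image: "t \<in> T \<Longrightarrow> \<Phi> t ` std_frontier = \<Union>(ed t)"
  using sides(1)[of t] by (auto simp: side_def std_frontier_def)

lemma compact_edge: "e \<in> E \<Longrightarrow> compact e"
  using edge_param[of e] compact_continuous_image[of "{0..1}" "\<phi> e"] by auto

lemma compact_tri: "t \<in> T \<Longrightarrow> compact t"
  using tri_param[of t] compact_continuous_image[of std_tri "\<Phi> t"] std_tri_compact by auto

lemma tri_meet: "t \<in> T \<Longrightarrow> t' \<in> T \<Longrightarrow> t \<noteq> t' \<Longrightarrow> t \<inter> t' \<subseteq> \<Union>(ed t)"
  using tri_inter[of t t'] vt_subset[of t] unfolding vt_def by blast

text \<open>Even when triangles are removed, all edges are kept; this way every triangle is attached along its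
  whole frontier.\<close>
definition skeleton :: "'a set set \<Rightarrow> 'a set" where
  "skeleton S = \<Union>E \<union> \<Union>S"

lemma skeleton_compact: "S \<subseteq> T \<Longrightarrow> compact (skeleton S)"
  unfolding skeleton_def using finite_subset[OF _ finite_T, of S] finite_E compact_edge compact_tri
  by (intro compact_Un compact_Union) auto

lemma skeleton_T: "skeleton T = \<Union>T"
  unfolding skeleton_def using edge_subset E_def by blast

lemma skeleton_meets: "t \<in> T \<Longrightarrow> S \<subseteq> T \<Longrightarrow> skeleton (S - {t}) \<inter> t \<subseteq> \<Union>(ed t)"
proof
  fix x assume t: "t \<in> T" "S \<subseteq> T" and x: "x \<in> skeleton (S - {t}) \<inter> t"
  then obtain t' where t': "t' \<in> T" "x \<in> t'" "t' \<noteq> t \<or> (\<exists>e\<in>ed t. x \<in> e)"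
    unfolding skeleton_def using edge_subset E_def by blast
  then show "x \<in> \<Union>(ed t)" using tri_meet[OF t(1), of t'] x by blast
qed

text \<open>The edges are attached one by one to the vertices.\<close>
lemma trivial_homology_graph: "F \<subseteq> E \<Longrightarrow> trivial_group (homology_group 2 (top_of_set (V \<union> \<Union>F)))"
proof (induction F rule: infinite_finite_induct)
  case (infinite F)
  then show ?case using finite_E finite_subset by blast
next
  case empty
  then show ?case using trivial_homology_finite[OF finite_V] by simp
next
  case (insert e F)
  have e: "e \<in> E" using insert.prems by blast
  note p = edge_param[OF e]
  obtain r where r: "radial_retraction {0..1::real} {0, 1} (1/2) r" using unit_interval_radial by blast
  have "trivial_group (homology_group 2 (top_of_set ((V \<union> \<Union>F) \<union> \<phi> e ` {0..1})))"
  proof (rule trivial_homology_attach[OF r])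
    show "closed (V \<union> \<Union>F)"
      using finite_V insert compact_edge by (intro closed_Un finite_imp_closed closed_Union) (auto intro: compact_imp_closed)
    show "\<phi> e ` {0, 1} \<subseteq> V \<union> \<Union>F" using p e V_def by auto
    have "v \<in> {tl e, hd e}" if "v \<in> V" "v \<in> e" for v
    proof -
      obtain e' where e': "e' \<in> E" "v \<in> {tl e', hd e'}" using \<open>v \<in> V\<close> V_def by blast
      then show ?thesis using edge_inter[OF e, of e'] ends_in_edge[OF e'(1)] \<open>v \<in> e\<close> by (cases "e = e'") auto
    qed
    then show "(V \<union> \<Union>F) \<inter> \<phi> e ` {0..1} \<subseteq> \<phi> e ` {0, 1}"
      using p edge_inter[OF e] insert by auto
  qed (use p insert homology_punctured_interval in auto)
  moreover have "(V \<union> \<Union>F) \<union> \<phi> e ` {0..1} = V \<union> \<Union>(insert e F)" using p by auto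
  ultimately show ?case by simp
qed

text \<open>By \<open>cell_attachment\<close> the new homology is an extension of a subgroup of the integers by an image of the
  old one.\<close>
lemma rank_skeleton_puncture:
  assumes S: "S \<subseteq> T" "t \<in> S" and r: "rank_le (homology_group 2 (top_of_set (skeleton (S - {t})))) n"
  shows "rank_le (homology_group 2 (top_of_set (skeleton S))) (Suc n)"
proof -
  have t: "t \<in> T" using S by blast
  note p = tri_param[OF t]
  let ?A = "skeleton (S - {t})" and ?X = "skeleton S"
  obtain \<rho> where \<rho>: "radial_retraction std_tri std_frontier std_mid \<rho>" using std_tri_radial by blast
  have X: "?X = ?A \<union> \<Phi> t ` std_tri" using p S by (auto simp: skeleton_def)
  have "S - {t} \<subseteq> T" using S by blast
  then have cl: "closed ?A" using skeleton_compact compact_imp_closed by blast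
  have fr: "\<Phi> t ` std_frontier \<subseteq> ?A" unfolding frontier_image[OF t] skeleton_def using ed_E[OF t] by blast
  have meet: "?A \<inter> \<Phi> t ` std_tri \<subseteq> \<Phi> t ` std_frontier"
    unfolding frontier_image[OF t] using skeleton_meets[OF t S(1)] p by simp
  have c: "continuous_on std_tri (\<Phi> t)" and i: "inj_on (\<Phi> t) std_tri" using p by auto
  obtain h where h: "h \<in> hom (homology_group (int 2) (top_of_set ?X)) (homology_group (int 2 - 1) (top_of_set (std_tri - {std_mid})))"
    "kernel (homology_group (int 2) (top_of_set ?X)) (homology_group (int 2 - 1) (top_of_set (std_tri - {std_mid}))) h
      \<subseteq> hom_induced (int 2) (top_of_set ?A) {} (top_of_set ?X) {} id ` carrier (homology_group (int 2) (top_of_set ?A))"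
    by (rule cell_attachment[OF \<rho> c i cl fr meet X, of 2]) simp
  let ?G = "homology_group 1 (top_of_set (std_tri - {std_mid}))" and ?H = "homology_group 2 (top_of_set ?X)"
  obtain g where g: "g \<in> iso ?G integer_group" using homology_punctured_std_tri by (auto simp: is_iso_def)
  have ghom: "g \<in> hom ?G integer_group" and ginj: "inj_on g (carrier ?G)" using g by (auto simp: iso_def bij_betw_def)
  show ?thesis
  proof (rule rank_le_extension[OF _ _ _ _ _ r])
    show "hom_induced 2 (top_of_set ?A) {} (top_of_set ?X) {} id \<in> hom (homology_group 2 (top_of_set ?A)) ?H"
      by (rule hom_induced_hom)
    show "g \<circ> h \<in> hom ?H integer_group" using hom_compose[OF _ ghom, of h ?H] h(1) by simp
    have "x \<in> kernel ?H ?G h" if x: "x \<in> kernel ?H integer_group (g \<circ> h)" for x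
    proof -
      have "h x \<in> carrier ?G" using x h(1) by (auto simp: kernel_def hom_def)
      moreover have "g (h x) = g \<one>\<^bsub>?G\<^esub>" using x hom_one[OF ghom] by (simp add: kernel_def)
      moreover have "\<one>\<^bsub>?G\<^esub> \<in> carrier ?G" by (intro monoid.one_closed group.is_monoid) simp
      ultimately have "h x = \<one>\<^bsub>?G\<^esub>" using ginj by (meson inj_onD)
      then show ?thesis using x by (simp add: kernel_def)
    qed
    then show "kernel ?H integer_group (g \<circ> h) \<subseteq> hom_induced 2 (top_of_set ?A) {} (top_of_set ?X) {} id ` carrier (homology_group 2 (top_of_set ?A))"
      using h(2) by auto
  qed auto
qed

text \<open>Pushing the triangle from its free edge towards the other two sides deforms \<open>skeleton S\<close> into
  \<open>skeleton (S - {t})\<close>. The free edge moves along, so that this is no retraction; but it suffices for the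
  surjectivity of the inclusion in homology.\<close>
lemma rank_skeleton_free:
  assumes S: "S \<subseteq> T" "t \<in> S" and e: "e \<in> ed t" "\<And>t'. t' \<in> S \<Longrightarrow> t' \<noteq> t \<Longrightarrow> e \<notin> ed t'"
    and r: "rank_le (homology_group 2 (top_of_set (skeleton (S - {t})))) n"
  shows "rank_le (homology_group 2 (top_of_set (skeleton S))) n"
proof -
  have t: "t \<in> T" using S by blast
  note p = tri_param[OF t]
  have eE: "e \<in> E" using ed_E[OF t e(1)] .
  obtain k where k: "k \<le> 2" "e = side t k" using ed_side[OF t] e(1) by blast
  have side_inj: "j = k" if "j \<le> 2" "side t j = side t k" for j
    using that k(1) sides(4-6)[OF t] by (auto simp: le_Suc_eq numeral_2_eq_2)
  have side_ed: "side t j \<in> ed t" if "j \<le> 2" for j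
    using that ed_side[OF t] by blast
  obtain g where g: "continuous_on std_tri g" "\<And>z. z \<in> std_tri \<Longrightarrow> \<exists>j\<le>2. j \<noteq> k \<and> g z \<in> std_side j"
    "\<And>j z. j \<le> 2 \<Longrightarrow> j \<noteq> k \<Longrightarrow> z \<in> std_side j \<Longrightarrow> g z = z"
    using std_tri_collapse[OF k(1)] by metis
  define A where "A = \<Union>(E - {e}) \<union> \<Union>(S - {t})"
  have X: "skeleton S = A \<union> \<Phi> t ` std_tri"
    using p S edge_subset[OF t e(1)] by (auto simp: skeleton_def A_def)
  have clA: "closed A"
    unfolding A_def using finite_E finite_subset[OF S(1) finite_T] compact_edge compact_tri S(1)
    by (intro closed_Un closed_Union) (auto intro: compact_imp_closed)
  \<comment> \<open>the ends of \<open>e\<close> lie on the other two sides\<close>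
  have ends: "x \<in> \<Union>(ed t - {e})" if x: "x \<in> {tl e, hd e}" for x
  proof -
    obtain e' where e': "e' \<noteq> e" "{e\<in>ed t. x \<in> {tl e, hd e}} = {e, e'}" using corner[OF t e(1) x] by blast
    then have "e' \<in> ed t" "x \<in> {tl e', hd e'}" by blast+
    then show ?thesis using ends_in_edge[OF ed_E[OF t]] e'(1) by blast
  qed
  have vts: "x \<in> \<Union>(ed t - {e})" if x: "x \<in> vt t" for x
  proof -
    obtain e' where e': "e' \<in> ed t" "x \<in> {tl e', hd e'}" using x by (auto simp: vt_def)
    then show ?thesis using ends ends_in_edge[OF ed_E[OF t e'(1)]] by (cases "e' = e") blast+
  qed
  have meet: "x \<in> \<Union>(ed t - {e})" if x: "x \<in> A" "x \<in> t" for x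
  proof -
    consider e' where "e' \<in> E" "e' \<noteq> e" "x \<in> e'" | t' where "t' \<in> S" "t' \<noteq> t" "x \<in> t'"
      using x(1) by (auto simp: A_def)
    then show ?thesis
    proof cases
      case 1
      obtain t' where t': "t' \<in> T" "e' \<in> ed t'" using 1(1) E_def by blast
      show ?thesis
      proof (cases "t' = t")
        case True
        then show ?thesis using 1 t' by blast
      next
        case False
        have "x \<in> t'" using edge_subset[OF t'] 1(3) by blast
        then have "x \<in> \<Union>(ed t) \<union> vt t" using tri_inter[OF t t'(1)] False x(2) unfolding vt_def by blast
        moreover have "x \<in> {tl e, hd e}" if "x \<in> e" using edge_inter[OF eE 1(1)] 1(2,3) that by blast
        ultimately show ?thesis using ends vts by blast
      qed
    next
      case 2
      then have "t' \<in> T" using S by blast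
      then have "x \<in> \<Union>(ed t \<inter> ed t') \<union> vt t" using tri_inter[OF t] 2 x(2) unfolding vt_def by blast
      then show ?thesis using e(2)[OF 2(1,2)] vts by blast
    qed
  qed
  obtain f where f: "homotopic_with_canon (\<lambda>x. True) (skeleton S) (skeleton S) id f"
    "\<And>x. x \<in> std_tri \<Longrightarrow> f (\<Phi> t x) = \<Phi> t (g x)" "\<And>y. y \<in> A \<Longrightarrow> f y = y"
  proof (rule homotopic_push[of std_tri "\<Phi> t" A std_tri g "skeleton S"])
    show "closed_segment x (g x) \<subseteq> std_tri" if "x \<in> std_tri" for x
      using that g(2)[OF that] by (intro closed_segment_subset std_tri_convex) (auto simp: std_side_def)
    show "g x = x" if x: "x \<in> std_tri" "\<Phi> t x \<in> A" for x
    proof -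
      have "\<Phi> t x \<in> t" using p x(1) by blast
      then obtain e' where e': "e' \<in> ed t" "e' \<noteq> e" "\<Phi> t x \<in> e'" using meet x(2) by blast
      then obtain j where j: "j \<le> 2" "e' = side t j" using ed_side[OF t] by blast
      then obtain y where y: "y \<in> std_side j" "\<Phi> t x = \<Phi> t y" using e'(3) by (auto simp: side_def)
      then have "x = y" using p x(1) by (auto simp: std_side_def inj_on_def)
      moreover have "j \<noteq> k" using e'(2) j(2) k(2) by blast
      ultimately show ?thesis using g(3)[OF j(1)] y(1) by blast
    qed
    have "closed (\<Phi> t ` std_tri)" using p compact_tri[OF t] compact_imp_closed by simp
    then show "closedin (top_of_set (skeleton S)) (\<Phi> t ` std_tri)" using X by (intro closed_subset) auto
  qed (use p clA g(1) X std_tri_compact in auto)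
  have "f \<in> topspace (top_of_set (skeleton S)) \<rightarrow> skeleton (S - {t})"
  proof
    fix y assume "y \<in> topspace (top_of_set (skeleton S))"
    then consider "y \<in> A" | x where "x \<in> std_tri" "y = \<Phi> t x" unfolding X by auto
    then show "f y \<in> skeleton (S - {t})"
    proof cases
      case 1
      then show ?thesis using f(3) by (auto simp: A_def skeleton_def)
    next
      case 2
      then obtain j where "j \<le> 2" "g x \<in> std_side j" using g(2) by blast
      then have "f y \<in> side t j" "side t j \<in> E" using 2 f(2) side_ed ed_E[OF t] by (auto simp: side_def)
      then show ?thesis by (auto simp: skeleton_def)
    qed
  qed
  with f(1) have "hom_induced 2 (subtopology (top_of_set (skeleton S)) (skeleton (S - {t}))) {} (top_of_set (skeleton S)) {} id
      \<in> epi (homology_group 2 (subtopology (top_of_set (skeleton S)) (skeleton (S - {t})))) (homology_group 2 (top_of_set (skeleton S)))"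
    by (intro epi_hom_induced_inclusion[of _ f]) auto
  moreover have "skeleton (S - {t}) \<subseteq> skeleton S" by (auto simp: skeleton_def)
  ultimately show ?thesis
    using r by (intro rank_le_surj[OF _ _ _ _ r]) (auto simp: epi_def subtopology_subtopology inf.absorb2)
qed

lemma rank_homology2_le: "rank_le (homology_group 2 (top_of_set (\<Union>T))) (card closed_classes)"
proof -
  have "rank_le (homology_group 2 (top_of_set (skeleton T))) (card closed_classes)"
  proof (rule dismantle[of "\<lambda>n S. rank_le (homology_group 2 (top_of_set (skeleton S))) n"])
    have "V \<subseteq> \<Union>E" using V_def ends_in_edge by blast
    then have "skeleton {} = V \<union> \<Union>E" by (auto simp: skeleton_def)
    then show "rank_le (homology_group 2 (top_of_set (skeleton {}))) 0"
      using trivial_homology_graph[of E] rank_le_trivial by simp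
  next
    fix n S t assume "S \<subseteq> T" "t \<in> S" "rank_le (homology_group 2 (top_of_set (skeleton (S - {t})))) n"
    then show "rank_le (homology_group 2 (top_of_set (skeleton S))) (Suc n)" by (rule rank_skeleton_puncture)
  next
    fix n S t e assume "S \<subseteq> T" "t \<in> S" "e \<in> ed t" "\<And>t'. t' \<in> S \<Longrightarrow> t' \<noteq> t \<Longrightarrow> e \<notin> ed t'"
      "rank_le (homology_group 2 (top_of_set (skeleton (S - {t})))) n"
    then show "rank_le (homology_group 2 (top_of_set (skeleton S))) n" by (rule rank_skeleton_free)
  qed
  then show ?thesis by (simp add: skeleton_T)
qed

subsection \<open>Fundamental classes\<close>

lemma frag_cmul_diff_right: "frag_cmul k (a - b) = frag_cmul k a - frag_cmul k b"
  by (rule poly_mapping_eqI) (simp add: lookup_minus algebra_simps)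

definition tri_chain :: "'a set \<Rightarrow> 'a chain" where
  "tri_chain t = frag_of (simplex_map 2 (\<Phi> t) std_simplex2)"

definition edge_chain :: "'a set \<Rightarrow> 'a chain" where
  "edge_chain e = frag_of (restrict (\<lambda>x. \<phi> e (x 1)) (standard_simplex 1))"

text \<open>The sign of the first side of a triangle in its boundary is the orientation of its parametrization.
  For a closed class this is the fundamental cycle of the component.\<close>
definition class_chain :: "'a set set \<Rightarrow> 'a chain" where
  "class_chain C = (\<Sum>t\<in>C. frag_cmul (s t (side t 0)) (tri_chain t))"

lemma tri_chain_singular: "t \<in> T \<Longrightarrow> singular_chain 2 (top_of_set t) (tri_chain t)"
  unfolding tri_chain_def singular_chain_of
  using tri_param[of t] by (intro singular_simplex_simplex_map[OF std_simplex2_singular]) auto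

lemma tri_chain_boundary:
  assumes "t \<in> T"
  shows "frag_cmul (s t (side t 0)) (chain_boundary 2 (tri_chain t)) = (\<Sum>e\<in>ed t. frag_cmul (s t e) (edge_chain e))"
proof -
  have face: "frag_of (singular_face 2 k (simplex_map 2 (\<Phi> t) std_simplex2)) = edge_chain e"
    if k: "k \<le> 2" and path: "\<And>u. u \<in> {0..1} \<Longrightarrow> \<Phi> t (linepath a b u) = \<phi> e u"
      and ab: "\<And>x. x \<in> standard_simplex 1 \<Longrightarrow> Complex (simplical_face k x 1) (simplical_face k x 2) = linepath a b (x 1)"
    for k a b e
  proof -
    have "singular_face 2 k (simplex_map 2 (\<Phi> t) std_simplex2) = restrict (\<lambda>x. \<phi> e (x 1)) (standard_simplex 1)"
    proof
      fix x
      show "singular_face 2 k (simplex_map 2 (\<Phi> t) std_simplex2) x = restrict (\<lambda>x. \<phi> e (x 1)) (standard_simplex 1) x"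
      proof (cases "x \<in> standard_simplex 1")
        case True
        then have "simplical_face k x \<in> standard_simplex 2"
          using k by (intro simplical_face_in_standard_simplex) auto
        moreover have "x 1 \<in> {0..1}" using True by (auto simp: standard_simplex_def)
        ultimately show ?thesis using True ab[OF True] path
          by (simp add: singular_face_def simplex_map_def std_simplex2_def)
      qed (simp add: singular_face_def)
    qed
    then show ?thesis by (simp add: edge_chain_def)
  qed
  have x0: "x 0 = 1 - x 1" if "x \<in> standard_simplex 1" for x
    using that by (simp add: standard_simplex_def)
  have f: "frag_of (singular_face 2 0 (simplex_map 2 (\<Phi> t) std_simplex2)) = edge_chain (side t 0)"
    "frag_of (singular_face 2 1 (simplex_map 2 (\<Phi> t) std_simplex2)) = edge_chain (side t 1)"
    "frag_of (singular_face 2 2 (simplex_map 2 (\<Phi> t) std_simplex2)) = edge_chain (side t 2)"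
    by (rule face[OF _ sides(7)[OF assms]] face[OF _ sides(8)[OF assms]] face[OF _ sides(9)[OF assms]];
        simp add: simplical_face_def linepath_def complex_eq_iff x0)+
  have "chain_boundary 2 (tri_chain t) = edge_chain (side t 0) - edge_chain (side t 1) + edge_chain (side t 2)"
    unfolding tri_chain_def by (simp add: chain_boundary_of numeral_2_eq_2 f[unfolded numeral_2_eq_2, simplified])
  then show ?thesis
    using sides(1-6)[OF assms] by (simp add: frag_cmul_distrib2 frag_cmul_diff_right minus_frag_cmul[symmetric] del: minus_frag_cmul)
qed

text \<open>Each edge of a closed class occurs in exactly two of its triangles, with opposite signs.\<close>
lemma class_chain_cycle:
  assumes "C \<in> closed_classes"
  shows "singular_relcycle 2 (top_of_set (\<Union>T)) {} (class_chain C)"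
  unfolding singular_cycle
proof
  have C: "C \<subseteq> T" using assms in_quotient_imp_subset[OF equiv_conn] by (auto simp: closed_classes_def)
  have fC: "finite C" using C finite_T finite_subset by blast
  show "singular_chain 2 (top_of_set (\<Union>T)) (class_chain C)"
    unfolding class_chain_def
  proof (intro singular_chain_sum singular_chain_cmul)
    fix t assume "t \<in> C"
    then have "t \<in> T" using C by blast
    then show "singular_chain 2 (top_of_set (\<Union>T)) (tri_chain t)"
      using singular_chain_mono[of 2 euclidean t "tri_chain t" "\<Union>T"] tri_chain_singular[of t] by auto
  qed
  have sub: "ed t \<subseteq> E" if "t \<in> C" for t using that C ed_E by blast
  have "chain_boundary 2 (class_chain C) = (\<Sum>t\<in>C. \<Sum>e\<in>ed t. frag_cmul (s t e) (edge_chain e))"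
    unfolding class_chain_def chain_boundary_sum using C
    by (intro sum.cong) (auto simp: chain_boundary_cmul tri_chain_boundary)
  also have "\<dots> = (\<Sum>t\<in>C. \<Sum>e\<in>E. frag_cmul (s t e) (edge_chain e))"
    using sub finite_E sign_outside by (intro sum.cong sum.mono_neutral_left) auto
  also have "\<dots> = (\<Sum>e\<in>E. \<Sum>t\<in>C. frag_cmul (s t e) (edge_chain e))" by (rule sum.swap)
  also have "\<dots> = 0"
  proof (rule sum.neutral, rule ballI)
    fix e assume "e \<in> E"
    show "(\<Sum>t\<in>C. frag_cmul (s t e) (edge_chain e)) = 0"
    proof (cases "\<exists>t\<in>C. e \<in> ed t")
      case True
      then obtain t where t: "t \<in> C" "e \<in> ed t" by blast
      obtain t' where t': "t' \<in> C" "t' \<noteq> t" "e \<in> ed t'" "{t\<in>T. e \<in> ed t} = {t, t'}"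
        using closed_class_opposite_edges[OF assms t] by metis
      have "(\<Sum>t\<in>C. frag_cmul (s t e) (edge_chain e)) = (\<Sum>t\<in>{t, t'}. frag_cmul (s t e) (edge_chain e))"
        using fC t t' C sign_outside by (intro sum.mono_neutral_right) auto
      also have "\<dots> = 0"
        using t' t C opposite[of t t' e] by (simp add: subset_iff frag_cmul_distrib[symmetric])
      finally show ?thesis .
    next
      case False
      then show ?thesis using sign_outside by (intro sum.neutral) auto
    qed
  qed
  finally show "chain_boundary 2 (class_chain C) = 0" .
qed

lemma std_simplex2_relcycle: "singular_relcycle 2 (top_of_set std_tri) (std_tri - {std_mid}) (frag_of std_simplex2)"
proof -
  have "singular_chain 1 (subtopology (top_of_set std_tri) (std_tri - {std_mid})) (frag_of (singular_face 2 k std_simplex2))"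
    if "k \<le> 2" for k
    unfolding singular_chain_of
  proof (rule iffD2[OF singular_simplex_subtopology], intro conjI)
    show "singular_simplex 1 (top_of_set std_tri) (singular_face 2 k std_simplex2)"
      using singular_simplex_singular_face[OF std_simplex2_singular _ that] by simp
    show "singular_face 2 k std_simplex2 ` standard_simplex 1 \<subseteq> std_tri - {std_mid}"
    proof (rule image_subsetI)
      fix x :: "nat \<Rightarrow> real" assume x: "x \<in> standard_simplex 1"
      then have f: "simplical_face k x \<in> standard_simplex 2"
        using that by (intro simplical_face_in_standard_simplex) auto
      have v: "singular_face 2 k std_simplex2 x = Complex (simplical_face k x 1) (simplical_face k x 2)"
        using x f by (simp add: singular_face_def std_simplex2_def)
      have ge: "0 \<le> simplical_face k x 1" "0 \<le> simplical_face k x 2" "simplical_face k x 0 + simplical_face k x 1 + simplical_face k x 2 = 1" "0 \<le> simplical_face k x 0"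
        using f by (auto simp: standard_simplex_def numeral_2_eq_2)
      have "simplical_face k x k = 0" by (simp add: simplical_face_def)
      then have "Complex (simplical_face k x 1) (simplical_face k x 2) \<noteq> std_mid"
        using that ge by (auto simp: std_mid_def le_Suc_eq numeral_2_eq_2)
      then show "singular_face 2 k std_simplex2 x \<in> std_tri - {std_mid}"
        unfolding v using ge by (simp add: std_tri_def)
    qed
  qed
  then have "singular_chain 1 (subtopology (top_of_set std_tri) (std_tri - {std_mid})) (chain_boundary 2 (frag_of std_simplex2))"
    unfolding chain_boundary_of by (auto intro!: singular_chain_sum singular_chain_cmul)
  then show ?thesis
    using std_simplex2_singular by (simp add: singular_relcycle singular_chain_of)
qed

text \<open>The map of \<open>cell_attachment\<close> for one triangle of the class \<open>C\<close> kills the cycles of the other classes, which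
  avoid its midpoint, and takes the cycle of \<open>C\<close> to the boundary of the standard triangle up to sign. No
  nonzero multiple of that is a boundary off the midpoint, because its winding number is not zero.\<close>
lemma class_chains_independent:
  "int_indep_family (homology_group 2 (top_of_set (\<Union>T))) closed_classes
     (\<lambda>C. homologous_rel_set 2 (top_of_set (\<Union>T)) {} (class_chain C))"
  unfolding int_indep_family_def
proof (intro conjI allI impI ballI closed_classes_finite)
  let ?X = "top_of_set (\<Union>T)" and ?D = "top_of_set (std_tri - {std_mid})"
  let ?H = "homology_group 2 ?X" and ?G = "homology_group 1 ?D"
  let ?z = "\<lambda>C. homologous_rel_set 2 ?X {} (class_chain C)"
  show carr: "?z \<in> closed_classes \<rightarrow> carrier ?H"
    using class_chain_cycle carrier_relative_homology_group[of 2 ?X "{}"] by auto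
  fix c :: "'a set set \<Rightarrow> int" and C
  assume one: "finprod ?H (\<lambda>C. ?z C [^]\<^bsub>?H\<^esub> c C) closed_classes = \<one>\<^bsub>?H\<^esub>" and C: "C \<in> closed_classes"
  have CT: "C \<subseteq> T" if "C \<in> closed_classes" for C
    using that in_quotient_imp_subset[OF equiv_conn] by (auto simp: closed_classes_def)
  have "C \<in> T // conn" using C by (simp add: closed_classes_def)
  then obtain t where tC: "t \<in> C" using in_quotient_imp_non_empty[OF equiv_conn] by blast
  then have t: "t \<in> T" using CT C by blast
  note p = tri_param[OF t]
  let ?A = "skeleton (T - {t})"
  obtain \<rho> where \<rho>: "radial_retraction std_tri std_frontier std_mid \<rho>" using std_tri_radial by blast
  have "skeleton T = ?A \<union> t" using t by (auto simp: skeleton_def)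
  then have X: "\<Union>T = ?A \<union> \<Phi> t ` std_tri" using p by (simp add: skeleton_T)
  have cl: "closed ?A" using skeleton_compact[of "T - {t}"] compact_imp_closed by blast
  have fr: "\<Phi> t ` std_frontier \<subseteq> ?A" unfolding frontier_image[OF t] skeleton_def using ed_E[OF t] by blast
  have meet: "?A \<inter> \<Phi> t ` std_tri \<subseteq> \<Phi> t ` std_frontier"
    unfolding frontier_image[OF t] using skeleton_meets[OF t order_refl] p by simp
  obtain h where h: "h \<in> hom ?H ?G"
    "\<And>c d. singular_relcycle 2 ?X {} c \<Longrightarrow> singular_relcycle 2 (top_of_set std_tri) (std_tri - {std_mid}) d \<Longrightarrow>
      singular_chain 2 (top_of_set (\<Union>T - {\<Phi> t std_mid})) (c - chain_map 2 (\<Phi> t) d) \<Longrightarrow>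
      h (homologous_rel_set 2 ?X {} c) = homologous_rel_set 1 ?D {} (chain_boundary 2 d)"
  proof (rule cell_attachment[OF \<rho> _ _ cl fr meet X, of 2])
    fix h
    assume "h \<in> hom (homology_group (int 2) ?X) (homology_group (int 2 - 1) ?D)"
      "\<And>c d. singular_relcycle 2 ?X {} c \<Longrightarrow> singular_relcycle 2 (top_of_set std_tri) (std_tri - {std_mid}) d \<Longrightarrow>
      singular_chain 2 (top_of_set (\<Union>T - {\<Phi> t std_mid})) (c - chain_map 2 (\<Phi> t) d) \<Longrightarrow>
      h (homologous_rel_set 2 ?X {} c) = homologous_rel_set (2 - 1) ?D {} (chain_boundary 2 d)"
    then show thesis by (intro that[of h]) simp_all
  qed (use p in simp_all)
  have mid_out: "\<Phi> t std_mid \<notin> t'" if "t' \<in> T" "t' \<noteq> t" for t'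
  proof
    assume m: "\<Phi> t std_mid \<in> t'"
    have "\<Phi> t std_mid \<in> t" using p std_mid_in by blast
    then have "\<Phi> t std_mid \<in> \<Phi> t ` std_frontier"
      unfolding frontier_image[OF t] using tri_meet[OF t that(1)] that(2) m by blast
    then obtain z where z: "z \<in> std_frontier" "\<Phi> t std_mid = \<Phi> t z" by blast
    have "z \<in> std_tri" using z(1) by (auto simp: std_frontier_def std_side_def)
    then have "std_mid = z" using p z(2) std_mid_in by (simp add: inj_on_def)
    then show False using z(1) by (auto simp: std_frontier_def std_side_def std_mid_def)
  qed
  have away: "singular_chain 2 (top_of_set (\<Union>T - {\<Phi> t std_mid})) (\<Sum>t'\<in>D. frag_cmul (s t' (side t' 0)) (tri_chain t'))"
    if D: "D \<subseteq> T - {t}" for D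
  proof (intro singular_chain_sum singular_chain_cmul)
    fix t' assume "t' \<in> D"
    then have t': "t' \<in> T" "t' \<noteq> t" using D by auto
    then have "t' \<subseteq> \<Union>T - {\<Phi> t std_mid}" using mid_out by blast
    then show "singular_chain 2 (top_of_set (\<Union>T - {\<Phi> t std_mid})) (tri_chain t')"
      using singular_chain_mono[of 2 euclidean t' "tri_chain t'"] tri_chain_singular[OF t'(1)] by blast
  qed
  define d where "d = frag_cmul (s t (side t 0)) (frag_of std_simplex2)"
  have d: "singular_relcycle 2 (top_of_set std_tri) (std_tri - {std_mid}) d"
    unfolding d_def by (rule singular_relcycle_cmul[OF std_simplex2_relcycle])
  have hC: "h (?z C) = homologous_rel_set 1 ?D {} (chain_boundary 2 d)"
  proof (rule h(2)[OF class_chain_cycle[OF C] d])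
    have "class_chain C - chain_map 2 (\<Phi> t) d = (\<Sum>t'\<in>C - {t}. frag_cmul (s t' (side t' 0)) (tri_chain t'))"
      unfolding class_chain_def d_def using tC finite_subset[OF CT[OF C] finite_T]
      by (subst sum.remove[OF _ tC]) (auto simp: tri_chain_def)
    then show "singular_chain 2 (top_of_set (\<Union>T - {\<Phi> t std_mid})) (class_chain C - chain_map 2 (\<Phi> t) d)"
      using away[of "C - {t}"] CT[OF C] by auto
  qed
  have hC': "h (?z C') = \<one>\<^bsub>?G\<^esub>" if C': "C' \<in> closed_classes" "C' \<noteq> C" for C'
  proof -
    have "t \<notin> C'" using quotient_disj[OF equiv_conn, of C C'] C C' tC by (auto simp: closed_classes_def)
    then have "h (?z C') = homologous_rel_set 1 ?D {} (chain_boundary 2 0)"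
      using away[of C'] CT[OF C'(1)] by (intro h(2)[OF class_chain_cycle[OF C'(1)]]) (auto simp: class_chain_def)
    also have "\<dots> = singular_relboundary_set 1 ?D {}"
      by (simp add: homologous_rel_set_eq_relboundary)
    finally show ?thesis using one_relative_homology_group[of 1 ?D "{}"] by simp
  qed
  interpret G: comm_group ?G by simp
  have hz: "h (?z C') \<in> carrier ?G" if "C' \<in> closed_classes" for C' using h(1) carr that by (auto simp: hom_def)
  have "\<one>\<^bsub>?G\<^esub> = h \<one>\<^bsub>?H\<^esub>" using hom_one[OF h(1)] by simp
  also have "\<dots> = finprod ?G (\<lambda>C. h (?z C) [^]\<^bsub>?G\<^esub> c C) closed_classes"
    unfolding one[symmetric] using carr by (intro hom_finprod_pow[OF _ _ h(1)]) auto
  also have "\<dots> = h (?z C) [^]\<^bsub>?G\<^esub> c C"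
    using hz hC' C closed_classes_finite by (intro G.finprod_single) auto
  also have "\<dots> = homologous_rel_set 1 ?D {} (frag_cmul (c C) (chain_boundary 2 d))"
  proof -
    have "singular_relcycle 1 ?D {} (chain_boundary 2 d)"
      unfolding singular_cycle using d chain_boundary_boundary[of 2 "top_of_set std_tri" d]
      by (auto simp: singular_relcycle subtopology_subtopology inf.absorb2 Diff_subset)
    then show ?thesis unfolding hC using int_pow_homologous_rel_set[of 1 ?D "{}"] by simp
  qed
  finally have "singular_relboundary 1 ?D {} (frag_cmul (c C) (chain_boundary 2 d))"
    using one_relative_homology_group[of 1 ?D "{}"] homologous_rel_set_eq_relboundary[of 1 ?D "{}"] by auto
  then obtain b where b: "singular_chain 2 ?D b" "chain_boundary 2 b = frag_cmul (c C) (chain_boundary 2 d)"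
    by (auto simp: singular_boundary numeral_2_eq_2)
  have "std_tri - {std_mid} \<subseteq> - {std_mid}" by blast
  then have "singular_chain 2 (top_of_set (- {std_mid})) b"
    using singular_chain_mono b(1) by blast
  then have "0 = chain_winding std_mid (frag_cmul (c C) (chain_boundary 2 d))"
    using chain_winding_boundary b(2) by metis
  also have "\<dots> = of_int (c C) * (of_int (s t (side t 0)) * chain_winding std_mid (chain_boundary 2 (frag_of std_simplex2)))"
    by (simp add: d_def chain_winding_cmul chain_boundary_cmul)
  finally show "c C = 0"
    using std_boundary_winding sign[OF t, of "side t 0"] sides(1)[OF t] by auto
qed

theorem betti_2: "betti 2 (\<Union>T) = card closed_classes"
  unfolding betti_def using abelian_rankI[OF _ rank_homology2_le class_chains_independent refl] by simp

subsection \<open>Path components\<close>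

text \<open>The unions of the classes of triangles are the path components.\<close>
theorem betti_0: "betti 0 (\<Union>T) = card (T // conn)"
proof -
  let ?X = "top_of_set (\<Union>T)"
  define U where "U C = \<Union>C" for C :: "'a set set"
  have CT: "C \<subseteq> T" if "C \<in> T // conn" for C
    using that in_quotient_imp_subset[OF equiv_conn] by blast
  have meet: "(t, t') \<in> conn" if "t \<in> T" "t' \<in> T" "x \<in> t" "x \<in> t'" for t t' x
  proof (cases "t = t'")
    case True
    then show ?thesis using that equiv_conn by (auto simp: equiv_def refl_on_def)
  next
    case False
    then have "x \<in> \<Union>(ed t \<inter> ed t') \<union> vt t \<inter> vt t'"
      using tri_inter[OF that(1,2)] that(3,4) unfolding vt_def by blast
    then show ?thesis using adj_conn[OF that(1,2)] vertex_conn[OF that(1,2)] by blast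
  qed
  have disj: "C = C'" if CC: "C \<in> T // conn" "C' \<in> T // conn" and x: "x \<in> U C" "x \<in> U C'" for C C' x
  proof -
    obtain t t' where t: "t \<in> C" "x \<in> t" "t' \<in> C'" "x \<in> t'" using x by (auto simp: U_def)
    then have "(t, t') \<in> conn" using meet CT CC by blast
    then show ?thesis using quotient_eqI[OF equiv_conn CC t(1,3)] by blast
  qed
  have comp: "path_component_of_set ?X x = U C" if C: "C \<in> T // conn" and x: "x \<in> U C" for C x
  proof
    have cl: "closed (\<Union>(U ` D))" if D: "D \<subseteq> T // conn" for D
    proof (intro closed_Union ballI finite_imageI)
      show "finite D" using D finite_classes finite_subset by blast
      fix S assume "S \<in> U ` D"
      then obtain C where "C \<in> T // conn" "S = U C" using D by blast
      then show "closed S" unfolding U_def using CT[of C] finite_subset[OF CT finite_T] compact_tri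
        by (auto intro!: closed_Union compact_imp_closed)
    qed
    have "U C \<subseteq> \<Union>T" using CT[OF C] by (auto simp: U_def)
    then have "closedin ?X (U C)" using cl[of "{C}"] C by (intro closed_subset) auto
    moreover have "closedin ?X (\<Union>(U ` (T // conn - {C})))"
      using cl[of "T // conn - {C}"] CT by (intro closed_subset) (auto simp: U_def)
    moreover have "\<Union>T - \<Union>(U ` (T // conn - {C})) = U C"
    proof -
      have UT: "\<Union>T = \<Union>(U ` (T // conn))"
        using Union_quotient[OF equiv_conn] by (auto simp: U_def)
      show ?thesis
      proof (intro equalityI subsetI)
        fix y assume "y \<in> \<Union>T - \<Union>(U ` (T // conn - {C}))"
        then show "y \<in> U C" unfolding UT by blast
      next
        fix y assume y: "y \<in> U C"
        then have "y \<notin> U C'" if "C' \<in> T // conn - {C}" for C' using disj[OF C, of C' y] that by blast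
        then show "y \<in> \<Union>T - \<Union>(U ` (T // conn - {C}))" unfolding UT using y C by blast
      qed
    qed
    ultimately have "closedin ?X (U C)" "openin ?X (U C)"
      using openin_diff[of ?X "\<Union>T" "\<Union>(U ` (T // conn - {C}))"] by auto
    moreover have "connectedin ?X (path_component_of_set ?X x)"
      by (intro path_connectedin_imp_connectedin path_connectedin_path_component_of)
    moreover have "x \<in> path_component_of_set ?X x"
      using x CT[OF C] by (auto simp: path_component_of_refl U_def)
    ultimately show "path_component_of_set ?X x \<subseteq> U C"
      using connectedin_clopen_cases x by (metis disjnt_iff)
    obtain t where t: "t \<in> C" "x \<in> t" using x by (auto simp: U_def)
    have tT: "t \<in> T" using t CT[OF C] by blast
    have tri: "path_connectedin ?X t" if "t \<in> T" for t
    proof -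
      have "path_connected t"
        using tri_param[OF that] path_connected_continuous_image[of std_tri "\<Phi> t"] convex_imp_path_connected[OF std_tri_convex] by auto
      then show ?thesis using that by (auto simp: path_connectedin_subtopology)
    qed
    show "U C \<subseteq> path_component_of_set ?X x"
    proof
      fix y assume "y \<in> U C"
      then obtain t' where t': "t' \<in> C" "y \<in> t'" by (auto simp: U_def)
      have "(t, t') \<in> conn" using in_quotient_imp_in_rel[OF equiv_conn C] t(1) t'(1) by blast
      then have "t' \<subseteq> path_component_of_set ?X x"
      proof (rule conn_induct)
        show "t \<subseteq> path_component_of_set ?X x"
          using path_component_of_maximal[OF tri[OF tT] t(2)] by blast
      next
        fix a b e assume ab: "a \<in> T" "b \<in> T" "e \<in> ed a" "e \<in> ed b" "a \<subseteq> path_component_of_set ?X x"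
        have "tl e \<in> a" "tl e \<in> b" using ends_in_edge[OF ed_E] edge_subset ab by blast+
        then have "b \<subseteq> path_component_of_set ?X (tl e)" "tl e \<in> path_component_of_set ?X x"
          using path_component_of_maximal[OF tri[OF ab(2)]] ab(5) by blast+
        then show "b \<subseteq> path_component_of_set ?X x"
          by (metis mem_Collect_eq path_component_of_equiv)
      qed
      then show "y \<in> path_component_of_set ?X x" using t' by blast
    qed
  qed
  have "path_components_of ?X = U ` (T // conn)"
  proof -
    have ne: "\<exists>x. x \<in> U C" if C: "C \<in> T // conn" for C
    proof -
      obtain t where t: "t \<in> C" using in_quotient_imp_non_empty[OF equiv_conn C] by blast
      then have "\<Phi> t std_mid \<in> t" using tri_param[of t] CT[OF C] std_mid_in by blast
      then show ?thesis using t by (auto simp: U_def)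
    qed
    have ex: "\<exists>C\<in>T // conn. x \<in> U C" if "x \<in> \<Union>T" for x
      using that Union_quotient[OF equiv_conn] by (auto simp: U_def)
    have sub: "U C \<subseteq> \<Union>T" if "C \<in> T // conn" for C using CT[OF that] by (auto simp: U_def)
    show ?thesis
    proof (intro equalityI subsetI)
      fix S assume "S \<in> path_components_of ?X"
      then obtain x where "x \<in> \<Union>T" "S = path_component_of_set ?X x" by (auto simp: path_components_of_def)
      then show "S \<in> U ` (T // conn)" using ex comp by blast
    next
      fix S assume "S \<in> U ` (T // conn)"
      then obtain C x where "C \<in> T // conn" "S = U C" "x \<in> U C" using ne by blast
      then have "S = path_component_of_set ?X x" "x \<in> \<Union>T" using comp sub by blast+
      then show "S \<in> path_components_of ?X" by (auto simp: path_components_of_def)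
    qed
  qed
  moreover have "inj_on U (T // conn)"
  proof (rule inj_onI)
    fix C C' assume CC: "C \<in> T // conn" "C' \<in> T // conn" "U C = U C'"
    obtain t where t: "t \<in> C" using in_quotient_imp_non_empty[OF equiv_conn CC(1)] by blast
    then have "\<Phi> t std_mid \<in> t" using tri_param[of t] CT[OF CC(1)] std_mid_in by blast
    then have "\<Phi> t std_mid \<in> U C" using t by (auto simp: U_def)
    then show "C = C'" using disj[OF CC(1,2)] CC(3) by simp
  qed
  ultimately have "finite (path_components_of ?X)" "card (path_components_of ?X) = card (T // conn)"
    using finite_classes by (auto simp: card_image)
  moreover have "abelian_rank (homology_group 0 ?X) = abelian_rank (free_Abelian_group (path_components_of ?X))"
    by (intro abelian_rank_iso zeroth_homology_group abelian_free_Abelian_group) simp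
  ultimately show ?thesis by (simp add: betti_def abelian_rank_free_Abelian_group)
qed

end

lemma betti_homeomorphic:
  assumes "X homeomorphic Y"
  shows "betti p X = betti p Y"
  unfolding betti_def using homeomorphic_imp_homeomorphic_space[OF assms]
  by (intro abelian_rank_iso homeomorphic_space_imp_isomorphic_homology_groups) auto

section \<open>The complex of a triangulation\<close>

lemma three_sorted:
  fixes f :: "'a \<Rightarrow> nat"
  assumes "card S = 3" "inj_on f S"
  obtains a b c where "S = {a, b, c}" "f a < f b" "f b < f c"
proof -
  obtain x y z where S: "S = {x, y, z}" "x \<noteq> y" "y \<noteq> z" "x \<noteq> z"
    using assms(1) by (auto simp: card_3_iff)
  have "f x \<noteq> f y" "f y \<noteq> f z" "f x \<noteq> f z" using assms(2) S by (auto simp: inj_on_def)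
  then consider "f x < f y" "f y < f z" | "f x < f z" "f z < f y" | "f y < f x" "f x < f z"
    | "f y < f z" "f z < f x" | "f z < f x" "f x < f y" | "f z < f y" "f y < f x" by linarith
  then show ?thesis
  proof cases
    case 1 then show ?thesis using that[of x y z] S by auto
  next
    case 2 then show ?thesis using that[of x z y] S by auto
  next
    case 3 then show ?thesis using that[of y x z] S by auto
  next
    case 4 then show ?thesis using that[of y z x] S by auto
  next
    case 5 then show ?thesis using that[of z x y] S by auto
  next
    case 6 then show ?thesis using that[of z y x] S by auto
  qed
qed

locale mesh =
  fixes K :: surface_mesh
  assumes triangulation: "oriented_triangulation K"
begin

abbreviation (input) "tris \<equiv> triangles K"

text \<open>A global numbering of the vertices. Ordering the vertices of each triangle by it directs every edge in
  the same way from all triangles that contain it.\<close>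
definition num :: "real^3 \<Rightarrow> nat" where
  "num = (SOME f. inj_on f (all_verts K))"

definition rv :: "(real^3) set \<Rightarrow> nat \<Rightarrow> real^2" where
  "rv T = (SOME r. ref_verts K T = {r 0, r 1, r 2} \<and>
     num (param K T (r 0)) < num (param K T (r 1)) \<and> num (param K T (r 1)) < num (param K T (r 2)))"

definition vx :: "(real^3) set \<Rightarrow> nat \<Rightarrow> real^3" where
  "vx T k = param K T (rv T k)"

definition eg :: "(real^3) set \<Rightarrow> nat \<Rightarrow> nat \<Rightarrow> (real^3) set" where
  "eg T i j = param K T ` closed_segment (rv T i) (rv T j)"

text \<open>The affine map of the standard triangle onto the reference triangle, with the corners \<open>0, 1, \<i>\<close> going to
  the vertices in their order.\<close>
definition af :: "(real^3) set \<Rightarrow> complex \<Rightarrow> real^2" where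
  "af T z = rv T 0 + Re z *\<^sub>R (rv T 1 - rv T 0) + Im z *\<^sub>R (rv T 2 - rv T 0)"

definition ep :: "(real^3) set \<Rightarrow> (real^3) set \<times> nat \<times> nat" where
  "ep E = (SOME (T, i, j). T \<in> tris \<and> i < j \<and> j \<le> 2 \<and> E = eg T i j)"

text \<open>The edge is parametrized from some triangle that contains it; by \<open>edge_match\<close> the choice does not
  matter.\<close>
definition edge_map :: "(real^3) set \<Rightarrow> real \<Rightarrow> real^3" where
  "edge_map E u = (case ep E of (T, i, j) \<Rightarrow> param K T (linepath (rv T i) (rv T j) u))"

definition edge_tail :: "(real^3) set \<Rightarrow> real^3" where "edge_tail E = edge_map E 0"
definition edge_head :: "(real^3) set \<Rightarrow> real^3" where "edge_head E = edge_map E 1"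

definition tri_map :: "(real^3) set \<Rightarrow> complex \<Rightarrow> real^3" where
  "tri_map T z = param K T (af T z)"

lemma finite_tris: "finite tris"
  and curved: "T \<in> tris \<Longrightarrow> curved_triangle K T"
  using triangulation by (auto simp: oriented_triangulation_def)

lemma conform: "T1 \<in> tris \<Longrightarrow> T2 \<in> tris \<Longrightarrow> T1 \<noteq> T2 \<Longrightarrow>
     T1 \<inter> T2 = {} \<or> (\<exists>x \<in> verts K T1 \<inter> verts K T2. T1 \<inter> T2 = {x}) \<or> T1 \<inter> T2 \<in> edges K T1 \<inter> edges K T2"
  using triangulation unfolding oriented_triangulation_def conforming_def by blast

lemma curvedD:
  assumes "T \<in> tris"
  shows "card (ref_verts K T) = 3" "\<not> affine_dependent (ref_verts K T)" "T = param K T ` ref_tri K T"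
    "inj_on (param K T) (ref_tri K T)" "\<exists>U. open U \<and> ref_tri K T \<subseteq> U \<and> smooth_on U (param K T)"
    "y \<in> ref_tri K T \<Longrightarrow> inj ((*v) (D_param K T y))"
  using curved[OF assms] unfolding curved_triangle_def by blast+

lemma finite_all_verts: "finite (all_verts K)"
proof -
  have "finite (ref_verts K T)" if "T \<in> tris" for T
    using curvedD(1)[OF that] by (metis card.infinite zero_neq_numeral)
  then show ?thesis using finite_tris by (simp add: all_verts_def verts_def)
qed

lemma num_inj: "inj_on num (all_verts K)"
proof -
  obtain f :: "real^3 \<Rightarrow> nat" where "inj_on f (all_verts K)"
    using finite_imp_inj_to_nat_seg[OF finite_all_verts] by blast
  then show ?thesis unfolding num_def by (rule someI[of "\<lambda>f. inj_on f (all_verts K)"])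
qed

lemma ref_verts_subset: "ref_verts K T \<subseteq> ref_tri K T"
  by (simp add: ref_tri_def hull_subset)

lemma rv:
  assumes "T \<in> tris"
  shows "ref_verts K T = {rv T 0, rv T 1, rv T 2}" "num (vx T 0) < num (vx T 1)" "num (vx T 1) < num (vx T 2)"
proof -
  have "inj_on (\<lambda>v. num (param K T v)) (ref_verts K T)"
  proof (rule inj_onI)
    fix x y assume xy: "x \<in> ref_verts K T" "y \<in> ref_verts K T" "num (param K T x) = num (param K T y)"
    have "param K T v \<in> all_verts K" if "v \<in> ref_verts K T" for v
      using that assms by (auto simp: all_verts_def verts_def)
    then have "param K T x = param K T y" using xy num_inj by (meson inj_onD)
    then show "x = y" using xy curvedD(4)[OF assms] ref_verts_subset by (meson inj_onD subsetD)
  qed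
  then obtain a b c where abc: "ref_verts K T = {a, b, c}" "num (param K T a) < num (param K T b)"
    "num (param K T b) < num (param K T c)"
    using three_sorted[OF curvedD(1)[OF assms]] by metis
  have "\<exists>r. ref_verts K T = {r 0, r 1, r (2::nat)} \<and>
     num (param K T (r 0)) < num (param K T (r 1)) \<and> num (param K T (r 1)) < num (param K T (r 2))"
    using abc by (intro exI[of _ "\<lambda>k. if k = 0 then a else if k = 1 then b else c"]) simp
  from someI_ex[OF this] show "ref_verts K T = {rv T 0, rv T 1, rv T 2}" "num (vx T 0) < num (vx T 1)" "num (vx T 1) < num (vx T 2)"
    unfolding rv_def[symmetric] vx_def by blast+
qed

lemma rv_distinct:
  assumes "T \<in> tris"
  shows "rv T 0 \<noteq> rv T 1" "rv T 1 \<noteq> rv T 2" "rv T 0 \<noteq> rv T 2" "vx T 0 \<noteq> vx T 1" "vx T 1 \<noteq> vx T 2" "vx T 0 \<noteq> vx T 2"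
  using rv(2,3)[OF assms] by (auto simp: vx_def)

lemma num_less: "T \<in> tris \<Longrightarrow> i < j \<Longrightarrow> j \<le> 2 \<Longrightarrow> num (vx T i) < num (vx T j)"
  using rv(2,3)[of T] by (auto simp: less_Suc_eq le_Suc_eq numeral_2_eq_2)

lemma rv_less_distinct: "T \<in> tris \<Longrightarrow> i < j \<Longrightarrow> j \<le> 2 \<Longrightarrow> rv T i \<noteq> rv T j"
  using num_less[of T i j] by (auto simp: vx_def)

lemma rv_ref: "T \<in> tris \<Longrightarrow> k \<le> 2 \<Longrightarrow> rv T k \<in> ref_verts K T"
  using rv(1)[of T] by (auto simp: le_Suc_eq numeral_2_eq_2)

lemma rv_in: "T \<in> tris \<Longrightarrow> k \<le> 2 \<Longrightarrow> rv T k \<in> ref_tri K T"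
  using rv_ref ref_verts_subset by blast

lemma ref_tri_convex: "convex (ref_tri K T)" by (simp add: ref_tri_def convex_convex_hull)

lemma seg_ref: "T \<in> tris \<Longrightarrow> i \<le> 2 \<Longrightarrow> j \<le> 2 \<Longrightarrow> closed_segment (rv T i) (rv T j) \<subseteq> ref_tri K T"
  by (intro closed_segment_subset rv_in ref_tri_convex)

lemma verts_vx: "T \<in> tris \<Longrightarrow> verts K T = {vx T 0, vx T 1, vx T 2}"
  using rv(1)[of T] by (simp add: verts_def vx_def)

lemma ref_vertsE: "T \<in> tris \<Longrightarrow> a \<in> ref_verts K T \<Longrightarrow> \<exists>i\<le>2. a = rv T i"
proof -
  assume "T \<in> tris" "a \<in> ref_verts K T"
  then have "a \<in> rv T ` {0, 1, 2}" using rv(1) by simp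
  then obtain k where "k \<in> {0, 1, 2}" "a = rv T k" by blast
  then show ?thesis by (intro exI[of _ k]) auto
qed

lemma edges_iff: "T \<in> tris \<Longrightarrow> E \<in> edges K T \<longleftrightarrow> (\<exists>i j. i < j \<and> j \<le> 2 \<and> E = eg T i j)"
proof
  assume T: "T \<in> tris" and "E \<in> edges K T"
  then obtain a b where ab: "a \<in> ref_verts K T" "b \<in> ref_verts K T" "a \<noteq> b" "E = param K T ` closed_segment a b"
    by (auto simp: edges_def)
  obtain i j where ij: "i \<le> 2" "j \<le> 2" "a = rv T i" "b = rv T j" using ref_vertsE[OF T] ab(1,2) by metis
  then consider "i < j" | "j < i" using ab(3) by fastforce
  then show "\<exists>i j. i < j \<and> j \<le> 2 \<and> E = eg T i j"
  proof cases
    case 1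
    then show ?thesis using ij ab(4) by (auto simp: eg_def)
  next
    case 2
    then show ?thesis using ij ab(4)
      by (intro exI[of _ j] exI[of _ i]) (simp add: eg_def closed_segment_commute[of "rv T i"])
  qed
next
  assume T: "T \<in> tris" and "\<exists>i j. i < j \<and> j \<le> 2 \<and> E = eg T i j"
  then obtain i j where "i < j" "j \<le> 2" "E = eg T i j" by blast
  then show "E \<in> edges K T"
    using rv_ref[OF T] rv_less_distinct[OF T] unfolding edges_def eg_def
    by (intro CollectI exI[of _ "rv T i"] exI[of _ "rv T j"]) auto
qed

lemma edges_eg: "T \<in> tris \<Longrightarrow> edges K T = {eg T 1 2, eg T 0 2, eg T 0 1}"
proof (intro equalityI subsetI)
  fix E assume "T \<in> tris" "E \<in> edges K T"
  then obtain i j where ij: "i < j" "j \<le> 2" "E = eg T i j" using edges_iff by blast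
  then consider "i = 1" "j = 2" | "i = 0" "j = 2" | "i = 0" "j = 1" by linarith
  then show "E \<in> {eg T 1 2, eg T 0 2, eg T 0 1}" using ij(3) by cases auto
next
  fix E assume "T \<in> tris" "E \<in> {eg T 1 2, eg T 0 2, eg T 0 1}"
  moreover have "(1::nat) < 2" "(0::nat) < 2" "(0::nat) < 1" "(2::nat) \<le> 2" "(1::nat) \<le> 2" by auto
  ultimately show "E \<in> edges K T" using edges_iff by blast
qed

lemma af_segment:
  "af T (linepath 1 \<i> u) = linepath (rv T 1) (rv T 2) u"
  "af T (linepath 0 \<i> u) = linepath (rv T 0) (rv T 2) u"
  "af T (linepath 0 1 u) = linepath (rv T 0) (rv T 1) u"
  by (simp_all add: af_def linepath_def algebra_simps)

lemma af_image: "T \<in> tris \<Longrightarrow> af T ` std_tri = ref_tri K T"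
proof -
  assume T: "T \<in> tris"
  show ?thesis
  proof (intro equalityI subsetI)
    fix y assume "y \<in> af T ` std_tri"
    then obtain z where z: "z \<in> std_tri" "y = af T z" by blast
    have "y = (1 - Re z - Im z) *\<^sub>R rv T 0 + Re z *\<^sub>R rv T 1 + Im z *\<^sub>R rv T 2"
      unfolding z(2) af_def by (simp add: algebra_simps)
    then show "y \<in> ref_tri K T" unfolding ref_tri_def rv(1)[OF T] convex_hull_3 using z(1)
      by (intro CollectI exI[of _ "1 - Re z - Im z"] exI[of _ "Re z"] exI[of _ "Im z"]) (auto simp: std_tri_def)
  next
    fix y assume "y \<in> ref_tri K T"
    then obtain u v w where uvw: "0 \<le> u" "0 \<le> v" "0 \<le> w" "u + v + w = 1" "y = u *\<^sub>R rv T 0 + v *\<^sub>R rv T 1 + w *\<^sub>R rv T 2"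
      unfolding ref_tri_def rv(1)[OF T] convex_hull_3 by auto
    have u: "u = 1 - v - w" using uvw(4) by simp
    have "y = af T (Complex v w)" unfolding uvw(5) af_def u by (simp add: algebra_simps)
    moreover have "Complex v w \<in> std_tri" using uvw by (simp add: std_tri_def)
    ultimately show "y \<in> af T ` std_tri" by blast
  qed
qed

lemma rv_independent:
  assumes T: "T \<in> tris" and "x *\<^sub>R (rv T 1 - rv T 0) + y *\<^sub>R (rv T 2 - rv T 0) = 0"
  shows "x = 0 \<and> y = 0"
proof (rule ccontr)
  assume xy: "\<not> (x = 0 \<and> y = 0)"
  let ?S = "{rv T 0, rv T 1, rv T 2}"
  define u where "u v = (if v = rv T 0 then - x - y else if v = rv T 1 then x else y)" for v
  have "sum u ?S = 0" "\<exists>v\<in>?S. u v \<noteq> 0" "(\<Sum>v\<in>?S. u v *\<^sub>R v) = 0"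
    using rv_distinct(1-3)[OF T] xy assms(2) by (auto simp: u_def algebra_simps)
  then have "affine_dependent ?S" unfolding affine_dependent_explicit_finite[of ?S, simplified]
    using affine_dependent_explicit_finite[of ?S] by auto
  then show False using curvedD(2)[OF T] rv(1)[OF T] by simp
qed

lemma af_inj: "T \<in> tris \<Longrightarrow> inj (af T)"
proof (rule injI)
  fix z w assume T: "T \<in> tris" and eq: "af T z = af T w"
  then have "(Re z - Re w) *\<^sub>R (rv T 1 - rv T 0) + (Im z - Im w) *\<^sub>R (rv T 2 - rv T 0) = 0"
    by (simp add: af_def algebra_simps)
  then show "z = w" using rv_independent[OF T, of "Re z - Re w" "Im z - Im w"] by (simp add: complex_eq_iff)
qed

lemma param_continuous: "T \<in> tris \<Longrightarrow> continuous_on (ref_tri K T) (param K T)"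
proof -
  assume "T \<in> tris"
  then obtain U where "ref_tri K T \<subseteq> U" "smooth_on U (param K T)" using curvedD(5) by blast
  moreover then have "Ck_on 0 U (param K T)" unfolding smooth_on_def by blast
  ultimately show ?thesis by (auto intro: continuous_on_subset)
qed

lemma tri_map:
  assumes "T \<in> tris"
  shows "continuous_on std_tri (tri_map T)" "inj_on (tri_map T) std_tri" "tri_map T ` std_tri = T"
proof -
  have "continuous_on std_tri (af T)" unfolding af_def by (intro continuous_intros)
  then show "continuous_on std_tri (tri_map T)"
    unfolding tri_map_def using param_continuous[OF assms] af_image[OF assms]
    by (intro continuous_on_compose2[OF param_continuous[OF assms]]) auto
  show "inj_on (tri_map T) std_tri"
  proof (rule inj_onI)
    fix z w assume zw: "z \<in> std_tri" "w \<in> std_tri" "tri_map T z = tri_map T w"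
    then have "af T z = af T w"
      using curvedD(4)[OF assms] af_image[OF assms] unfolding tri_map_def by (metis imageI inj_onD)
    then show "z = w" using af_inj[OF assms] by (simp add: inj_eq)
  qed
  show "tri_map T ` std_tri = T"
    using curvedD(3)[OF assms] af_image[OF assms] by (metis (no_types, lifting) image_cong image_image tri_map_def)
qed

lemma eg_side:
  assumes "T \<in> tris"
  shows "eg T 1 2 = tri_map T ` std_side 0" "eg T 0 2 = tri_map T ` std_side 1" "eg T 0 1 = tri_map T ` std_side 2"
proof -
  have "tri_map T ` closed_segment x y = param K T ` closed_segment a b"
    if "\<And>u. af T (linepath x y u) = linepath a b u" for x y a b
    unfolding linepath_image_01[symmetric] image_image tri_map_def that ..
  then show "eg T 1 2 = tri_map T ` std_side 0" "eg T 0 2 = tri_map T ` std_side 1" "eg T 0 1 = tri_map T ` std_side 2"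
    unfolding eg_def std_side_segment using af_segment by metis+
qed

lemma vx_corner: "vx T 0 = tri_map T 0" "vx T 1 = tri_map T 1" "vx T 2 = tri_map T \<i>"
  by (simp_all add: vx_def tri_map_def af_def)

lemma side_meet:
  "z \<in> std_side 0 \<Longrightarrow> z \<in> std_side 1 \<Longrightarrow> z = \<i>" "z \<in> std_side 0 \<Longrightarrow> z \<in> std_side 2 \<Longrightarrow> z = 1"
  "z \<in> std_side 1 \<Longrightarrow> z \<in> std_side 2 \<Longrightarrow> z = 0"
  by (auto simp: std_side_def complex_eq_iff)

lemma tri_map_eq: "T \<in> tris \<Longrightarrow> z \<in> std_tri \<Longrightarrow> w \<in> std_tri \<Longrightarrow> tri_map T z = tri_map T w \<Longrightarrow> z = w"
  using tri_map(2) by (meson inj_onD)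

lemma std_side_in: "z \<in> std_side k \<Longrightarrow> z \<in> std_tri" by (simp add: std_side_def)

lemma corner_in: "0 \<in> std_tri" "1 \<in> std_tri" "\<i> \<in> std_tri" by (auto simp: std_tri_def)

lemma eg_meet:
  assumes "T \<in> tris"
  shows "eg T 1 2 \<inter> eg T 0 2 \<subseteq> {vx T 2}" "eg T 1 2 \<inter> eg T 0 1 \<subseteq> {vx T 1}" "eg T 0 2 \<inter> eg T 0 1 \<subseteq> {vx T 0}"
  unfolding eg_side[OF assms] vx_corner
  using tri_map_eq[OF assms std_side_in std_side_in] side_meet by (auto; metis)+

lemma eg_opposite:
  assumes "T \<in> tris"
  shows "vx T 0 \<notin> eg T 1 2" "vx T 1 \<notin> eg T 0 2" "vx T 2 \<notin> eg T 0 1"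
proof -
  have out: "tri_map T z \<notin> tri_map T ` std_side k" if "z \<in> std_tri" "z \<notin> std_side k" for z k
    using that tri_map_eq[OF assms that(1) std_side_in] by auto
  have "vx T 0 \<notin> eg T 1 2 \<and> vx T 1 \<notin> eg T 0 2 \<and> vx T 2 \<notin> eg T 0 1"
    unfolding eg_side[OF assms] vx_corner by (intro conjI out corner_in) (auto simp: std_side_def)
  then show "vx T 0 \<notin> eg T 1 2" "vx T 1 \<notin> eg T 0 2" "vx T 2 \<notin> eg T 0 1" by auto
qed

lemma eg_ends: "vx T i \<in> eg T i j" "vx T j \<in> eg T i j"
  by (auto simp: eg_def vx_def)

lemma eg_subset: "T \<in> tris \<Longrightarrow> i \<le> 2 \<Longrightarrow> j \<le> 2 \<Longrightarrow> eg T i j \<subseteq> T"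
  using seg_ref[of T i j] curvedD(3)[of T] unfolding eg_def by blast

lemma edge_subset_tri: "T \<in> tris \<Longrightarrow> E \<in> edges K T \<Longrightarrow> E \<subseteq> T"
proof -
  assume T: "T \<in> tris" "E \<in> edges K T"
  then obtain i j where "i < j" "j \<le> 2" "E = eg T i j" using edges_iff by blast
  then show ?thesis using eg_subset[OF T(1), of i j] by simp
qed

lemma verts_subset_tri: "T \<in> tris \<Longrightarrow> verts K T \<subseteq> T"
  using curvedD(3)[of T] ref_verts_subset[of T] unfolding verts_def by blast

lemma eg_distinct:
  assumes "T \<in> tris"
  shows "eg T 1 2 \<noteq> eg T 0 2" "eg T 0 2 \<noteq> eg T 0 1" "eg T 1 2 \<noteq> eg T 0 1"
  using eg_opposite[OF assms] eg_ends by metis+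

text \<open>The two parametrizations agree up to a reversal, which is excluded since both run from the vertex with
  the smaller number to the other one.\<close>
lemma edge_match:
  assumes T: "T \<in> tris" "T' \<in> tris" and ij: "i < j" "j \<le> 2" "i' < j'" "j' \<le> 2"
    and eq: "eg T i j = eg T' i' j'" and u: "u \<in> {0..1}"
  shows "param K T (linepath (rv T i) (rv T j) u) = param K T' (linepath (rv T' i') (rv T' j') u)"
proof -
  have ends: "{a, b} = {rv T i, rv T j}"
    if "T \<in> tris" "i < j" "j \<le> 2" "a \<in> ref_verts K T" "b \<in> ref_verts K T"
      "param K T ` closed_segment a b = eg T i j" for T i j a b
  proof -
    have "closed_segment a b \<subseteq> ref_tri K T"
      using that ref_verts_subset by (intro closed_segment_subset ref_tri_convex) auto
    then have "closed_segment a b = closed_segment (rv T i) (rv T j)"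
      using that(6) inj_on_image_eq_iff[OF curvedD(4)[OF that(1)]] seg_ref[OF that(1), of i j] that(2,3)
      unfolding eg_def by auto
    then show ?thesis by simp
  qed
  show ?thesis
  proof (cases "T = T'")
    case True
    then have "{rv T i', rv T j'} = {rv T i, rv T j}"
      using ends[OF T(1) ij(1,2), of "rv T i'" "rv T j'"] rv_ref[OF T(1)] ij eq by (simp add: eg_def)
    then have "rv T i' = rv T i \<and> rv T j' = rv T j"
      using num_less[OF T(1) ij(1,2)] num_less[OF T(1) ij(3,4)] by (auto simp: doubleton_eq_iff vx_def)
    then show ?thesis using True by simp
  next
    case False
    have mem: "eg T i j \<in> edges K T \<inter> edges K T'"
      using edges_iff T ij eq by blast
    have "edge_compatible K" using triangulation by (simp add: oriented_triangulation_def)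
    with mem obtain a1 b1 a2 b2 where ab: "a1 \<in> ref_verts K T" "b1 \<in> ref_verts K T" "a2 \<in> ref_verts K T'" "b2 \<in> ref_verts K T'"
      "eg T i j = param K T ` closed_segment a1 b1"
      and m: "\<And>t. t \<in> {0..1} \<Longrightarrow> param K T (linepath a1 b1 t) = param K T' (linepath a2 b2 t)"
      using \<open>edge_compatible K\<close>[unfolded edge_compatible_def, rule_format, OF T _ False] by blast
    have "eg T' i' j' = param K T' ` closed_segment a2 b2"
      unfolding eq[symmetric] ab(5) linepath_image_01[symmetric] image_image using m by (intro image_cong) auto
    then have 1: "{a1, b1} = {rv T i, rv T j}" and 2: "{a2, b2} = {rv T' i', rv T' j'}"
      using ends[OF T(1) ij(1,2) ab(1,2)] ends[OF T(2) ij(3,4) ab(3,4)] ab(5) by auto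
    have 3: "param K T a1 = param K T' a2" "param K T b1 = param K T' b2"
      using m[of 0] m[of 1] by (simp_all add: linepath_def)
    note lt = num_less[OF T(1) ij(1,2), unfolded vx_def] num_less[OF T(2) ij(3,4), unfolded vx_def]
    consider "a1 = rv T i" "b1 = rv T j" | "a1 = rv T j" "b1 = rv T i" using 1 by (auto simp: doubleton_eq_iff)
    then show ?thesis
    proof cases
      case 1
      then have "a2 = rv T' i' \<and> b2 = rv T' j'" using 2 3 lt by (auto simp: doubleton_eq_iff)
      then show ?thesis using 1 m[OF u] by simp
    next
      case c: 2
      then have "a2 = rv T' j' \<and> b2 = rv T' i'" using 2 3 lt by (auto simp: doubleton_eq_iff)
      moreover have "linepath b a u = linepath a b (1 - u)" for a b :: "real^2"
        by (simp add: linepath_def add.commute)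
      ultimately show ?thesis using c m[of "1 - u"] u by simp
    qed
  qed
qed

lemma edge_map:
  assumes "T \<in> tris" "i < j" "j \<le> 2" "u \<in> {0..1}"
  shows "edge_map (eg T i j) u = param K T (linepath (rv T i) (rv T j) u)"
proof -
  have "\<exists>x. case x of (T', i', j') \<Rightarrow> T' \<in> tris \<and> i' < j' \<and> j' \<le> 2 \<and> eg T i j = eg T' i' j'"
    using assms by (intro exI[of _ "(T, i, j)"]) simp
  then have *: "case ep (eg T i j) of (T', i', j') \<Rightarrow> T' \<in> tris \<and> i' < j' \<and> j' \<le> 2 \<and> eg T i j = eg T' i' j'"
    unfolding ep_def by (rule someI_ex)
  obtain T' i' j' where e: "ep (eg T i j) = (T', i', j')" by (cases "ep (eg T i j)")
  with * have "T' \<in> tris" "i' < j'" "j' \<le> 2" "eg T i j = eg T' i' j'" by auto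
  with e show ?thesis using edge_match[OF assms(1) _ assms(2,3) _ _ _ assms(4), of T' i' j'] by (simp add: edge_map_def)
qed

lemma edge_ends: "T \<in> tris \<Longrightarrow> i < j \<Longrightarrow> j \<le> 2 \<Longrightarrow> edge_tail (eg T i j) = vx T i \<and> edge_head (eg T i j) = vx T j"
  by (simp add: edge_tail_def edge_head_def edge_map vx_def linepath_def)

lemma edge_ends_T:
  assumes "T \<in> tris"
  shows "edge_tail (eg T 1 2) = vx T 1" "edge_head (eg T 1 2) = vx T 2" "edge_tail (eg T 0 2) = vx T 0"
    "edge_head (eg T 0 2) = vx T 2" "edge_tail (eg T 0 1) = vx T 0" "edge_head (eg T 0 1) = vx T 1"
  using edge_ends[OF assms, of 1 2] edge_ends[OF assms, of 0 2] edge_ends[OF assms, of 0 1] by auto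

lemma all_edgesE:
  assumes "E \<in> all_edges K"
  obtains T i j where "T \<in> tris" "i < j" "j \<le> 2" "E = eg T i j" "E \<in> edges K T"
  using assms edges_iff unfolding all_edges_def by blast

lemma vx_on_edge:
  assumes "T \<in> tris" "E \<in> edges K T" "z \<in> verts K T" "z \<in> E"
  shows "z \<in> {edge_tail E, edge_head E}"
  using assms edge_ends_T[OF assms(1)] eg_opposite[OF assms(1)]
  unfolding edges_eg[OF assms(1)] verts_vx[OF assms(1)] by auto

lemma edge_ends_verts: "T \<in> tris \<Longrightarrow> E \<in> edges K T \<Longrightarrow> {edge_tail E, edge_head E} \<subseteq> verts K T \<inter> E"
  using edge_ends_T[of T] eg_ends unfolding edges_eg[of T] verts_vx[of T] by auto

lemma all_vert_in_tri:
  assumes "z \<in> all_verts K" "T \<in> tris" "z \<in> T"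
  shows "z \<in> verts K T"
proof -
  obtain T' where T': "T' \<in> tris" "z \<in> verts K T'" using assms(1) by (auto simp: all_verts_def)
  have "z \<in> T'" using T' verts_subset_tri by blast
  show ?thesis
  proof (cases "T = T'")
    case False
    consider x where "x \<in> verts K T" "T \<inter> T' = {x}" | "T \<inter> T' \<in> edges K T \<inter> edges K T'"
      using conform[OF assms(2) T'(1) False] assms(3) \<open>z \<in> T'\<close> by blast
    then show ?thesis
    proof cases
      case 1
      have "z \<in> T \<inter> T'" using assms(3) \<open>z \<in> T'\<close> by blast
      then show ?thesis using 1 by simp
    next
      case 2
      then have "z \<in> {edge_tail (T \<inter> T'), edge_head (T \<inter> T')}"
        using vx_on_edge[OF T'(1) _ T'(2)] assms(3) \<open>z \<in> T'\<close> by blast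
      then show ?thesis using edge_ends_verts[OF assms(2)] 2 by blast
    qed
  qed (use T' in simp)
qed

lemma edges_same_tri_meet:
  assumes "T \<in> tris" "E \<in> edges K T" "E' \<in> edges K T" "E \<noteq> E'"
  shows "E \<inter> E' \<subseteq> {edge_tail E, edge_head E}"
  using assms(2-4) eg_meet[OF assms(1)] edge_ends_T[OF assms(1)] unfolding edges_eg[OF assms(1)] by auto

lemma edges_meet:
  assumes E: "E \<in> all_edges K" "E' \<in> all_edges K" "E \<noteq> E'"
  shows "E \<inter> E' \<subseteq> {edge_tail E, edge_head E}"
proof
  fix x assume x: "x \<in> E \<inter> E'"
  obtain T T' where T: "T \<in> tris" "E \<in> edges K T" "T' \<in> tris" "E' \<in> edges K T'"
    using E by (auto simp: all_edges_def)
  have in_T: "x \<in> T" "x \<in> T'" using x T edge_subset_tri by blast+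
  show "x \<in> {edge_tail E, edge_head E}"
  proof (cases "E' \<in> edges K T \<or> E \<in> edges K T'")
    case True
    then show ?thesis using edges_same_tri_meet T E(3) x by blast
  next
    case False
    then have ne: "T \<noteq> T'" using T by blast
    show ?thesis
    proof (cases "T \<inter> T' \<in> edges K T \<inter> edges K T'")
      case True
      moreover have "T \<inter> T' \<noteq> E" using True False by auto
      ultimately show ?thesis using edges_same_tri_meet[OF T(1,2), of "T \<inter> T'"] x in_T by blast
    next
      case False
      then obtain y where "y \<in> verts K T" "T \<inter> T' = {y}" using conform[OF T(1,3) ne] in_T by blast
      moreover then have "x = y" using in_T by blast
      ultimately show ?thesis using vx_on_edge[OF T(1,2)] x by blast
    qed
  qed
qed

text \<open>The boundary of a triangle with vertices 0, 1, 2 runs through its edge from 0 to 2 backwards. The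
  number \<open>\<epsilon> T\<close> is the orientation of the triangle relative to the order of its vertices.\<close>
definition edge_sign :: "((real^3) set \<Rightarrow> int) \<Rightarrow> (real^3) set \<Rightarrow> (real^3) set \<Rightarrow> int" where
  "edge_sign \<epsilon> T E = (if E \<in> {eg T 1 2, eg T 0 1} then \<epsilon> T else if E = eg T 0 2 then - \<epsilon> T else 0)"

lemma edge_sign:
  assumes "T \<in> tris"
  shows "edge_sign \<epsilon> T (eg T 1 2) = \<epsilon> T" "edge_sign \<epsilon> T (eg T 0 2) = - \<epsilon> T" "edge_sign \<epsilon> T (eg T 0 1) = \<epsilon> T"
  using eg_distinct[OF assms] by (auto simp: edge_sign_def)

text \<open>Conformity provides the intersections, the numbering the directions of the edges, and the assumption
  on the links of vertices the connectedness of the stars.\<close>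
lemma mesh_complex:
  assumes \<epsilon>: "\<And>T. T \<in> tris \<Longrightarrow> \<epsilon> T = 1 \<or> \<epsilon> T = -1"
    and opp: "\<And>T T' E. T \<in> tris \<Longrightarrow> T' \<in> tris \<Longrightarrow> T \<noteq> T' \<Longrightarrow> E \<in> edges K T \<Longrightarrow> E \<in> edges K T' \<Longrightarrow>
      edge_sign \<epsilon> T' E = - edge_sign \<epsilon> T E"
  shows "curved_complex (all_verts K) (all_edges K) tris edge_tail edge_head (edges K) (\<lambda>T E. if T \<in> tris then edge_sign \<epsilon> T E else 0) edge_map tri_map"
proof -
  have surf: "surface_like K" using triangulation by (simp add: oriented_triangulation_def)
  have vt: "(\<Union>e\<in>edges K T. {edge_tail e, edge_head e}) = verts K T" if "T \<in> tris" for T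
    unfolding edges_eg[OF that] verts_vx[OF that] using edge_ends_T[OF that] by auto
  have oc: "oriented_complex (all_verts K) (all_edges K) tris edge_tail edge_head (edges K) (\<lambda>T E. if T \<in> tris then edge_sign \<epsilon> T E else 0)"
  proof (unfold_locales, goal_cases)
    case 1 show ?case by (rule finite_tris)
  next
    case (2 t) then show ?case by (simp add: edges_eg)
  next
    case (3 t) then show ?case by (simp add: edges_eg)
  next
    case 4 show ?case by (simp add: all_edges_def)
  next
    case 5 show ?case using vt by (auto simp: all_verts_def all_edges_def)
  next
    case (6 e)
    then show ?case using edge_ends num_less by (elim all_edgesE) fastforce
  next
    case (7 e)
    then show ?case using surf by (simp add: surface_like_def)
  next
    case (8 t e)
    then consider "e = eg t 1 2" | "e = eg t 0 2" | "e = eg t 0 1" using edges_eg by blast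
    then show ?case using 8(1) edge_sign[OF 8(1), of \<epsilon>] \<epsilon>[OF 8(1)] by cases auto
  next
    case (9 e t) then show ?case by (cases "t \<in> tris") (simp_all add: edges_eg edge_sign_def)
  next
    case (10 t t' e) then show ?case using opp[OF 10(1-5)] by (simp only: if_True)
  next
    case (11 t z)
    then show ?case using edge_sign[of t \<epsilon>] edge_ends_T[of t] eg_distinct[of t] rv_distinct(4-6)[of t] by (simp add: edges_eg)
  next
    case (12 t e z)
    note f = edge_ends_T[OF 12(1)] eg_distinct[OF 12(1)] rv_distinct(4-6)[OF 12(1)]
    have S: "{e \<in> edges K t. z \<in> {edge_tail e, edge_head e}} =
        (if z \<in> {vx t 1, vx t 2} then {eg t 1 2} else {}) \<union> (if z \<in> {vx t 0, vx t 2} then {eg t 0 2} else {})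
        \<union> (if z \<in> {vx t 0, vx t 1} then {eg t 0 1} else {})"
      unfolding edges_eg[OF 12(1)] using f(1-6) by auto
    consider "e = eg t 1 2" "z = vx t 1" | "e = eg t 1 2" "z = vx t 2" | "e = eg t 0 2" "z = vx t 0"
      | "e = eg t 0 2" "z = vx t 2" | "e = eg t 0 1" "z = vx t 0" | "e = eg t 0 1" "z = vx t 1"
      using 12(2,3) f(1-6) unfolding edges_eg[OF 12(1)] by auto
    then show ?case
    proof cases
      case 1 then show ?thesis unfolding S using f(7-12) by (intro exI[of _ "eg t 0 1"]) auto
    next
      case 2 then show ?thesis unfolding S using f(7-12) by (intro exI[of _ "eg t 0 2"]) auto
    next
      case 3 then show ?thesis unfolding S using f(7-12) by (intro exI[of _ "eg t 0 1"]) auto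
    next
      case 4 then show ?thesis unfolding S using f(7-12) by (intro exI[of _ "eg t 1 2"]) auto
    next
      case 5 then show ?thesis unfolding S using f(7-12) by (intro exI[of _ "eg t 0 2"]) auto
    next
      case 6 then show ?thesis unfolding S using f(7-12) by (intro exI[of _ "eg t 1 2"]) auto
    qed
  next
    case (13 t e e' z z')
    have "z \<in> verts K t" "z' \<in> verts K t" using 13 vt[OF 13(1)] by blast+
    then show ?case using 13(6) edge_ends_T[OF 13(1)] unfolding verts_vx[OF 13(1)] edges_eg[OF 13(1)] by auto
  next
    case (14 t t' e e' z)
    have z: "z \<in> verts K t" "z \<in> verts K t'" using 14 vt by blast+
    then have zV: "z \<in> all_verts K" using 14(1) by (auto simp: all_verts_def)
    have "z \<in> t" "z \<in> t'" using z verts_subset_tri 14(1,2) by blast+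
    then have "(t, t') \<in> {(A, B). A \<in> tris \<and> B \<in> tris \<and> z \<in> A \<inter> B \<and> A \<inter> B \<in> edges K A \<inter> edges K B}\<^sup>*"
      using surf zV 14(1,2) unfolding surface_like_def by blast
    moreover have "{(A, B). A \<in> tris \<and> B \<in> tris \<and> z \<in> A \<inter> B \<and> A \<inter> B \<in> edges K A \<inter> edges K B} \<subseteq>
      {(A, B). A \<in> tris \<and> B \<in> tris \<and> (\<exists>f\<in>edges K A \<inter> edges K B. z \<in> {edge_tail f, edge_head f})}"
    proof safe
      fix A B assume AB: "A \<in> tris" "B \<in> tris" "z \<in> A" "z \<in> B" "A \<inter> B \<in> edges K A" "A \<inter> B \<in> edges K B"
      have "z \<in> {edge_tail (A \<inter> B), edge_head (A \<inter> B)}"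
        using vx_on_edge[OF AB(1,5) all_vert_in_tri[OF zV AB(1,3)]] AB(3,4) by blast
      then show "\<exists>f\<in>edges K A \<inter> edges K B. z \<in> {edge_tail f, edge_head f}" using AB(5,6) by blast
    qed
    ultimately show ?case using rtrancl_mono by blast
  qed
  interpret oriented_complex "all_verts K" "all_edges K" tris edge_tail edge_head "edges K" "\<lambda>T E. if T \<in> tris then edge_sign \<epsilon> T E else 0" by (rule oc)
  show ?thesis
  proof (unfold_locales, goal_cases)
    case (1 e)
    then obtain T i j where T: "T \<in> tris" "i < j" "j \<le> 2" "e = eg T i j" by (rule all_edgesE)
    have em: "edge_map e u = param K T (linepath (rv T i) (rv T j) u)" if "u \<in> {0..1}" for u
      using edge_map[OF T(1-3) that] T(4) by simp
    have seg: "linepath (rv T i) (rv T j) u \<in> ref_tri K T" if "u \<in> {0..1}" for u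
      using seg_ref[OF T(1), of i j] T(2,3) linepath_in_path[of u "rv T i" "rv T j"] that by auto
    have "continuous_on {0..1} (\<lambda>u. param K T (linepath (rv T i) (rv T j) u))"
      by (rule continuous_on_compose2[OF param_continuous[OF T(1)]]) (use seg in \<open>auto intro: continuous_intros\<close>)
    then have "continuous_on {0..1} (edge_map e)" by (rule continuous_on_eq) (simp add: em)
    moreover have "inj_on (edge_map e) {0..1}"
    proof (rule inj_onI)
      fix u v assume uv: "u \<in> {0..1}" "v \<in> {0..1}" "edge_map e u = edge_map e v"
      then have "linepath (rv T i) (rv T j) u = linepath (rv T i) (rv T j) v"
        using em seg curvedD(4)[OF T(1)] by (metis inj_onD)
      then have "(u - v) *\<^sub>R (rv T j - rv T i) = 0" by (simp add: linepath_def algebra_simps)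
      then show "u = v" using rv_less_distinct[OF T(1-3)] by auto
    qed
    moreover have "edge_map e ` {0..1} = e"
      using em unfolding T(4) eg_def linepath_image_01[symmetric] image_image by (intro image_cong) auto
    ultimately show ?case by (simp add: edge_tail_def edge_head_def)
  next
    case (2 t) then show ?case using tri_map by simp
  next
    case (3 t)
    have "\<forall>u\<in>{0..1}. tri_map t (linepath 1 \<i> u) = edge_map (eg t 1 2) u \<and> tri_map t (linepath 0 \<i> u) = edge_map (eg t 0 2) u \<and>
      tri_map t (linepath 0 1 u) = edge_map (eg t 0 1) u"
    proof
      fix u :: real assume u: "u \<in> {0..1}"
      show "tri_map t (linepath 1 \<i> u) = edge_map (eg t 1 2) u \<and> tri_map t (linepath 0 \<i> u) = edge_map (eg t 0 2) u \<and>
        tri_map t (linepath 0 1 u) = edge_map (eg t 0 1) u"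
        using edge_map[OF 3 _ _ u, of 1 2] edge_map[OF 3 _ _ u, of 0 2] edge_map[OF 3 _ _ u, of 0 1]
        unfolding tri_map_def af_segment by simp
    qed
    note u = this
    show ?case
    proof (rule exI[of _ "eg t 1 2"], rule exI[of _ "eg t 0 2"], rule exI[of _ "eg t 0 1"], intro conjI)
      show "edges K t = {eg t 1 2, eg t 0 2, eg t 0 1}" by (rule edges_eg[OF 3])
      show "(if t \<in> tris then edge_sign \<epsilon> t (eg t 0 2) else 0) = - (if t \<in> tris then edge_sign \<epsilon> t (eg t 1 2) else 0)"
        "(if t \<in> tris then edge_sign \<epsilon> t (eg t 0 1) else 0) = (if t \<in> tris then edge_sign \<epsilon> t (eg t 1 2) else 0)"
        using 3 by (simp_all only: edge_sign[OF 3] if_True)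
    qed (rule eg_distinct[OF 3] u)+
  next
    case (4 e e') then show ?case by (rule edges_meet)
  next
    case (5 t t')
    show ?case using conform[OF 5] unfolding vt[OF 5(1)] vt[OF 5(2)] by (elim disjE bexE) auto
  qed
qed

end

section \<open>Symmetry of second derivatives\<close>

text \<open>Both mixed derivatives are limits of the second difference quotient over small parallelograms,
  by applying the mean value theorem twice in either order.\<close>
lemma second_difference:
  fixes f :: "'a::real_normed_vector \<Rightarrow> real"
  assumes pos: "0 < h"
    and U: "\<And>s t. 0 \<le> s \<Longrightarrow> s \<le> h \<Longrightarrow> 0 \<le> t \<Longrightarrow> t \<le> h \<Longrightarrow> x + s *\<^sub>R a + t *\<^sub>R b \<in> U"
    and da: "\<And>y. y \<in> U \<Longrightarrow> ((\<lambda>t. f (y + t *\<^sub>R a)) has_real_derivative fa y) (at 0)"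
    and dab: "\<And>y. y \<in> U \<Longrightarrow> ((\<lambda>t. fa (y + t *\<^sub>R b)) has_real_derivative fab y) (at 0)"
  shows "\<exists>s t. 0 < s \<and> s < h \<and> 0 < t \<and> t < h \<and>
    f (x + h *\<^sub>R a + h *\<^sub>R b) - f (x + h *\<^sub>R a) - f (x + h *\<^sub>R b) + f x = h * h * fab (x + s *\<^sub>R a + t *\<^sub>R b)"
proof -
  have shift: "((\<lambda>s. g (y + s *\<^sub>R v)) has_real_derivative D) (at s0)"
    if "((\<lambda>t. g (y + s0 *\<^sub>R v + t *\<^sub>R v)) has_real_derivative D) (at 0)" for g :: "'a \<Rightarrow> real" and y v D s0
  proof -
    have "((\<lambda>t. g (y + (t + s0) *\<^sub>R v)) has_real_derivative D) (at 0)"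
      using that by (simp add: algebra_simps)
    then show ?thesis using DERIV_shift[of "\<lambda>s. g (y + s *\<^sub>R v)" D 0 s0] by simp
  qed
  define g where "g s = f (x + h *\<^sub>R b + s *\<^sub>R a) - f (x + s *\<^sub>R a)" for s
  have "\<exists>s>0. s < h \<and> g h - g 0 = (h - 0) * (fa (x + s *\<^sub>R a + h *\<^sub>R b) - fa (x + s *\<^sub>R a))"
  proof (rule MVT2[OF pos])
    fix s assume s: "0 \<le> s" "s \<le> h"
    have "x + s *\<^sub>R a + h *\<^sub>R b \<in> U" "x + s *\<^sub>R a \<in> U" using U[OF s, of h] U[OF s, of 0] pos by auto
    then have "((\<lambda>t. f (x + h *\<^sub>R b + s *\<^sub>R a + t *\<^sub>R a)) has_real_derivative fa (x + s *\<^sub>R a + h *\<^sub>R b)) (at 0)"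
      "((\<lambda>t. f (x + s *\<^sub>R a + t *\<^sub>R a)) has_real_derivative fa (x + s *\<^sub>R a)) (at 0)"
      using da[of "x + s *\<^sub>R a + h *\<^sub>R b"] da[of "x + s *\<^sub>R a"] by (simp_all add: add.commute add.left_commute)
    then show "(g has_real_derivative fa (x + s *\<^sub>R a + h *\<^sub>R b) - fa (x + s *\<^sub>R a)) (at s)"
      unfolding g_def
      using shift[of f "x + h *\<^sub>R b" s a "fa (x + s *\<^sub>R a + h *\<^sub>R b)"] shift[of f x s a "fa (x + s *\<^sub>R a)"]
      by (intro DERIV_diff) auto
  qed
  then obtain s where s: "0 < s" "s < h" and gs: "g h - g 0 = h * (fa (x + s *\<^sub>R a + h *\<^sub>R b) - fa (x + s *\<^sub>R a))" by auto
  define k where "k t = fa (x + s *\<^sub>R a + t *\<^sub>R b)" for t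
  have "\<exists>t>0. t < h \<and> k h - k 0 = (h - 0) * fab (x + s *\<^sub>R a + t *\<^sub>R b)"
  proof (rule MVT2[OF pos])
    fix t assume t: "0 \<le> t" "t \<le> h"
    have "x + s *\<^sub>R a + t *\<^sub>R b \<in> U" using U[of s t] s t by auto
    then have "((\<lambda>u. fa (x + s *\<^sub>R a + t *\<^sub>R b + u *\<^sub>R b)) has_real_derivative fab (x + s *\<^sub>R a + t *\<^sub>R b)) (at 0)"
      by (rule dab)
    then show "(k has_real_derivative fab (x + s *\<^sub>R a + t *\<^sub>R b)) (at t)"
      unfolding k_def by (rule shift[of fa "x + s *\<^sub>R a" t b "fab (x + s *\<^sub>R a + t *\<^sub>R b)"])
  qed
  then obtain t where t: "0 < t" "t < h" "k h - k 0 = h * fab (x + s *\<^sub>R a + t *\<^sub>R b)" by auto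
  have "f (x + h *\<^sub>R a + h *\<^sub>R b) - f (x + h *\<^sub>R a) - f (x + h *\<^sub>R b) + f x = g h - g 0"
    by (simp add: g_def add.commute add.left_commute)
  also have "\<dots> = h * h * fab (x + s *\<^sub>R a + t *\<^sub>R b)" unfolding gs using t(3) by (simp add: k_def)
  finally show ?thesis using s t by blast
qed

lemma mixed_derivatives_commute:
  fixes f :: "'a::real_normed_vector \<Rightarrow> real"
  assumes U: "open U" "x \<in> U"
    and "\<And>y. y \<in> U \<Longrightarrow> ((\<lambda>t. f (y + t *\<^sub>R a)) has_real_derivative fa y) (at 0)"
    and "\<And>y. y \<in> U \<Longrightarrow> ((\<lambda>t. f (y + t *\<^sub>R b)) has_real_derivative fb y) (at 0)"
    and "\<And>y. y \<in> U \<Longrightarrow> ((\<lambda>t. fa (y + t *\<^sub>R b)) has_real_derivative fab y) (at 0)"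
    and "\<And>y. y \<in> U \<Longrightarrow> ((\<lambda>t. fb (y + t *\<^sub>R a)) has_real_derivative fba y) (at 0)"
    and cont: "continuous_on U fab" "continuous_on U fba"
  shows "fab x = fba x"
proof (rule ccontr)
  assume neq: "fab x \<noteq> fba x"
  define e where "e = \<bar>fab x - fba x\<bar> / 2"
  have e: "e > 0" using neq by (simp add: e_def)
  obtain d1 where d1: "d1 > 0" "\<And>y. y \<in> U \<Longrightarrow> dist y x < d1 \<Longrightarrow> dist (fab y) (fab x) < e"
    using cont(1) U(2) e unfolding continuous_on_iff by blast
  obtain d2 where d2: "d2 > 0" "\<And>y. y \<in> U \<Longrightarrow> dist y x < d2 \<Longrightarrow> dist (fba y) (fba x) < e"
    using cont(2) U(2) e unfolding continuous_on_iff by blast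
  obtain r where r: "r > 0" "ball x r \<subseteq> U" using U by (meson openE)
  define d where "d = min r (min d1 d2)"
  have d: "d > 0" using d1 d2 r by (simp add: d_def)
  define c where "c = norm a + norm b + 1"
  define h where "h = d / (2 * c)"
  have nn: "norm a + norm b + 1 > 0" using norm_ge_zero[of a] norm_ge_zero[of b] by linarith
  have h: "h > 0" using d nn by (simp add: h_def c_def)
  have near: "dist (x + s *\<^sub>R a + t *\<^sub>R b) x < d" if "0 \<le> s" "s \<le> h" "0 \<le> t" "t \<le> h" for s t
  proof -
    have "dist (x + s *\<^sub>R a + t *\<^sub>R b) x = norm (s *\<^sub>R a + t *\<^sub>R b)" by (simp add: dist_norm)
    also have "\<dots> \<le> s * norm a + t * norm b" using that norm_triangle_ineq[of "s *\<^sub>R a" "t *\<^sub>R b"] by simp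
    also have "\<dots> \<le> h * norm a + h * norm b" using that by (intro add_mono mult_right_mono) auto
    also have "\<dots> \<le> h * c" using h by (simp add: distrib_left c_def)
    also have "\<dots> = d / 2" using nn[folded c_def] by (simp add: h_def)
    also have "\<dots> < d" using d by simp
    finally show ?thesis .
  qed
  then have inU: "x + s *\<^sub>R a + t *\<^sub>R b \<in> U" if "0 \<le> s" "s \<le> h" "0 \<le> t" "t \<le> h" for s t
    using that r by (auto simp: d_def subset_iff dist_commute)
  have inU': "x + s *\<^sub>R b + t *\<^sub>R a \<in> U" if "0 \<le> s" "s \<le> h" "0 \<le> t" "t \<le> h" for s t
    using inU[of t s] that by (simp add: add.commute add.left_commute)
  obtain s t where st: "0 < s" "s < h" "0 < t" "t < h"
    "f (x + h *\<^sub>R a + h *\<^sub>R b) - f (x + h *\<^sub>R a) - f (x + h *\<^sub>R b) + f x = h * h * fab (x + s *\<^sub>R a + t *\<^sub>R b)"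
    using second_difference[OF h inU assms(3,5)] by auto
  obtain s' t' where st': "0 < s'" "s' < h" "0 < t'" "t' < h"
    "f (x + h *\<^sub>R b + h *\<^sub>R a) - f (x + h *\<^sub>R b) - f (x + h *\<^sub>R a) + f x = h * h * fba (x + s' *\<^sub>R b + t' *\<^sub>R a)"
    using second_difference[OF h inU' assms(4,6)] by auto
  have "h * h * fab (x + s *\<^sub>R a + t *\<^sub>R b) = h * h * fba (x + s' *\<^sub>R b + t' *\<^sub>R a)"
  proof -
    have "f (x + h *\<^sub>R a + h *\<^sub>R b) = f (x + h *\<^sub>R b + h *\<^sub>R a)" by (simp add: add.commute add.left_commute)
    then show ?thesis using st(5) st'(5) by linarith
  qed
  then have eq: "fab (x + s *\<^sub>R a + t *\<^sub>R b) = fba (x + s' *\<^sub>R b + t' *\<^sub>R a)" using h by simp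
  have "dist (fab (x + s *\<^sub>R a + t *\<^sub>R b)) (fab x) < e"
    using st inU[of s t] near[of s t] by (intro d1(2)) (auto simp: d_def)
  moreover have "dist (fba (x + s' *\<^sub>R b + t' *\<^sub>R a)) (fba x) < e"
    using st' inU'[of s' t'] near[of t' s'] by (intro d2(2)) (auto simp: d_def add.commute add.left_commute)
  ultimately have "\<bar>fab x - fba x\<bar> < 2 * e" using eq by (simp add: dist_real_def)
  then show False by (simp add: e_def)
qed

section \<open>Polynomials in two variables\<close>

definition mono2 :: "nat \<times> nat \<Rightarrow> real^2 \<Rightarrow> real" where
  "mono2 = (\<lambda>(i, j) y. (y$1) ^ i * (y$2) ^ j)"

definition mono2_index :: "nat \<Rightarrow> (nat \<times> nat) set" where
  "mono2_index k = {(i, j). i + j \<le> k}"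

lemma finite_mono2_index: "finite (mono2_index k)"
  by (rule finite_subset[of _ "{..k} \<times> {..k}"]) (auto simp: mono2_index_def)

lemma poly2_span: "poly2 k = span (mono2 ` mono2_index k)"
proof -
  have idx: "mono2_index k = (SIGMA i:{..k}. {..k - i})" by (auto simp: mono2_index_def)
  show ?thesis
  proof (intro equalityI subsetI)
    fix p assume "p \<in> poly2 k"
    then obtain c where c: "\<And>y. p y = (\<Sum>i\<le>k. \<Sum>j\<le>k - i. c i j * (y$1) ^ i * (y$2) ^ j)"
      by (auto simp: poly2_def)
    have "p = (\<Sum>(i, j)\<in>mono2_index k. c i j *\<^sub>R mono2 (i, j))"
    proof
      fix y
      have "(\<Sum>(i, j)\<in>mono2_index k. c i j *\<^sub>R mono2 (i, j)) y = (\<Sum>(i, j)\<in>mono2_index k. c i j * ((y$1) ^ i * (y$2) ^ j))"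
        unfolding sum_fun_apply by (intro sum.cong) (auto simp: mono2_def scaleR_fun_def)
      also have "\<dots> = p y" unfolding c idx by (subst sum.Sigma) (auto simp: mult.assoc)
      finally show "p y = (\<Sum>(i, j)\<in>mono2_index k. c i j *\<^sub>R mono2 (i, j)) y" by simp
    qed
    also have "\<dots> \<in> span (mono2 ` mono2_index k)"
    proof (rule span_sum, clarify)
      fix i j assume "(i, j) \<in> mono2_index k"
      then show "c i j *\<^sub>R mono2 (i, j) \<in> span (mono2 ` mono2_index k)"
        by (intro span_scale span_base imageI)
    qed
    finally show "p \<in> span (mono2 ` mono2_index k)" .
  next
    fix p assume "p \<in> span (mono2 ` mono2_index k)"
    then show "p \<in> poly2 k"
    proof (induction rule: span_induct_alt)
      case base
      then show ?case by (auto simp: poly2_def intro!: exI[of _ "\<lambda>_ _. 0"])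
    next
      case (step r m p)
      obtain i0 j0 where m: "m = mono2 (i0, j0)" "i0 + j0 \<le> k" using step(1) by (auto simp: mono2_index_def)
      obtain c where c: "\<And>y. p y = (\<Sum>i\<le>k. \<Sum>j\<le>k - i. c i j * (y$1) ^ i * (y$2) ^ j)"
        using step(2) by (auto simp: poly2_def)
      define d where "d i j = c i j + (if (i, j) = (i0, j0) then r else 0)" for i j
      have "(r *\<^sub>R m + p) y = (\<Sum>i\<le>k. \<Sum>j\<le>k - i. d i j * (y$1) ^ i * (y$2) ^ j)" for y
      proof -
        have "(\<Sum>i\<le>k. \<Sum>j\<le>k - i. (if (i, j) = (i0, j0) then r else 0) * ((y$1) ^ i * (y$2) ^ j))
          = (\<Sum>x\<in>mono2_index k. if x = (i0, j0) then r * ((y$1) ^ i0 * (y$2) ^ j0) else 0)"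
        proof -
          have "(\<Sum>i\<le>k. \<Sum>j\<le>k - i. (if (i, j) = (i0, j0) then r else 0) * ((y$1) ^ i * (y$2) ^ j))
            = (\<Sum>(i, j)\<in>mono2_index k. (if (i, j) = (i0, j0) then r else 0) * ((y$1) ^ i * (y$2) ^ j))"
            unfolding idx by (rule sum.Sigma) auto
          also have "\<dots> = (\<Sum>x\<in>mono2_index k. if x = (i0, j0) then r * ((y$1) ^ i0 * (y$2) ^ j0) else 0)"
          proof (rule sum.cong[OF refl], clarify)
            fix i j
            show "(if (i, j) = (i0, j0) then r else 0) * ((y$1) ^ i * (y$2) ^ j)
              = (if (i, j) = (i0, j0) then r * ((y$1) ^ i0 * (y$2) ^ j0) else 0)" by simp
          qed
          finally show ?thesis .
        qed
        also have "\<dots> = r * ((y$1) ^ i0 * (y$2) ^ j0)"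
          using m(2) finite_mono2_index[of k] by (auto simp: mono2_index_def)
        finally show ?thesis
          unfolding d_def by (simp add: c m(1) mono2_def scaleR_fun_def distrib_right sum.distrib mult.assoc)
      qed
      then show ?case unfolding poly2_def by blast
    qed
  qed
qed

lemma subspace_poly2: "subspace (poly2 k)" by (simp add: poly2_span)

lemma poly2_mono: "k \<le> l \<Longrightarrow> poly2 k \<subseteq> poly2 l"
  unfolding poly2_span by (intro span_mono) (auto simp: mono2_index_def)

lemma mono2_poly2: "i + j \<le> k \<Longrightarrow> mono2 (i, j) \<in> poly2 k"
  unfolding poly2_span by (intro span_base) (auto simp: mono2_index_def)

lemma poly2_const: "(\<lambda>_. c) \<in> poly2 k"
proof -
  have "c *\<^sub>R mono2 (0, 0) \<in> poly2 k" by (intro subspace_scale subspace_poly2 mono2_poly2) simp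
  then show ?thesis by (simp add: mono2_def scaleR_fun_def)
qed

lemma poly2_affine: "(\<lambda>y. c + a * y$1 + b * y$2) \<in> poly2 (Suc k)"
proof -
  have "c *\<^sub>R mono2 (0, 0) + a *\<^sub>R mono2 (1, 0) + b *\<^sub>R mono2 (0, 1) \<in> poly2 (Suc k)"
    by (intro subspace_add subspace_scale subspace_poly2 mono2_poly2) auto
  also have "c *\<^sub>R mono2 (0, 0) + a *\<^sub>R mono2 (1, 0) + b *\<^sub>R mono2 (0, 1) = (\<lambda>y. c + a * y$1 + b * y$2)"
    by (simp add: mono2_def scaleR_fun_def fun_eq_iff)
  finally show ?thesis .
qed

definition grad2 :: "(real^2 \<Rightarrow> real) \<Rightarrow> (real^2 \<Rightarrow> real) \<Rightarrow> (real^2 \<Rightarrow> real) \<Rightarrow> bool" where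
  "grad2 p p1 p2 \<longleftrightarrow> (\<forall>y. (p has_derivative (\<lambda>h. p1 y * h$1 + p2 y * h$2)) (at y))"

lemma grad2_lincomb:
  assumes "grad2 p p1 p2" "grad2 q q1 q2"
  shows "grad2 (c *\<^sub>R p + q) (c *\<^sub>R p1 + q1) (c *\<^sub>R p2 + q2)"
  unfolding grad2_def
proof
  fix y
  have "((\<lambda>z. c * p z + q z) has_derivative (\<lambda>h. c * (p1 y * h$1 + p2 y * h$2) + (q1 y * h$1 + q2 y * h$2))) (at y)"
    using assms by (intro derivative_intros) (auto simp: grad2_def)
  then show "((c *\<^sub>R p + q) has_derivative (\<lambda>h. (c *\<^sub>R p1 + q1) y * h$1 + (c *\<^sub>R p2 + q2) y * h$2)) (at y)"
    by (simp add: scaleR_fun_def plus_fun_def algebra_simps)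
qed

lemma grad2_zero: "grad2 0 0 0" by (simp add: grad2_def zero_fun_def)

lemma grad2_mono2: "grad2 (mono2 (i, j)) (real i *\<^sub>R mono2 (i - 1, j)) (real j *\<^sub>R mono2 (i, j - 1))"
  unfolding grad2_def
proof
  fix y :: "real^2"
  have lin: "((\<lambda>y::real^2. y$k) has_derivative (\<lambda>h. h$k)) (at y)" for k
    by (rule bounded_linear.has_derivative[OF bounded_linear_vec_nth]) (rule has_derivative_ident)
  have "((\<lambda>y. (y$1) ^ i * (y$2) ^ j) has_derivative
      (\<lambda>h. (y$1) ^ i * (real j * h$2 * (y$2) ^ (j - 1)) + real i * h$1 * (y$1) ^ (i - 1) * (y$2) ^ j)) (at y)"
    by (intro has_derivative_mult has_derivative_power lin)
  then show "(mono2 (i, j) has_derivative (\<lambda>h. (real i *\<^sub>R mono2 (i - 1, j)) y * h$1 + (real j *\<^sub>R mono2 (i, j - 1)) y * h$2)) (at y)"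
    by (simp add: mono2_def scaleR_fun_def algebra_simps)
qed

lemma poly2_grad:
  assumes "p \<in> poly2 (Suc k)"
  obtains p1 p2 where "p1 \<in> poly2 k" "p2 \<in> poly2 k" "grad2 p p1 p2"
proof -
  have "\<exists>p1\<in>poly2 k. \<exists>p2\<in>poly2 k. grad2 p p1 p2"
    using assms unfolding poly2_span[of "Suc k"]
  proof (induction rule: span_induct_alt)
    case base
    then show ?case using grad2_zero subspace_0[OF subspace_poly2] by blast
  next
    case (step r m q)
    obtain q1 q2 where q: "q1 \<in> poly2 k" "q2 \<in> poly2 k" "grad2 q q1 q2" using step(2) by blast
    obtain i j where ij: "m = mono2 (i, j)" "i + j \<le> Suc k" using step(1) by (auto simp: mono2_index_def)
    have "real i *\<^sub>R mono2 (i - 1, j) \<in> poly2 k"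
    proof (cases "i = 0")
      case True then show ?thesis using subspace_0[OF subspace_poly2] by simp
    next
      case False then show ?thesis using ij by (intro subspace_scale subspace_poly2 mono2_poly2) auto
    qed
    moreover have "real j *\<^sub>R mono2 (i, j - 1) \<in> poly2 k"
    proof (cases "j = 0")
      case True then show ?thesis using subspace_0[OF subspace_poly2] by simp
    next
      case False then show ?thesis using ij by (intro subspace_scale subspace_poly2 mono2_poly2) auto
    qed
    ultimately show ?case
      using q grad2_lincomb[OF grad2_mono2 q(3), of r i j] unfolding ij(1)
      by (meson subspace_add subspace_poly2 subspace_scale)
  qed
  then show ?thesis using that by blast
qed

lemma grad2_continuous: "grad2 p p1 p2 \<Longrightarrow> continuous_on S p"
  unfolding grad2_def by (meson continuous_at_imp_continuous_on has_derivative_continuous)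

lemma poly2_continuous: "p \<in> poly2 k \<Longrightarrow> continuous_on S p"
  using poly2_grad[of p k] poly2_mono[of k "Suc k"] grad2_continuous by (meson le_SucI order_refl subsetD)

lemma has_derivative_direction:
  fixes f :: "'a::real_normed_vector \<Rightarrow> real"
  assumes "(f has_derivative f') (at y)"
  shows "((\<lambda>t. f (y + t *\<^sub>R v)) has_real_derivative f' v) (at 0)"
proof -
  have "((\<lambda>t. y + t *\<^sub>R v) has_derivative (\<lambda>t. t *\<^sub>R v)) (at 0)"
    by (auto intro!: derivative_eq_intros)
  moreover have "(f has_derivative f') (at (y + 0 *\<^sub>R v))" using assms by simp
  ultimately have "((\<lambda>t. f (y + t *\<^sub>R v)) has_derivative (\<lambda>t. f' (t *\<^sub>R v))) (at 0)"
    by (rule has_derivative_compose[of _ _ 0 UNIV f])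
  moreover have "f' (t *\<^sub>R v) = f' v * t" for t
    using has_derivative_linear[OF assms] by (simp add: linear_scale)
  ultimately show ?thesis by (simp add: has_field_derivative_def mult_commute_abs)
qed

lemma grad2_direction:
  assumes "grad2 p p1 p2"
  shows "((\<lambda>t. p (y + t *\<^sub>R axis 1 1)) has_real_derivative p1 y) (at 0)"
    "((\<lambda>t. p (y + t *\<^sub>R axis 2 1)) has_real_derivative p2 y) (at 0)"
proof -
  have ax: "(axis 1 1 :: real^2) $ 1 = 1" "(axis 1 1 :: real^2) $ 2 = 0" "(axis 2 1 :: real^2) $ 1 = 0" "(axis 2 1 :: real^2) $ 2 = 1"
    by (simp_all add: axis_def)
  have "(p has_derivative (\<lambda>h. p1 y * h$1 + p2 y * h$2)) (at y)" using assms by (simp add: grad2_def)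
  from has_derivative_direction[OF this, of "axis 1 1"] has_derivative_direction[OF this, of "axis 2 1"]
  show "((\<lambda>t. p (y + t *\<^sub>R axis 1 1)) has_real_derivative p1 y) (at 0)"
    "((\<lambda>t. p (y + t *\<^sub>R axis 2 1)) has_real_derivative p2 y) (at 0)"
    by (simp_all only: ax mult_1_right mult_zero_right add_0_right add_0_left)
qed

lemma grad2_unique:
  assumes "grad2 p p1 p2" "grad2 p q1 q2"
  shows "p1 = q1" "p2 = q2"
  using grad2_direction[OF assms(1)] grad2_direction[OF assms(2)] DERIV_unique by blast+

lemma grad2_commute:
  assumes p: "grad2 p p1 p2" "grad2 p1 p11 p12" "grad2 p2 p21 p22" and "p12 \<in> poly2 k" "p21 \<in> poly2 l"
  shows "p12 = p21"
proof
  fix y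
  show "p12 y = p21 y"
    by (rule mixed_derivatives_commute[of UNIV y p "axis 1 1" p1 "axis 2 1" p2 p12 p21])
      (use grad2_direction[OF p(1)] grad2_direction[OF p(2)] grad2_direction[OF p(3)] assms(4,5) in \<open>auto intro: poly2_continuous\<close>)
qed

lemma poly2_antiderivative2:
  assumes "p \<in> poly2 k"
  obtains P P1 where "P \<in> poly2 (Suc k)" "P1 \<in> poly2 k" "grad2 P P1 p"
proof -
  have "\<exists>P\<in>poly2 (Suc k). \<exists>P1. grad2 P P1 p"
    using assms unfolding poly2_span[of k]
  proof (induction rule: span_induct_alt)
    case base
    then show ?case using grad2_zero subspace_0[OF subspace_poly2] by blast
  next
    case (step r m q)
    obtain Q Q1 where Q: "Q \<in> poly2 (Suc k)" "grad2 Q Q1 q" using step(2) by blast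
    obtain i j where ij: "m = mono2 (i, j)" "i + j \<le> k" using step(1) by (auto simp: mono2_index_def)
    define M where "M = (1 / real (Suc j)) *\<^sub>R mono2 (i, Suc j)"
    have "M \<in> poly2 (Suc k)" unfolding M_def using ij by (intro subspace_scale subspace_poly2 mono2_poly2) auto
    moreover have "grad2 M ((1 / real (Suc j)) *\<^sub>R real i *\<^sub>R mono2 (i - 1, Suc j)) m"
      using grad2_lincomb[OF grad2_mono2 grad2_zero, of "1 / real (Suc j)" i "Suc j"] unfolding M_def ij(1) by simp
    ultimately show ?case
      using Q grad2_lincomb[of M _ m Q Q1 q r] by (meson subspace_add subspace_poly2 subspace_scale)
  qed
  then obtain P P1 where P: "P \<in> poly2 (Suc k)" "grad2 P P1 p" by blast
  obtain Q1 Q2 where "Q1 \<in> poly2 k" "grad2 P Q1 Q2" using poly2_grad[OF P(1)] by blast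
  then show ?thesis using that[OF P(1) _ P(2)] grad2_unique(1)[OF P(2)] by blast
qed

lemma poly2_antiderivative1_axis:
  assumes "p \<in> poly2 k"
  obtains P where "P \<in> poly2 (Suc k)" "grad2 P (\<lambda>y. p (vector [y$1, 0])) 0"
proof -
  have "\<exists>P\<in>poly2 (Suc k). grad2 P (\<lambda>y. p (vector [y$1, 0])) 0"
    using assms unfolding poly2_span[of k]
  proof (induction rule: span_induct_alt)
    case base
    then show ?case using grad2_zero subspace_0[OF subspace_poly2] by (force simp: zero_fun_def)
  next
    case (step r m q)
    obtain Q where Q: "Q \<in> poly2 (Suc k)" "grad2 Q (\<lambda>y. q (vector [y$1, 0])) 0" using step(2) by blast
    obtain i j where ij: "m = mono2 (i, j)" "i + j \<le> k" using step(1) by (auto simp: mono2_index_def)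
    have "\<exists>M\<in>poly2 (Suc k). grad2 M (\<lambda>y. m (vector [y$1, 0])) 0"
    proof (cases "j = 0")
      case True
      have "grad2 ((1 / real (Suc i)) *\<^sub>R mono2 (Suc i, 0)) (mono2 (i, 0)) 0"
        using grad2_lincomb[OF grad2_mono2 grad2_zero, of "1 / real (Suc i)" "Suc i" 0] by simp
      moreover have "mono2 (i, 0) = (\<lambda>y. m (vector [y$1, 0]))" using True by (simp add: ij(1) mono2_def fun_eq_iff)
      moreover have "(1 / real (Suc i)) *\<^sub>R mono2 (Suc i, 0) \<in> poly2 (Suc k)"
        using ij True by (intro subspace_scale subspace_poly2 mono2_poly2) auto
      ultimately show ?thesis by metis
    next
      case False
      then have "(\<lambda>y. m (vector [y$1, 0])) = (0 :: real^2 \<Rightarrow> real)" by (simp add: ij(1) mono2_def fun_eq_iff)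
      then show ?thesis using grad2_zero subspace_0[OF subspace_poly2] by metis
    qed
    then obtain M where M: "M \<in> poly2 (Suc k)" "grad2 M (\<lambda>y. m (vector [y$1, 0])) 0" by blast
    have "r *\<^sub>R M + Q \<in> poly2 (Suc k)" using M(1) Q(1) by (intro subspace_add subspace_scale subspace_poly2)
    moreover have "grad2 (r *\<^sub>R M + Q) (\<lambda>y. (r *\<^sub>R m + q) (vector [y$1, 0])) 0"
      using grad2_lincomb[OF M(2) Q(2), of r] by (simp add: scaleR_fun_def plus_fun_def zero_fun_def)
    ultimately show ?case by blast
  qed
  then show ?thesis using that by blast
qed

text \<open>A divergence-free polynomial field is the curl of a polynomial of the next degree: integrate the
  first component in the second variable and correct by a polynomial in the first variable.\<close>
lemma poly2_stream_function:
  assumes p: "p1 \<in> poly2 k" "p2 \<in> poly2 k" and d: "grad2 p1 p11 p12" "grad2 p2 p21 p22"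
    and div: "\<And>y. p11 y + p22 y = 0"
  obtains q where "q \<in> poly2 (Suc k)" "grad2 q (- p2) p1"
proof -
  have up: "f \<in> poly2 (Suc k)" if "f \<in> poly2 k" for f using that poly2_mono[of k "Suc k"] by auto
  obtain P P1 where P: "P \<in> poly2 (Suc k)" "P1 \<in> poly2 k" "grad2 P P1 p1"
    using poly2_antiderivative2[OF p(1)] by blast
  obtain P11 P12 where P1: "P11 \<in> poly2 k" "P12 \<in> poly2 k" "grad2 P1 P11 P12" using poly2_grad[OF up[OF P(2)]] by blast
  obtain a1 a2 where a: "a1 \<in> poly2 k" "grad2 p1 a1 a2" using poly2_grad[OF up[OF p(1)]] by blast
  have "p11 \<in> poly2 k" using grad2_unique(1)[OF d(1) a(2)] a(1) by simp
  then have P12: "P12 = p11" using grad2_commute[OF P(3) P1(3) d(1) P1(2)] by blast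
  \<comment> \<open>the error in the first derivative depends only on the first variable\<close>
  define r where "r = (-1) *\<^sub>R p2 + (-1) *\<^sub>R P1"
  have r: "r \<in> poly2 k" unfolding r_def using p P by (intro subspace_add subspace_scale subspace_poly2)
  have gr: "grad2 r ((-1) *\<^sub>R p21 + (-1) *\<^sub>R P11) 0"
  proof -
    have "grad2 r ((-1) *\<^sub>R p21 + ((-1) *\<^sub>R P11 + 0)) ((-1) *\<^sub>R p22 + ((-1) *\<^sub>R P12 + 0))"
      unfolding r_def using grad2_lincomb[OF d(2) grad2_lincomb[OF P1(3) grad2_zero, of "-1"], of "-1"] by simp
    moreover have "(-1) *\<^sub>R p22 + ((-1) *\<^sub>R P12 + 0) = 0" using div by (auto simp: fun_eq_iff P12 scaleR_fun_def add_eq_0_iff)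
    ultimately show ?thesis by simp
  qed
  have r_axis: "r (vector [y$1, 0]) = r y" for y
  proof -
    have "((\<lambda>t. r (vector [y$1, t])) has_real_derivative 0) (at t)" for t
    proof -
      have "((\<lambda>s. r (vector [y$1, t] + s *\<^sub>R axis 2 1)) has_real_derivative 0) (at 0)"
        using grad2_direction(2)[OF gr, of "vector [y$1, t]"] by simp
      moreover have "vector [y$1, t] + s *\<^sub>R axis 2 1 = (vector [y$1, s + t] :: real^2)" for s
        by (simp add: vec_eq_iff forall_2 axis_def)
      ultimately show ?thesis using DERIV_shift[of "\<lambda>t. r (vector [y$1, t])" 0 0 t] by simp
    qed
    then have "r (vector [y$1, 0]) = r (vector [y$1, y$2])"
      using DERIV_isconst_all[of "\<lambda>t. r (vector [y$1, t])"] by blast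
    also have "vector [y$1, y$2] = y" by (simp add: vec_eq_iff forall_2)
    finally show ?thesis .
  qed
  obtain R where R: "R \<in> poly2 (Suc k)" "grad2 R (\<lambda>y. r (vector [y$1, 0])) 0"
    using poly2_antiderivative1_axis[OF r] by blast
  have "P + R \<in> poly2 (Suc k)" using P(1) R(1) by (intro subspace_add subspace_poly2)
  moreover have "grad2 (P + R) (- p2) p1"
  proof -
    have "P1 + (\<lambda>y. r (vector [y$1, 0])) = P1 + r" by (simp only: r_axis)
    then have "P1 + (\<lambda>y. r (vector [y$1, 0])) = - p2" by (simp add: r_def fun_eq_iff scaleR_fun_def)
    then show ?thesis using grad2_lincomb[OF P(3) R(2), of 1] by simp
  qed
  ultimately show ?thesis using that by blast
qed

text \<open>On a line through an inner point of \<open>S\<close> the polynomial in one variable has infinitely many zeros.\<close>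
lemma poly2_zero:
  assumes p: "p \<in> poly2 k" and S: "interior S \<noteq> {}" "\<And>y. y \<in> S \<Longrightarrow> p y = 0"
  shows "p y = 0"
proof -
  obtain z where z: "z \<in> interior S" using S(1) by blast
  then obtain r where r: "r > 0" "ball z r \<subseteq> S" by (meson mem_interior)
  define d where "d = y - z"
  have "\<exists>P::real poly. \<forall>t. p (z + t *\<^sub>R d) = poly P t"
    using p unfolding poly2_span
  proof (induction rule: span_induct_alt)
    case base
    then show ?case by (auto intro: exI[of _ 0])
  next
    case (step c m q)
    obtain Q where Q: "\<And>t. q (z + t *\<^sub>R d) = poly Q t" using step(2) by blast
    obtain i j where "m = mono2 (i, j)" using step(1) by auto
    then have "(c *\<^sub>R m + q) (z + t *\<^sub>R d) = poly (Polynomial.smult c ([:z$1, d$1:] ^ i * [:z$2, d$2:] ^ j) + Q) t" for t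
      using Q by (simp add: mono2_def scaleR_fun_def)
    then show ?case by blast
  qed
  then obtain P :: "real poly" where P: "\<And>t. p (z + t *\<^sub>R d) = poly P t" by blast
  define e where "e = r / (norm d + 1)"
  have e: "e > 0" using r(1) by (simp add: e_def add_nonneg_pos)
  have "poly P t = 0" if "t \<in> {0<..<e}" for t
  proof -
    have "t * norm d < r"
    proof -
      have "t * norm d \<le> t * (norm d + 1)" using that by (simp add: distrib_left)
      also have "\<dots> < e * (norm d + 1)" using that by (intro mult_strict_right_mono) (auto simp: add_nonneg_pos)
      also have "\<dots> = r" by (simp add: e_def add_nonneg_eq_0_iff)
      finally show ?thesis .
    qed
    then have "z + t *\<^sub>R d \<in> ball z r" using that by (simp add: dist_norm)
    then show ?thesis using P[of t] S(2) r(2) by (metis subsetD)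
  qed
  then have "{0<..<e} \<subseteq> {t. poly P t = 0}" by blast
  then have "infinite {t. poly P t = 0}" using e infinite_Ioo finite_subset by blast
  then have "P = 0" using poly_roots_finite by blast
  then show ?thesis using P[of 1] by (simp add: d_def)
qed

unbundle cross3_syntax

section \<open>Linear algebra of a parametrized tangent plane\<close>

lemma matrix_vector_columns2: "D *v p = p$1 *\<^sub>R column 1 D + p$2 *\<^sub>R column 2 D" for D :: "real^2^'n"
  by (simp add: vec_eq_iff matrix_vector_mult_def column_def sum_2 mult.commute)

lemma transpose_mult_entry: "(transpose D ** M) $ i $ j = column i D \<bullet> column j M" for D :: "real^'m^'n" and M :: "real^'k^'n"
  by (simp add: matrix_matrix_mult_def transpose_def column_def inner_vec_def)

lemma matrix_inv_eqI:
  fixes G H :: "real^'n^'n"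
  assumes "G ** H = mat 1" "H ** G = mat 1"
  shows "matrix_inv G = H"
proof -
  have inv: "G ** matrix_inv G = mat 1 \<and> matrix_inv G ** G = mat 1"
    unfolding matrix_inv_def by (rule someI[of _ H]) (use assms in simp)
  have "matrix_inv G = matrix_inv G ** (G ** H)" by (simp add: assms(1))
  also have "\<dots> = (matrix_inv G ** G) ** H" by (simp add: matrix_mul_assoc)
  also have "\<dots> = H" using inv by simp
  finally show ?thesis .
qed

lemma matrix_inv_2:
  fixes G :: "real^2^2"
  assumes "det G \<noteq> 0"
  shows "matrix_inv G = (\<chi> i j. (if i = 1 then if j = 1 then G$2$2 else - G$1$2 else if j = 1 then - G$2$1 else G$1$1) / det G)"
    (is "_ = ?H")
proof (rule matrix_inv_eqI)
  define n where "n = det G"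
  have n: "n \<noteq> 0" "G$1$1 * G$2$2 = n + G$1$2 * G$2$1" "G$2$2 * G$1$1 = n + G$1$2 * G$2$1"
    using assms by (auto simp: n_def det_2)
  show "G ** ?H = mat 1"
    unfolding vec_eq_iff forall_2 n_def[symmetric] using n(1)
    by (simp add: matrix_matrix_mult_def mat_def sum_2 divide_simps n(2,3) mult.commute[of "G$2$1" "G$1$2"])
  show "?H ** G = mat 1"
    unfolding vec_eq_iff forall_2 n_def[symmetric] using n(1)
    by (simp add: matrix_matrix_mult_def mat_def sum_2 divide_simps n(2,3) mult.commute[of "G$2$1" "G$1$2"])
qed

text \<open>Below, \<open>A\<close> and \<open>B\<close> are the tangent vectors of the parameter lines, \<open>g\<close> is the determinant of
  their Gram matrix, and \<open>dualA\<close>, \<open>dualB\<close> form the dual basis of the tangent plane.\<close>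
definition gdet :: "real^3 \<Rightarrow> real^3 \<Rightarrow> real" where
  "gdet A B = (A \<bullet> A) * (B \<bullet> B) - (A \<bullet> B)\<^sup>2"

definition dualA :: "real^3 \<Rightarrow> real^3 \<Rightarrow> real^3" where
  "dualA A B = (1 / gdet A B) *\<^sub>R ((B \<bullet> B) *\<^sub>R A - (A \<bullet> B) *\<^sub>R B)"

definition dualB :: "real^3 \<Rightarrow> real^3 \<Rightarrow> real^3" where
  "dualB A B = (1 / gdet A B) *\<^sub>R ((A \<bullet> A) *\<^sub>R B - (A \<bullet> B) *\<^sub>R A)"

lemma det_gram: "det (transpose D ** D) = gdet (column 1 D) (column 2 D)" for D :: "real^2^3"
  by (simp add: det_2 transpose_mult_entry gdet_def power2_eq_square inner_commute)

lemma gdet_cross: "gdet A B = (A \<times> B) \<bullet> (A \<times> B)"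
  by (simp add: gdet_def dot_cross power2_eq_square inner_commute)

lemma gdet_pos:
  fixes D :: "real^2^3"
  assumes "inj ((*v) D)"
  shows "gdet (column 1 D) (column 2 D) > 0"
proof -
  let ?A = "column 1 D" and ?B = "column 2 D"
  have ker: "p = 0" if "D *v p = 0" for p
    using assms that by (metis injD matrix_vector_mult_0_right)
  have "gdet ?A ?B \<noteq> 0"
  proof
    assume g: "gdet ?A ?B = 0"
    define w where "w = (?B \<bullet> ?B) *\<^sub>R ?A - (?A \<bullet> ?B) *\<^sub>R ?B"
    have "w \<bullet> w = (?B \<bullet> ?B) * gdet ?A ?B"
      by (simp add: w_def gdet_def inner_diff_left inner_diff_right power2_eq_square algebra_simps inner_commute)
    then have "w = 0" using g by simp
    then have "D *v (vector [?B \<bullet> ?B, - (?A \<bullet> ?B)]) = 0"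
      by (simp add: matrix_vector_columns2 w_def)
    then have "vector [?B \<bullet> ?B, - (?A \<bullet> ?B)] = (0::real^2)" by (rule ker)
    then have "(vector [?B \<bullet> ?B, - (?A \<bullet> ?B)] :: real^2) $ 1 = 0" by simp
    then have "?B = 0" by simp
    then have "D *v (vector [0, 1]) = 0" by (simp add: matrix_vector_columns2)
    then have "vector [0, 1] = (0::real^2)" by (rule ker)
    then have "(vector [0, 1] :: real^2) $ 2 = 0" by simp
    then show False by simp
  qed
  moreover have "gdet ?A ?B \<ge> 0" unfolding gdet_cross by simp
  ultimately show ?thesis by simp
qed

lemma trace_inv_gram:
  fixes D M :: "real^2^3"
  assumes "gdet (column 1 D) (column 2 D) \<noteq> 0"
  shows "trace (matrix_inv (transpose D ** D) ** (transpose D ** M))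
    = dualA (column 1 D) (column 2 D) \<bullet> column 1 M + dualB (column 1 D) (column 2 D) \<bullet> column 2 M"
proof -
  have d: "det (transpose D ** D) \<noteq> 0" using assms by (simp add: det_gram)
  show ?thesis
    unfolding matrix_inv_2[OF d] trace_def sum_2
    by (simp add: matrix_matrix_mult_def[of "\<chi> i j. _ i j"] sum_2 transpose_mult_entry det_gram dualA_def dualB_def
        inner_diff_left inner_commute diff_divide_distrib algebra_simps)
qed

lemma grad_inv_gram:
  fixes D :: "real^2^3"
  assumes "gdet (column 1 D) (column 2 D) \<noteq> 0"
  shows "D *v (matrix_inv (transpose D ** D) *v q)
    = q$1 *\<^sub>R dualA (column 1 D) (column 2 D) + q$2 *\<^sub>R dualB (column 1 D) (column 2 D)"
proof -
  have d: "det (transpose D ** D) \<noteq> 0" using assms by (simp add: det_gram)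
  let ?A = "column 1 D" and ?B = "column 2 D" and ?g = "gdet (column 1 D) (column 2 D)"
  have 1: "(matrix_inv (transpose D ** D) *v q) $ 1 = (?B \<bullet> ?B * q$1 - ?A \<bullet> ?B * q$2) / ?g"
    "(matrix_inv (transpose D ** D) *v q) $ 2 = (?A \<bullet> ?A * q$2 - ?A \<bullet> ?B * q$1) / ?g"
    unfolding matrix_inv_2[OF d]
    by (simp_all add: matrix_vector_mult_def sum_2 transpose_mult_entry det_gram inner_commute diff_divide_distrib)
  show ?thesis
    unfolding matrix_vector_columns2[of D] 1 dualA_def dualB_def
    by (simp add: vec_eq_iff diff_divide_distrib algebra_simps)
qed

lemma cross_dual:
  assumes "gdet A B \<noteq> 0"
  shows "(A \<times> B) \<times> dualA A B = B" "(A \<times> B) \<times> dualB A B = - A"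
proof -
  have cA: "(A \<times> B) \<times> A = (A \<bullet> A) *\<^sub>R B - (A \<bullet> B) *\<^sub>R A"
    using Lagrange[of A A B] by (metis cross_skew minus_diff_eq)
  have cB: "(A \<times> B) \<times> B = (A \<bullet> B) *\<^sub>R B - (B \<bullet> B) *\<^sub>R A"
    using Lagrange[of B A B] by (metis cross_skew inner_commute minus_diff_eq)
  have "(A \<times> B) \<times> dualA A B = (1 / gdet A B) *\<^sub>R ((B \<bullet> B) *\<^sub>R ((A \<times> B) \<times> A) - (A \<bullet> B) *\<^sub>R ((A \<times> B) \<times> B))"
    by (simp add: dualA_def cross_mult_right Cross3.right_diff_distrib)
  also have "\<dots> = (1 / gdet A B) *\<^sub>R (gdet A B *\<^sub>R B)"
    unfolding cA cB by (simp add: gdet_def algebra_simps power2_eq_square)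
  finally show "(A \<times> B) \<times> dualA A B = B" using assms by simp
  have "(A \<times> B) \<times> dualB A B = (1 / gdet A B) *\<^sub>R ((A \<bullet> A) *\<^sub>R ((A \<times> B) \<times> B) - (A \<bullet> B) *\<^sub>R ((A \<times> B) \<times> A))"
    by (simp add: dualB_def cross_mult_right Cross3.right_diff_distrib)
  also have "\<dots> = (1 / gdet A B) *\<^sub>R (- gdet A B *\<^sub>R A)"
    unfolding cA cB by (simp add: gdet_def algebra_simps power2_eq_square)
  finally show "(A \<times> B) \<times> dualB A B = - A" using assms by simp
qed

lemma dual_basis:
  assumes "gdet A B \<noteq> 0"
  shows "dualA A B \<bullet> A = 1" "dualA A B \<bullet> B = 0" "dualB A B \<bullet> A = 0" "dualB A B \<bullet> B = 1"
  using assms by (simp_all add: dualA_def dualB_def inner_diff_left gdet_def power2_eq_square inner_commute[of B A])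

definition det2 :: "real^2 \<Rightarrow> real^2 \<Rightarrow> real" where
  "det2 v w = v$1 * w$2 - v$2 * w$1"

lemma cross_tangent:
  fixes D :: "real^2^3"
  shows "(D *v v) \<times> (D *v w) = det2 v w *\<^sub>R (column 1 D \<times> column 2 D)"
  unfolding matrix_vector_columns2[of D]
  by (simp add: cross3_simps det2_def forall_3 vec_eq_iff algebra_simps)

section \<open>Calculus on an element\<close>

text \<open>At a corner of a triangle no coordinate direction need point into it, but the differences of its
  points span the plane.\<close>
lemma has_derivative_within_convex_unique:
  fixes f :: "'a::euclidean_space \<Rightarrow> 'b::real_normed_vector"
  assumes S: "convex S" "interior S \<noteq> {}" "y \<in> S"
    and f: "(f has_derivative f') (at y within S)" "(f has_derivative f'') (at y within S)"
  shows "f' = f''"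
proof -
  have lin: "linear f'" "linear f''" using f by (auto dest: has_derivative_linear)
  have eq: "f' (z - y) = f'' (z - y)" if z: "z \<in> S" for z
  proof -
    let ?l = "\<lambda>t::real. y + t *\<^sub>R (z - y)"
    have l: "?l ` {0..1} \<subseteq> S"
    proof
      fix w assume "w \<in> ?l ` {0..1}"
      then obtain t where t: "t \<in> {0..1}" "w = y + t *\<^sub>R (z - y)" by blast
      have "w = (1 - t) *\<^sub>R y + t *\<^sub>R z" unfolding t(2) by (simp add: algebra_simps)
      then show "w \<in> S" using t(1) S(1,3) z by (auto simp: convex_alt)
    qed
    have dl: "(?l has_derivative (\<lambda>t. t *\<^sub>R (z - y))) (at 0 within {0..1})"
      by (auto intro!: derivative_eq_intros)
    have comp: "((\<lambda>t. f (?l t)) has_derivative (\<lambda>t. d (t *\<^sub>R (z - y)))) (at 0 within {0..1})"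
      if "(f has_derivative d) (at y within S)" for d
    proof -
      have "(f has_derivative d) (at (?l 0) within ?l ` {0..1})"
        using has_derivative_subset[OF that l] by simp
      from has_derivative_in_compose[OF dl this] show ?thesis .
    qed
    have "(\<lambda>t. f' (t *\<^sub>R (z - y))) = (\<lambda>t. f'' (t *\<^sub>R (z - y)))"
    proof (rule frechet_derivative_unique_within[OF comp[OF f(1)] comp[OF f(2)]])
      fix i e :: real assume "i \<in> Basis" "e > 0"
      then show "\<exists>d. 0 < \<bar>d\<bar> \<and> \<bar>d\<bar> < e \<and> 0 + d *\<^sub>R i \<in> {0..1}"
        by (intro exI[of _ "min (e / 2) 1"]) (auto simp: min_def)
    qed
    from fun_cong[OF this, of 1] show ?thesis by simp
  qed
  obtain z r where z: "r > 0" "ball z r \<subseteq> S" using S(2) by (meson all_not_in_conv mem_interior)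
  show ?thesis
  proof
    fix h :: 'a
    define c where "c = norm h + 1"
    have c: "c > 0" "norm h \<le> c" by (simp_all add: c_def add_nonneg_pos)
    define e where "e = r / (2 * c)"
    have e: "e > 0" using z(1) c by (simp add: e_def)
    have "norm (e *\<^sub>R h) \<le> e * c" using e c by simp
    also have "\<dots> < r" using z(1) c by (simp add: e_def)
    finally have "norm (e *\<^sub>R h) < r" .
    then have "z + e *\<^sub>R h \<in> S" "z \<in> S" using z by (auto simp: subset_iff dist_norm)
    then have "f' (z + e *\<^sub>R h - y) - f' (z - y) = f'' (z + e *\<^sub>R h - y) - f'' (z - y)" using eq by simp
    moreover have "f' (e *\<^sub>R h) = f' (z + e *\<^sub>R h - y) - f' (z - y)" "f'' (e *\<^sub>R h) = f'' (z + e *\<^sub>R h - y) - f'' (z - y)"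
      using linear_diff[OF lin(1), of "z + e *\<^sub>R h - y" "z - y"] linear_diff[OF lin(2), of "z + e *\<^sub>R h - y" "z - y"] by simp_all
    ultimately have "f' (e *\<^sub>R h) = f'' (e *\<^sub>R h)" by simp
    then show "f' h = f'' h" using e by (simp add: linear_scale lin)
  qed
qed

lemma linear_real2:
  fixes f :: "real^2 \<Rightarrow> 'b::real_vector"
  assumes "linear f"
  shows "f h = h$1 *\<^sub>R f (axis 1 1) + h$2 *\<^sub>R f (axis 2 1)"
proof -
  have "h = h$1 *\<^sub>R axis 1 1 + h$2 *\<^sub>R axis 2 1" by (simp add: vec_eq_iff forall_2 axis_def)
  then have "f h = f (h$1 *\<^sub>R axis 1 1 + h$2 *\<^sub>R axis 2 1)" by simp
  then show ?thesis using assms by (simp add: linear_add linear_scale)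
qed

lemma matrix_column_axis: "linear f \<Longrightarrow> column i (matrix f) = f (axis i 1)" for f :: "real^'n \<Rightarrow> real^'m"
  by (simp add: column_def matrix_def vec_eq_iff)

text \<open>The derivative of the Gram determinant in the directions \<open>X\<close> and \<open>Y\<close> of \<open>A\<close> and \<open>B\<close>, in terms of the dual
  basis.\<close>
lemma gdet_derivative:
  assumes "gdet A B \<noteq> 0"
  shows "2 * (A \<bullet> X) * (B \<bullet> B) + (A \<bullet> A) * (2 * (B \<bullet> Y)) - 2 * (A \<bullet> B) * (X \<bullet> B + A \<bullet> Y)
    = 2 * gdet A B * (dualA A B \<bullet> X + dualB A B \<bullet> Y)"
  using assms by (simp add: dualA_def dualB_def inner_diff_left distrib_left inner_commute[of X B] right_diff_distrib algebra_simps)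

context mesh
begin

lemma ref_tri_interior: "T \<in> tris \<Longrightarrow> interior (ref_tri K T) \<noteq> {}"
  using interior_convex_hull_eq_empty[of "ref_verts K T"] curvedD(1,2)[of T] by (simp add: ref_tri_def)

lemma ref_tri_compact: "T \<in> tris \<Longrightarrow> compact (ref_tri K T)"
  using rv(1)[of T] by (simp add: ref_tri_def finite_imp_compact_convex_hull)

lemma frechet_derivative_ref:
  assumes "T \<in> tris" "y \<in> ref_tri K T" "(f has_derivative f') (at y within ref_tri K T)"
  shows "frechet_derivative f (at y within ref_tri K T) = f'"
proof -
  have "f differentiable (at y within ref_tri K T)" using assms(3) by (auto simp: differentiable_def)
  then have "(f has_derivative frechet_derivative f (at y within ref_tri K T)) (at y within ref_tri K T)"
    by (simp add: frechet_derivative_works)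
  then show ?thesis
    using has_derivative_within_convex_unique[OF ref_tri_convex ref_tri_interior[OF assms(1)] assms(2) _ assms(3)] by blast
qed

text \<open>The tangent vectors of the two parameter lines.\<close>
definition tA :: "(real^3) set \<Rightarrow> real^2 \<Rightarrow> real^3" where "tA T y = column 1 (D_param K T y)"
definition tB :: "(real^3) set \<Rightarrow> real^2 \<Rightarrow> real^3" where "tB T y = column 2 (D_param K T y)"

lemma D_param_apply: "D_param K T y *v p = p$1 *\<^sub>R tA T y + p$2 *\<^sub>R tB T y"
  unfolding tA_def tB_def by (rule matrix_vector_columns2)

lemma gdet_tangent_pos: "T \<in> tris \<Longrightarrow> y \<in> ref_tri K T \<Longrightarrow> gdet (tA T y) (tB T y) > 0"
  unfolding tA_def tB_def by (intro gdet_pos curvedD(6))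

lemma area_factor_eq: "area_factor K T y = sqrt (gdet (tA T y) (tB T y))"
  by (simp add: area_factor_def gram_def det_gram tA_def tB_def)

lemma area_factor_pos: "T \<in> tris \<Longrightarrow> y \<in> ref_tri K T \<Longrightarrow> area_factor K T y > 0"
  using gdet_tangent_pos by (simp add: area_factor_eq)

text \<open>All that the divergence of a Piola-mapped field involves: the first derivatives of the
  parametrization and their derivatives.\<close>
lemma param_C2:
  assumes T: "T \<in> tris"
  obtains A B A1 A2 B1 B2 where
    "\<And>y. y \<in> ref_tri K T \<Longrightarrow> (param K T has_derivative (\<lambda>h. h$1 *\<^sub>R A y + h$2 *\<^sub>R B y)) (at y)"
    "\<And>y. y \<in> ref_tri K T \<Longrightarrow> (A has_derivative (\<lambda>h. h$1 *\<^sub>R A1 y + h$2 *\<^sub>R A2 y)) (at y)"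
    "\<And>y. y \<in> ref_tri K T \<Longrightarrow> (B has_derivative (\<lambda>h. h$1 *\<^sub>R B1 y + h$2 *\<^sub>R B2 y)) (at y)"
    "\<And>y. y \<in> ref_tri K T \<Longrightarrow> A2 y = B1 y"
    "\<And>y. y \<in> ref_tri K T \<Longrightarrow> tA T y = A y" "\<And>y. y \<in> ref_tri K T \<Longrightarrow> tB T y = B y"
proof -
  let ?P = "param K T"
  obtain U where U: "open U" "ref_tri K T \<subseteq> U" "smooth_on U ?P" using curvedD(5)[OF T] by blast
  define A where "A y = frechet_derivative ?P (at y) (axis 1 1)" for y
  define B where "B y = frechet_derivative ?P (at y) (axis 2 1)" for y
  define A1 where "A1 y = frechet_derivative A (at y) (axis 1 1)" for y
  define A2 where "A2 y = frechet_derivative A (at y) (axis 2 1)" for y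
  define B1 where "B1 y = frechet_derivative B (at y) (axis 1 1)" for y
  define B2 where "B2 y = frechet_derivative B (at y) (axis 2 1)" for y
  have bas: "axis 1 1 \<in> (Basis :: (real^2) set)" "axis 2 1 \<in> (Basis :: (real^2) set)"
    by (auto simp: axis_in_Basis_iff)
  have "Ck_on (Suc (Suc 0)) U ?P" using U(3) unfolding smooth_on_def by blast
  then have C: "?P differentiable_on U" "Ck_on (Suc 0) U A" "Ck_on (Suc 0) U B"
    using bas by (auto simp: A_def[abs_def] B_def[abs_def])
  then have C': "A differentiable_on U" "B differentiable_on U" "continuous_on U A2" "continuous_on U B1"
    using bas by (auto simp: A2_def[abs_def] B1_def[abs_def])
  have der: "(f has_derivative (\<lambda>h. h$1 *\<^sub>R frechet_derivative f (at y) (axis 1 1) + h$2 *\<^sub>R frechet_derivative f (at y) (axis 2 1))) (at y)"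
    if "f differentiable_on U" "y \<in> U" for f :: "real^2 \<Rightarrow> real^3" and y
  proof -
    have "f differentiable (at y)" using that U(1) by (simp add: differentiable_on_eq_differentiable_at)
    then have d: "(f has_derivative frechet_derivative f (at y)) (at y)" by (simp add: frechet_derivative_works)
    then have "frechet_derivative f (at y) = (\<lambda>h. h$1 *\<^sub>R frechet_derivative f (at y) (axis 1 1) + h$2 *\<^sub>R frechet_derivative f (at y) (axis 2 1))"
      using linear_real2[OF has_derivative_linear[OF d]] by blast
    then show ?thesis using d by simp
  qed
  have dP: "(?P has_derivative (\<lambda>h. h$1 *\<^sub>R A y + h$2 *\<^sub>R B y)) (at y)" if "y \<in> U" for y
    using der[OF C(1) that] by (simp add: A_def B_def)
  have dA: "(A has_derivative (\<lambda>h. h$1 *\<^sub>R A1 y + h$2 *\<^sub>R A2 y)) (at y)" if "y \<in> U" for y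
    using der[OF C'(1) that] by (simp add: A1_def A2_def)
  have dB: "(B has_derivative (\<lambda>h. h$1 *\<^sub>R B1 y + h$2 *\<^sub>R B2 y)) (at y)" if "y \<in> U" for y
    using der[OF C'(2) that] by (simp add: B1_def B2_def)
  have ax: "(axis 1 1 :: real^2) $ 1 = 1" "(axis 1 1 :: real^2) $ 2 = 0" "(axis 2 1 :: real^2) $ 1 = 0" "(axis 2 1 :: real^2) $ 2 = 1"
    by (simp_all add: axis_def)
  have sym: "A2 y = B1 y" if y: "y \<in> U" for y
    unfolding vec_eq_iff
  proof
    fix c
    have comp: "((\<lambda>t. f (z + t *\<^sub>R v) $ c) has_real_derivative (v$1 *\<^sub>R X + v$2 *\<^sub>R Y) $ c) (at 0)"
      if "(f has_derivative (\<lambda>h. h$1 *\<^sub>R X + h$2 *\<^sub>R Y)) (at z)" for f :: "real^2 \<Rightarrow> real^3" and z X Y v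
    proof -
      have "((\<lambda>z. f z $ c) has_derivative (\<lambda>h. (h$1 *\<^sub>R X + h$2 *\<^sub>R Y) $ c)) (at z)"
        by (rule bounded_linear.has_derivative[OF bounded_linear_vec_nth that])
      from has_derivative_direction[OF this] show ?thesis .
    qed
    show "A2 y $ c = B1 y $ c"
    proof (rule mixed_derivatives_commute[OF U(1) y, of "\<lambda>y. ?P y $ c" "axis 1 1" "\<lambda>y. A y $ c" "axis 2 1" "\<lambda>y. B y $ c"])
      fix z assume z: "z \<in> U"
      show "((\<lambda>t. ?P (z + t *\<^sub>R axis 1 1) $ c) has_real_derivative A z $ c) (at 0)"
        using comp[OF dP[OF z], of "axis 1 1"] by (simp add: ax)
      show "((\<lambda>t. ?P (z + t *\<^sub>R axis 2 1) $ c) has_real_derivative B z $ c) (at 0)"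
        using comp[OF dP[OF z], of "axis 2 1"] by (simp add: ax)
      show "((\<lambda>t. A (z + t *\<^sub>R axis 2 1) $ c) has_real_derivative A2 z $ c) (at 0)"
        using comp[OF dA[OF z], of "axis 2 1"] by (simp add: ax)
      show "((\<lambda>t. B (z + t *\<^sub>R axis 1 1) $ c) has_real_derivative B1 z $ c) (at 0)"
        using comp[OF dB[OF z], of "axis 1 1"] by (simp add: ax)
    qed (use C'(3,4) in \<open>auto intro: continuous_intros\<close>)
  qed
  have tan: "tA T y = A y \<and> tB T y = B y" if y: "y \<in> ref_tri K T" for y
  proof -
    have d: "(?P has_derivative (\<lambda>h. h$1 *\<^sub>R A y + h$2 *\<^sub>R B y)) (at y within ref_tri K T)"
      using dP[of y] y U(2) has_derivative_at_withinI by blast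
    show ?thesis
      unfolding tA_def tB_def D_param_def jacobian_def frechet_derivative_ref[OF T y d]
      using matrix_column_axis[OF has_derivative_linear[OF d]] by (simp add: ax)
  qed
  show ?thesis
    by (rule that[of A B A1 A2 B1 B2]) (use dP dA dB sym tan U(2) in auto)
qed

lemma param_derivative:
  assumes "T \<in> tris" "y \<in> ref_tri K T"
  shows "(param K T has_derivative (\<lambda>h. D_param K T y *v h)) (at y)"
proof -
  obtain A B A1 A2 B1 B2 where d:
    "\<And>y. y \<in> ref_tri K T \<Longrightarrow> (param K T has_derivative (\<lambda>h. h$1 *\<^sub>R A y + h$2 *\<^sub>R B y)) (at y)"
    "\<And>y. y \<in> ref_tri K T \<Longrightarrow> (A has_derivative (\<lambda>h. h$1 *\<^sub>R A1 y + h$2 *\<^sub>R A2 y)) (at y)"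
    "\<And>y. y \<in> ref_tri K T \<Longrightarrow> (B has_derivative (\<lambda>h. h$1 *\<^sub>R B1 y + h$2 *\<^sub>R B2 y)) (at y)"
    "\<And>y. y \<in> ref_tri K T \<Longrightarrow> A2 y = B1 y"
    "\<And>y. y \<in> ref_tri K T \<Longrightarrow> tA T y = A y" "\<And>y. y \<in> ref_tri K T \<Longrightarrow> tB T y = B y"
    by (rule param_C2[OF assms(1)], rule that)
  from d(1,5,6)[OF assms(2)] show ?thesis unfolding D_param_apply by simp
qed

lemma tangent_continuous:
  assumes "T \<in> tris"
  shows "continuous_on (ref_tri K T) (tA T)" "continuous_on (ref_tri K T) (tB T)"
proof -
  obtain A B A1 A2 B1 B2 where d:
    "\<And>y. y \<in> ref_tri K T \<Longrightarrow> (param K T has_derivative (\<lambda>h. h$1 *\<^sub>R A y + h$2 *\<^sub>R B y)) (at y)"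
    "\<And>y. y \<in> ref_tri K T \<Longrightarrow> (A has_derivative (\<lambda>h. h$1 *\<^sub>R A1 y + h$2 *\<^sub>R A2 y)) (at y)"
    "\<And>y. y \<in> ref_tri K T \<Longrightarrow> (B has_derivative (\<lambda>h. h$1 *\<^sub>R B1 y + h$2 *\<^sub>R B2 y)) (at y)"
    "\<And>y. y \<in> ref_tri K T \<Longrightarrow> A2 y = B1 y"
    "\<And>y. y \<in> ref_tri K T \<Longrightarrow> tA T y = A y" "\<And>y. y \<in> ref_tri K T \<Longrightarrow> tB T y = B y"
    by (rule param_C2[OF assms], rule that)
  have "continuous_on (ref_tri K T) A" "continuous_on (ref_tri K T) B"
    using d(2,3) by (meson continuous_at_imp_continuous_on has_derivative_continuous)+
  then show "continuous_on (ref_tri K T) (tA T)" "continuous_on (ref_tri K T) (tB T)"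
    using d(5,6) by (simp_all cong: continuous_on_cong)
qed

lemma area_factor_continuous: "T \<in> tris \<Longrightarrow> continuous_on (ref_tri K T) (area_factor K T)"
  unfolding area_factor_eq[abs_def] gdet_def using tangent_continuous by (intro continuous_intros) auto

lemma ref_point_param: "T \<in> tris \<Longrightarrow> y \<in> ref_tri K T \<Longrightarrow> ref_point K T (param K T y) = y"
  unfolding ref_point_def using curvedD(4) by (simp add: inv_into_f_f)

lemma param_in: "T \<in> tris \<Longrightarrow> y \<in> ref_tri K T \<Longrightarrow> param K T y \<in> T"
  using curvedD(3) by blast

lemma tri_pointE:
  assumes "T \<in> tris" "x \<in> T"
  obtains y where "y \<in> ref_tri K T" "x = param K T y"
  using assms curvedD(3) by blast

text \<open>By \<open>gdet_derivative\<close>, the logarithmic derivatives of the area factor are traces of the derivatives of the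
  tangent vectors in the dual basis.
  Since the second derivatives of the parametrization are symmetric, the two contributions cancel and
  only the divergence in the reference triangle is left.\<close>
lemma surf_div_piola:
  assumes T: "T \<in> tris" and y: "y \<in> ref_tri K T"
    and p: "grad2 p1 p11 p12" "grad2 p2 p21 p22"
    and v: "\<And>z. z \<in> ref_tri K T \<Longrightarrow> v T (param K T z) = (1 / area_factor K T z) *\<^sub>R (p1 z *\<^sub>R tA T z + p2 z *\<^sub>R tB T z)"
  shows "surf_div K v T (param K T y) = (p11 y + p22 y) / area_factor K T y"
proof -
  obtain A B A1 A2 B1 B2 where AB:
    "\<And>y. y \<in> ref_tri K T \<Longrightarrow> (param K T has_derivative (\<lambda>h. h$1 *\<^sub>R A y + h$2 *\<^sub>R B y)) (at y)"
    "\<And>y. y \<in> ref_tri K T \<Longrightarrow> (A has_derivative (\<lambda>h. h$1 *\<^sub>R A1 y + h$2 *\<^sub>R A2 y)) (at y)"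
    "\<And>y. y \<in> ref_tri K T \<Longrightarrow> (B has_derivative (\<lambda>h. h$1 *\<^sub>R B1 y + h$2 *\<^sub>R B2 y)) (at y)"
    "\<And>y. y \<in> ref_tri K T \<Longrightarrow> A2 y = B1 y"
    "\<And>y. y \<in> ref_tri K T \<Longrightarrow> tA T y = A y" "\<And>y. y \<in> ref_tri K T \<Longrightarrow> tB T y = B y"
    by (rule param_C2[OF T], rule that)
  define A' where "A' h = h$1 *\<^sub>R A1 y + h$2 *\<^sub>R A2 y" for h :: "real^2"
  define B' where "B' h = h$1 *\<^sub>R B1 y + h$2 *\<^sub>R B2 y" for h :: "real^2"
  define P1 where "P1 h = p11 y * h$1 + p12 y * h$2" for h :: "real^2"
  define P2 where "P2 h = p21 y * h$1 + p22 y * h$2" for h :: "real^2"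
  have dA: "(A has_derivative A') (at y)" and dB: "(B has_derivative B') (at y)"
    and dp1: "(p1 has_derivative P1) (at y)" and dp2: "(p2 has_derivative P2) (at y)"
    using AB(2,3)[OF y] p by (auto simp: A'_def[abs_def] B'_def[abs_def] P1_def[abs_def] P2_def[abs_def] grad2_def)
  define g where "g z = gdet (A z) (B z)" for z
  have gy: "g y > 0" using gdet_tangent_pos[OF T y] AB(5,6)[OF y] by (simp add: g_def)
  let ?dA = "dualA (A y) (B y)" and ?dB = "dualB (A y) (B y)"
  have dg: "(g has_derivative (\<lambda>h. 2 * g y * (?dA \<bullet> A' h + ?dB \<bullet> B' h))) (at y)"
  proof -
    have "(g has_derivative (\<lambda>h. (A y \<bullet> A y) * (B y \<bullet> B' h + B' h \<bullet> B y) + (A y \<bullet> A' h + A' h \<bullet> A y) * (B y \<bullet> B y)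
       - real 2 * (A y \<bullet> B' h + A' h \<bullet> B y) * (A y \<bullet> B y) ^ (2 - 1))) (at y)"
      unfolding g_def gdet_def by (intro has_derivative_diff has_derivative_mult has_derivative_power has_derivative_inner dA dB)
    moreover have "(A y \<bullet> A y) * (B y \<bullet> B' h + B' h \<bullet> B y) + (A y \<bullet> A' h + A' h \<bullet> A y) * (B y \<bullet> B y)
       - real 2 * (A y \<bullet> B' h + A' h \<bullet> B y) * (A y \<bullet> B y) ^ (2 - 1) = 2 * g y * (?dA \<bullet> A' h + ?dB \<bullet> B' h)" for h
      using gdet_derivative[of "A y" "B y" "A' h" "B' h"] gy
      by (simp add: g_def inner_commute[of "A' h" "A y"] inner_commute[of "B' h" "B y"] algebra_simps)
    ultimately show ?thesis by simp
  qed
  define w where "w z = 1 / sqrt (g z)" for z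
  have wy: "w y > 0" using gy by (simp add: w_def)
  have dw: "(w has_derivative (\<lambda>h. - w y * (?dA \<bullet> A' h + ?dB \<bullet> B' h))) (at y)"
  proof -
    have "((\<lambda>x. 1 / sqrt x) has_real_derivative - (inverse (sqrt (g y)) / 2) / (sqrt (g y) * sqrt (g y))) (at (g y))"
      using gy by (auto intro!: derivative_eq_intros)
    then have "(w has_derivative (\<lambda>h. - (inverse (sqrt (g y)) / 2) / (sqrt (g y) * sqrt (g y)) * (2 * g y * (?dA \<bullet> A' h + ?dB \<bullet> B' h)))) (at y)"
      unfolding w_def[abs_def] has_field_derivative_def by (rule has_derivative_compose[OF dg])
    moreover have "- (inverse (sqrt (g y)) / 2) / (sqrt (g y) * sqrt (g y)) * (2 * g y * c) = - w y * c" for c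
      using gy by (simp add: w_def divide_simps)
    ultimately show ?thesis by simp
  qed
  define F where "F z = w z *\<^sub>R (p1 z *\<^sub>R A z + p2 z *\<^sub>R B z)" for z
  define F' where "F' h = w y *\<^sub>R ((p1 y *\<^sub>R A' h + P1 h *\<^sub>R A y) + (p2 y *\<^sub>R B' h + P2 h *\<^sub>R B y))
    + (- w y * (?dA \<bullet> A' h + ?dB \<bullet> B' h)) *\<^sub>R (p1 y *\<^sub>R A y + p2 y *\<^sub>R B y)" for h
  have "(F has_derivative F') (at y)"
    unfolding F_def F'_def by (intro has_derivative_scaleR has_derivative_add dA dB dp1 dp2 dw)
  then have "(F has_derivative F') (at y within ref_tri K T)" by (rule has_derivative_at_withinI)
  then have dv: "((\<lambda>z. v T (param K T z)) has_derivative F') (at y within ref_tri K T)"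
    by (rule has_derivative_transform[OF y, rotated])
      (simp add: v F_def w_def g_def area_factor_eq AB(5,6))
  have ax: "(axis 1 1 :: real^2) $ 1 = 1" "(axis 1 1 :: real^2) $ 2 = 0" "(axis 2 1 :: real^2) $ 1 = 0" "(axis 2 1 :: real^2) $ 2 = 1"
    by (simp_all add: axis_def)
  have e: "A' (axis 1 1) = A1 y" "A' (axis 2 1) = A2 y" "B' (axis 1 1) = A2 y" "B' (axis 2 1) = B2 y"
    "P1 (axis 1 1) = p11 y" "P2 (axis 2 1) = p22 y"
    by (simp_all add: A'_def B'_def P1_def P2_def ax AB(4)[OF y])
  note db = dual_basis[of "A y" "B y"]
  have "surf_div K v T (param K T y) = ?dA \<bullet> F' (axis 1 1) + ?dB \<bullet> F' (axis 2 1)"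
  proof -
    have "surf_div K v T (param K T y) = trace (matrix_inv (transpose (D_param K T y) ** D_param K T y) **
        (transpose (D_param K T y) ** jacobian (\<lambda>z. v T (param K T z)) (at y within ref_tri K T)))"
      using T y by (simp add: surf_div_def param_in ref_point_param gram_def Let_def)
    also have "\<dots> = dualA (tA T y) (tB T y) \<bullet> column 1 (jacobian (\<lambda>z. v T (param K T z)) (at y within ref_tri K T))
      + dualB (tA T y) (tB T y) \<bullet> column 2 (jacobian (\<lambda>z. v T (param K T z)) (at y within ref_tri K T))"
      unfolding tA_def tB_def using gdet_tangent_pos[OF T y] by (intro trace_inv_gram) (simp add: tA_def tB_def)
    finally show ?thesis
      unfolding jacobian_def frechet_derivative_ref[OF T y dv] matrix_column_axis[OF has_derivative_linear[OF dv]] AB(5,6)[OF y] .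
  qed
  also have "\<dots> = w y * (p11 y + p22 y)"
    using gy db unfolding F'_def e g_def
    by (simp add: inner_add_right algebra_simps)
  also have "\<dots> = (p11 y + p22 y) / area_factor K T y"
    using AB(5,6)[OF y] by (simp add: w_def g_def area_factor_eq)
  finally show ?thesis .
qed

lemma surf_grad_formula:
  assumes T: "T \<in> tris" and y: "y \<in> ref_tri K T" and q: "grad2 q q1 q2"
    and u: "\<And>z. z \<in> ref_tri K T \<Longrightarrow> u T (param K T z) = q z"
  shows "surf_grad K u T (param K T y) = q1 y *\<^sub>R dualA (tA T y) (tB T y) + q2 y *\<^sub>R dualB (tA T y) (tB T y)"
proof -
  have "(q has_derivative (\<lambda>h. q1 y * h$1 + q2 y * h$2)) (at y within ref_tri K T)"
    using q by (auto simp: grad2_def intro: has_derivative_at_withinI)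
  then have d: "((\<lambda>z. u T (param K T z)) has_derivative (\<lambda>h. q1 y * h$1 + q2 y * h$2)) (at y within ref_tri K T)"
    by (rule has_derivative_transform[OF y, rotated]) (simp add: u)
  have "surf_grad K u T (param K T y) = D_param K T y *v (matrix_inv (transpose (D_param K T y) ** D_param K T y) *v
      (\<chi> i. q1 y * (axis i 1 :: real^2)$1 + q2 y * (axis i 1 :: real^2)$2))"
    using T y frechet_derivative_ref[OF T y d] by (simp add: surf_grad_def param_in ref_point_param gram_def Let_def)
  also have "\<dots> = q1 y *\<^sub>R dualA (tA T y) (tB T y) + q2 y *\<^sub>R dualB (tA T y) (tB T y)"
    using gdet_tangent_pos[OF T y] grad_inv_gram[of "D_param K T y"] by (simp add: tA_def tB_def axis_def)
  finally show ?thesis .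
qed

definition normal_sign :: "(real^3) set \<Rightarrow> real" where
  "normal_sign T = (unit_normal K T (vx T 0) \<bullet> (tA T (rv T 0) \<times> tB T (rv T 0))) / area_factor K T (rv T 0)"

lemma norm_cross_tangent: "norm (tA T y \<times> tB T y) = area_factor K T y"
  by (simp add: area_factor_eq gdet_cross norm_eq_sqrt_inner)

text \<open>The given unit normal is the normal of the parametrization up to a sign, which cannot jump.\<close>
lemma unit_normal_eq:
  assumes T: "T \<in> tris"
  shows "normal_sign T = 1 \<or> normal_sign T = -1"
    "y \<in> ref_tri K T \<Longrightarrow> unit_normal K T (param K T y) = (normal_sign T / area_factor K T y) *\<^sub>R (tA T y \<times> tB T y)"
proof -
  let ?R = "ref_tri K T"
  define f where "f y = (unit_normal K T (param K T y) \<bullet> (tA T y \<times> tB T y)) / area_factor K T y" for y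
  have om: "oriented_mesh K" using triangulation by (simp add: oriented_triangulation_def)
  then have n: "continuous_on T (unit_normal K T)" "\<And>x. x \<in> T \<Longrightarrow> norm (unit_normal K T x) = 1"
    "\<And>x w. x \<in> T \<Longrightarrow> w \<in> tangent_plane K T x \<Longrightarrow> unit_normal K T x \<bullet> w = 0"
    using T unfolding oriented_mesh_def by blast+
  have pt: "unit_normal K T (param K T y) = (f y / area_factor K T y) *\<^sub>R (tA T y \<times> tB T y) \<and> \<bar>f y\<bar> = 1" if y: "y \<in> ?R" for y
  proof -
    let ?n = "unit_normal K T (param K T y)" and ?A = "tA T y" and ?B = "tB T y"
    have tp: "D_param K T y *v p \<in> tangent_plane K T (param K T y)" for p
      using ref_point_param[OF T y] by (simp add: tangent_plane_def)
    have "?n \<bullet> (D_param K T y *v p) = 0" for p using n(3)[OF param_in[OF T y] tp] .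
    from this[of "axis 1 1"] this[of "axis 2 1"] have nAB: "?n \<bullet> ?A = 0" "?n \<bullet> ?B = 0"
      unfolding D_param_apply by (simp_all add: axis_def)
    have "?n \<times> (?A \<times> ?B) = 0" unfolding Lagrange using nAB by simp
    have "(?A \<times> ?B) \<times> (?n \<times> (?A \<times> ?B)) = ((?A \<times> ?B) \<bullet> (?A \<times> ?B)) *\<^sub>R ?n - ((?A \<times> ?B) \<bullet> ?n) *\<^sub>R (?A \<times> ?B)"
      by (rule Lagrange)
    then have "gdet ?A ?B *\<^sub>R ?n = (?n \<bullet> (?A \<times> ?B)) *\<^sub>R (?A \<times> ?B)"
      unfolding \<open>?n \<times> (?A \<times> ?B) = 0\<close> by (simp add: gdet_cross inner_commute)
    moreover have ga: "gdet ?A ?B = area_factor K T y * area_factor K T y"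
      using gdet_tangent_pos[OF T y] by (simp add: area_factor_eq)
    moreover have a: "area_factor K T y > 0" by (rule area_factor_pos[OF T y])
    ultimately have "(area_factor K T y * area_factor K T y) *\<^sub>R ?n = (f y * area_factor K T y) *\<^sub>R (?A \<times> ?B)"
      by (simp add: f_def)
    then have "(1 / (area_factor K T y * area_factor K T y)) *\<^sub>R ((area_factor K T y * area_factor K T y) *\<^sub>R ?n)
      = (1 / (area_factor K T y * area_factor K T y)) *\<^sub>R ((f y * area_factor K T y) *\<^sub>R (?A \<times> ?B))" by simp
    then have eq: "?n = (f y / area_factor K T y) *\<^sub>R (?A \<times> ?B)" using a by (simp add: field_simps)
    have "1 = norm ?n" using n(2)[OF param_in[OF T y]] by simp
    also have "\<dots> = \<bar>f y\<bar>" using a by (subst eq) (simp add: norm_cross_tangent)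
    finally show ?thesis using eq by simp
  qed
  have "continuous_on ?R (\<lambda>y. unit_normal K T (param K T y))"
    using n(1) param_continuous[OF T] curvedD(3)[OF T] by (auto intro: continuous_on_compose2)
  then have "continuous_on ?R f"
    unfolding f_def using tangent_continuous[OF T] area_factor_continuous[OF T] area_factor_pos[OF T]
    by (intro continuous_intros continuous_on_cross) (auto simp: less_imp_neq[symmetric])
  moreover have "f y = 1 \<or> f y = -1" if "y \<in> ?R" for y using conjunct2[OF pt[OF that]] by linarith
  then have "f ` ?R \<subseteq> {1, -1}" by blast
  ultimately have "f constant_on ?R"
    using continuous_finite_range_constant[of ?R f] convex_connected[OF ref_tri_convex]
    by (meson finite.emptyI finite.insertI finite_subset)
  moreover have r0: "rv T 0 \<in> ?R" using rv_in[OF T] by simp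
  moreover have ns: "normal_sign T = f (rv T 0)" by (simp add: normal_sign_def f_def vx_def)
  ultimately have fy: "f y = normal_sign T" if "y \<in> ?R" for y using that by (auto simp: constant_on_def)
  show "normal_sign T = 1 \<or> normal_sign T = -1" using pt[OF r0] unfolding ns by (auto simp: abs_if split: if_splits)
  show "y \<in> ?R \<Longrightarrow> unit_normal K T (param K T y) = (normal_sign T / area_factor K T y) *\<^sub>R (tA T y \<times> tB T y)"
    using pt fy by simp
qed

text \<open>The rotation by the normal takes the dual basis to the tangent basis, so that the surface rotation is
  the Piola image of the planar one up to the sign of the normal.\<close>
lemma rot_formula:
  assumes T: "T \<in> tris" and y: "y \<in> ref_tri K T" and q: "grad2 q q1 q2"
    and uq: "\<And>z. z \<in> ref_tri K T \<Longrightarrow> u T (param K T z) = q z"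
  shows "rot K u T (param K T y) = (1 / area_factor K T y) *\<^sub>R ((normal_sign T * q2 y) *\<^sub>R tA T y + (- normal_sign T * q1 y) *\<^sub>R tB T y)"
proof -
  have g: "gdet (tA T y) (tB T y) \<noteq> 0" using gdet_tangent_pos[OF T y] by simp
  have sg: "surf_grad K u T (param K T y) = q1 y *\<^sub>R dualA (tA T y) (tB T y) + q2 y *\<^sub>R dualB (tA T y) (tB T y)"
    by (rule surf_grad_formula[OF T y q]) (rule uq)
  have "rot K u T (param K T y) = - (unit_normal K T (param K T y) \<times> surf_grad K u T (param K T y))"
    using T y by (simp add: rot_def rotate_J_def param_in)
  also have "\<dots> = - ((normal_sign T / area_factor K T y) *\<^sub>R (q1 y *\<^sub>R tB T y - q2 y *\<^sub>R tA T y))"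
    unfolding unit_normal_eq(2)[OF T y] sg
    by (simp add: cross_mult_left cross_mult_right cross_add_right cross_dual[OF g] algebra_simps)
  finally show ?thesis by (simp add: algebra_simps)
qed

end

section \<open>Conormals and edge fluxes\<close>

text \<open>Being orthogonal to \<open>t\<close> and \<open>N\<close> fixes a unit vector up to its sign, and the sign is fixed by the side
  of \<open>w\<close>.\<close>
lemma cross_direction_unique:
  assumes m: "norm m = 1" "m = r *\<^sub>R (t \<times> N)" "m \<bullet> w < 0"
    and \<nu>: "norm \<nu> = 1" "\<nu> \<bullet> t = 0" "\<nu> \<bullet> N = 0" "\<nu> \<bullet> w \<le> 0"
  shows "\<nu> = m"
proof -
  have "\<nu> \<times> (t \<times> N) = 0" unfolding Lagrange using \<nu>(2,3) by simp
  then have "\<nu> \<times> m = 0" unfolding m(2) by (simp add: cross_mult_right)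
  then have "(m \<bullet> m) *\<^sub>R \<nu> - (m \<bullet> \<nu>) *\<^sub>R m = 0" using Lagrange[of m \<nu> m] by simp
  moreover have "m \<bullet> m = 1" using m(1) by (simp add: norm_eq_1)
  ultimately have e: "\<nu> = (m \<bullet> \<nu>) *\<^sub>R m" by simp
  then have "norm \<nu> = \<bar>m \<bullet> \<nu>\<bar> * norm m" by (metis norm_scaleR)
  then have a: "\<bar>m \<bullet> \<nu>\<bar> = 1" using m(1) \<nu>(1) by simp
  have "\<nu> \<bullet> w = (m \<bullet> \<nu>) * (m \<bullet> w)" by (metis e inner_scaleR_left)
  then have "(m \<bullet> \<nu>) * (m \<bullet> w) \<le> 0" using \<nu>(4) by simp
  then have "m \<bullet> \<nu> \<ge> 0" using m(3) by (simp add: mult_le_0_iff)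
  then have "m \<bullet> \<nu> = 1" using a by simp
  with e show ?thesis by simp
qed

lemma norm_cross_orthogonal: "x \<bullet> y = 0 \<Longrightarrow> norm (x \<times> y) = norm x * norm y"
proof -
  assume "x \<bullet> y = 0"
  then have "(norm (x \<times> y))\<^sup>2 = (norm x * norm y)\<^sup>2" using norm_cross_dot[of x y] by simp
  then show ?thesis by (simp add: power2_eq_iff_nonneg)
qed

lemma det2_basis_nonzero:
  assumes "\<And>x y. x *\<^sub>R a + y *\<^sub>R b = 0 \<Longrightarrow> x = 0 \<and> y = 0"
  shows "det2 a b \<noteq> 0"
proof
  assume d: "det2 a b = 0"
  have "b$2 *\<^sub>R a + (- a$2) *\<^sub>R b = 0" "b$1 *\<^sub>R a + (- a$1) *\<^sub>R b = 0"
    using d by (auto simp: vec_eq_iff forall_2 det2_def mult.commute)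
  then have "a$1 = 0" "a$2 = 0" using assms by (metis neg_equal_0_iff_equal)+
  then have "1 *\<^sub>R a + 0 *\<^sub>R b = 0" by (simp add: vec_eq_iff forall_2)
  then show False using assms by fastforce
qed

context mesh
begin

lemma D_param_cross: "(D_param K T y *v v) \<times> (D_param K T y *v w) = det2 v w *\<^sub>R (tA T y \<times> tB T y)"
  unfolding tA_def tB_def by (rule cross_tangent)

lemma D_param_normal: "(D_param K T y *v v) \<bullet> (tA T y \<times> tB T y) = 0"
  unfolding D_param_apply by (simp add: inner_add_left dot_cross_self)

lemma D_param_nonzero: "T \<in> tris \<Longrightarrow> y \<in> ref_tri K T \<Longrightarrow> v \<noteq> 0 \<Longrightarrow> D_param K T y *v v \<noteq> 0"
  using curvedD(6)[of T y] by (metis injD matrix_vector_mult_0_right)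

text \<open>Reference points are expanded along the edge and towards the opposite vertex, so that the conditions on
  the conormal reduce to one equation and one inequality.\<close>
lemma conormal_eq:
  assumes T: "T \<in> tris" and abc: "ref_verts K T = {a, b, c}" and d: "det2 (b - a) (c - a) \<noteq> 0"
    and u: "u \<in> {0..1}" and y: "y = a + u *\<^sub>R (b - a)"
  shows "conormal K T (param K T ` closed_segment a b) (param K T y) =
    (sgn (det2 (b - a) (c - a)) / (norm (D_param K T y *v (b - a)) * area_factor K T y)) *\<^sub>R
      ((D_param K T y *v (b - a)) \<times> (tA T y \<times> tB T y))" (is "_ = ?m")
proof -
  let ?D = "\<lambda>v. D_param K T y *v v"
  let ?t = "?D (b - a)" and ?w = "?D (c - a)" and ?N = "tA T y \<times> tB T y" and ?d = "det2 (b - a) (c - a)"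
  have hull: "a \<in> ref_tri K T" "b \<in> ref_tri K T" "c \<in> ref_tri K T" using ref_verts_subset[of T] abc by auto
  have yseg: "y \<in> closed_segment a b" unfolding closed_segment_def y using u by (auto intro!: exI[of _ u] simp: algebra_simps)
  then have yR: "y \<in> ref_tri K T" using closed_segment_subset[OF hull(1,2) ref_tri_convex] by blast
  have ap: "area_factor K T y > 0" by (rule area_factor_pos[OF T yR])
  have "b - a \<noteq> 0" using d by (auto simp: det2_def)
  then have tp: "norm ?t > 0" using D_param_nonzero[OF T yR] by simp
  define r where "r = sgn ?d / (norm ?t * area_factor K T y)"
  have m: "?m = r *\<^sub>R (?t \<times> ?N)" by (simp add: r_def)
  have NN: "?N \<bullet> ?N = area_factor K T y * area_factor K T y"
    using norm_cross_tangent[of T y] by (metis power2_eq_square power2_norm_eq_inner)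
  have mt: "?m \<bullet> ?t = 0" by (simp add: m dot_cross_self)
  have tri: "(?t \<times> ?N) \<bullet> ?w = - ?d * (?N \<bullet> ?N)"
  proof -
    have "(?t \<times> ?N) \<bullet> ?w = ?N \<bullet> (?w \<times> ?t)"
      by (metis cross_triple inner_commute)
    also have "\<dots> = det2 (c - a) (b - a) * (?N \<bullet> ?N)" unfolding D_param_cross by simp
    also have "det2 (c - a) (b - a) = - ?d" by (simp add: det2_def)
    finally show ?thesis .
  qed
  have mw: "?m \<bullet> ?w < 0"
  proof -
    have "?m \<bullet> ?w = - (sgn ?d * ?d) * (area_factor K T y / norm ?t)"
      unfolding m inner_scaleR_left tri NN using ap tp by (simp add: r_def field_simps)
    moreover have "sgn ?d * ?d > 0" using d by (simp add: sgn_if)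
    ultimately show ?thesis using ap tp by (simp add: mult_less_0_iff divide_less_0_iff)
  qed
  have nm: "norm ?m = 1"
  proof -
    have "norm ?m = \<bar>r\<bar> * norm (?t \<times> ?N)" unfolding m by simp
    also have "norm (?t \<times> ?N) = norm ?t * area_factor K T y"
      using norm_cross_orthogonal[OF D_param_normal] norm_cross_tangent by simp
    also have "\<bar>r\<bar> * (norm ?t * area_factor K T y) = 1" using ap tp d by (simp add: r_def abs_mult sgn_if)
    finally show ?thesis .
  qed
  have lin: "?D (x *\<^sub>R (b - a) + v *\<^sub>R (c - a)) = x *\<^sub>R ?t + v *\<^sub>R ?w" for x v
    by (simp add: matrix_vector_right_distrib scaleR_matrix_vector_assoc matrix_vector_mult_scaleR)
  have coord: "\<exists>x v. v \<ge> 0 \<and> z - y = x *\<^sub>R (b - a) + v *\<^sub>R (c - a)" if zR: "z \<in> ref_tri K T" for z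
  proof -
    obtain p q v where z: "0 \<le> v" "p + q + v = 1" "z = p *\<^sub>R a + q *\<^sub>R b + v *\<^sub>R c"
      using zR[unfolded ref_tri_def abc convex_hull_3 mem_Collect_eq] by (elim exE conjE)
    have p: "p = 1 - q - v" using z(2) by simp
    have "z - y = (q - u) *\<^sub>R (b - a) + v *\<^sub>R (c - a)" unfolding z(3) y p by (simp add: algebra_simps)
    then show ?thesis using z(1) by blast
  qed
  have edge: "\<exists>x. z - y = x *\<^sub>R (b - a) + 0 *\<^sub>R (c - a)"
    if z: "z \<in> ref_tri K T" "param K T z \<in> param K T ` closed_segment a b" for z
  proof -
    have "z \<in> closed_segment a b"
      using inj_on_image_mem_iff[OF curvedD(4)[OF T] z(1) closed_segment_subset[OF hull(1,2) ref_tri_convex]] z(2) by blast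
    then obtain l where "z = (1 - l) *\<^sub>R a + l *\<^sub>R b" by (auto simp: closed_segment_def)
    then have "z - y = (l - u) *\<^sub>R (b - a) + 0 *\<^sub>R (c - a)" by (simp add: y algebra_simps)
    then show ?thesis by blast
  qed
  have ty: "tangent_plane K T (param K T y) = range ?D" by (simp add: tangent_plane_def ref_point_param[OF T yR])
  have "r *\<^sub>R (p *\<^sub>R tA T y - q *\<^sub>R tB T y) = ?D (r *\<^sub>R vector [p, - q])" for p q
    unfolding D_param_apply by (simp add: algebra_simps)
  then have mT: "?m \<in> range ?D" unfolding m unfolding Lagrange by blast
  show ?thesis
    unfolding conormal_def Let_def ref_point_param[OF T yR] ty
  proof (rule the_equality, intro conjI ballI impI)
    fix z assume "z \<in> ref_tri K T" "param K T z \<in> param K T ` closed_segment a b"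
    then obtain x where "z - y = x *\<^sub>R (b - a) + 0 *\<^sub>R (c - a)" using edge by blast
    then show "?m \<bullet> ?D (z - y) = 0" using mt by (simp only: lin inner_add_right inner_scaleR_right)
  next
    fix z assume "z \<in> ref_tri K T"
    then obtain x v where "v \<ge> 0" "z - y = x *\<^sub>R (b - a) + v *\<^sub>R (c - a)" using coord by blast
    moreover then have "v * (?m \<bullet> ?w) \<le> 0" using mw by (simp only: mult_nonneg_nonpos less_imp_le)
    ultimately show "?m \<bullet> ?D (z - y) \<le> 0" using mt by (simp only: lin inner_add_right inner_scaleR_right)
  next
    fix \<nu> assume \<nu>: "norm \<nu> = 1 \<and> \<nu> \<in> range ?D \<and>
         (\<forall>z\<in>ref_tri K T. param K T z \<in> param K T ` closed_segment a b \<longrightarrow> \<nu> \<bullet> ?D (z - y) = 0) \<and>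
         (\<forall>z\<in>ref_tri K T. \<nu> \<bullet> ?D (z - y) \<le> 0)"
    have "\<nu> \<bullet> ?D (a - y) = 0" "\<nu> \<bullet> ?D (b - y) = 0" "\<nu> \<bullet> ?D (c - y) \<le> 0" using \<nu> hull by auto
    moreover have "a - y = (- u) *\<^sub>R (b - a) + 0 *\<^sub>R (c - a)" "b - y = (1 - u) *\<^sub>R (b - a) + 0 *\<^sub>R (c - a)"
      "c - y = (- u) *\<^sub>R (b - a) + 1 *\<^sub>R (c - a)" by (simp_all add: y algebra_simps)
    ultimately have "- u * (\<nu> \<bullet> ?t) = 0" "(1 - u) * (\<nu> \<bullet> ?t) = 0" "- u * (\<nu> \<bullet> ?t) + \<nu> \<bullet> ?w \<le> 0"
      by (simp_all only: lin inner_add_right inner_scaleR_right)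
    then have "\<nu> \<bullet> ?t = 0" "\<nu> \<bullet> ?w \<le> 0" by auto
    moreover have "\<nu> \<bullet> ?N = 0" using \<nu> D_param_normal by fastforce
    ultimately show "\<nu> = ?m" using cross_direction_unique[OF nm m mw] \<nu> by blast
  qed (use nm mT in auto)
qed

text \<open>The area factor cancels in the flux of a Piola-mapped field, and the vector \<open>n \<times> \<nu>\<close> is the unit tangent
  of the edge up to sign.\<close>
lemma conormal_flux:
  assumes T: "T \<in> tris" and abc: "ref_verts K T = {a, b, c}" and d: "det2 (b - a) (c - a) \<noteq> 0"
    and u: "u \<in> {0..1}" and y: "y = a + u *\<^sub>R (b - a)"
  shows "((1 / area_factor K T y) *\<^sub>R (D_param K T y *v p)) \<bullet> conormal K T (param K T ` closed_segment a b) (param K T y)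
      = sgn (det2 (b - a) (c - a)) * det2 p (b - a) / norm (D_param K T y *v (b - a))" (is ?flux)
    and "unit_normal K T (param K T y) \<times> conormal K T (param K T ` closed_segment a b) (param K T y)
      = (normal_sign T * sgn (det2 (b - a) (c - a)) / norm (D_param K T y *v (b - a))) *\<^sub>R (D_param K T y *v (b - a))" (is ?normal)
proof -
  let ?t = "D_param K T y *v (b - a)" and ?N = "tA T y \<times> tB T y"
  have hull: "a \<in> ref_tri K T" "b \<in> ref_tri K T" using ref_verts_subset[of T] abc by auto
  have "y \<in> closed_segment a b" unfolding closed_segment_def y using u by (auto intro!: exI[of _ u] simp: algebra_simps)
  then have yR: "y \<in> ref_tri K T" using closed_segment_subset[OF hull ref_tri_convex] by blast
  have ap: "area_factor K T y > 0" by (rule area_factor_pos[OF T yR])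
  have "b - a \<noteq> 0" using d by (auto simp: det2_def)
  then have tp: "norm ?t > 0" using D_param_nonzero[OF T yR] by simp
  have NN: "?N \<bullet> ?N = area_factor K T y * area_factor K T y"
    using norm_cross_tangent[of T y] by (metis power2_eq_square power2_norm_eq_inner)
  have "(D_param K T y *v p) \<bullet> (?t \<times> ?N) = ((D_param K T y *v p) \<times> ?t) \<bullet> ?N"
    by (metis cross_triple inner_commute)
  also have "\<dots> = det2 p (b - a) * (?N \<bullet> ?N)" unfolding D_param_cross by simp
  finally have e: "(D_param K T y *v p) \<bullet> (?t \<times> ?N) = det2 p (b - a) * (area_factor K T y * area_factor K T y)" by (simp add: NN)
  show ?flux unfolding conormal_eq[OF assms] inner_scaleR_left inner_scaleR_right e using ap tp by (simp add: field_simps)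
  have tN: "?N \<bullet> ?t = 0" using D_param_normal by (simp add: inner_commute)
  have "?N \<times> (?t \<times> ?N) = (area_factor K T y * area_factor K T y) *\<^sub>R ?t" unfolding Lagrange[of ?N ?t ?N] NN tN by simp
  then show ?normal
    unfolding conormal_eq[OF assms] unit_normal_eq(2)[OF T yR] cross_mult_left cross_mult_right
    using ap tp by (simp add: field_simps)
qed

text \<open>The orientation of a triangle by its unit normal, compared with the order of its vertices.\<close>
definition orient :: "(real^3) set \<Rightarrow> int" where
  "orient T = (if normal_sign T * det2 (rv T 1 - rv T 0) (rv T 2 - rv T 0) > 0 then 1 else -1)"

definition osign :: "(real^3) set \<Rightarrow> (real^3) set \<Rightarrow> int" where
  "osign T E = (if T \<in> tris then edge_sign orient T E else 0)"

lemma edge_frame: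
  assumes T: "T \<in> tris" "E \<in> edges K T"
  obtains i j k where "i < j" "j \<le> 2" "E = eg T i j" "ref_verts K T = {rv T i, rv T j, rv T k}"
    "det2 (rv T j - rv T i) (rv T k - rv T i) \<noteq> 0"
    "real_of_int (osign T E) = normal_sign T * sgn (det2 (rv T j - rv T i) (rv T k - rv T i))"
proof -
  let ?r = "rv T" and ?d = "det2 (rv T 1 - rv T 0) (rv T 2 - rv T 0)"
  have d: "?d \<noteq> 0" using det2_basis_nonzero rv_independent[OF T(1)] by blast
  have o: "real_of_int (orient T) = normal_sign T * sgn ?d"
    using unit_normal_eq(1)[OF T(1)] d by (auto simp: orient_def sgn_if)
  have 12: "det2 (?r 2 - ?r 1) (?r 0 - ?r 1) = ?d" and 02: "det2 (?r 2 - ?r 0) (?r 1 - ?r 0) = - ?d"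
    by (simp_all add: det2_def algebra_simps)
  consider "E = eg T 1 2" | "E = eg T 0 2" | "E = eg T 0 1" using T edges_eg by blast
  then show ?thesis
  proof cases
    case 1
    show ?thesis
      by (rule that[of 1 2 0]) (use 1 T o d 12 rv(1)[OF T(1)] edge_sign[OF T(1), of orient] in \<open>auto simp: osign_def\<close>)
  next
    case 2
    show ?thesis
      by (rule that[of 0 2 1]) (use 2 T o d 02 rv(1)[OF T(1)] in \<open>auto simp: osign_def edge_sign sgn_minus\<close>)
  next
    case 3
    show ?thesis
      by (rule that[of 0 1 2]) (use 3 T o d rv(1)[OF T(1)] edge_sign[OF T(1), of orient] in \<open>auto simp: osign_def\<close>)
  qed
qed

definition speed :: "(real^3) set \<Rightarrow> real \<Rightarrow> real" where
  "speed E u = norm (vector_derivative (edge_map E) (at u within {0..1}))"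

text \<open>On each of the three edges, with \<open>a + u t\<close> the reference point at the parameter \<open>u\<close>. The speed and the
  tangent are expressed by the edge alone, which makes the fluxes from two triangles comparable.\<close>
lemma edge_calculus:
  assumes T: "T \<in> tris" "E \<in> edges K T"
  obtains a t where "\<And>u. u \<in> {0..1} \<Longrightarrow> a + u *\<^sub>R t \<in> ref_tri K T"
    "\<And>u. u \<in> {0..1} \<Longrightarrow> edge_map E u = param K T (a + u *\<^sub>R t)"
    "\<And>u. u \<in> {0..1} \<Longrightarrow> speed E u > 0"
    "\<And>u p. u \<in> {0..1} \<Longrightarrow>
      ((1 / area_factor K T (a + u *\<^sub>R t)) *\<^sub>R (D_param K T (a + u *\<^sub>R t) *v p)) \<bullet> conormal K T E (edge_map E u)
      = normal_sign T * osign T E * det2 p t / speed E u"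
    "\<And>u. u \<in> {0..1} \<Longrightarrow> unit_normal K T (edge_map E u) \<times> conormal K T E (edge_map E u)
      = (osign T E / speed E u) *\<^sub>R vector_derivative (edge_map E) (at u within {0..1})"
proof -
  obtain i j k where ij: "i < j" "j \<le> 2" "E = eg T i j" and abc: "ref_verts K T = {rv T i, rv T j, rv T k}"
    and d: "det2 (rv T j - rv T i) (rv T k - rv T i) \<noteq> 0"
    and s: "real_of_int (osign T E) = normal_sign T * sgn (det2 (rv T j - rv T i) (rv T k - rv T i))"
    by (rule edge_frame[OF T])
  define a where "a = rv T i"
  define t where "t = rv T j - rv T i"
  have lp: "linepath (rv T i) (rv T j) u = a + u *\<^sub>R t" for u by (simp add: linepath_def a_def t_def algebra_simps)
  have in_R: "a + u *\<^sub>R t \<in> ref_tri K T" if "u \<in> {0..1}" for u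
    using seg_ref[OF T(1), of i j] ij linepath_in_path[of u "rv T i" "rv T j"] that unfolding lp by auto
  have em: "edge_map E u = param K T (a + u *\<^sub>R t)" if "u \<in> {0..1}" for u
    using edge_map[OF T(1) ij(1,2) that] unfolding lp ij(3) .
  have vd: "vector_derivative (edge_map E) (at u within {0..1}) = D_param K T (a + u *\<^sub>R t) *v t" if u: "u \<in> {0..1}" for u
  proof -
    have "((\<lambda>u. a + u *\<^sub>R t) has_derivative (\<lambda>h. h *\<^sub>R t)) (at u within {0..1})" by (auto intro!: derivative_eq_intros)
    from has_derivative_compose[OF this param_derivative[OF T(1) in_R[OF u]]]
    have "((\<lambda>u. param K T (a + u *\<^sub>R t)) has_vector_derivative D_param K T (a + u *\<^sub>R t) *v t) (at u within {0..1})"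
      by (simp add: has_vector_derivative_def matrix_vector_mult_scaleR)
    then have "(edge_map E has_vector_derivative D_param K T (a + u *\<^sub>R t) *v t) (at u within {0..1})"
      by (rule has_vector_derivative_transform[OF u, rotated]) (rule em)
    then show ?thesis by (rule vector_derivative_within_cbox[of 0 1, simplified, rotated 1]) (use u in auto)
  qed
  have sp: "speed E u = norm (D_param K T (a + u *\<^sub>R t) *v t)" if "u \<in> {0..1}" for u
    unfolding speed_def vd[OF that] ..
  have t0: "t \<noteq> 0" using d by (auto simp: t_def det2_def)
  have E: "E = param K T ` closed_segment a (rv T j)" by (simp add: ij(3) eg_def a_def)
  have sq: "normal_sign T * normal_sign T = 1" using unit_normal_eq(1)[OF T(1)] by auto
  have s': "sgn (det2 (rv T j - a) (rv T k - a)) = normal_sign T * osign T E"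
    using sq by (simp add: s a_def mult.assoc[symmetric])
  note fl = conormal_flux[OF T(1) abc d _ refl, folded t_def a_def, folded E]
  show ?thesis
  proof (rule that[of a t])
    fix u :: real assume u: "u \<in> {0..1}"
    show "speed E u > 0" using D_param_nonzero[OF T(1) in_R[OF u] t0] by (simp add: sp[OF u])
    show "((1 / area_factor K T (a + u *\<^sub>R t)) *\<^sub>R (D_param K T (a + u *\<^sub>R t) *v p)) \<bullet> conormal K T E (edge_map E u)
      = normal_sign T * osign T E * det2 p t / speed E u" for p
      unfolding em[OF u] sp[OF u] fl(1)[OF u] s'[folded t_def a_def] using s' by (simp add: t_def a_def)
    show "unit_normal K T (edge_map E u) \<times> conormal K T E (edge_map E u)
      = (osign T E / speed E u) *\<^sub>R vector_derivative (edge_map E) (at u within {0..1})"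
      unfolding sp[OF u] vd[OF u] unfolding em[OF u] fl(2)[OF u] using s by (simp add: t_def a_def)
  qed (use in_R em in auto)
qed

text \<open>Both triangles see the same parametrization of the edge, and \<open>n \<times> \<nu>\<close> is its unit tangent with the
  sign \<open>osign\<close>; the signs can be compared at one end of the edge.\<close>
lemma osign_opposite:
  assumes T: "T \<in> tris" "T' \<in> tris" "T \<noteq> T'" "E \<in> edges K T" "E \<in> edges K T'"
  shows "osign T' E = - osign T E"
proof -
  have u: "(0::real) \<in> {0..1}" by simp
  let ?x = "edge_map E 0" and ?v = "vector_derivative (edge_map E) (at 0 within {0..1})"
  have e: "speed E 0 > 0" "unit_normal K T ?x \<times> conormal K T E ?x = (osign T E / speed E 0) *\<^sub>R ?v"
    by (rule edge_calculus[OF T(1,4)], use u in blast)+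
  have e': "unit_normal K T' ?x \<times> conormal K T' E ?x = (osign T' E / speed E 0) *\<^sub>R ?v"
    by (rule edge_calculus[OF T(2,5)], use u in blast)
  have "?x \<in> E" using edge_ends_verts[OF T(1,4)] by (simp add: edge_tail_def)
  moreover have "oriented_mesh K" using triangulation by (simp add: oriented_triangulation_def)
  ultimately have "unit_normal K T ?x \<times> conormal K T E ?x = - (unit_normal K T' ?x \<times> conormal K T' E ?x)"
    using T(4,5) by (intro conjunct2[OF iffD1[OF oriented_mesh_def], rule_format, OF _ T(1,2) _ T(3)]) auto
  then have "((osign T E + osign T' E) / speed E 0) *\<^sub>R ?v = 0" unfolding e(2) e' by (simp add: algebra_simps add_divide_distrib)
  moreover have "?v \<noteq> 0" using e(1) by (auto simp: speed_def)
  ultimately have "real_of_int (osign T E + osign T' E) = 0" using e(1) by simp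
  then show ?thesis by linarith
qed

sublocale curved_complex "all_verts K" "all_edges K" tris edge_tail edge_head "edges K" osign edge_map tri_map
proof -
  have "curved_complex (all_verts K) (all_edges K) tris edge_tail edge_head (edges K) (\<lambda>T E. if T \<in> tris then edge_sign orient T E else 0) edge_map tri_map"
  proof (rule mesh_complex)
    show "orient T = 1 \<or> orient T = -1" for T by (simp add: orient_def)
    show "edge_sign orient T' E = - edge_sign orient T E"
      if "T \<in> tris" "T' \<in> tris" "T \<noteq> T'" "E \<in> edges K T" "E \<in> edges K T'" for T T' E
      using osign_opposite[OF that] that(1,2) by (simp add: osign_def)
  qed
  then show "curved_complex (all_verts K) (all_edges K) tris edge_tail edge_head (edges K) osign edge_map tri_map"
    by (simp add: osign_def[abs_def])
qed

end

section \<open>Potentials of solenoidal fields\<close>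

context mesh
begin

text \<open>The difference of the two traces on an interior edge and the trace on a boundary edge, up to sign.\<close>
definition jump :: "scalar_field \<Rightarrow> (real^3) set \<Rightarrow> real \<Rightarrow> real" where
  "jump f E u = (\<Sum>T\<in>tris. real_of_int (osign T E) * f T (edge_map E u))"

definition potentials :: "nat \<Rightarrow> scalar_field set" where
  "potentials k = {f \<in> scalar_P K (Suc k). \<forall>E\<in>all_edges K. \<forall>u\<in>{0..1}. jump f E u = jump f E 0}"

lemma edge_image: "E \<in> all_edges K \<Longrightarrow> edge_map E ` {0..1} = E"
  using edge_param by blast

text \<open>The sum has two terms on an interior edge and one on a boundary edge, so that it unites both edge
  conditions.\<close>
lemma BDM0_iff:
  "v \<in> BDM0 K k \<longleftrightarrow> v \<in> vector_P K k \<and>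
    (\<forall>E\<in>all_edges K. \<forall>x\<in>E. (\<Sum>T\<in>{T\<in>tris. E \<in> edges K T}. v T x \<bullet> conormal K T E x) = 0)"
proof (intro iffI conjI ballI)
  assume v: "v \<in> BDM0 K k"
  then show "v \<in> vector_P K k" by (simp add: BDM0_def BDM_def)
  fix E x assume E: "E \<in> all_edges K" and x: "x \<in> E"
  then obtain T where T: "T \<in> tris" "E \<in> edges K T" by (auto simp: all_edges_def)
  show "(\<Sum>T\<in>{T\<in>tris. E \<in> edges K T}. v T x \<bullet> conormal K T E x) = 0"
  proof (cases "\<exists>T'\<in>tris. T' \<noteq> T \<and> E \<in> edges K T'")
    case True
    then obtain T' where T': "T' \<in> tris" "T \<noteq> T'" "E \<in> edges K T'" by blast
    have "v T x \<bullet> conormal K T E x + v T' x \<bullet> conormal K T' E x = 0"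
      using v T T' x unfolding BDM0_def BDM_def by blast
    then show ?thesis unfolding edges_of_two[OF T(1) T'(1,2) T(2) T'(3)] using T'(2) by simp
  next
    case False
    then have *: "{T\<in>tris. E \<in> edges K T} = {T}" using T by blast
    have "\<exists>!T. T \<in> tris \<and> E \<in> edges K T" using False T by blast
    then have "E \<in> boundary_edges K" using E by (simp add: boundary_edges_def)
    then have "v T x \<bullet> conormal K T E x = 0" using v T x unfolding BDM0_def by blast
    then show ?thesis unfolding * by simp
  qed
next
  assume v: "v \<in> vector_P K k \<and>
    (\<forall>E\<in>all_edges K. \<forall>x\<in>E. (\<Sum>T\<in>{T\<in>tris. E \<in> edges K T}. v T x \<bullet> conormal K T E x) = 0)"
  have all: "E \<in> all_edges K" if "T \<in> tris" "E \<in> edges K T" for T E using that by (auto simp: all_edges_def)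
  have "v T x \<bullet> conormal K T E x + v T' x \<bullet> conormal K T' E x = 0"
    if T: "T \<in> tris" "T' \<in> tris" "T \<noteq> T'" "E \<in> edges K T" "E \<in> edges K T'" and "x \<in> E" for T T' E x
  proof -
    have "(\<Sum>T\<in>{T\<in>tris. E \<in> edges K T}. v T x \<bullet> conormal K T E x) = 0" using v all[OF T(1,4)] \<open>x \<in> E\<close> by blast
    then show ?thesis unfolding edges_of_two[OF T] using T(3) by simp
  qed
  moreover have "v T x \<bullet> conormal K T E x = 0"
    if T: "T \<in> tris" "E \<in> edges K T" "E \<in> boundary_edges K" and "x \<in> E" for T E x
  proof -
    have "(\<Sum>T\<in>{T\<in>tris. E \<in> edges K T}. v T x \<bullet> conormal K T E x) = 0" using v all[OF T(1,2)] \<open>x \<in> E\<close> by blast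
    moreover have "{T\<in>tris. E \<in> edges K T} = {T}" using T unfolding boundary_edges_def by blast
    ultimately show ?thesis by simp
  qed
  ultimately show "v \<in> BDM0 K k" using v by (auto simp: BDM0_def BDM_def)
qed

lemma scalar_P_poly:
  assumes "f \<in> scalar_P K (Suc k)" "T \<in> tris"
  obtains q q1 q2 where "q \<in> poly2 (Suc k)" "q1 \<in> poly2 k" "q2 \<in> poly2 k" "grad2 q q1 q2"
    "\<And>y. y \<in> ref_tri K T \<Longrightarrow> f T (param K T y) = q y"
proof -
  obtain q where q: "q \<in> poly2 (Suc k)" "\<And>y. y \<in> ref_tri K T \<Longrightarrow> f T (param K T y) = q y"
    using assms unfolding scalar_P_def by blast
  obtain q1 q2 where "q1 \<in> poly2 k" "q2 \<in> poly2 k" "grad2 q q1 q2" by (rule poly2_grad[OF q(1)])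
  then show ?thesis using that q by blast
qed

lemma supported_rot: "supported K (rot K f)"
  by (auto simp: supported_def rot_def rotate_J_def)

lemma supported_eqI:
  assumes "supported K f" "supported K g"
    and "\<And>T y. T \<in> tris \<Longrightarrow> y \<in> ref_tri K T \<Longrightarrow> f T (param K T y) = g T (param K T y)"
  shows "f = g"
proof (intro ext)
  fix T x
  show "f T x = g T x"
  proof (cases "T \<in> tris \<and> x \<in> T")
    case True
    then show ?thesis using assms(3) tri_pointE by metis
  qed (use assms(1,2) in \<open>auto simp: supported_def\<close>)
qed

lemma rot_param:
  assumes T: "T \<in> tris" and y: "y \<in> ref_tri K T" and q: "grad2 q q1 q2"
    and f: "\<And>z. z \<in> ref_tri K T \<Longrightarrow> f T (param K T z) = q z"
  shows "rot K f T (param K T y) = (1 / area_factor K T y) *\<^sub>R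
    (D_param K T y *v vector [normal_sign T * q2 y, - normal_sign T * q1 y])"
proof -
  have "rot K f T (param K T y) = (1 / area_factor K T y) *\<^sub>R
      ((normal_sign T * q2 y) *\<^sub>R tA T y + (- normal_sign T * q1 y) *\<^sub>R tB T y)"
    by (rule rot_formula[OF T y q]) (rule f)
  then show ?thesis unfolding D_param_apply by simp
qed

lemma normal_sign_square: "T \<in> tris \<Longrightarrow> normal_sign T * (normal_sign T * x) = x"
  using unit_normal_eq(1)[of T] by auto

lemma rot_vector_P:
  assumes "f \<in> scalar_P K (Suc k)"
  shows "rot K f \<in> vector_P K k"
proof -
  have "\<exists>p :: real^2 \<Rightarrow> real^2. (\<forall>i. (\<lambda>y. p y $ i) \<in> poly2 k) \<and>
        (\<forall>y\<in>ref_tri K T. rot K f T (param K T y) = (1 / area_factor K T y) *\<^sub>R (D_param K T y *v p y))" if T: "T \<in> tris" for T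
  proof -
    obtain q q1 q2 where q: "q \<in> poly2 (Suc k)" "q1 \<in> poly2 k" "q2 \<in> poly2 k" "grad2 q q1 q2"
      "\<And>y. y \<in> ref_tri K T \<Longrightarrow> f T (param K T y) = q y" by (rule scalar_P_poly[OF assms T], rule that)
    define p :: "real^2 \<Rightarrow> real^2" where "p y = vector [normal_sign T * q2 y, - normal_sign T * q1 y]" for y
    have "normal_sign T *\<^sub>R q2 \<in> poly2 k" "(- normal_sign T) *\<^sub>R q1 \<in> poly2 k"
      using q(2,3) by (intro subspace_scale[OF subspace_poly2]; simp)+
    then have "\<forall>i. (\<lambda>y. p y $ i) \<in> poly2 k" by (simp add: forall_2 p_def scaleR_fun_def)
    moreover have "\<forall>y\<in>ref_tri K T. rot K f T (param K T y) = (1 / area_factor K T y) *\<^sub>R (D_param K T y *v p y)"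
      unfolding p_def using rot_param[OF T _ q(4), of _ f] q(5) by blast
    ultimately show ?thesis by blast
  qed
  then show ?thesis by (simp add: vector_P_def supported_rot)
qed

lemma rot_div_free:
  assumes f: "f \<in> scalar_P K (Suc k)" and T: "T \<in> tris" "x \<in> T"
  shows "surf_div K (rot K f) T x = 0"
proof -
  obtain y where y: "y \<in> ref_tri K T" "x = param K T y" by (rule tri_pointE[OF T])
  obtain q q1 q2 where q: "q \<in> poly2 (Suc k)" "q1 \<in> poly2 k" "q2 \<in> poly2 k" "grad2 q q1 q2"
    "\<And>y. y \<in> ref_tri K T \<Longrightarrow> f T (param K T y) = q y" by (rule scalar_P_poly[OF f T(1)], rule that)
  have up: "q1 \<in> poly2 (Suc k)" "q2 \<in> poly2 (Suc k)" using q(2,3) poly2_mono[of k "Suc k"] by auto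
  obtain q11 q12 where q1: "q12 \<in> poly2 k" "grad2 q1 q11 q12" by (rule poly2_grad[OF up(1)])
  obtain q21 q22 where q2: "q21 \<in> poly2 k" "grad2 q2 q21 q22" by (rule poly2_grad[OF up(2)])
  have c: "q12 = q21" by (rule grad2_commute[OF q(4) q1(2) q2(2) q1(1) q2(1)])
  let ?s = "normal_sign T"
  have g: "grad2 (?s *\<^sub>R q2) (?s *\<^sub>R q21) (?s *\<^sub>R q22)" "grad2 ((- ?s) *\<^sub>R q1) ((- ?s) *\<^sub>R q11) ((- ?s) *\<^sub>R q12)"
    using grad2_lincomb[OF q2(2) grad2_zero, of ?s] grad2_lincomb[OF q1(2) grad2_zero, of "- ?s"] by simp_all
  have "surf_div K (rot K f) T (param K T y) = ((?s *\<^sub>R q21) y + ((- ?s) *\<^sub>R q12) y) / area_factor K T y"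
  proof (rule surf_div_piola[OF T(1) y(1) g])
    fix z assume "z \<in> ref_tri K T"
    then show "rot K f T (param K T z) = (1 / area_factor K T z) *\<^sub>R ((?s *\<^sub>R q2) z *\<^sub>R tA T z + ((- ?s) *\<^sub>R q1) z *\<^sub>R tB T z)"
      using rot_param[OF T(1) _ q(4), of z f] q(5) by (simp add: scaleR_fun_def D_param_apply)
  qed
  then show ?thesis unfolding y(2) c by (simp add: scaleR_fun_def)
qed

text \<open>The stream function of the reference field, which exists because the Piola map preserves the
  divergence up to the area factor.\<close>
lemma stream_function:
  assumes v: "v \<in> vector_P K k" and div: "\<And>T x. T \<in> tris \<Longrightarrow> x \<in> T \<Longrightarrow> surf_div K v T x = 0"
  obtains f where "f \<in> scalar_P K (Suc k)" "rot K f = v"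
proof -
  have "\<exists>q\<in>poly2 (Suc k). \<exists>q1 q2. grad2 q q1 q2 \<and> (\<forall>y\<in>ref_tri K T. v T (param K T y) =
      (1 / area_factor K T y) *\<^sub>R (D_param K T y *v vector [q2 y, - q1 y]))" if T: "T \<in> tris" for T
  proof -
    obtain p :: "real^2 \<Rightarrow> real^2" where p: "\<And>i. (\<lambda>y. p y $ i) \<in> poly2 k"
      "\<And>y. y \<in> ref_tri K T \<Longrightarrow> v T (param K T y) = (1 / area_factor K T y) *\<^sub>R (D_param K T y *v p y)"
      using v T unfolding vector_P_def by blast
    have up: "(\<lambda>y. p y $ i) \<in> poly2 (Suc k)" for i using p(1) poly2_mono[of k "Suc k"] by auto
    obtain p11 p12 where g1: "p11 \<in> poly2 k" "grad2 (\<lambda>y. p y $ 1) p11 p12" by (rule poly2_grad[OF up])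
    obtain p21 p22 where g2: "p22 \<in> poly2 k" "grad2 (\<lambda>y. p y $ 2) p21 p22" by (rule poly2_grad[OF up])
    have "(p11 + p22) y = 0" for y
    proof (rule poly2_zero[OF _ ref_tri_interior[OF T]])
      show "p11 + p22 \<in> poly2 k" by (rule subspace_add[OF subspace_poly2 g1(1) g2(1)])
      fix y assume y: "y \<in> ref_tri K T"
      have "surf_div K v T (param K T y) = (p11 y + p22 y) / area_factor K T y"
        by (rule surf_div_piola[OF T y g1(2) g2(2)]) (simp add: p(2) D_param_apply)
      then show "(p11 + p22) y = 0" using div[OF T param_in[OF T y]] area_factor_pos[OF T y] by simp
    qed
    then have "p11 y + p22 y = 0" for y by simp
    from poly2_stream_function[OF p(1) p(1) g1(2) g2(2) this]
    obtain q where q: "q \<in> poly2 (Suc k)" "grad2 q (- (\<lambda>y. p y $ 2)) (\<lambda>y. p y $ 1)" by blast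
    have "vector [p y $ 1, - (- (\<lambda>y. p y $ 2)) y] = p y" for y by (simp add: vec_eq_iff forall_2)
    then have "\<forall>y\<in>ref_tri K T. v T (param K T y) =
      (1 / area_factor K T y) *\<^sub>R (D_param K T y *v vector [p y $ 1, - (- (\<lambda>y. p y $ 2)) y])" using p(2) by metis
    then show ?thesis using q by blast
  qed
  then obtain q q1 q2 where q: "\<And>T. T \<in> tris \<Longrightarrow> q T \<in> poly2 (Suc k)" "\<And>T. T \<in> tris \<Longrightarrow> grad2 (q T) (q1 T) (q2 T)"
    "\<And>T y. T \<in> tris \<Longrightarrow> y \<in> ref_tri K T \<Longrightarrow> v T (param K T y) = (1 / area_factor K T y) *\<^sub>R (D_param K T y *v vector [q2 T y, - q1 T y])"
    by metis
  \<comment> \<open>the sign of the normal enters \<open>rot\<close> once more and cancels\<close>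
  define f where "f T x = (if T \<in> tris \<and> x \<in> T then normal_sign T * q T (ref_point K T x) else 0)" for T x
  have fp: "f T (param K T y) = (normal_sign T *\<^sub>R q T) y" if "T \<in> tris" "y \<in> ref_tri K T" for T y
    using that by (simp add: f_def param_in ref_point_param scaleR_fun_def)
  have "supported K f" by (auto simp: supported_def f_def)
  then have "f \<in> scalar_P K (Suc k)"
    unfolding scalar_P_def using fp q(1) subspace_scale[OF subspace_poly2] by blast
  moreover have "rot K f = v"
  proof (rule supported_eqI[OF supported_rot])
    show "supported K v" using v by (simp add: vector_P_def)
    fix T y assume T: "T \<in> tris" and y: "y \<in> ref_tri K T"
    have "grad2 (normal_sign T *\<^sub>R q T) (normal_sign T *\<^sub>R q1 T) (normal_sign T *\<^sub>R q2 T)"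
      using grad2_lincomb[OF q(2)[OF T] grad2_zero] by simp
    from rot_param[OF T y this, of f] fp[OF T]
    show "rot K f T (param K T y) = v T (param K T y)"
      by (simp add: q(3)[OF T y] scaleR_fun_def normal_sign_square[OF T])
  qed
  ultimately show ?thesis using that by blast
qed

text \<open>On an edge, the normal component of the rotated gradient is the tangential derivative of the
  potential; the sign is that of the edge in the boundary of the triangle.\<close>
lemma rot_flux:
  assumes T: "T \<in> tris" "E \<in> edges K T" and f: "f \<in> scalar_P K (Suc k)" and u: "u \<in> {0..1}"
  shows "\<exists>g'. ((\<lambda>u. f T (edge_map E u)) has_real_derivative g') (at u within {0..1}) \<and>
    rot K f T (edge_map E u) \<bullet> conormal K T E (edge_map E u) = real_of_int (osign T E) * g' / speed E u \<and> speed E u > 0"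
proof -
  obtain a t where e: "\<And>u. u \<in> {0..1} \<Longrightarrow> a + u *\<^sub>R t \<in> ref_tri K T"
    "\<And>u. u \<in> {0..1} \<Longrightarrow> edge_map E u = param K T (a + u *\<^sub>R t)"
    "\<And>u. u \<in> {0..1} \<Longrightarrow> speed E u > 0"
    "\<And>u p. u \<in> {0..1} \<Longrightarrow>
      ((1 / area_factor K T (a + u *\<^sub>R t)) *\<^sub>R (D_param K T (a + u *\<^sub>R t) *v p)) \<bullet> conormal K T E (edge_map E u)
      = normal_sign T * osign T E * det2 p t / speed E u"
    by (rule edge_calculus[OF T], rule that)
  obtain q q1 q2 where q: "q \<in> poly2 (Suc k)" "q1 \<in> poly2 k" "q2 \<in> poly2 k" "grad2 q q1 q2"
    "\<And>y. y \<in> ref_tri K T \<Longrightarrow> f T (param K T y) = q y" by (rule scalar_P_poly[OF f T(1)], rule that)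
  let ?y = "a + u *\<^sub>R t"
  define g' where "g' = q1 ?y * t$1 + q2 ?y * t$2"
  have "((\<lambda>u. a + u *\<^sub>R t) has_derivative (\<lambda>h. h *\<^sub>R t)) (at u within {0..1})" by (auto intro!: derivative_eq_intros)
  moreover have "(q has_derivative (\<lambda>h. q1 ?y * h$1 + q2 ?y * h$2)) (at ?y)" using q(4) by (simp add: grad2_def)
  ultimately have "((\<lambda>u. q (a + u *\<^sub>R t)) has_derivative (\<lambda>h. q1 ?y * (h *\<^sub>R t)$1 + q2 ?y * (h *\<^sub>R t)$2)) (at u within {0..1})"
    by (rule has_derivative_compose)
  moreover have "(\<lambda>h. q1 ?y * (h *\<^sub>R t)$1 + q2 ?y * (h *\<^sub>R t)$2) = (*) g'" by (auto simp: g'_def algebra_simps)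
  ultimately have "((\<lambda>u. q (a + u *\<^sub>R t)) has_real_derivative g') (at u within {0..1})" by (simp add: has_field_derivative_def)
  then have d: "((\<lambda>u. f T (edge_map E u)) has_real_derivative g') (at u within {0..1})"
    by (rule has_field_derivative_transform_within[of _ _ _ _ 1]) (use u in \<open>simp_all add: e q(5)\<close>)
  have "rot K f T (edge_map E u) \<bullet> conormal K T E (edge_map E u)
      = normal_sign T * osign T E * det2 (vector [normal_sign T * q2 ?y, - normal_sign T * q1 ?y]) t / speed E u"
    unfolding e(4)[OF u, symmetric] using rot_param[OF T(1) e(1)[OF u] q(4), of f] q(5) by (simp add: e(2)[OF u])
  also have "normal_sign T * osign T E * det2 (vector [normal_sign T * q2 ?y, - normal_sign T * q1 ?y]) t
     = normal_sign T * (normal_sign T * (real_of_int (osign T E) * g'))"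
    by (simp add: det2_def g'_def algebra_simps)
  finally show ?thesis using d e(3)[OF u] unfolding normal_sign_square[OF T(1)] by blast
qed

lemma jump_derivative:
  assumes E: "E \<in> all_edges K" and f: "f \<in> scalar_P K (Suc k)" and u: "u \<in> {0..1}"
  shows "\<exists>j'. (jump f E has_real_derivative j') (at u within {0..1}) \<and> speed E u > 0 \<and>
    (\<Sum>T\<in>{T\<in>tris. E \<in> edges K T}. rot K f T (edge_map E u) \<bullet> conormal K T E (edge_map E u)) = j' / speed E u"
proof -
  let ?S = "{T\<in>tris. E \<in> edges K T}"
  have "\<forall>T\<in>?S. \<exists>g'. ((\<lambda>u. f T (edge_map E u)) has_real_derivative g') (at u within {0..1}) \<and>
    rot K f T (edge_map E u) \<bullet> conormal K T E (edge_map E u) = real_of_int (osign T E) * g' / speed E u \<and> speed E u > 0"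
    using rot_flux[OF _ _ f u] by simp
  from bchoice[OF this] obtain g' where g: "\<And>T. T \<in> ?S \<Longrightarrow> ((\<lambda>u. f T (edge_map E u)) has_real_derivative g' T) (at u within {0..1})"
    "\<And>T. T \<in> ?S \<Longrightarrow> rot K f T (edge_map E u) \<bullet> conormal K T E (edge_map E u) = real_of_int (osign T E) * g' T / speed E u"
    "\<And>T. T \<in> ?S \<Longrightarrow> speed E u > 0"
    by blast
  have "jump f E = (\<lambda>u. \<Sum>T\<in>?S. real_of_int (osign T E) * f T (edge_map E u))"
    unfolding jump_def by (rule ext) (rule sum_signs)
  moreover have "((\<lambda>u. \<Sum>T\<in>?S. real_of_int (osign T E) * f T (edge_map E u)) has_real_derivative (\<Sum>T\<in>?S. real_of_int (osign T E) * g' T)) (at u within {0..1})"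
    by (intro DERIV_sum DERIV_cmult g(1))
  moreover have "(\<Sum>T\<in>?S. rot K f T (edge_map E u) \<bullet> conormal K T E (edge_map E u)) = (\<Sum>T\<in>?S. real_of_int (osign T E) * g' T) / speed E u"
    unfolding sum_divide_distrib by (intro sum.cong refl g(2))
  moreover have "speed E u > 0" using E g(3) by (auto simp: all_edges_def)
  ultimately show ?thesis by auto
qed

text \<open>By \<open>jump_derivative\<close> the total flux through an edge is the derivative of the jump along the edge.\<close>
lemma flux_free_iff:
  assumes E: "E \<in> all_edges K" and f: "f \<in> scalar_P K (Suc k)"
  shows "(\<forall>x\<in>E. (\<Sum>T\<in>{T\<in>tris. E \<in> edges K T}. rot K f T x \<bullet> conormal K T E x) = 0) \<longleftrightarrow>
    (\<forall>u\<in>{0..1}. jump f E u = jump f E 0)"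
proof
  assume z: "\<forall>x\<in>E. (\<Sum>T\<in>{T\<in>tris. E \<in> edges K T}. rot K f T x \<bullet> conormal K T E x) = 0"
  have "(jump f E has_real_derivative 0) (at u within {0..1})" if u: "u \<in> {0..1}" for u
  proof -
    obtain j' where j: "(jump f E has_real_derivative j') (at u within {0..1})" "speed E u > 0"
      "(\<Sum>T\<in>{T\<in>tris. E \<in> edges K T}. rot K f T (edge_map E u) \<bullet> conormal K T E (edge_map E u)) = j' / speed E u"
      using jump_derivative[OF E f u] by blast
    have "edge_map E u \<in> E" using edge_image[OF E] u by blast
    then have "j' / speed E u = 0" using z unfolding j(3)[symmetric] by blast
    then have "j' = 0" using j(2) by simp
    then show ?thesis using j(1) by simp
  qed
  then have "\<exists>c. \<forall>u\<in>{0..1}. jump f E u = c" by (intro has_field_derivative_zero_constant) auto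
  then obtain c where c: "\<And>u. u \<in> {0..1} \<Longrightarrow> jump f E u = c" by blast
  show "\<forall>u\<in>{0..1}. jump f E u = jump f E 0" using c c[of 0] by simp
next
  assume c: "\<forall>u\<in>{0..1}. jump f E u = jump f E 0"
  show "\<forall>x\<in>E. (\<Sum>T\<in>{T\<in>tris. E \<in> edges K T}. rot K f T x \<bullet> conormal K T E x) = 0"
  proof
    fix x assume "x \<in> E"
    then obtain u where u: "u \<in> {0..1}" "x = edge_map E u" using edge_image[OF E] by blast
    obtain j' where j: "(jump f E has_real_derivative j') (at u within {0..1})"
      "(\<Sum>T\<in>{T\<in>tris. E \<in> edges K T}. rot K f T (edge_map E u) \<bullet> conormal K T E (edge_map E u)) = j' / speed E u"
      using jump_derivative[OF E f u(1)] by blast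
    have "((\<lambda>_. jump f E 0) has_real_derivative 0) (at u within {0..1})" by simp
    then have "(jump f E has_real_derivative 0) (at u within {0..1})"
      by (rule has_field_derivative_transform_within[where d = 1]) (use u(1) c in \<open>simp_all only: zero_less_one\<close>)
    then have "j' = 0"
      using j(1) u(1) vector_derivative_unique_within_closed_interval[of 0 1 u "jump f E" j' 0]
      by (simp add: has_real_derivative_iff_has_vector_derivative)
    then show "(\<Sum>T\<in>{T\<in>tris. E \<in> edges K T}. rot K f T x \<bullet> conormal K T E x) = 0" using j(2) u(2) by simp
  qed
qed

theorem J_BDM_potentials: "J_BDM K k = rot K ` potentials k"
proof (intro equalityI subsetI)
  fix v assume v: "v \<in> J_BDM K k"
  then have "v \<in> BDM0 K k" "\<And>T x. T \<in> tris \<Longrightarrow> x \<in> T \<Longrightarrow> surf_div K v T x = 0"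
    by (simp_all add: J_BDM_def)
  moreover from this have "v \<in> vector_P K k" by (simp add: BDM0_def BDM_def)
  ultimately obtain f where f: "f \<in> scalar_P K (Suc k)" "rot K f = v" using stream_function by blast
  have "v \<in> BDM0 K k" using v by (simp add: J_BDM_def)
  have "\<forall>u\<in>{0..1}. jump f E u = jump f E 0" if "E \<in> all_edges K" for E
    by (rule iffD1[OF flux_free_iff[OF that f(1)]], unfold f(2))
      (use that \<open>v \<in> BDM0 K k\<close>[unfolded BDM0_iff] in blast)
  then have "f \<in> potentials k" using f(1) unfolding potentials_def by blast
  then show "v \<in> rot K ` potentials k" using f(2) by blast
next
  fix v assume "v \<in> rot K ` potentials k"
  then obtain f where f: "f \<in> potentials k" "v = rot K f" by blast
  then have fP: "f \<in> scalar_P K (Suc k)" by (simp add: potentials_def)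
  have "v \<in> BDM0 K k" unfolding BDM0_iff f(2)
  proof (intro conjI rot_vector_P[OF fP] ballI[where A = "all_edges K"])
    fix E assume E: "E \<in> all_edges K"
    then have "\<forall>u\<in>{0..1}. jump f E u = jump f E 0" using f(1) unfolding potentials_def by blast
    then show "\<forall>x\<in>E. (\<Sum>T\<in>{T\<in>tris. E \<in> edges K T}. rot K f T x \<bullet> conormal K T E x) = 0"
      by (rule iffD2[OF flux_free_iff[OF E fP]])
  qed
  then show "v \<in> J_BDM K k" using rot_div_free[OF fP] by (simp add: J_BDM_def f(2))
qed

subsection \<open>Linear structure\<close>

lemma subspace_scalar_P: "subspace (scalar_P K m)"
proof (rule subspaceI)
  show "0 \<in> scalar_P K m" using subspace_0[OF subspace_poly2] by (auto simp: scalar_P_def supported_def intro!: bexI[of _ 0])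
next
  fix f g assume fg: "f \<in> scalar_P K m" "g \<in> scalar_P K m"
  have "\<exists>p\<in>poly2 m. \<forall>y\<in>ref_tri K T. (f + g) T (param K T y) = p y" if "T \<in> tris" for T
  proof -
    obtain p q where p: "p \<in> poly2 m" "\<forall>y\<in>ref_tri K T. f T (param K T y) = p y"
      and q: "q \<in> poly2 m" "\<forall>y\<in>ref_tri K T. g T (param K T y) = q y"
      using fg \<open>T \<in> tris\<close> unfolding scalar_P_def by blast
    show ?thesis by (rule bexI[OF _ subspace_add[OF subspace_poly2 p(1) q(1)]]) (simp add: p(2) q(2))
  qed
  then show "f + g \<in> scalar_P K m" using fg by (auto simp: scalar_P_def supported_def)
next
  fix c :: real and f assume f: "f \<in> scalar_P K m"
  have "\<exists>p\<in>poly2 m. \<forall>y\<in>ref_tri K T. (c *\<^sub>R f) T (param K T y) = p y" if "T \<in> tris" for T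
  proof -
    obtain p where p: "p \<in> poly2 m" "\<forall>y\<in>ref_tri K T. f T (param K T y) = p y"
      using f \<open>T \<in> tris\<close> unfolding scalar_P_def by blast
    show ?thesis by (rule bexI[OF _ subspace_scale[OF subspace_poly2 p(1), of c]]) (use p(2) in \<open>simp add: scaleR_fun_def\<close>)
  qed
  then show "c *\<^sub>R f \<in> scalar_P K m" using f by (auto simp: scalar_P_def supported_def scaleR_fun_def)
qed

definition extend :: "(real^3) set \<Rightarrow> (real^2 \<Rightarrow> real) \<Rightarrow> scalar_field" where
  "extend T0 p = (\<lambda>T x. if T = T0 \<and> x \<in> T0 then p (ref_point K T0 x) else 0)"

lemma extend_param: "T \<in> tris \<Longrightarrow> y \<in> ref_tri K T \<Longrightarrow> extend T0 p T (param K T y) = (if T = T0 then p y else 0)"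
  using param_in[of T y] by (auto simp: extend_def ref_point_param)

lemma extend_linear: "linear (extend T0)"
  by (rule linearI) (auto simp: extend_def fun_eq_iff scaleR_fun_def)

lemma finite_dim_scalar_P: "finite_dim (scalar_P K m)"
proof -
  let ?B = "\<Union>T\<in>tris. extend T ` mono2 ` mono2_index m"
  have "f \<in> span ?B" if f: "f \<in> scalar_P K m" for f
  proof -
    have "\<forall>T\<in>tris. \<exists>p. p \<in> poly2 m \<and> (\<forall>y\<in>ref_tri K T. f T (param K T y) = p y)"
      using f unfolding scalar_P_def by blast
    from bchoice[OF this] obtain p where p: "\<And>T. T \<in> tris \<Longrightarrow> p T \<in> poly2 m"
      "\<And>T y. T \<in> tris \<Longrightarrow> y \<in> ref_tri K T \<Longrightarrow> f T (param K T y) = p T y"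
      by blast
    have app: "(\<Sum>T\<in>A. extend T (p T)) S x = (\<Sum>T\<in>A. extend T (p T) S x)" for A S x
      by (induction A rule: infinite_finite_induct) auto
    have "f = (\<Sum>T\<in>tris. extend T (p T))"
    proof (rule supported_eqI)
      show "supported K f" using f by (simp add: scalar_P_def)
      show "supported K (\<Sum>T\<in>tris. extend T (p T))"
        unfolding supported_def app by (auto intro!: sum.neutral simp: extend_def)
      fix T y assume T: "T \<in> tris" "y \<in> ref_tri K T"
      show "f T (param K T y) = (\<Sum>T\<in>tris. extend T (p T)) T (param K T y)"
        unfolding app extend_param[OF T] using T p(2) finite_tris by simp
    qed
    moreover have "extend T (p T) \<in> span ?B" if "T \<in> tris" for T
    proof -
      have "extend T (p T) \<in> extend T ` span (mono2 ` mono2_index m)" using p(1)[OF that] by (simp add: poly2_span)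
      also have "\<dots> = span (extend T ` mono2 ` mono2_index m)" by (rule linear_span_image[OF extend_linear, symmetric])
      also have "\<dots> \<subseteq> span ?B" using that by (intro span_mono) auto
      finally show ?thesis .
    qed
    ultimately show ?thesis by (simp add: span_sum)
  qed
  then show ?thesis unfolding finite_dim_def using finite_tris finite_mono2_index by (intro exI[of _ ?B]) auto
qed

lemma rot_linear: "linear_map_on (scalar_P K (Suc k)) (rot K)"
proof -
  have "rot K (c *\<^sub>R f + g) = c *\<^sub>R rot K f + rot K g" if f: "f \<in> scalar_P K (Suc k)" and g: "g \<in> scalar_P K (Suc k)" for f g c
  proof (rule supported_eqI[OF supported_rot])
    show "supported K (c *\<^sub>R rot K f + rot K g)"
      using supported_rot[of f] supported_rot[of g] by (auto simp: supported_def scaleR_fun_def)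
    fix T y assume T: "T \<in> tris" and y: "y \<in> ref_tri K T"
    obtain p p1 p2 where p: "p \<in> poly2 (Suc k)" "p1 \<in> poly2 k" "p2 \<in> poly2 k" "grad2 p p1 p2"
      "\<And>y. y \<in> ref_tri K T \<Longrightarrow> f T (param K T y) = p y" by (rule scalar_P_poly[OF f T], rule that)
    obtain q q1 q2 where q: "q \<in> poly2 (Suc k)" "q1 \<in> poly2 k" "q2 \<in> poly2 k" "grad2 q q1 q2"
      "\<And>y. y \<in> ref_tri K T \<Longrightarrow> g T (param K T y) = q y" by (rule scalar_P_poly[OF g T], rule that)
    have a: "rot K f T (param K T y) = (1 / area_factor K T y) *\<^sub>R (D_param K T y *v vector [normal_sign T * p2 y, - normal_sign T * p1 y])"
      by (rule rot_param[OF T y p(4)]) (rule p(5))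
    have b: "rot K g T (param K T y) = (1 / area_factor K T y) *\<^sub>R (D_param K T y *v vector [normal_sign T * q2 y, - normal_sign T * q1 y])"
      by (rule rot_param[OF T y q(4)]) (rule q(5))
    have "rot K (c *\<^sub>R f + g) T (param K T y) = (1 / area_factor K T y) *\<^sub>R (D_param K T y *v
        vector [normal_sign T * (c *\<^sub>R p2 + q2) y, - normal_sign T * (c *\<^sub>R p1 + q1) y])"
      by (rule rot_param[OF T y grad2_lincomb[OF p(4) q(4)]]) (simp add: p(5) q(5) scaleR_fun_def)
    then show "rot K (c *\<^sub>R f + g) T (param K T y) = (c *\<^sub>R rot K f + rot K g) T (param K T y)"
      by (simp add: a b scaleR_fun_def D_param_apply algebra_simps)
  qed
  note * = this
  have 0: "0 \<in> scalar_P K (Suc k)" by (rule subspace_0[OF subspace_scalar_P])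
  have "rot K 0 = 0" using *[OF 0 0, of "-1"] by simp
  then show ?thesis using *[of _ _ 1] *[OF _ 0] by (auto simp: linear_map_on_def)
qed

text \<open>The reference gradient vanishes because the parametrization is an immersion.\<close>
lemma rot_zero_iff:
  assumes f: "f \<in> scalar_P K (Suc k)"
  shows "rot K f = 0 \<longleftrightarrow> (\<forall>T\<in>tris. \<forall>x\<in>T. f T x = f T (vx T 0))"
proof
  assume z: "rot K f = 0"
  show "\<forall>T\<in>tris. \<forall>x\<in>T. f T x = f T (vx T 0)"
  proof (intro ballI)
    fix T x assume T: "T \<in> tris" and x: "x \<in> T"
    obtain y where y: "y \<in> ref_tri K T" "x = param K T y" by (rule tri_pointE[OF T x])
    obtain q q1 q2 where q: "q \<in> poly2 (Suc k)" "q1 \<in> poly2 k" "q2 \<in> poly2 k" "grad2 q q1 q2"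
      "\<And>y. y \<in> ref_tri K T \<Longrightarrow> f T (param K T y) = q y" by (rule scalar_P_poly[OF f T], rule that)
    have "(q has_derivative (\<lambda>h. 0)) (at y within ref_tri K T)" if y: "y \<in> ref_tri K T" for y
    proof -
      have "rot K f T (param K T y) = (1 / area_factor K T y) *\<^sub>R (D_param K T y *v vector [normal_sign T * q2 y, - normal_sign T * q1 y])"
        by (rule rot_param[OF T y q(4)]) (rule q(5))
      then have "D_param K T y *v vector [normal_sign T * q2 y, - normal_sign T * q1 y] = 0"
        using z area_factor_pos[OF T y] by simp
      then have "(vector [normal_sign T * q2 y, - normal_sign T * q1 y] :: real^2) = 0"
        using D_param_nonzero[OF T y] by blast
      then have "q1 y = 0" "q2 y = 0" using unit_normal_eq(1)[OF T] by (auto simp: vec_eq_iff forall_2)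
      moreover have "(q has_derivative (\<lambda>h. q1 y * h$1 + q2 y * h$2)) (at y within ref_tri K T)"
        using q(4) by (auto simp: grad2_def intro: has_derivative_at_withinI)
      ultimately show ?thesis by simp
    qed
    then have "\<exists>c. \<forall>y\<in>ref_tri K T. q y = c" by (intro has_derivative_zero_constant ref_tri_convex) auto
    then have "q y = q (rv T 0)" using y(1) rv_in[OF T, of 0] by auto
    then show "f T x = f T (vx T 0)" unfolding y(2) vx_def using q(5) y(1) rv_in[OF T, of 0] by simp
  qed
next
  assume c: "\<forall>T\<in>tris. \<forall>x\<in>T. f T x = f T (vx T 0)"
  show "rot K f = 0"
  proof (rule supported_eqI[OF supported_rot])
    show "supported K (0 :: vector_field)" by (simp add: supported_def)
    fix T y assume T: "T \<in> tris" and y: "y \<in> ref_tri K T"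
    have "grad2 (\<lambda>_. f T (vx T 0)) 0 0" by (simp add: grad2_def)
    then have "rot K f T (param K T y) = (1 / area_factor K T y) *\<^sub>R (D_param K T y *v vector [normal_sign T * 0 y, - normal_sign T * 0 y])"
      by (rule rot_param[OF T y]) (use c param_in[OF T] T in blast)
    then show "rot K f T (param K T y) = 0 T (param K T y)" by (simp add: D_param_apply)
  qed
qed

end

section \<open>The L2 inner product\<close>

lemma continuous_integrable_on_compact:
  fixes f :: "'a::euclidean_space \<Rightarrow> real"
  assumes "compact S" "continuous_on S f"
  shows "f integrable_on S"
proof -
  have "set_integrable lborel S f"
    using borel_integrable_compact[OF assms] by (simp add: set_integrable_def)
  then show ?thesis by (rule set_borel_integral_eq_integral(1))
qed

text \<open>The function vanishes on small boxes in the interior, and on the rest by continuity since the interior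
  of a convex set is dense in it.\<close>
lemma zero_integral_imp_zero:
  fixes f :: "'a::euclidean_space \<Rightarrow> real"
  assumes S: "compact S" "convex S" "interior S \<noteq> {}" and f: "continuous_on S f" "\<And>x. x \<in> S \<Longrightarrow> f x \<ge> 0"
    and int: "integral S f = 0" and x: "x \<in> S"
  shows "f x = 0"
proof -
  have cl: "closure (interior S) = S"
    using convex_closure_interior[OF S(2,3)] compact_imp_closed[OF S(1)] by simp
  have "f z = 0" if z: "z \<in> interior S" for z
  proof -
    obtain a b where ab: "cbox a b \<subseteq> interior S" "z \<in> box a b"
      by (rule open_contains_cbox[OF open_interior z], rule that)
    then have sub: "cbox a b \<subseteq> S" using interior_subset by blast
    have c: "continuous_on (cbox a b) f" using continuous_on_subset[OF f(1) sub] .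
    have "integral (cbox a b) f \<le> integral S f"
      using sub f continuous_integrable_on_compact[OF S(1) f(1)] continuous_integrable_on_compact[OF compact_cbox c]
      by (intro integral_subset_le) auto
    moreover have "integral (cbox a b) f \<ge> 0"
      using sub f(2) by (intro integral_nonneg continuous_integrable_on_compact[OF compact_cbox c]) auto
    ultimately have "integral (cbox a b) f = 0" using int by simp
    then have h: "(f has_integral 0) (cbox a b)"
      using integrable_integral[OF continuous_integrable_on_compact[OF compact_cbox c]] by simp
    show ?thesis
    proof (rule has_integral_0_cbox_imp_0[OF c _ h])
      show "0 \<le> f x" if "x \<in> box a b" for x using f(2) sub box_subset_cbox that by blast
      show "box a b \<noteq> {}" using ab(2) by blast
      show "z \<in> cbox a b" using ab(2) box_subset_cbox by blast
    qed
  qed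
  then show ?thesis
    using continuous_constant_on_closure[of "interior S" f 0 x] f(1) x unfolding cl by blast
qed

context mesh
begin

lemma vector_P_param:
  assumes "v \<in> vector_P K k" "T \<in> tris"
  obtains p :: "real^2 \<Rightarrow> real^2" where "\<And>i. (\<lambda>y. p y $ i) \<in> poly2 k"
    "\<And>y. y \<in> ref_tri K T \<Longrightarrow> v T (param K T y) = (1 / area_factor K T y) *\<^sub>R (D_param K T y *v p y)"
  using assms unfolding vector_P_def by blast

lemma vector_P_continuous:
  assumes "v \<in> vector_P K k" "T \<in> tris"
  shows "continuous_on (ref_tri K T) (\<lambda>y. v T (param K T y))"
proof -
  obtain p :: "real^2 \<Rightarrow> real^2" where p: "\<And>i. (\<lambda>y. p y $ i) \<in> poly2 k"
    "\<And>y. y \<in> ref_tri K T \<Longrightarrow> v T (param K T y) = (1 / area_factor K T y) *\<^sub>R (D_param K T y *v p y)"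
    by (rule vector_P_param[OF assms], rule that)
  have c: "continuous_on (ref_tri K T) (\<lambda>y. p y $ i)" for i by (rule poly2_continuous[OF p(1)])
  have a: "area_factor K T y \<noteq> 0" if "y \<in> ref_tri K T" for y using area_factor_pos[OF assms(2) that] by simp
  have "continuous_on (ref_tri K T) (\<lambda>y. (1 / area_factor K T y) *\<^sub>R (p y $ 1 *\<^sub>R tA T y + p y $ 2 *\<^sub>R tB T y))"
    by (intro continuous_intros c tangent_continuous[OF assms(2)] area_factor_continuous[OF assms(2)]) (use a in blast)
  then show ?thesis by (rule continuous_on_eq) (simp add: p(2) D_param_apply)
qed

lemma L2_integrand_continuous:
  assumes "v \<in> vector_P K k" "w \<in> vector_P K k" "T \<in> tris"
  shows "continuous_on (ref_tri K T) (\<lambda>y. (v T (param K T y) \<bullet> w T (param K T y)) * area_factor K T y)"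
  using assms by (intro continuous_intros vector_P_continuous area_factor_continuous)

lemma L2_integrable:
  assumes "v \<in> vector_P K k" "w \<in> vector_P K k" "T \<in> tris"
  shows "(\<lambda>y. (v T (param K T y) \<bullet> w T (param K T y)) * area_factor K T y) integrable_on ref_tri K T"
  using continuous_integrable_on_compact[OF ref_tri_compact[OF assms(3)] L2_integrand_continuous[OF assms]] .

lemma subspace_vector_P: "subspace (vector_P K k)"
proof (rule subspaceI)
  show "0 \<in> vector_P K k"
    using subspace_0[OF subspace_poly2[of k]] by (auto simp: vector_P_def supported_def zero_fun_def intro!: exI[of _ "\<lambda>_. 0"])
next
  fix v w assume v: "v \<in> vector_P K k" and w: "w \<in> vector_P K k"
  have "\<exists>p :: real^2 \<Rightarrow> real^2. (\<forall>i. (\<lambda>y. p y $ i) \<in> poly2 k) \<and>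
      (\<forall>y\<in>ref_tri K T. (v + w) T (param K T y) = (1 / area_factor K T y) *\<^sub>R (D_param K T y *v p y))" if T: "T \<in> tris" for T
  proof -
    obtain p :: "real^2 \<Rightarrow> real^2" where p: "\<And>i. (\<lambda>y. p y $ i) \<in> poly2 k"
      "\<And>y. y \<in> ref_tri K T \<Longrightarrow> v T (param K T y) = (1 / area_factor K T y) *\<^sub>R (D_param K T y *v p y)"
      by (rule vector_P_param[OF v T], rule that)
    obtain q :: "real^2 \<Rightarrow> real^2" where q: "\<And>i. (\<lambda>y. q y $ i) \<in> poly2 k"
      "\<And>y. y \<in> ref_tri K T \<Longrightarrow> w T (param K T y) = (1 / area_factor K T y) *\<^sub>R (D_param K T y *v q y)"
      by (rule vector_P_param[OF w T], rule that)
    have "(\<lambda>y. (p y + q y) $ i) \<in> poly2 k" for i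
      using subspace_add[OF subspace_poly2 p(1)[of i] q(1)[of i]] by (simp add: plus_fun_def)
    then show ?thesis
      by (intro exI[of _ "\<lambda>y. p y + q y"]) (simp add: p(2) q(2) matrix_vector_right_distrib scaleR_add_right)
  qed
  then show "v + w \<in> vector_P K k" using v w by (auto simp: vector_P_def supported_def)
next
  fix c :: real and v assume v: "v \<in> vector_P K k"
  have "\<exists>p :: real^2 \<Rightarrow> real^2. (\<forall>i. (\<lambda>y. p y $ i) \<in> poly2 k) \<and>
      (\<forall>y\<in>ref_tri K T. (c *\<^sub>R v) T (param K T y) = (1 / area_factor K T y) *\<^sub>R (D_param K T y *v p y))" if T: "T \<in> tris" for T
  proof -
    obtain p :: "real^2 \<Rightarrow> real^2" where p: "\<And>i. (\<lambda>y. p y $ i) \<in> poly2 k"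
      "\<And>y. y \<in> ref_tri K T \<Longrightarrow> v T (param K T y) = (1 / area_factor K T y) *\<^sub>R (D_param K T y *v p y)"
      by (rule vector_P_param[OF v T], rule that)
    have "(\<lambda>y. (c *\<^sub>R p y) $ i) \<in> poly2 k" for i
      using subspace_scale[OF subspace_poly2 p(1)[of i], of c] by (simp add: scaleR_fun_def)
    then show ?thesis
      by (intro exI[of _ "\<lambda>y. c *\<^sub>R p y"]) (simp add: p(2) matrix_vector_mult_scaleR scaleR_fun_def)
  qed
  then show "c *\<^sub>R v \<in> vector_P K k" using v by (auto simp: vector_P_def supported_def scaleR_fun_def)
qed

text \<open>Definiteness holds because the traces of a piecewise polynomial field are continuous up to the edges
  and the fields are normalized to be zero off the triangles.\<close>
theorem L2_inner_product: "inner_product_on (vector_P K k) (L2_inner K)"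
  unfolding inner_product_on_def
proof (intro conjI ballI allI impI subspace_vector_P)
  fix v w z assume P: "v \<in> vector_P K k" "w \<in> vector_P K k" "z \<in> vector_P K k"
  have "integral (ref_tri K T) (\<lambda>y. ((v + w) T (param K T y) \<bullet> z T (param K T y)) * area_factor K T y) =
      integral (ref_tri K T) (\<lambda>y. (v T (param K T y) \<bullet> z T (param K T y)) * area_factor K T y) +
      integral (ref_tri K T) (\<lambda>y. (w T (param K T y) \<bullet> z T (param K T y)) * area_factor K T y)" if "T \<in> tris" for T
    unfolding Henstock_Kurzweil_Integration.integral_add[OF L2_integrable[OF P(1,3) that] L2_integrable[OF P(2,3) that], symmetric]
    by (simp add: inner_add_left distrib_right)
  then show "L2_inner K (v + w) z = L2_inner K v z + L2_inner K w z"
    by (simp add: L2_inner_def surface_integral_def sum.distrib)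
next
  fix c :: real and v w
  show "L2_inner K (c *\<^sub>R v) w = c * L2_inner K v w"
    by (simp add: L2_inner_def surface_integral_def sum_distrib_left scaleR_fun_def mult.assoc)
next
  fix v w show "L2_inner K v w = L2_inner K w v" by (simp add: L2_inner_def inner_commute)
next
  fix v assume v: "v \<in> vector_P K k" and z: "L2_inner K v v = 0"
  let ?f = "\<lambda>T y. (v T (param K T y) \<bullet> v T (param K T y)) * area_factor K T y"
  have nn: "?f T y \<ge> 0" if "T \<in> tris" "y \<in> ref_tri K T" for T y
    using area_factor_pos[OF that] by simp
  have "integral (ref_tri K T) (?f T) \<ge> 0" if "T \<in> tris" for T
    using nn[OF that] by (intro integral_nonneg L2_integrable[OF v v that])
  moreover have "(\<Sum>T\<in>tris. integral (ref_tri K T) (?f T)) = 0" using z by (simp add: L2_inner_def surface_integral_def)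
  ultimately have int: "integral (ref_tri K T) (?f T) = 0" if "T \<in> tris" for T
    using that finite_tris by (simp add: sum_nonneg_eq_0_iff)
  show "v = 0"
  proof (rule supported_eqI)
    show "supported K v" using v by (simp add: vector_P_def)
    show "supported K (0 :: vector_field)" by (simp add: supported_def)
    fix T y assume T: "T \<in> tris" and y: "y \<in> ref_tri K T"
    have "?f T y = 0"
      by (rule zero_integral_imp_zero[OF ref_tri_compact[OF T] ref_tri_convex ref_tri_interior[OF T]
            L2_integrand_continuous[OF v v T] nn[OF T] int[OF T] y])
    then show "v T (param K T y) = 0 T (param K T y)" using area_factor_pos[OF T y] by simp
  qed
qed

lemma subspace_BDM0: "subspace (BDM0 K k)"
proof -
  let ?F = "\<lambda>v E x. \<Sum>T\<in>{T\<in>tris. E \<in> edges K T}. v T x \<bullet> conormal K T E x"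
  have 0: "?F 0 E x = 0" for E x by simp
  have add: "?F (v + w) E x = ?F v E x + ?F w E x" for v w E x by (simp add: inner_add_left sum.distrib)
  have scale: "?F (c *\<^sub>R v) E x = c * ?F v E x" for c v E x by (simp add: scaleR_fun_def sum_distrib_left)
  show ?thesis
  proof (rule subspaceI)
    show "0 \<in> BDM0 K k" unfolding BDM0_iff using subspace_0[OF subspace_vector_P] 0 by blast
  next
    fix v w assume "v \<in> BDM0 K k" "w \<in> BDM0 K k"
    then show "v + w \<in> BDM0 K k" unfolding BDM0_iff add using subspace_add[OF subspace_vector_P] by simp
  next
    fix c :: real and v assume "v \<in> BDM0 K k"
    then show "c *\<^sub>R v \<in> BDM0 K k" unfolding BDM0_iff scale using subspace_scale[OF subspace_vector_P] by simp
  qed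
qed

section \<open>The dimension of the discrete harmonic fields\<close>

text \<open>These are the continuous potentials that vanish on the boundary.\<close>
definition conforming_potentials :: "nat \<Rightarrow> scalar_field set" where
  "conforming_potentials k = {f \<in> potentials k. \<forall>E\<in>all_edges K. jump f E 0 = 0}"

definition jumps :: "scalar_field \<Rightarrow> (real^3) set \<Rightarrow> real" where
  "jumps f = (\<lambda>E. if E \<in> all_edges K then jump f E 0 else 0)"

definition piecewise_const :: "((real^3) set \<Rightarrow> real) \<Rightarrow> scalar_field" where
  "piecewise_const c = (\<lambda>T x. if T \<in> tris \<and> x \<in> T then c T else 0)"

lemma jump_add: "jump (f + g) E u = jump f E u + jump g E u"
  by (simp add: jump_def distrib_left sum.distrib)

lemma jump_scale: "jump (c *\<^sub>R f) E u = c * jump f E u"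
  by (simp add: jump_def scaleR_fun_def sum_distrib_left mult.left_commute)

lemma subspace_potentials: "subspace (potentials k)"
proof (rule subspaceI)
  show "0 \<in> potentials k" using subspace_0[OF subspace_scalar_P] by (simp add: potentials_def jump_def)
next
  fix f g assume "f \<in> potentials k" "g \<in> potentials k"
  then show "f + g \<in> potentials k"
    unfolding potentials_def mem_Collect_eq jump_add using subspace_add[OF subspace_scalar_P] by metis
next
  fix c :: real and f assume "f \<in> potentials k"
  then show "c *\<^sub>R f \<in> potentials k"
    unfolding potentials_def mem_Collect_eq jump_scale using subspace_scale[OF subspace_scalar_P] by metis
qed

lemma potentials_scalar_P: "potentials k \<subseteq> scalar_P K (Suc k)" by (auto simp: potentials_def)

lemma jumps_linear: "linear_map_on S jumps"
  unfolding linear_map_on_def jumps_def jump_add jump_scale by (auto simp: fun_eq_iff scaleR_fun_def)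

lemma conforming_potentials_kernel: "conforming_potentials k = {f \<in> potentials k. jumps f = 0}"
  by (auto simp: conforming_potentials_def jumps_def fun_eq_iff)

lemma edge_point:
  assumes "T \<in> tris" "E \<in> edges K T" "u \<in> {0..1}"
  shows "edge_map E u \<in> E" "edge_map E u \<in> T"
proof -
  have "E \<in> all_edges K" using assms by (auto simp: all_edges_def)
  then show "edge_map E u \<in> E" using edge_image assms(3) by blast
  then show "edge_map E u \<in> T" using edge_subset_tri assms by blast
qed

lemma osign_outside: "T \<in> tris \<Longrightarrow> E \<notin> edges K T \<Longrightarrow> osign T E = 0"
  by (rule sign_outside)

lemma piecewise_const_jump: "u \<in> {0..1} \<Longrightarrow> jump (piecewise_const c) E u = (\<Sum>T\<in>tris. real_of_int (osign T E) * c T)"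
  unfolding jump_def
proof (intro sum.cong refl)
  fix T assume "T \<in> tris" "u \<in> {0..1}"
  then show "real_of_int (osign T E) * piecewise_const c T (edge_map E u) = real_of_int (osign T E) * c T"
    using edge_point(2)[of T E u] osign_outside[of T E] by (cases "E \<in> edges K T") (simp_all add: piecewise_const_def)
qed

lemma piecewise_const_potential: "piecewise_const c \<in> potentials k"
proof -
  have "\<exists>p\<in>poly2 (Suc k). \<forall>y\<in>ref_tri K T. piecewise_const c T (param K T y) = p y" if "T \<in> tris" for T
    by (rule bexI[OF _ poly2_const[of "c T"]]) (simp add: piecewise_const_def that param_in)
  then have "piecewise_const c \<in> scalar_P K (Suc k)" by (simp add: scalar_P_def supported_def piecewise_const_def)
  then show ?thesis unfolding potentials_def using piecewise_const_jump by simp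
qed

lemma vx_in: "T \<in> tris \<Longrightarrow> vx T 0 \<in> T"
  using rv_in[of T 0] param_in by (simp add: vx_def)

lemma rot_kernel: "{f \<in> potentials k. rot K f = 0} = piecewise_const ` functions_on tris"
proof (intro equalityI subsetI)
  fix f assume "f \<in> {f \<in> potentials k. rot K f = 0}"
  then have f: "f \<in> scalar_P K (Suc k)" "rot K f = 0" using potentials_scalar_P by auto
  then have c: "f T x = f T (vx T 0)" if "T \<in> tris" "x \<in> T" for T x using rot_zero_iff that by blast
  define d where "d T = (if T \<in> tris then f T (vx T 0) else 0)" for T
  have "f = piecewise_const d"
  proof (intro ext)
    fix T x show "f T x = piecewise_const d T x"
      using f(1) c[of T x] by (auto simp: piecewise_const_def d_def scalar_P_def supported_def)
  qed
  moreover have "d \<in> functions_on tris" by (simp add: d_def functions_on_def)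
  ultimately show "f \<in> piecewise_const ` functions_on tris" by blast
next
  fix f assume "f \<in> piecewise_const ` functions_on tris"
  then obtain c where c: "f = piecewise_const c" by blast
  have "f \<in> potentials k" unfolding c by (rule piecewise_const_potential)
  moreover have "rot K f = 0"
    using rot_zero_iff[OF subsetD[OF potentials_scalar_P \<open>f \<in> potentials k\<close>]] vx_in by (simp add: c piecewise_const_def)
  ultimately show "f \<in> {f \<in> potentials k. rot K f = 0}" by blast
qed

lemma piecewise_const_linear: "linear_map_on S piecewise_const"
  by (auto simp: linear_map_on_def piecewise_const_def fun_eq_iff scaleR_fun_def)

lemma piecewise_const_injective: "c \<in> functions_on tris \<Longrightarrow> piecewise_const c = 0 \<Longrightarrow> c = 0"
proof
  fix T assume c: "c \<in> functions_on tris" "piecewise_const c = 0"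
  show "c T = 0 T"
  proof (cases "T \<in> tris")
    case True
    then have "piecewise_const c T (vx T 0) = c T" using vx_in by (simp add: piecewise_const_def)
    then show ?thesis using c(2) by simp
  qed (use c(1) in \<open>simp add: functions_on_def\<close>)
qed

lemma rot_kernel_conforming: "{f \<in> conforming_potentials k. rot K f = 0} = piecewise_const ` cycles2"
proof -
  have "piecewise_const c \<in> conforming_potentials k \<longleftrightarrow> (\<forall>E\<in>all_edges K. (\<Sum>T\<in>tris. real_of_int (osign T E) * c T) = 0)" for c
    using piecewise_const_potential piecewise_const_jump[of 0] by (simp add: conforming_potentials_def)
  then have "cycles2 = {c \<in> functions_on tris. piecewise_const c \<in> conforming_potentials k}"
    unfolding cycles2_def by simp
  moreover have "{f \<in> conforming_potentials k. rot K f = 0} = {f \<in> piecewise_const ` functions_on tris. f \<in> conforming_potentials k}"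
    unfolding rot_kernel[of k, symmetric] by (auto simp: conforming_potentials_def)
  ultimately show ?thesis by auto
qed

text \<open>Along an edge, the piecewise linear interpolant of vertex values interpolates the jumps of the
  vertex values.\<close>
lemma affine_interpolation:
  assumes T: "T \<in> tris"
  obtains A B C :: real where "\<And>i. i \<le> 2 \<Longrightarrow> A + B * rv T i $ 1 + C * rv T i $ 2 = g (vx T i)"
proof -
  let ?a = "rv T 1 - rv T 0" and ?b = "rv T 2 - rv T 0"
  define d where "d = det2 ?a ?b"
  have d: "d \<noteq> 0" unfolding d_def using det2_basis_nonzero rv_independent[OF T] by blast
  define p q where "p = g (vx T 1) - g (vx T 0)" and "q = g (vx T 2) - g (vx T 0)"
  define B where "B = (?b$2 * p - ?a$2 * q) / d"
  define C where "C = (?a$1 * q - ?b$1 * p) / d"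
  define A where "A = g (vx T 0) - B * rv T 0 $ 1 - C * rv T 0 $ 2"
  have "B * ?a$1 + C * ?a$2 = (d * p) / d" "B * ?b$1 + C * ?b$2 = (d * q) / d"
    unfolding B_def C_def by (simp_all add: add_divide_distrib[symmetric] d_def det2_def algebra_simps)
  then have "B * ?a$1 + C * ?a$2 = p" "B * ?b$1 + C * ?b$2 = q" using d by simp_all
  then have "A + B * rv T i $ 1 + C * rv T i $ 2 = g (vx T i)" if "i \<in> {0, 1, 2}" for i
    using that by (auto simp: A_def p_def q_def algebra_simps)
  moreover have "i \<in> {0, 1, 2}" if "i \<le> 2" for i :: nat using that by auto
  ultimately show ?thesis by (intro that[of A B C]) simp
qed

text \<open>The jumps of a potential form a cycle since they may be evaluated at both ends of an edge. Conversely,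
  vertex values with the jumps prescribed by a cycle exist at every vertex, and their piecewise linear
  interpolant has constant jumps along the edges.\<close>
lemma jumps_image: "jumps ` potentials k = cycles1"
proof (intro equalityI subsetI)
  fix c assume "c \<in> jumps ` potentials k"
  then obtain f where f: "f \<in> potentials k" "c = jumps f" by blast
  show "c \<in> cycles1"
  proof (rule jumps_are_cycles)
    show "c \<in> functions_on (all_edges K)" by (simp add: f(2) functions_on_def jumps_def)
    fix E z assume E: "E \<in> all_edges K" and z: "z \<in> {edge_tail E, edge_head E}"
    have "(1::real) \<in> {0..1}" by simp
    then have "jump f E 1 = jump f E 0" using f(1) E unfolding potentials_def by blast
    then show "c E = (\<Sum>T\<in>tris. real_of_int (osign T E) * f T z)"
      using z E by (auto simp: f(2) jumps_def jump_def edge_tail_def edge_head_def)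
  qed
next
  fix c assume c: "c \<in> cycles1"
  have "\<forall>z\<in>all_verts K. \<exists>w. \<forall>E\<in>all_edges K. z \<in> {edge_tail E, edge_head E} \<longrightarrow> (\<Sum>T\<in>tris. real_of_int (osign T E) * w T) = c E"
    using cycles_are_jumps[OF c] by blast
  from bchoice[OF this] obtain w where w: "\<And>z E. z \<in> all_verts K \<Longrightarrow> E \<in> all_edges K \<Longrightarrow> z \<in> {edge_tail E, edge_head E} \<Longrightarrow>
      (\<Sum>T\<in>tris. real_of_int (osign T E) * w z T) = c E" by blast
  have "\<forall>T\<in>tris. \<exists>A B C :: real. \<forall>i\<le>2. A + B * rv T i $ 1 + C * rv T i $ 2 = w (vx T i) T"
  proof
    fix T assume T: "T \<in> tris"
    obtain A B C :: real where "\<And>i. i \<le> 2 \<Longrightarrow> A + B * rv T i $ 1 + C * rv T i $ 2 = w (vx T i) T"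
      by (rule affine_interpolation[OF T, of "\<lambda>z. w z T"], rule that)
    then show "\<exists>A B C :: real. \<forall>i\<le>2. A + B * rv T i $ 1 + C * rv T i $ 2 = w (vx T i) T" by blast
  qed
  then obtain A B C :: "(real^3) set \<Rightarrow> real" where
    ABC: "\<And>T i. T \<in> tris \<Longrightarrow> i \<le> 2 \<Longrightarrow> A T + B T * rv T i $ 1 + C T * rv T i $ 2 = w (vx T i) T"
    by metis
  define p where "p T y = A T + B T * y$1 + C T * y$2" for T and y :: "real^2"
  define f where "f T x = (if T \<in> tris \<and> x \<in> T then p T (ref_point K T x) else 0)" for T x
  have fp: "f T (param K T y) = p T y" if "T \<in> tris" "y \<in> ref_tri K T" for T y
    using that by (simp add: f_def param_in ref_point_param)
  have "p T \<in> poly2 (Suc k)" for T unfolding p_def by (rule poly2_affine)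
  then have fP: "f \<in> scalar_P K (Suc k)"
    unfolding scalar_P_def using fp by (auto simp: supported_def f_def)
  have edge_val: "f T (edge_map E u) = (1 - u) * w (edge_tail E) T + u * w (edge_head E) T"
    if T: "T \<in> tris" "E \<in> edges K T" and u: "u \<in> {0..1}" for T E u
  proof -
    obtain i j where ij: "i < j" "j \<le> 2" "E = eg T i j" using T edges_iff by blast
    have in_R: "linepath (rv T i) (rv T j) u \<in> ref_tri K T"
      using seg_ref[OF T(1), of i j] ij linepath_in_path[of u "rv T i" "rv T j"] u by auto
    have "f T (edge_map E u) = p T (linepath (rv T i) (rv T j) u)"
      using edge_map[OF T(1) ij(1,2) u] fp[OF T(1) in_R] ij(3) by simp
    also have "\<dots> = (1 - u) * p T (rv T i) + u * p T (rv T j)" by (simp add: p_def linepath_def algebra_simps)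
    also have "\<dots> = (1 - u) * w (edge_tail E) T + u * w (edge_head E) T"
      using ABC[OF T(1), of i] ABC[OF T(1), of j] ij edge_ends[OF T(1) ij(1,2)] by (simp add: p_def)
    finally show ?thesis .
  qed
  have jump_f: "jump f E u = c E" if E: "E \<in> all_edges K" and u: "u \<in> {0..1}" for E u
  proof -
    have "jump f E u = (\<Sum>T\<in>tris. (1 - u) * (real_of_int (osign T E) * w (edge_tail E) T) + u * (real_of_int (osign T E) * w (edge_head E) T))"
      unfolding jump_def
    proof (intro sum.cong refl)
      fix T assume T: "T \<in> tris"
      show "real_of_int (osign T E) * f T (edge_map E u) =
          (1 - u) * (real_of_int (osign T E) * w (edge_tail E) T) + u * (real_of_int (osign T E) * w (edge_head E) T)"
      proof (cases "E \<in> edges K T")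
        case True
        show ?thesis unfolding edge_val[OF T True u] by (simp add: algebra_simps)
      next
        case False
        then show ?thesis by (simp add: osign_outside[OF T])
      qed
    qed
    also have "\<dots> = (1 - u) * (\<Sum>T\<in>tris. real_of_int (osign T E) * w (edge_tail E) T) + u * (\<Sum>T\<in>tris. real_of_int (osign T E) * w (edge_head E) T)"
      by (simp add: sum.distrib sum_distrib_left)
    also have "(\<Sum>T\<in>tris. real_of_int (osign T E) * w (edge_tail E) T) = c E"
      using E edge_ends_verts by (intro w) (auto simp: all_edges_def all_verts_def)
    also have "(\<Sum>T\<in>tris. real_of_int (osign T E) * w (edge_head E) T) = c E"
      using E edge_ends_verts by (intro w) (auto simp: all_edges_def all_verts_def)
    finally show ?thesis by (simp add: algebra_simps)
  qed
  have "jump f E u = jump f E 0" if "E \<in> all_edges K" "u \<in> {0..1}" for E u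
    using jump_f[OF that] jump_f[OF that(1), of 0] by simp
  then have "f \<in> potentials k" unfolding potentials_def using fP by blast
  moreover have "c = jumps f"
  proof
    fix E show "c E = jumps f E"
      using jump_f[of E 0] c by (simp add: jumps_def cycles1_def functions_on_def)
  qed
  ultimately show "c \<in> jumps ` potentials k" by blast
qed

lemma finite_dim_potentials: "finite_dim (potentials k)"
  using finite_dim_subset[OF finite_dim_scalar_P potentials_scalar_P] .

lemma rot_linear_potentials: "S \<subseteq> potentials k \<Longrightarrow> linear_map_on S (rot K)"
  using linear_map_on_subset[OF rot_linear] potentials_scalar_P by blast

lemma subspace_conforming_potentials: "subspace (conforming_potentials k)"
  unfolding conforming_potentials_kernel by (rule linear_map_on_kernel[OF subspace_potentials jumps_linear])

lemma conforming_potentials_subset: "conforming_potentials k \<subseteq> potentials k"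
  by (auto simp: conforming_potentials_def)

lemma J_BDM_subspace: "subspace (J_BDM K k)" and J_BDM_finite_dim: "finite_dim (J_BDM K k)"
  unfolding J_BDM_potentials
  using linear_map_on_image[OF subspace_potentials rot_linear_potentials[OF order_refl]]
    rank_nullity(1)[OF subspace_potentials finite_dim_potentials rot_linear_potentials[OF order_refl]] by blast+

text \<open>Rank-nullity for \<open>rot\<close> on all potentials, for \<open>jumps\<close>, and for \<open>rot\<close> on the conforming potentials.\<close>
theorem dim_J_BDM_minus_rot:
  "dim (J_BDM K k) + card tris = dim (rot K ` conforming_potentials k) + card closed_classes + dim cycles1"
proof -
  have fin: "finite_dim (conforming_potentials k)"
    using finite_dim_subset[OF finite_dim_potentials conforming_potentials_subset] .
  have 1: "dim (potentials k) = dim {f \<in> potentials k. rot K f = 0} + dim (J_BDM K k)"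
    unfolding J_BDM_potentials
    by (rule rank_nullity(2)[OF subspace_potentials finite_dim_potentials rot_linear_potentials[OF order_refl]])
  have 2: "dim (potentials k) = dim (conforming_potentials k) + dim cycles1"
    unfolding conforming_potentials_kernel jumps_image[of k, symmetric]
    by (rule rank_nullity(2)[OF subspace_potentials finite_dim_potentials jumps_linear])
  have 3: "dim (conforming_potentials k) = dim {f \<in> conforming_potentials k. rot K f = 0} + dim (rot K ` conforming_potentials k)"
    by (rule rank_nullity(2)[OF subspace_conforming_potentials fin rot_linear_potentials[OF conforming_potentials_subset]])
  have 4: "dim {f \<in> potentials k. rot K f = 0} = card tris"
    unfolding rot_kernel using functions_on_dim[OF finite_tris] piecewise_const_injective
      dim_injective_image[OF subspace_functions_on functions_on_dim(1)[OF finite_tris] piecewise_const_linear] by simp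
  have "cycles2 \<subseteq> functions_on tris" by (auto simp: cycles2_def)
  moreover have "subspace cycles2"
  proof -
    have "cycles2 = {x \<in> functions_on tris. (\<lambda>E. if E \<in> all_edges K then \<Sum>T\<in>tris. real_of_int (osign T E) * x T else 0) = 0}"
      by (auto simp: cycles2_def fun_eq_iff)
    also have "subspace \<dots>"
      by (rule linear_map_on_kernel[OF subspace_functions_on])
        (auto simp: linear_map_on_def fun_eq_iff scaleR_fun_def distrib_left sum.distrib sum_distrib_left mult.left_commute)
    finally show ?thesis .
  qed
  ultimately have 5: "dim {f \<in> conforming_potentials k. rot K f = 0} = card closed_classes"
    unfolding rot_kernel_conforming dim_cycles2[symmetric]
    using piecewise_const_injective finite_dim_subset[OF functions_on_dim(1)[OF finite_tris]]
    by (intro dim_injective_image piecewise_const_linear) auto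
  show ?thesis using 1 2 3 4 5 by simp
qed

subsection \<open>Lagrange elements and conforming potentials\<close>

lemma conforming_jump_zero:
  assumes "f \<in> conforming_potentials k" "E \<in> all_edges K" "u \<in> {0..1}"
  shows "jump f E u = 0"
proof -
  have "jump f E u = jump f E 0" using assms unfolding conforming_potentials_def potentials_def by blast
  then show ?thesis using assms(1,2) by (simp add: conforming_potentials_def)
qed

text \<open>Two triangles that meet in a single vertex are connected by triangles around this vertex, each of which
  has a common edge with the next.\<close>
lemma conforming_continuous:
  assumes f: "f \<in> conforming_potentials k" and T: "T \<in> tris" "T' \<in> tris" "x \<in> T" "x \<in> T'"
  shows "f T x = f T' x"
proof -
  have shared: "f A x = f B x" if AB: "A \<in> tris" "B \<in> tris" "A \<noteq> B" "E \<in> edges K A" "E \<in> edges K B" "x \<in> E" for A B E x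
  proof -
    have E: "E \<in> all_edges K" using AB(1,4) by (auto simp: all_edges_def)
    obtain u where u: "u \<in> {0..1}" "x = edge_map E u" using AB(6) edge_image[OF E] by blast
    have "real_of_int (osign A E) * (f A x - f B x) = 0"
      using conforming_jump_zero[OF f E u(1)] jump_shared[OF AB(1-5), of "\<lambda>T. f T x"] by (simp add: jump_def u(2))
    then show ?thesis using sign[OF AB(1,4)] by auto
  qed
  show ?thesis
  proof (cases "T = T'")
    case False
    consider z where "z \<in> verts K T" "T \<inter> T' = {z}" | "T \<inter> T' \<in> edges K T \<inter> edges K T'"
      using conform[OF T(1,2) False] T(3,4) by blast
    then show ?thesis
    proof cases
      case 1
      have "x \<in> T \<inter> T'" using T(3,4) by blast
      then have "x \<in> all_verts K" using 1 T(1) by (auto simp: all_verts_def)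
      moreover have "surface_like K" using triangulation by (simp add: oriented_triangulation_def)
      ultimately have "(T, T') \<in> {(A, B). A \<in> tris \<and> B \<in> tris \<and> x \<in> A \<inter> B \<and> A \<inter> B \<in> edges K A \<inter> edges K B}\<^sup>*"
        using T unfolding surface_like_def by blast
      then show ?thesis
      proof induction
        case (step A B)
        then have "f A x = f B x" using shared[of A B "A \<inter> B" x] by (cases "A = B") auto
        then show ?case using step.IH by simp
      qed simp
    next
      case 2
      then show ?thesis using shared[OF T(1,2) False, of "T \<inter> T'" x] T(3,4) by blast
    qed
  qed simp
qed

lemma conforming_boundary:
  assumes f: "f \<in> conforming_potentials k" and T: "T \<in> tris" "x \<in> T" "x \<in> mesh_boundary K"
  shows "f T x = 0"
proof -
  obtain E where E: "E \<in> boundary_edges K" "x \<in> E" using T(3) by (auto simp: mesh_boundary_def)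
  then obtain A where A: "A \<in> tris" "E \<in> edges K A" "\<And>B. B \<in> tris \<Longrightarrow> E \<in> edges K B \<Longrightarrow> B = A"
    unfolding boundary_edges_def by blast
  have EE: "E \<in> all_edges K" using E(1) by (simp add: boundary_edges_def)
  obtain u where u: "u \<in> {0..1}" "x = edge_map E u" using E(2) edge_image[OF EE] by blast
  have "real_of_int (osign A E) * f A x = 0"
    using conforming_jump_zero[OF f EE u(1)] jump_free[OF A(1,2), of "\<lambda>T. f T x"] A(3) by (auto simp: jump_def u(2))
  then have "f A x = 0" using sign[OF A(1,2)] by auto
  moreover have "x \<in> A" using edge_subset_tri[OF A(1,2)] E(2) by blast
  ultimately show ?thesis using conforming_continuous[OF f T(1) A(1) T(2)] by simp
qed

lemma lagrange_conforming:
  assumes f: "f \<in> lagrange0 K (Suc k)"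
  shows "f \<in> conforming_potentials k"
proof -
  have f': "f \<in> scalar_P K (Suc k) \<and> (\<forall>A\<in>tris. \<forall>B\<in>tris. \<forall>x \<in> A \<inter> B. f A x = f B x) \<and>
     (if mesh_boundary K \<noteq> {} then \<forall>A\<in>tris. \<forall>x \<in> A \<inter> mesh_boundary K. f A x = 0 else surface_integral K f = 0)"
    using f unfolding lagrange0_def mem_Collect_eq .
  then have fP: "f \<in> scalar_P K (Suc k)" and cont: "\<And>A B x. A \<in> tris \<Longrightarrow> B \<in> tris \<Longrightarrow> x \<in> A \<inter> B \<Longrightarrow> f A x = f B x" by blast+
  have bd: "f A x = 0" if "A \<in> tris" "x \<in> A" "x \<in> mesh_boundary K" for A x
  proof -
    have "mesh_boundary K \<noteq> {}" using that(3) by blast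
    from f'[unfolded if_P[OF this]] show ?thesis using that by blast
  qed
  have z: "jump f E u = 0" if E: "E \<in> all_edges K" and u: "u \<in> {0..1}" for E u
  proof -
    obtain T where T: "T \<in> tris" "E \<in> edges K T" using E by (auto simp: all_edges_def)
    let ?x = "edge_map E u"
    show ?thesis
    proof (cases "\<exists>T'\<in>tris. T' \<noteq> T \<and> E \<in> edges K T'")
      case True
      then obtain T' where T': "T' \<in> tris" "T \<noteq> T'" "E \<in> edges K T'" by blast
      have "f T ?x = f T' ?x" using cont[OF T(1) T'(1)] edge_point(2)[OF T u] edge_point(2)[OF T'(1,3) u] by blast
      then show ?thesis
        unfolding jump_def using jump_shared[OF T(1) T'(1,2) T(2) T'(3), of "\<lambda>T. f T ?x"] by simp
    next
      case False
      have "\<exists>!T. T \<in> tris \<and> E \<in> edges K T" using False T by blast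
      then have "E \<in> boundary_edges K" using E by (simp add: boundary_edges_def)
      then have "?x \<in> mesh_boundary K" using edge_point(1)[OF T u] by (auto simp: mesh_boundary_def)
      then have "f T ?x = 0" using bd[OF T(1) edge_point(2)[OF T u]] by blast
      then show ?thesis
        unfolding jump_def using jump_free[OF T, of "\<lambda>T. f T ?x"] False by auto
    qed
  qed
  then have "\<forall>E\<in>all_edges K. \<forall>u\<in>{0..1}. jump f E u = jump f E 0" by simp
  then show ?thesis using fP z unfolding conforming_potentials_def potentials_def by auto
qed

lemma scalar_P_integrable:
  assumes "f \<in> scalar_P K (Suc k)" "T \<in> tris"
  shows "continuous_on (ref_tri K T) (\<lambda>y. f T (param K T y) * area_factor K T y)"
    "(\<lambda>y. f T (param K T y) * area_factor K T y) integrable_on ref_tri K T"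
proof -
  obtain q where q: "q \<in> poly2 (Suc k)" "\<And>y. y \<in> ref_tri K T \<Longrightarrow> f T (param K T y) = q y"
    using assms unfolding scalar_P_def by blast
  have "continuous_on (ref_tri K T) (\<lambda>y. f T (param K T y))"
    using poly2_continuous[OF q(1), of "ref_tri K T"] q(2) by (simp cong: continuous_on_cong)
  then show 1: "continuous_on (ref_tri K T) (\<lambda>y. f T (param K T y) * area_factor K T y)"
    by (intro continuous_intros area_factor_continuous[OF assms(2)])
  show "(\<lambda>y. f T (param K T y) * area_factor K T y) integrable_on ref_tri K T"
    by (rule continuous_integrable_on_compact[OF ref_tri_compact[OF assms(2)] 1])
qed

lemma surface_integral_add_scaled:
  assumes "f \<in> scalar_P K (Suc k)" "g \<in> scalar_P K (Suc k)"
  shows "surface_integral K (f + c *\<^sub>R g) = surface_integral K f + c * surface_integral K g"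
proof -
  have "integral (ref_tri K T) (\<lambda>y. (f + c *\<^sub>R g) T (param K T y) * area_factor K T y) =
      integral (ref_tri K T) (\<lambda>y. f T (param K T y) * area_factor K T y) +
      c * integral (ref_tri K T) (\<lambda>y. g T (param K T y) * area_factor K T y)" if T: "T \<in> tris" for T
  proof -
    have "integral (ref_tri K T) (\<lambda>y. (f + c *\<^sub>R g) T (param K T y) * area_factor K T y) =
      integral (ref_tri K T) (\<lambda>y. f T (param K T y) * area_factor K T y + c * (g T (param K T y) * area_factor K T y))"
      by (simp add: scaleR_fun_def algebra_simps)
    also have "\<dots> = integral (ref_tri K T) (\<lambda>y. f T (param K T y) * area_factor K T y) +
      integral (ref_tri K T) (\<lambda>y. c * (g T (param K T y) * area_factor K T y))"
      using scalar_P_integrable(2)[OF assms(1) T] scalar_P_integrable(2)[OF assms(2) T]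
      by (intro Henstock_Kurzweil_Integration.integral_add integrable_on_mult_right)
    finally show ?thesis by simp
  qed
  then show ?thesis by (simp add: surface_integral_def sum.distrib sum_distrib_left)
qed

lemma surface_area_nonzero:
  assumes "tris \<noteq> {}"
  shows "surface_integral K (piecewise_const (\<lambda>_. 1)) \<noteq> 0"
proof
  let ?g = "piecewise_const (\<lambda>_. 1)"
  assume z: "surface_integral K ?g = 0"
  have g: "?g \<in> scalar_P K (Suc 0)" using piecewise_const_potential potentials_scalar_P by blast
  have gv: "?g T (param K T y) * area_factor K T y = area_factor K T y" if "T \<in> tris" "y \<in> ref_tri K T" for T y
    using param_in that by (simp add: piecewise_const_def)
  have nn: "?g T (param K T y) * area_factor K T y \<ge> 0" if "T \<in> tris" "y \<in> ref_tri K T" for T y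
    unfolding gv[OF that] using area_factor_pos[OF that] by simp
  have "integral (ref_tri K T) (\<lambda>y. ?g T (param K T y) * area_factor K T y) \<ge> 0" if "T \<in> tris" for T
    using nn[OF that] by (intro integral_nonneg scalar_P_integrable(2)[OF g that])
  then have int: "integral (ref_tri K T) (\<lambda>y. ?g T (param K T y) * area_factor K T y) = 0" if "T \<in> tris" for T
    using z that finite_tris unfolding surface_integral_def by (simp add: sum_nonneg_eq_0_iff)
  obtain T where T: "T \<in> tris" using assms by blast
  have r: "rv T 0 \<in> ref_tri K T" using rv_in[OF T] by simp
  have "?g T (param K T (rv T 0)) * area_factor K T (rv T 0) = 0"
    by (rule zero_integral_imp_zero[OF ref_tri_compact[OF T] ref_tri_convex ref_tri_interior[OF T]
          scalar_P_integrable(1)[OF g T] nn[OF T] int[OF T] r])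
  then show False using gv[OF T r] area_factor_pos[OF T r] by simp
qed

text \<open>On a closed surface the Lagrange elements have mean value zero, which is achieved by subtracting a
  constant that \<open>rot\<close> does not see.\<close>
theorem rot_lagrange: "rot K ` lagrange0 K (Suc k) = rot K ` conforming_potentials k"
proof (intro equalityI subsetI)
  fix v assume "v \<in> rot K ` lagrange0 K (Suc k)"
  then show "v \<in> rot K ` conforming_potentials k" using lagrange_conforming by blast
next
  fix v assume "v \<in> rot K ` conforming_potentials k"
  then obtain f where f: "f \<in> conforming_potentials k" "v = rot K f" by blast
  then have fP: "f \<in> scalar_P K (Suc k)" using conforming_potentials_subset potentials_scalar_P by blast
  let ?g = "piecewise_const (\<lambda>_. 1)"
  have g: "?g \<in> potentials k" and gP: "?g \<in> scalar_P K (Suc k)"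
    using piecewise_const_potential potentials_scalar_P by blast+
  show "v \<in> rot K ` lagrange0 K (Suc k)"
  proof (cases "mesh_boundary K = {}")
    case False
    have "f \<in> lagrange0 K (Suc k)"
      unfolding lagrange0_def mem_Collect_eq if_P[OF False]
      using fP conforming_continuous[OF f(1)] conforming_boundary[OF f(1)] by blast
    then show ?thesis using f(2) by blast
  next
    case True
    define c where "c = - surface_integral K f / surface_integral K ?g"
    define h where "h = f + c *\<^sub>R ?g"
    have "surface_integral K f + c * surface_integral K ?g = 0"
    proof (cases "tris = {}")
      case True then show ?thesis by (simp add: surface_integral_def)
    next
      case False then show ?thesis using surface_area_nonzero by (simp add: c_def)
    qed
    then have "surface_integral K h = 0" unfolding h_def surface_integral_add_scaled[OF fP gP] .
    moreover have "h \<in> scalar_P K (Suc k)"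
      unfolding h_def by (intro subspace_add subspace_scale subspace_scalar_P fP gP)
    moreover have "h A x = h B x" if "A \<in> tris" "B \<in> tris" "x \<in> A \<inter> B" for A B x
      using conforming_continuous[OF f(1), of A B x] that by (simp add: h_def scaleR_fun_def piecewise_const_def)
    moreover have nb: "\<not> mesh_boundary K \<noteq> {}" using True by simp
    ultimately have "h \<in> lagrange0 K (Suc k)" unfolding lagrange0_def mem_Collect_eq if_not_P[OF nb] by blast
    moreover have "rot K h = v"
    proof -
      have l: "linear_map_on (scalar_P K (Suc k)) (rot K)" by (rule rot_linear)
      have "rot K ?g = 0" using rot_zero_iff[OF gP] vx_in by (auto simp: piecewise_const_def)
      then have "rot K (c *\<^sub>R ?g) = 0" using l gP unfolding linear_map_on_def by simp
      then show ?thesis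
        using l fP subspace_scale[OF subspace_scalar_P gP, of c] unfolding linear_map_on_def h_def f(2) by simp
    qed
    ultimately show ?thesis by blast
  qed
qed

text \<open>The two counts of cycles turn the alternating sum of cells into Betti numbers, and the Euler formula
  removes the numbers of cells.\<close>
theorem dim_H_BDM:
  assumes "has_topology_of K M"
  shows "dim (H_BDM K k) = betti 1 M"
proof -
  let ?R = "rot K ` conforming_potentials k"
  have R: "subspace ?R" "?R \<subseteq> J_BDM K k"
    using linear_map_on_image[OF subspace_conforming_potentials rot_linear_potentials[OF conforming_potentials_subset]]
      conforming_potentials_subset unfolding J_BDM_potentials by blast+
  have JP: "J_BDM K k \<subseteq> vector_P K k" by (auto simp: J_BDM_def BDM0_def BDM_def)
  have "dim (J_BDM K k) = dim ?R + dim (H_BDM K k)"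
    unfolding H_BDM_def Suc_eq_plus1[symmetric] rot_lagrange
    by (rule dim_orth_complement[OF L2_inner_product J_BDM_subspace JP J_BDM_finite_dim R])
  then have "dim (H_BDM K k) + card tris = card closed_classes + dim cycles1"
    using dim_J_BDM_minus_rot[of k] by simp
  moreover have "betti p M = betti p (\<Union>tris)" for p
    using assms betti_homeomorphic[of "mesh_surface K" M p] by (simp add: has_topology_of_def mesh_surface_def)
  then have "betti 0 M = card (tris // conn)" "betti 2 M = card closed_classes" using betti_0 betti_2 by simp_all
  moreover have "int (card (all_verts K)) - int (card (all_edges K)) + int (card tris) = int (betti 0 M) - int (betti 1 M) + int (betti 2 M)"
    using assms by (simp add: has_topology_of_def euler_char_def numeral_2_eq_2)
  ultimately show ?thesis using dim_cycles1 by linarith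
qed

end

theorem theorem3p2:
  fixes M :: "(real^3) set" and K :: surface_mesh and \<kappa> :: real and k :: nat
  assumes "compact_oriented_surface M"
    and "oriented_triangulation K"
    and "shape_regular \<kappa> K"
    and "has_topology_of K M"
  shows "orth_direct_sum K (J_BDM K k) [rot K ` lagrange0 K (k + 1), H_BDM K k]
    \<and> ((\<exists>B. finite B \<and> H_BDM K k \<subseteq> span B) \<and> dim (H_BDM K k) = betti 1 M)
    \<and> orth_direct_sum K (BDM0 K k)
        [rot K ` lagrange0 K (k + 1), H_BDM K k, orth_complement_in K (BDM0 K k) (J_BDM K k)]"
proof -
  interpret mesh K by unfold_locales (rule assms(2))
  have R: "subspace (rot K ` lagrange0 K (k + 1))" "rot K ` lagrange0 K (k + 1) \<subseteq> J_BDM K k"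
    unfolding Suc_eq_plus1[symmetric] rot_lagrange
    using linear_map_on_image[OF subspace_conforming_potentials rot_linear_potentials[OF conforming_potentials_subset]]
      conforming_potentials_subset unfolding J_BDM_potentials by blast+
  have P: "J_BDM K k \<subseteq> BDM0 K k" "BDM0 K k \<subseteq> vector_P K k" by (auto simp: J_BDM_def BDM0_def BDM_def)
  have J: "orth_direct_sum K (J_BDM K k) [rot K ` lagrange0 K (k + 1), H_BDM K k]"
    unfolding H_BDM_def using P finite_dim_subset[OF J_BDM_finite_dim R(2)]
    by (intro orth_direct_sum_complement[OF L2_inner_product J_BDM_subspace _ R]) auto
  have "orth_direct_sum K (BDM0 K k) [J_BDM K k, orth_complement_in K (BDM0 K k) (J_BDM K k)]"
    by (rule orth_direct_sum_complement[OF L2_inner_product subspace_BDM0 P(2) J_BDM_subspace P(1) J_BDM_finite_dim])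
  moreover have "finite_dim (H_BDM K k)"
    by (rule finite_dim_subset[OF J_BDM_finite_dim]) (auto simp: H_BDM_def orth_complement_in_def)
  ultimately show ?thesis
    using J orth_direct_sum_refine dim_H_BDM[OF assms(4)] unfolding finite_dim_def by blast
qed

end
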